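(* There is a constant $c_1'>0$, and for all $C_1,C_2>0$ there is a constant $C>0$ depending only on $C_1$ and $C_2$, such that the following holds. Let $0<q\le1$, $1\le k\le d$, $\bar\epsilon>0$, let $A$ be a real $k\times d$ matrix with $AA^T=I_k$ and $\left(\sum_{j=1}^d|a_{ij}|^q\right)^{1/q}\le C_1$ for $i=1,\dots,k$, let $g\in C^2(B_{\mathbb R^k}(1+\bar\epsilon))$ satisfy $\sup_{|\beta|\le2}\|D^\beta g\|_\infty\le C_2$, put $f(x)=g(Ax)$ for $x\in B_{\mathbb R^d}(1+\bar\epsilon)$, and let $\alpha>0$ be such that $\sigma_1(H^f)\ge\dots\ge\sigma_k(H^f)\ge\alpha$, where $$H^f=\int_{\mathbb S^{d-1}}\nabla f(x)\nabla f(x)^T\,d\mu_{\mathbb S^{d-1}}(x).$$ Let $0<s<1$, let $m_{\mathcal X},m_\Phi\in\mathbb N$ with $\log d\le m_\Phi\le[\log6]^{-2}d$, and let $\epsilon>0$ with $\epsilon\sqrt{d/m_\Phi}\le\bar\epsilon$. Then, using $m_{\mathcal X}\cdot(m_\Phi+1)$ function evaluations of $f$, Algorithm 2 (described in the context) defines a function $\hat f:B_{\mathbb R^d}(1+\bar\epsilon)\to\mathbb R$ that, with probability at least $$1-\left(e^{-c_1'm_\Phi}+e^{-\sqrt{m_\Phi d}}+k\,e^{-\frac{m_{\mathcal X}\alpha s^2}{2kC_2^2}}\right),$$ satisfies $$\|f-\hat f\|_\infty\le 2C_2\sqrt k\,(1+\bar\epsilon)\frac{\nu_2}{\sqrt{\alpha(1-s)}-\nu_2},$$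 where $$\nu_2=C\left(k^{1/q}\left[\frac{m_\Phi}{\log(d/m_\Phi)}\right]^{1/2-1/q}+\frac{\epsilon k^2}{\sqrt{m_\Phi}}\right)$$ and $\|\cdot\|_\infty$ is the supremum norm on $B_{\mathbb R^d}(1+\bar\epsilon)$.
   Context: $B_{\mathbb R^n}(r)$ is the Euclidean ball of radius $r$ in $\mathbb R^n$, $\mathbb S^{d-1}$ is the unit sphere of $\mathbb R^d$, and $\mu_{\mathbb S^{d-1}}$ is the uniform (rotation invariant) probability measure on it. $\sigma_1(M)\ge\sigma_2(M)\ge\dots$ denote the singular values of a matrix $M$. $\|z\|_{\ell_1^d}=\sum_i|z_i|$. Algorithm 2 (inputs: $m_\Phi,m_{\mathcal X}$, $k$, step size $\epsilon$, point evaluations of $f$): 1. Draw at random $\xi_1,\dots,\xi_{m_{\mathcal X}}\in\mathbb S^{d-1}$ independently according to $\mu_{\mathbb S^{d-1}}$, and an $m_\Phi\times d$ matrix $\Phi$ with independent entries equal to $+1/\sqrt{m_\Phi}$ or $-1/\sqrt{m_\Phi}$, each with probability $1/2$. Let $\varphi_1,\dots,\varphi_{m_\Phi}\in\mathbb R^d$ be the rows of $\Phi$ regarded as column vectors. Set $y_{ij}=\frac{f(\xi_j+\epsilon\varphi_i)-f(\xi_j)}{\epsilon}$ for $i=1,\dots,m_\Phi$, $j=1,\dots,m_{\mathcal X}$, and $y_j=(y_{1j},\dots,y_{m_\Phi j})^T$. 2. For each $j$ let $\hat x_j$ be a minimizer of $\|z\|_{\ell_1^d}$ over all $z\in\mathbb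 R^d$ with $\Phi z=y_j$; let $\hat X=(\hat x_1,\dots,\hat x_{m_{\mathcal X}})$, a $d\times m_{\mathcal X}$ matrix. 3. Compute a singular value decomposition of $\hat X^T$, with singular values in nonincreasing order, and let $\hat V_1$ be the $d\times k$ matrix whose orthonormal columns are the right singular vectors belonging to the $k$ largest singular values. 4. Set $\hat A=\hat V_1^T$, and define $\hat g(y)=f(\hat A^Ty)$ and $\hat f(x)=\hat g(\hat Ax)$, i.e. $\hat f(x)=f(\hat A^T\hat Ax)$. The probability is with respect to the random draw of $\Phi$ and $\xi_1,\dots,\xi_{m_{\mathcal X}}$.
   Formalization: The constant C may depend on q as well as on C_1 and C_2 (a C uniform over all 0<q≤1 is impossible as q→0), and the error bound is asserted only when ν_2 < sqrt(α(1-s)), since otherwise its right-hand side is negative or undefined. *)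

theory Defs
  imports "HOL-Probability.Probability"
begin

text \<open>
  The constants of the theorem are uniform in all dimensions, so dimensions have to be natural
  numbers that can be quantified inside a formula. A vector of \<open>\<real>\<^sup>n\<close> is an element of
  \<^term>\<open>topspace (Euclidean_space n)\<close>, i.e. a function \<open>nat \<Rightarrow> real\<close> that vanishes from index \<open>n\<close> on.
  The topology (and the Borel sets) that the product topology of \<open>nat \<Rightarrow> real\<close> induces there are the
  Euclidean ones. All indices start at 0. An \<open>m \<times> n\<close> matrix is a function
  \<open>M :: nat \<Rightarrow> nat \<Rightarrow> real\<close> of which only the entries \<open>M i j\<close> with \<open>i < m\<close>, \<open>j < n\<close> are used.
\<close>

definition euclid_ball :: "nat \<Rightarrow> real \<Rightarrow> (nat \<Rightarrow> real) set" where
  "euclid_ball n r = {x \<in> topspace (Euclidean_space n). L2_set x {..<n} < r}"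

definition euclid_cball :: "nat \<Rightarrow> real \<Rightarrow> (nat \<Rightarrow> real) set" where
  "euclid_cball n r = {x \<in> topspace (Euclidean_space n). L2_set x {..<n} \<le> r}"

definition euclid_sphere :: "nat \<Rightarrow> (nat \<Rightarrow> real) set" where
  "euclid_sphere n = {x \<in> topspace (Euclidean_space n). L2_set x {..<n} = 1}"

definition mat_vec :: "nat \<Rightarrow> nat \<Rightarrow> (nat \<Rightarrow> nat \<Rightarrow> real) \<Rightarrow> (nat \<Rightarrow> real) \<Rightarrow> nat \<Rightarrow> real" where
  "mat_vec m n M x = (\<lambda>i. if i < m then \<Sum>j<n. M i j * x j else 0)"

definition mat_transpose :: "(nat \<Rightarrow> nat \<Rightarrow> real) \<Rightarrow> nat \<Rightarrow> nat \<Rightarrow> real" where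
  "mat_transpose M = (\<lambda>i j. M j i)"

text \<open>\<open>V\<^sup>T V = I\<^sub>n\<close> for an \<open>m \<times> n\<close> matrix \<open>V\<close>; for \<open>m = n\<close> this says that \<open>V\<close> is orthogonal.\<close>

definition orthonormal_columns :: "nat \<Rightarrow> nat \<Rightarrow> (nat \<Rightarrow> nat \<Rightarrow> real) \<Rightarrow> bool" where
  "orthonormal_columns m n V \<longleftrightarrow>
     (\<forall>i<n. \<forall>j<n. (\<Sum>l<m. V l i * V l j) = (if i = j then 1 else 0))"

text \<open>
  \<open>M = U \<Sigma> V\<^sup>T\<close> with orthogonal \<open>U\<close> (\<open>m \<times> m\<close>) and \<open>V\<close> (\<open>n \<times> n\<close>), where the \<open>m \<times> n\<close> matrix \<open>\<Sigma>\<close> has the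
  diagonal entries \<open>s 0 \<ge> s 1 \<ge> \<dots> \<ge> 0\<close> and is zero elsewhere.
\<close>

definition is_svd :: "nat \<Rightarrow> nat \<Rightarrow> (nat \<Rightarrow> nat \<Rightarrow> real) \<Rightarrow>
    (nat \<Rightarrow> nat \<Rightarrow> real) \<Rightarrow> (nat \<Rightarrow> real) \<Rightarrow> (nat \<Rightarrow> nat \<Rightarrow> real) \<Rightarrow> bool" where
  "is_svd m n M U s V \<longleftrightarrow>
     orthonormal_columns m m U \<and> orthonormal_columns n n V \<and>
     (\<forall>i < min m n. 0 \<le> s i) \<and>
     (\<forall>i j. i \<le> j \<and> j < min m n \<longrightarrow> s j \<le> s i) \<and>
     (\<forall>i<m. \<forall>j<n. M i j = (\<Sum>l < min m n. U i l * s l * V j l))"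

text \<open>\<open>s i\<close> is \<open>\<sigma>\<^sub>i\<^sub>+\<^sub>1(M)\<close>.\<close>

definition has_singular_values :: "nat \<Rightarrow> nat \<Rightarrow> (nat \<Rightarrow> nat \<Rightarrow> real) \<Rightarrow> (nat \<Rightarrow> real) \<Rightarrow> bool" where
  "has_singular_values m n M s \<longleftrightarrow> (\<exists>U V. is_svd m n M U s V)"

definition partial_deriv :: "nat \<Rightarrow> ((nat \<Rightarrow> real) \<Rightarrow> real) \<Rightarrow> (nat \<Rightarrow> real) \<Rightarrow> real" where
  "partial_deriv i g x = deriv (\<lambda>t. g (x(i := t))) (x i)"

text \<open>A multi-index of order \<open>p\<close> is written as a list of \<open>p\<close> coordinates, in all possible orders.\<close>

fun iter_partial :: "nat list \<Rightarrow> ((nat \<Rightarrow> real) \<Rightarrow> real) \<Rightarrow> (nat \<Rightarrow> real) \<Rightarrow> real" where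
  "iter_partial [] g = g"
| "iter_partial (i # \<beta>) g = partial_deriv i (iter_partial \<beta> g)"

definition multi_indices :: "nat \<Rightarrow> nat \<Rightarrow> nat list set" where
  "multi_indices n p = {\<beta>. set \<beta> \<subseteq> {..<n} \<and> length \<beta> \<le> p}"

text \<open>
  \<open>g \<in> C\<^sup>2\<close> on the closed ball of radius \<open>r\<close> in \<open>\<real>\<^sup>n\<close>: all partial derivatives up to order two exist in
  the open ball and they extend continuously to the closed ball; the extension of \<open>g\<close> is \<open>g\<close> itself.
\<close>

definition C2_on_cball :: "nat \<Rightarrow> real \<Rightarrow> ((nat \<Rightarrow> real) \<Rightarrow> real) \<Rightarrow> bool" where
  "C2_on_cball n r g \<longleftrightarrow>
     continuous_on (euclid_cball n r) g \<and>
     (\<forall>\<beta> \<in> multi_indices n 1. \<forall>i<n. \<forall>x \<in> euclid_ball n r.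
        (\<lambda>t. iter_partial \<beta> g (x(i := t))) field_differentiable at (x i)) \<and>
     (\<forall>\<beta> \<in> multi_indices n 2. \<exists>h. continuous_on (euclid_cball n r) h \<and>
        (\<forall>x \<in> euclid_ball n r. h x = iter_partial \<beta> g x))"

text \<open>The rotation invariant Borel probability measure on the unit sphere of \<open>\<real>\<^sup>d\<close>, \<open>d \<ge> 1\<close>.\<close>

definition uniform_on_sphere :: "nat \<Rightarrow> (nat \<Rightarrow> real) measure \<Rightarrow> bool" where
  "uniform_on_sphere d \<mu> \<longleftrightarrow>
     prob_space \<mu> \<and> sets \<mu> = sets (restrict_space borel (euclid_sphere d)) \<and>
     (\<forall>Q. orthonormal_columns d d Q \<longrightarrow> distr \<mu> \<mu> (mat_vec d d Q) = \<mu>)"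

definition gradient_second_moment ::
  "(nat \<Rightarrow> real) measure \<Rightarrow> ((nat \<Rightarrow> real) \<Rightarrow> real) \<Rightarrow> nat \<Rightarrow> nat \<Rightarrow> real" where
  "gradient_second_moment \<mu> f = (\<lambda>i j. LINT x|\<mu>. partial_deriv i f x * partial_deriv j f x)"

text \<open>
  The law of the random draw \<open>(\<Phi>, \<xi>)\<close>: \<open>\<Phi> i j\<close> for \<open>i < m\<^sub>\<Phi>\<close>, \<open>j < d\<close> are independent signs divided by
  \<open>sqrt m\<^sub>\<Phi>\<close>, and \<open>\<xi> j\<close> for \<open>j < m\<^sub>X\<close> are independent with law \<open>\<mu>\<close>.
\<close>

definition draw_measure :: "nat \<Rightarrow> nat \<Rightarrow> nat \<Rightarrow> (nat \<Rightarrow> real) measure \<Rightarrow>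
    ((nat \<Rightarrow> nat \<Rightarrow> real) \<times> (nat \<Rightarrow> nat \<Rightarrow> real)) measure" where
  "draw_measure m\<Phi> mX d \<mu> =
     (\<Pi>\<^sub>M i\<in>{..<m\<Phi>}. \<Pi>\<^sub>M j\<in>{..<d}. uniform_count_measure {1 / sqrt (real m\<Phi>), - 1 / sqrt (real m\<Phi>)})
     \<Otimes>\<^sub>M (\<Pi>\<^sub>M j\<in>{..<mX}. \<mu>)"

definition query_point ::
  "nat \<Rightarrow> real \<Rightarrow> (nat \<Rightarrow> nat \<Rightarrow> real) \<Rightarrow> (nat \<Rightarrow> nat \<Rightarrow> real) \<Rightarrow> nat \<Rightarrow> nat \<Rightarrow> nat \<Rightarrow> real" where
  "query_point d \<epsilon> \<Phi> \<xi> i j = (\<lambda>l. if l < d then \<xi> j l + \<epsilon> * \<Phi> i l else 0)"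

text \<open>The points at which \<open>f\<close> is evaluated in order to find \<open>A\<close>, listed with repetitions.\<close>

definition queries :: "nat \<Rightarrow> nat \<Rightarrow> nat \<Rightarrow> real \<Rightarrow> (nat \<Rightarrow> nat \<Rightarrow> real) \<Rightarrow> (nat \<Rightarrow> nat \<Rightarrow> real) \<Rightarrow>
    (nat \<Rightarrow> real) list" where
  "queries m\<Phi> mX d \<epsilon> \<Phi> \<xi> =
     concat (map (\<lambda>j. \<xi> j # map (\<lambda>i. query_point d \<epsilon> \<Phi> \<xi> i j) [0..<m\<Phi>]) [0..<mX])"

definition difference_quotients :: "nat \<Rightarrow> nat \<Rightarrow> real \<Rightarrow> ((nat \<Rightarrow> real) \<Rightarrow> real) \<Rightarrow>
    (nat \<Rightarrow> nat \<Rightarrow> real) \<Rightarrow> (nat \<Rightarrow> nat \<Rightarrow> real) \<Rightarrow> nat \<Rightarrow> nat \<Rightarrow> real" where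
  "difference_quotients m\<Phi> d \<epsilon> f \<Phi> \<xi> j =
     (\<lambda>i. if i < m\<Phi> then (f (query_point d \<epsilon> \<Phi> \<xi> i j) - f (\<xi> j)) / \<epsilon> else 0)"

definition is_l1_minimizer ::
  "nat \<Rightarrow> nat \<Rightarrow> (nat \<Rightarrow> nat \<Rightarrow> real) \<Rightarrow> (nat \<Rightarrow> real) \<Rightarrow> (nat \<Rightarrow> real) \<Rightarrow> bool" where
  "is_l1_minimizer m d \<Phi> y x \<longleftrightarrow>
     x \<in> topspace (Euclidean_space d) \<and> mat_vec m d \<Phi> x = y \<and>
     (\<forall>z \<in> topspace (Euclidean_space d). mat_vec m d \<Phi> z = y \<longrightarrow>
        (\<Sum>i<d. \<bar>x i\<bar>) \<le> (\<Sum>i<d. \<bar>z i\<bar>))"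

text \<open>
  The possible matrices \<open>A = V\<^sub>1\<^sup>T\<close> (\<open>k \<times> d\<close>) that the first three steps and the beginning of the fourth
  step of the algorithm return. It is a relation since neither the minimizers nor the singular value
  decomposition need be unique. The \<open>j\<close>-th row \<open>X j\<close> of the \<open>m\<^sub>X \<times> d\<close> matrix \<open>X\<close> is the \<open>j\<close>-th minimizer,
  so \<open>X\<close> is already the transpose of the matrix whose columns are the minimizers.
\<close>

definition algorithm2_matrix :: "nat \<Rightarrow> nat \<Rightarrow> nat \<Rightarrow> nat \<Rightarrow> real \<Rightarrow> ((nat \<Rightarrow> real) \<Rightarrow> real) \<Rightarrow>
    (nat \<Rightarrow> nat \<Rightarrow> real) \<Rightarrow> (nat \<Rightarrow> nat \<Rightarrow> real) \<Rightarrow> (nat \<Rightarrow> nat \<Rightarrow> real) \<Rightarrow> bool" where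
  "algorithm2_matrix m\<Phi> mX d k \<epsilon> f \<Phi> \<xi> A \<longleftrightarrow>
     (\<exists>X U s V.
        (\<forall>j<mX. is_l1_minimizer m\<Phi> d \<Phi> (difference_quotients m\<Phi> d \<epsilon> f \<Phi> \<xi> j) (X j)) \<and>
        is_svd mX d X U s V \<and>
        A = (\<lambda>i l. if i < k \<and> l < d then V l i else 0))"

text \<open>
  The possible outputs. The matrix is computed from the restriction of \<open>f\<close> to the queried points,
  so it depends on \<open>f\<close> through these evaluations only.
\<close>

definition algorithm2_output :: "nat \<Rightarrow> nat \<Rightarrow> nat \<Rightarrow> nat \<Rightarrow> real \<Rightarrow> ((nat \<Rightarrow> real) \<Rightarrow> real) \<Rightarrow>
    (nat \<Rightarrow> nat \<Rightarrow> real) \<Rightarrow> (nat \<Rightarrow> nat \<Rightarrow> real) \<Rightarrow> ((nat \<Rightarrow> real) \<Rightarrow> real) \<Rightarrow> bool" where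
  "algorithm2_output m\<Phi> mX d k \<epsilon> f \<Phi> \<xi> fhat \<longleftrightarrow>
     (\<exists>A ghat.
        algorithm2_matrix m\<Phi> mX d k \<epsilon> (restrict f (set (queries m\<Phi> mX d \<epsilon> \<Phi> \<xi>))) \<Phi> \<xi> A \<and>
        ghat = (\<lambda>y. f (mat_vec d k (mat_transpose A) y)) \<and>
        fhat = (\<lambda>x. ghat (mat_vec k d A x)))"

text \<open>
  \<open>C\<close> depends on \<open>q\<close> as well as on \<open>C\<^sub>1\<close>, \<open>C\<^sub>2\<close>. It cannot be uniform for \<open>q \<rightarrow> 0\<close>: if
  \<open>m\<^sub>\<Phi> = \<lceil>log d\<rceil>\<close>, then \<open>m\<^sub>\<Phi> / log (d / m\<^sub>\<Phi>) > 1\<close>, so its power \<open>1/2 - 1/q\<close> tends to 0; but \<open>\<Phi>\<close> has at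
  most \<open>2\<^sup>m\<close> different columns for \<open>m = m\<^sub>\<Phi>\<close>, much fewer than \<open>d\<close>, and not even \<open>f x = x 0\<close> is
  recovered. The error bound \<open>\<nu>\<^sub>2 / (sqrt (\<alpha> (1 - s)) - \<nu>\<^sub>2)\<close> is meant for \<open>\<nu>\<^sub>2 < sqrt (\<alpha> (1 - s))\<close>.
\<close>

definition nu2 :: "real \<Rightarrow> real \<Rightarrow> nat \<Rightarrow> nat \<Rightarrow> nat \<Rightarrow> real \<Rightarrow> real" where
  "nu2 C q k d m\<Phi> \<epsilon> =
     C * (real k powr (1 / q) * (real m\<Phi> / ln (real d / real m\<Phi>)) powr (1 / 2 - 1 / q)
          + \<epsilon> * (real k)\<^sup>2 / sqrt (real m\<Phi>))"

end

theory Submission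
  imports Defs
begin

text \<open>
  By Taylor's formula \<open>y\<^sub>j = \<Phi> x\<^sub>j + e\<^sub>j\<close>, where \<open>x\<^sub>j = A\<^sup>T grad g (A \<xi>\<^sub>j)\<close> is compressible and \<open>e\<^sub>j\<close> is a small error.
  A random sign matrix is, up to exponentially small probability, almost isometric on sparse vectors and
  has the \<open>l\<^sub>1\<close> quotient property, so that \<open>l\<^sub>1\<close> minimization recovers each \<open>x\<^sub>j\<close> up to \<open>\<nu>\<^sub>2\<close>. A matrix
  Chernoff bound shows that the gradients \<open>grad g (A \<xi>\<^sub>j)\<close> span \<open>\<real>\<^sup>k\<close> quantitatively: the smallest eigenvalue of
  their empirical second moment matrix is at least \<open>\<alpha> (1 - s)\<close>. If \<open>w\<close> is orthogonal to the first \<open>k\<close> right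
  singular vectors of the matrix with rows \<open>X\<^sub>j\<close>, then comparing this matrix with the rank \<open>k\<close> matrix
  with rows \<open>x\<^sub>j\<close> gives \<open>sqrt (\<alpha> (1 - s)) \<bar>A w\<bar> \<le> 2 \<nu>\<^sub>2 \<bar>w\<bar>\<close>, and \<open>g\<close> is Lipschitz.
\<close>

subsection \<open>Inner products and singular value decompositions\<close>

text \<open>The failure probability exp (- c1 m) has no factor in front, whereas union bounds
  produce factors. Large \<open>m\<close> absorbs them; when the sparsity level is below 1 and d / m
  is bounded, only finitely many pairs (m, d) remain, and a positive probability is enough. The
  measurement error is controlled entry by entry, because the entries of \<open>\<Phi>\<close> have
  modulus 1 / sqrt m. Writing it as \<open>\<Phi> u\<close> costs l1 mass of order sqrt (m / ln (d /
  m)), which the kernel width sqrt (ln (d / m) / m) cancels. If d / m is bounded, a lower bound of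
  order sqrt d for combinations of rows gives this order. If d / m is large, the logarithm must be
  gained from columns whose sign sums are atypically large. Suprema over real vectors are reduced to
  integer vectors by rounding towards zero; the remainder is treated by convexity, so no nets of
  spheres occur. The error bound is claimed only for \<nu>2 < sqrt (\<alpha> (1 - s)), which is at
  most C2. This excludes sparsity below 1, where merely the existence of an output is at
  stake.\<close>

definition ip :: "nat \<Rightarrow> (nat \<Rightarrow> real) \<Rightarrow> (nat \<Rightarrow> real) \<Rightarrow> real" where
  "ip n u v = (\<Sum>l<n. u l * v l)"

lemma ip_commute: "ip n u v = ip n v u"
  by (simp add: ip_def mult.commute)

lemma ip_add_right: "ip n u (\<lambda>l. v l + w l) = ip n u v + ip n u w"
  by (simp add: ip_def algebra_simps sum.distrib)

lemma ip_diff_right: "ip n u (\<lambda>l. v l - w l) = ip n u v - ip n u w"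
  by (simp add: ip_def algebra_simps sum_subtractf)

lemma ip_scale_right: "ip n u (\<lambda>l. c * v l) = c * ip n u v"
  by (simp add: ip_def sum_distrib_left algebra_simps)

lemma ip_sum_right: "ip n u (\<lambda>l. \<Sum>i\<in>I. w i l) = (\<Sum>i\<in>I. ip n u (w i))"
  unfolding ip_def sum_distrib_left by (rule sum.swap)

lemma ip_add_left: "ip n (\<lambda>l. v l + w l) u = ip n v u + ip n w u"
  by (metis ip_commute ip_add_right)

lemma ip_diff_left: "ip n (\<lambda>l. v l - w l) u = ip n v u - ip n w u"
  by (metis ip_commute ip_diff_right)

lemma ip_scale_left: "ip n (\<lambda>l. c * v l) u = c * ip n v u"
  by (metis ip_commute ip_scale_right)

lemma ip_sum_left: "ip n (\<lambda>l. \<Sum>i\<in>I. w i l) u = (\<Sum>i\<in>I. ip n (w i) u)"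
  unfolding ip_def sum_distrib_right by (rule sum.swap)

lemmas ip_linear = ip_add_right ip_diff_right ip_scale_right ip_sum_right
  ip_add_left ip_diff_left ip_scale_left ip_sum_left

lemma ip_self_nonneg [simp]: "0 \<le> ip n u u"
  by (simp add: ip_def sum_nonneg)

lemma ip_self: "ip n u u = (\<Sum>l<n. (u l)\<^sup>2)"
  by (simp add: ip_def power2_eq_square)

lemma ip_self_eq_0_iff: "ip n u u = 0 \<longleftrightarrow> (\<forall>l<n. u l = 0)"
  by (auto simp: ip_def sum_nonneg_eq_0_iff)

lemma L2_set_ip: "L2_set u {..<n} = sqrt (ip n u u)"
  by (simp add: L2_set_def ip_self)

lemma ip_CS: "(ip n u v)\<^sup>2 \<le> ip n u u * ip n v v"
  using Cauchy_Schwarz_ineq_sum[of u v "{..<n}"] by (simp add: ip_def power2_eq_square)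

lemma ip_cong: "(\<And>l. l < n \<Longrightarrow> u l = u' l) \<Longrightarrow> (\<And>l. l < n \<Longrightarrow> v l = v' l) \<Longrightarrow> ip n u v = ip n u' v'"
  by (simp add: ip_def)

lemma ip_unit: "i < n \<Longrightarrow> ip n (\<lambda>l. if l = i then 1 else 0) v = v i"
  by (simp add: ip_def if_distrib[of "\<lambda>x. x * _"] cong: if_cong)

lemma orthonormal_columns_ip:
  "orthonormal_columns n r V \<longleftrightarrow>
     (\<forall>i<r. \<forall>j<r. ip n (\<lambda>l. V l i) (\<lambda>l. V l j) = (if i = j then 1 else 0))"
  by (simp add: orthonormal_columns_def ip_def)

lemma residual_orthogonal:
  assumes V: "orthonormal_columns n r V" and j: "j < r"
  shows "ip n (\<lambda>l. V l j) (\<lambda>l. x l - (\<Sum>i<r. ip n (\<lambda>l. V l i) x * V l i)) = 0"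
proof -
  have "(\<Sum>i<r. ip n (\<lambda>l. V l i) x * ip n (\<lambda>l. V l j) (\<lambda>l. V l i)) =
      (\<Sum>i<r. if i = j then ip n (\<lambda>l. V l i) x else 0)"
    by (rule sum.cong) (use V j in \<open>auto simp: orthonormal_columns_ip\<close>)
  then show ?thesis using j by (simp add: ip_linear)
qed

lemma residual_norm:
  assumes V: "orthonormal_columns n r V"
  fixes x
  defines "y \<equiv> \<lambda>l. x l - (\<Sum>i<r. ip n (\<lambda>l. V l i) x * V l i)"
  shows "ip n y y = ip n x x - (\<Sum>i<r. (ip n (\<lambda>l. V l i) x)\<^sup>2)"
proof -
  have 0: "ip n (\<lambda>l. V l i) y = 0" if "i < r" for i
    unfolding y_def by (rule residual_orthogonal[OF V that])
  have "ip n y y = ip n x y - (\<Sum>i<r. ip n (\<lambda>l. V l i) x * ip n (\<lambda>l. V l i) y)"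
    by (subst (1) y_def) (simp add: ip_linear)
  also have "\<dots> = ip n x y" using 0 by simp
  also have "\<dots> = ip n x x - (\<Sum>i<r. (ip n (\<lambda>l. V l i) x)\<^sup>2)"
    by (simp add: y_def ip_linear power2_eq_square ip_commute)
  finally show ?thesis .
qed

lemma bessel:
  assumes V: "orthonormal_columns n r V"
  shows "(\<Sum>i<r. (ip n (\<lambda>l. V l i) x)\<^sup>2) \<le> ip n x x"
  using residual_norm[OF V, of x] ip_self_nonneg
  by (metis (no_types, lifting) diff_ge_0_iff_ge)

text \<open>The squared Frobenius norm counted by columns. Combined with
  \<open>orthonormal_row_le\<close> it does the work of dimension theory: r <= n, a coordinate
  vector outside the span if r < n, and unit rows if r = n.\<close>

lemma orthonormal_columns_sum_rows:
  assumes "orthonormal_columns n r V"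
  shows "(\<Sum>l<n. \<Sum>i<r. (V l i)\<^sup>2) = real r"
proof -
  have "(\<Sum>l<n. \<Sum>i<r. (V l i)\<^sup>2) = (\<Sum>i<r. ip n (\<lambda>l. V l i) (\<lambda>l. V l i))"
    unfolding ip_self by (rule sum.swap)
  also have "\<dots> = real r" using assms by (simp add: orthonormal_columns_ip)
  finally show ?thesis .
qed

lemma orthonormal_row_le:
  assumes "orthonormal_columns n r V" "l < n"
  shows "(\<Sum>i<r. (V l i)\<^sup>2) \<le> 1"
  using bessel[OF assms(1), of "\<lambda>j. if j = l then 1 else 0"] assms(2)
  by (simp add: ip_unit ip_commute[of n "\<lambda>j. V j _"])

lemma orthonormal_columns_le:
  assumes "orthonormal_columns n r V"
  shows "r \<le> n"
proof -
  have "real r = (\<Sum>l<n. \<Sum>i<r. (V l i)\<^sup>2)" using orthonormal_columns_sum_rows[OF assms] ..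
  also have "\<dots> \<le> (\<Sum>l<n. 1)" using orthonormal_row_le[OF assms] by (intro sum_mono) auto
  finally show ?thesis by simp
qed

lemma normalize:
  assumes "ip n y y \<noteq> 0"
  obtains c where "c \<noteq> 0" "ip n (\<lambda>l. c * y l) (\<lambda>l. c * y l) = 1"
proof
  show "inverse (sqrt (ip n y y)) \<noteq> 0" using assms by simp
  have "inverse (sqrt (ip n y y)) * inverse (sqrt (ip n y y)) = inverse (ip n y y)"
    by (metis inverse_mult_distrib ip_self_nonneg real_sqrt_mult_self abs_of_nonneg)
  then show "ip n (\<lambda>l. inverse (sqrt (ip n y y)) * y l) (\<lambda>l. inverse (sqrt (ip n y y)) * y l) = 1"
    using assms by (simp add: ip_linear mult.assoc[symmetric])
qed

lemma exists_unit_orthogonal_columns: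
  assumes V: "orthonormal_columns n r V" and r: "r < n"
  obtains x where "ip n x x = 1" "\<And>i. i < r \<Longrightarrow> ip n (\<lambda>l. V l i) x = 0" "\<And>l. l \<ge> n \<Longrightarrow> x l = 0"
proof -
  have "\<exists>l<n. (\<Sum>i<r. (V l i)\<^sup>2) < 1"
  proof (rule ccontr)
    assume "\<not> ?thesis"
    then have "(\<Sum>l<n. 1) \<le> (\<Sum>l<n. \<Sum>i<r. (V l i)\<^sup>2)" by (intro sum_mono) force
    then show False using orthonormal_columns_sum_rows[OF V] r by simp
  qed
  then obtain j where j: "j < n" "(\<Sum>i<r. (V j i)\<^sup>2) < 1" by blast
  define e :: "nat \<Rightarrow> real" where "e = (\<lambda>l. if l = j then 1 else 0)"
  have e: "ip n (\<lambda>l. V l i) e = V j i" for i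
    unfolding e_def by (subst ip_commute) (simp add: ip_unit j)
  define y where "y = (\<lambda>l. e l - (\<Sum>i<r. ip n (\<lambda>l. V l i) e * V l i))"
  have "ip n e e = 1" unfolding e_def by (simp add: ip_unit j)
  then have "ip n y y = 1 - (\<Sum>i<r. (V j i)\<^sup>2)"
    unfolding y_def residual_norm[OF V] by (simp add: e)
  then have "ip n y y > 0" using j by simp
  then obtain c where c: "ip n (\<lambda>l. c * y l) (\<lambda>l. c * y l) = 1"
    using normalize[of n y] by auto
  define x where "x = (\<lambda>l. if l < n then c * y l else 0)"
  show thesis
  proof
    have "ip n x x = ip n (\<lambda>l. c * y l) (\<lambda>l. c * y l)"
      by (rule ip_cong) (auto simp: x_def)
    then show "ip n x x = 1" using c by simp
    show "ip n (\<lambda>l. V l i) x = 0" if "i < r" for i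
    proof -
      have "ip n (\<lambda>l. V l i) x = ip n (\<lambda>l. V l i) (\<lambda>l. c * y l)"
        by (rule ip_cong) (auto simp: x_def)
      also have "\<dots> = 0" using residual_orthogonal[OF V that, of e]
        by (simp add: ip_scale_right y_def[symmetric])
      finally show ?thesis .
    qed
  qed (simp add: x_def)
qed

lemma orthonormal_columns_Suc:
  assumes V: "orthonormal_columns n r V" and x: "ip n x x = 1"
    and o: "\<And>i. i < r \<Longrightarrow> ip n (\<lambda>l. V l i) x = 0"
  shows "orthonormal_columns n (Suc r) (\<lambda>l i. if i = r then x l else V l i)"
  using V x o by (auto simp: orthonormal_columns_ip less_Suc_eq ip_commute)

text \<open>Gram-Schmidt that skips dependent vectors, hence r <= m only. The vectors to which it is
  applied, such as the rows of a random matrix, need not be independent.\<close>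

lemma orthonormal_span_exists:
  "\<exists>r V. r \<le> m \<and> orthonormal_columns n r V \<and>
     (\<forall>a<m. \<exists>c. \<forall>l<n. w a l = (\<Sum>i<r. c i * V l i))"
proof (induction m)
  case 0
  then show ?case by (auto simp: orthonormal_columns_def)
next
  case (Suc m)
  then obtain r V where r: "r \<le> m" and V: "orthonormal_columns n r V"
    and sp: "\<forall>a<m. \<exists>c. \<forall>l<n. w a l = (\<Sum>i<r. c i * V l i)" by blast
  define y where "y = (\<lambda>l. w m l - (\<Sum>i<r. ip n (\<lambda>l. V l i) (w m) * V l i))"
  show ?case
  proof (cases "ip n y y = 0")
    case True
    then have "\<forall>l<n. w m l = (\<Sum>i<r. ip n (\<lambda>l. V l i) (w m) * V l i)"
      unfolding ip_self_eq_0_iff by (simp add: y_def)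
    then have "\<exists>c. \<forall>l<n. w m l = (\<Sum>i<r. c i * V l i)"
      by (intro exI[of _ "\<lambda>i. ip n (\<lambda>l. V l i) (w m)"])
    then show ?thesis using r V sp by (intro exI[of _ r] exI[of _ V]) (auto simp: less_Suc_eq)
  next
    case False
    then obtain c where c: "c \<noteq> 0" "ip n (\<lambda>l. c * y l) (\<lambda>l. c * y l) = 1"
      using normalize by blast
    define V' where "V' = (\<lambda>l i. if i = r then c * y l else V l i)"
    have V': "orthonormal_columns n (Suc r) V'" unfolding V'_def
      by (rule orthonormal_columns_Suc[OF V c(2)])
        (use residual_orthogonal[OF V] in \<open>simp add: ip_scale_right y_def\<close>)
    have "\<exists>c. \<forall>l<n. w a l = (\<Sum>i<Suc r. c i * V' l i)" if a: "a < Suc m" for a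
    proof (cases "a = m")
      case True
      have "w m l = (\<Sum>i<Suc r. (if i = r then inverse c else ip n (\<lambda>l. V l i) (w m)) * V' l i)" for l
        using c(1) by (simp add: V'_def y_def mult.assoc[symmetric])
      then show ?thesis using True
        by (intro exI[of _ "\<lambda>i. if i = r then inverse c else ip n (\<lambda>l. V l i) (w m)"]) simp
    next
      case False
      then have "a < m" using a by simp
      then obtain b where "\<forall>l<n. w a l = (\<Sum>i<r. b i * V l i)" using sp by blast
      then have "\<forall>l<n. w a l = (\<Sum>i<Suc r. (if i = r then 0 else b i) * V' l i)"
        by (simp add: V'_def)
      then show ?thesis by (intro exI[of _ "\<lambda>i. if i = r then 0 else b i"])
    qed
    then show ?thesis using r V' by (intro exI[of _ "Suc r"] exI[of _ V']) auto
  qed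
qed

lemma exists_unit_orthogonal:
  assumes "m < n"
  obtains x where "ip n x x = 1" "\<And>a. a < m \<Longrightarrow> ip n (w a) x = 0" "\<And>l. l \<ge> n \<Longrightarrow> x l = 0"
proof -
  obtain r V where r: "r \<le> m" and V: "orthonormal_columns n r V"
    and sp: "\<forall>a<m. \<exists>c. \<forall>l<n. w a l = (\<Sum>i<r. c i * V l i)"
    using orthonormal_span_exists by blast
  obtain x where x: "ip n x x = 1" "\<And>i. i < r \<Longrightarrow> ip n (\<lambda>l. V l i) x = 0" "\<And>l. l \<ge> n \<Longrightarrow> x l = 0"
    using exists_unit_orthogonal_columns[OF V] r assms by (metis le_less_trans)
  have "ip n (w a) x = 0" if a: "a < m" for a
  proof -
    obtain c where "\<forall>l<n. w a l = (\<Sum>i<r. c i * V l i)"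
      using sp a by blast
    then have "ip n (w a) x = ip n (\<lambda>l. \<Sum>i<r. c i * V l i) x" by (intro ip_cong) auto
    then show ?thesis using x(2) by (simp add: ip_linear)
  qed
  then show thesis using that x by blast
qed

lemma orthonormal_extend:
  assumes V: "orthonormal_columns n r V"
  shows "\<exists>U. orthonormal_columns n n U \<and> (\<forall>l. \<forall>i<r. U l i = V l i)"
proof -
  have "\<exists>U. orthonormal_columns n (r + j) U \<and> (\<forall>l. \<forall>i<r. U l i = V l i)" if "r + j \<le> n" for j
    using that
  proof (induction j)
    case 0
    then show ?case using V by auto
  next
    case (Suc j)
    then obtain U where U: "orthonormal_columns n (r + j) U" "\<forall>l. \<forall>i<r. U l i = V l i" by auto
    obtain x where x: "ip n x x = 1" "\<And>i. i < r + j \<Longrightarrow> ip n (\<lambda>l. U l i) x = 0"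
      using exists_unit_orthogonal_columns[OF U(1)] Suc.prems by (metis add_Suc_right Suc_le_eq)
    show ?case
      using orthonormal_columns_Suc[OF U(1) x] U(2)
      by (intro exI[of _ "\<lambda>l i. if i = r + j then x l else U l i"]) auto
  qed
  from this[of "n - r"] show ?thesis using orthonormal_columns_le[OF V] by simp
qed

lemma orthonormal_square_expand:
  assumes V: "orthonormal_columns n n V" and l: "l < n"
  shows "(\<Sum>i<n. ip n (\<lambda>l. V l i) x * V l i) = x l"
proof -
  have row: "(\<Sum>i<n. (V j i)\<^sup>2) = 1" if j: "j < n" for j
  proof (rule ccontr)
    assume "(\<Sum>i<n. (V j i)\<^sup>2) \<noteq> 1"
    then have "(\<Sum>i<n. (V j i)\<^sup>2) < 1" using orthonormal_row_le[OF V j] by simp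
    then have "(\<Sum>l<n. \<Sum>i<n. (V l i)\<^sup>2) < (\<Sum>l<n. 1)"
      using orthonormal_row_le[OF V] j by (intro sum_strict_mono_ex1) auto
    then show False using orthonormal_columns_sum_rows[OF V] by simp
  qed
  have unit: "(\<Sum>i<n. V j i * V l i) = (if l = j then 1 else 0)" if j: "j < n" for j
  proof -
    define e :: "nat \<Rightarrow> real" where "e = (\<lambda>l. if l = j then 1 else 0)"
    have e: "ip n (\<lambda>l. V l i) e = V j i" for i
      unfolding e_def by (subst ip_commute) (simp add: ip_unit j)
    have "ip n e e = 1" unfolding e_def by (simp add: ip_unit j)
    then have "ip n (\<lambda>l. e l - (\<Sum>i<n. ip n (\<lambda>l. V l i) e * V l i))
        (\<lambda>l. e l - (\<Sum>i<n. ip n (\<lambda>l. V l i) e * V l i)) = 0"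
      unfolding residual_norm[OF V] unfolding e using row[OF j] by simp
    then have "e l - (\<Sum>i<n. V j i * V l i) = 0"
      unfolding ip_self_eq_0_iff using l by (simp add: e)
    then show ?thesis by (simp add: e_def)
  qed
  have "(\<Sum>i<n. ip n (\<lambda>l. V l i) x * V l i) = (\<Sum>i<n. \<Sum>j<n. x j * (V j i * V l i))"
    by (simp add: ip_def sum_distrib_left mult_ac)
  also have "\<dots> = (\<Sum>j<n. x j * (\<Sum>i<n. V j i * V l i))"
    by (subst sum.swap) (simp add: sum_distrib_left)
  also have "\<dots> = (\<Sum>j<n. if j = l then x j else 0)"
    by (rule sum.cong) (auto simp: unit)
  finally show ?thesis using l by simp
qed

lemma parseval:
  assumes V: "orthonormal_columns n n V"
  shows "ip n x x = (\<Sum>i<n. (ip n (\<lambda>l. V l i) x)\<^sup>2)"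
proof -
  have "ip n (\<lambda>l. x l - (\<Sum>i<n. ip n (\<lambda>l. V l i) x * V l i))
      (\<lambda>l. x l - (\<Sum>i<n. ip n (\<lambda>l. V l i) x * V l i)) = 0"
    unfolding ip_self_eq_0_iff using orthonormal_square_expand[OF V] by simp
  then show ?thesis unfolding residual_norm[OF V] by simp
qed

lemma orthonormal_combination_norm:
  assumes V: "orthonormal_columns n r V"
  shows "ip n (\<lambda>l. \<Sum>i<r. c i * V l i) (\<lambda>l. \<Sum>i<r. c i * V l i) = (\<Sum>i<r. (c i)\<^sup>2)"
proof -
  have "ip n (\<lambda>l. \<Sum>i<r. c i * V l i) (\<lambda>l. \<Sum>i<r. c i * V l i)
      = (\<Sum>i<r. \<Sum>j<r. c i * (c j * ip n (\<lambda>l. V l j) (\<lambda>l. V l i)))"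
    by (simp add: ip_linear sum_distrib_left)
  also have "\<dots> = (\<Sum>i<r. \<Sum>j<r. if j = i then c i * c i else 0)"
    using V by (intro sum.cong refl) (auto simp: orthonormal_columns_ip)
  finally show ?thesis by (simp add: power2_eq_square)
qed

section \<open>Compactness and the existence of singular vectors\<close>

lemma continuous_on_ip:
  fixes f g :: "'a::topological_space \<Rightarrow> nat \<Rightarrow> real"
  shows "continuous_on S f \<Longrightarrow> continuous_on S g \<Longrightarrow> continuous_on S (\<lambda>x. ip n (f x) (g x))"
  unfolding ip_def
  by (intro continuous_on_sum continuous_on_mult) (auto intro: continuous_on_product_then_coordinatewise)



lemma continuous_on_ip_self: "continuous_on S (\<lambda>x. ip n x x)"
  by (rule continuous_on_ip[OF continuous_on_id continuous_on_id])

lemma continuous_on_ip_const: "continuous_on S (\<lambda>x. ip n u x)"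
  by (rule continuous_on_ip[OF continuous_on_const continuous_on_id])

text \<open>Closed bounded sets of all sequences need not be compact. Coordinates from
  \<open>n\<close> on are pinned to 0, so the set lies in a product of compact intervals and
  Tychonoff's theorem applies.\<close>

lemma compact_bounded_vectors:
  fixes S :: "(nat \<Rightarrow> real) set"
  assumes "closed S" and "\<And>x i. x \<in> S \<Longrightarrow> i \<ge> n \<Longrightarrow> x i = 0"
    and "\<And>x i. x \<in> S \<Longrightarrow> i < n \<Longrightarrow> \<bar>x i\<bar> \<le> r"
  shows "compact S"
proof -
  define B where "B = PiE UNIV (\<lambda>i. if i < n then {-r..r} else {0})"
  have "compactin (powertop_real UNIV) B"
    unfolding B_def compactin_PiE by simp
  then have "compact B"
    by (simp add: euclidean_product_topology)
  moreover have "S \<subseteq> B"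
  proof
    fix x assume x: "x \<in> S"
    have "x i \<in> (if i < n then {-r..r} else {0})" for i
      using assms(2)[OF x, of i] assms(3)[OF x, of i] by (auto simp: abs_le_iff)
    then show "x \<in> B" unfolding B_def by blast
  qed
  ultimately show ?thesis
    using compact_Int_closed[OF _ assms(1), of B] by (simp add: Int_absorb1)
qed

lemma ip_le_1_coord: "ip n x x \<le> 1 \<Longrightarrow> i < n \<Longrightarrow> \<bar>x i\<bar> \<le> 1"
proof -
  assume a: "ip n x x \<le> 1" "i < n"
  have "(x i)\<^sup>2 \<le> ip n x x" unfolding ip_self
    using member_le_sum[of i "{..<n}" "\<lambda>i. (x i)\<^sup>2"] a by simp
  then have "(x i)\<^sup>2 \<le> 1" using a by linarith
  then show ?thesis by (simp only: abs_square_le_1)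
qed

lemma closed_Euclidean_supp: "closed {x :: nat \<Rightarrow> real. \<forall>i\<ge>n. x i = 0}"
proof -
  have "{x :: nat \<Rightarrow> real. \<forall>i\<ge>n. x i = 0} = (\<Inter>i\<in>{n..}. {x. x i = 0})" by auto
  also have "closed \<dots>"
    by (intro closed_INT ballI closed_Collect_eq continuous_intros continuous_on_product_coordinates)
  finally show ?thesis .
qed

text \<open>Column \<open>i\<close> maximizes \<open>Q\<close> among the unit vectors orthogonal to
  the earlier columns. Keeping \<open>Q\<close> abstract serves twice: with |M x|^2 for singular
  vectors, and with a negated quadratic form for the smallest eigenvalue.\<close>

lemma greedy_orthonormal:
  fixes Q :: "(nat \<Rightarrow> real) \<Rightarrow> real"
  assumes cont: "continuous_on UNIV Q"
    and hom: "\<And>c x. Q (\<lambda>l. c * x l) = c\<^sup>2 * Q x"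
    and cong: "\<And>x y. (\<And>l. l < n \<Longrightarrow> x l = y l) \<Longrightarrow> Q x = Q y"
  shows "j \<le> n \<Longrightarrow> \<exists>V. orthonormal_columns n j V \<and>
    (\<forall>i<j. \<forall>x. (\<forall>p<i. ip n (\<lambda>l. V l p) x = 0) \<longrightarrow> Q x \<le> Q (\<lambda>l. V l i) * ip n x x)"
proof (induction j)
  case 0
  then show ?case by (auto simp: orthonormal_columns_def)
next
  case (Suc j)
  then obtain V where V: "orthonormal_columns n j V"
    and max: "\<forall>i<j. \<forall>x. (\<forall>p<i. ip n (\<lambda>l. V l p) x = 0) \<longrightarrow> Q x \<le> Q (\<lambda>l. V l i) * ip n x x"
    by auto
  define S where "S = {x. \<forall>i\<ge>n. x i = 0} \<inter> {x. ip n x x = 1} \<inter> (\<Inter>p\<in>{..<j}. {x. ip n (\<lambda>l. V l p) x = 0})"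
  have "closed S" unfolding S_def
    by (intro closed_Int closed_Euclidean_supp closed_INT ballI closed_Collect_eq
        continuous_on_ip_self continuous_on_ip_const continuous_on_const)
  then have "compact S"
  proof (rule compact_bounded_vectors[where n = n and r = 1])
    fix x i assume x: "x \<in> S"
    show "x i = 0" if "i \<ge> n" using x that by (simp add: S_def)
    have "ip n x x \<le> 1" using x by (simp add: S_def)
    then show "\<bar>x i\<bar> \<le> 1" if "i < n" using that by (rule ip_le_1_coord)
  qed
  moreover have "S \<noteq> {}"
  proof -
    have "j < n" using Suc.prems by simp
    then obtain x where "ip n x x = 1" "\<And>i. i < j \<Longrightarrow> ip n (\<lambda>l. V l i) x = 0" "\<And>l. l \<ge> n \<Longrightarrow> x l = 0"
      using exists_unit_orthogonal_columns[OF V] by metis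
    then have "x \<in> S" unfolding S_def by blast
    then show ?thesis by blast
  qed
  moreover have "continuous_on S Q" by (rule continuous_on_subset[OF cont]) simp
  ultimately obtain v where v: "v \<in> S" "\<And>y. y \<in> S \<Longrightarrow> Q y \<le> Q v"
    using continuous_attains_sup[of S Q] by metis
  have new: "Q x \<le> Q v * ip n x x" if x: "\<forall>p<j. ip n (\<lambda>l. V l p) x = 0" for x
  proof (cases "ip n x x = 0")
    case True
    then have "Q x = Q (\<lambda>l. 0 * x l)"
      by (intro cong) (simp add: ip_self_eq_0_iff)
    also have "\<dots> = 0" using hom[of 0 x] by simp
    finally show ?thesis using True by simp
  next
    case False
    then obtain c where c: "c \<noteq> 0" "ip n (\<lambda>l. c * x l) (\<lambda>l. c * x l) = 1"
      using normalize by blast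
    define y where "y = (\<lambda>l. if l < n then c * x l else 0)"
    have yc: "ip n u y = ip n u (\<lambda>l. c * x l)" for u by (rule ip_cong) (auto simp: y_def)
    have "ip n y y = ip n (\<lambda>l. c * x l) (\<lambda>l. c * x l)" by (rule ip_cong) (auto simp: y_def)
    then have "ip n y y = 1" using c(2) by simp
    moreover have "ip n (\<lambda>l. V l p) y = 0" if "p < j" for p
      using x that by (simp only: yc ip_scale_right)
    moreover have "y i = 0" if "i \<ge> n" for i using that by (simp add: y_def)
    ultimately have "y \<in> S" unfolding S_def by blast
    then have "Q y \<le> Q v" by (rule v(2))
    moreover have "Q y = Q (\<lambda>l. c * x l)" by (rule cong) (auto simp: y_def)
    then have "Q y = c\<^sup>2 * Q x" using hom[of c x] by (rule trans)
    moreover have "c\<^sup>2 * ip n x x = 1" using c(2) by (simp add: ip_linear power2_eq_square)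
    ultimately have "c\<^sup>2 * Q x \<le> c\<^sup>2 * (Q v * ip n x x)" by (simp add: mult.left_commute)
    then show ?thesis using c(1) by simp
  qed
  define V' where "V' = (\<lambda>l i. if i = j then v l else V l i)"
  have "orthonormal_columns n (Suc j) V'" unfolding V'_def
    by (rule orthonormal_columns_Suc[OF V]) (use v(1) in \<open>auto simp: S_def\<close>)
  moreover have "Q x \<le> Q (\<lambda>l. V' l i) * ip n x x"
    if "i < Suc j" "\<forall>p<i. ip n (\<lambda>l. V' l p) x = 0" for i x
  proof (cases "i = j")
    case True
    then show ?thesis using new[of x] that by (auto simp: V'_def)
  next
    case False
    then show ?thesis using max that by (auto simp: V'_def)
  qed
  ultimately show ?case by blast
qed

text \<open>The right singular vectors are the greedy maximizers of |M x|^2. Maximality makes their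
  images orthogonal, and the normalized nonzero images are the left singular vectors.\<close>

lemma svd_exists: "\<exists>U s V. is_svd m n M U s V"
proof -
  define T where "T = (\<lambda>x a. ip n (M a) x)"
  define Q where "Q = (\<lambda>x. ip m (T x) (T x))"
  have Tlin: "T (\<lambda>l. x l + c * y l) = (\<lambda>a. T x a + c * T y a)" for x y c
    by (simp add: T_def ip_linear)
  have "continuous_on UNIV Q" unfolding Q_def T_def
    by (intro continuous_on_ip continuous_on_coordinatewise_then_product continuous_on_ip_const)
  moreover have "Q (\<lambda>l. c * x l) = c\<^sup>2 * Q x" for c x
    by (simp add: Q_def T_def ip_linear power2_eq_square)
  moreover have "Q x = Q y" if "\<And>l. l < n \<Longrightarrow> x l = y l" for x y
    using that by (simp add: Q_def T_def ip_def)
  ultimately obtain V where V: "orthonormal_columns n n V"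
    and max: "\<And>i x. i < n \<Longrightarrow> (\<forall>p<i. ip n (\<lambda>l. V l p) x = 0) \<Longrightarrow> Q x \<le> Q (\<lambda>l. V l i) * ip n x x"
    using greedy_orthonormal[of Q n n] by blast
  define q where "q = (\<lambda>i. Q (\<lambda>l. V l i))"
  have q0: "0 \<le> q i" for i by (simp add: q_def Q_def)
  have mono: "q j \<le> q i" if "i \<le> j" "j < n" for i j
    using max[of i "\<lambda>l. V l j"] that V by (simp add: q_def orthonormal_columns_ip)
  \<comment> \<open>First variation: if the images of columns i < j were not orthogonal, moving from
    column i by a small multiple of column j, of the sign of \<open>?b\<close>, would raise
    \<open>Q\<close> above the maximum.\<close>
  have orth0: "ip m (T (\<lambda>l. V l i)) (T (\<lambda>l. V l j)) = 0" if ij: "i < j" "j < n" for i j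
  proof (rule ccontr)
    let ?b = "ip m (T (\<lambda>l. V l i)) (T (\<lambda>l. V l j))"
    assume b: "?b \<noteq> 0"
    have le: "q i + 2 * c * ?b + c\<^sup>2 * q j \<le> q i * (1 + c\<^sup>2)" for c
    proof -
      have "Q (\<lambda>l. V l i + c * V l j) \<le> q i * ip n (\<lambda>l. V l i + c * V l j) (\<lambda>l. V l i + c * V l j)"
        unfolding q_def
        by (rule max) (use ij V in \<open>auto simp: ip_linear orthonormal_columns_ip\<close>)
      also have "ip n (\<lambda>l. V l i + c * V l j) (\<lambda>l. V l i + c * V l j) = 1 + c\<^sup>2"
        using ij V by (simp add: ip_linear orthonormal_columns_ip power2_eq_square)
      also have "Q (\<lambda>l. V l i + c * V l j) = q i + 2 * c * ?b + c\<^sup>2 * q j"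
        unfolding Q_def Tlin q_def
        by (simp add: ip_linear power2_eq_square ip_commute algebra_simps)
      finally show ?thesis .
    qed
    have "q i > 0 \<or> q i = 0" using q0[of i] by linarith
    then show False
    proof
      assume qi: "q i > 0"
      have "2 * (?b / q i) * ?b + (?b / q i)\<^sup>2 * q j \<le> q i * (?b / q i)\<^sup>2"
        using le[of "?b / q i"] by (simp add: algebra_simps)
      moreover have "q i * (?b / q i)\<^sup>2 = (?b / q i) * ?b"
        using qi by (simp add: power2_eq_square)
      moreover have "(?b / q i)\<^sup>2 * q j \<ge> 0" using q0 by simp
      ultimately have "(?b / q i) * ?b \<le> 0" by linarith
      then have "?b * ?b \<le> 0" using qi by (simp add: divide_le_0_iff)
      then show False using b by (metis less_le_not_le not_real_square_gt_zero)
    next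
      assume "q i = 0"
      then have "2 * ?b * ?b + ?b\<^sup>2 * q j \<le> 0" using le[of ?b] by simp
      moreover have "?b\<^sup>2 * q j \<ge> 0" using q0 by simp
      moreover have "?b * ?b > 0" using b by (metis not_real_square_gt_zero)
      ultimately show False by linarith
    qed
  qed
  have orth: "ip m (T (\<lambda>l. V l i)) (T (\<lambda>l. V l j)) = (if i = j then q i else 0)"
    if "i < n" "j < n" for i j
    using orth0[of i j] orth0[of j i] that
    by (cases i j rule: linorder_cases) (auto simp: q_def Q_def ip_commute)
  \<comment> \<open>The rank: from this index on the images vanish, since the values
    \<open>q\<close> are nonincreasing. The left vectors beyond it are an arbitrary orthonormal
    completion.\<close>
  define r where "r = (LEAST i. i = n \<or> q i = 0)"
  have r: "r = n \<or> q r = 0" unfolding r_def by (rule LeastI[of _ n]) simp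
  have rn: "r \<le> n" unfolding r_def by (rule Least_le) simp
  have r1: "q i > 0" if "i < r" for i
    using not_less_Least[of i "\<lambda>i. i = n \<or> q i = 0"] that q0[of i] by (auto simp: r_def)
  have r2: "q i = 0" if "r \<le> i" "i < n" for i
    using r mono[OF that] that q0[of i] by auto
  define s where "s = (\<lambda>i. sqrt (q i))"
  have ss: "s i * s i = q i" for i using q0 by (simp add: s_def)
  have spos: "s i > 0" if "i < r" for i using r1[OF that] by (simp add: s_def)
  have "orthonormal_columns m r (\<lambda>a i. inverse (s i) * T (\<lambda>l. V l i) a)"
    unfolding orthonormal_columns_ip ip_linear
  proof (intro allI impI)
    fix i j assume i: "i < r" and j: "j < r"
    then show "inverse (s j) * (inverse (s i) * ip m (T (\<lambda>l. V l i)) (T (\<lambda>l. V l j)))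
        = (if i = j then 1 else 0)"
      using orth[of i j] rn spos[of i] ss[of i] by (auto simp: field_simps)
  qed
  from orthonormal_extend[OF this] orthonormal_columns_le[OF this]
  obtain U where U: "orthonormal_columns m m U" and rm: "r \<le> m"
    and UV: "\<And>a i. i < r \<Longrightarrow> U a i = inverse (s i) * T (\<lambda>l. V l i) a" by auto
  have TU: "T (\<lambda>l. V l i) a = U a i * s i" if "i < r" for i a
    using UV[OF that] spos[OF that] by (simp add: field_simps)
  have T0: "T (\<lambda>l. V l i) a = 0" if i: "r \<le> i" "i < n" and a: "a < m" for i a
  proof -
    have "ip m (T (\<lambda>l. V l i)) (T (\<lambda>l. V l i)) = 0" using orth[of i i] r2[OF i] i by simp
    then show ?thesis using a by (simp add: ip_self_eq_0_iff)
  qed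
  have "M a j = (\<Sum>l<min m n. U a l * s l * V j l)" if a: "a < m" and j: "j < n" for a j
  proof -
    have "M a j = (\<Sum>i<n. T (\<lambda>l. V l i) a * V j i)"
      using orthonormal_square_expand[OF V j, of "M a"] by (simp add: T_def ip_commute)
    also have "\<dots> = (\<Sum>i<r. T (\<lambda>l. V l i) a * V j i)"
      by (rule sum.mono_neutral_right) (use rn T0 a in auto)
    also have "\<dots> = (\<Sum>i<r. U a i * s i * V j i)"
      by (rule sum.cong) (auto simp: TU)
    also have "\<dots> = (\<Sum>l<min m n. U a l * s l * V j l)"
      by (rule sum.mono_neutral_left) (use rn rm r2 in \<open>auto simp: s_def\<close>)
    finally show ?thesis .
  qed
  then have "is_svd m n M U s V"
    unfolding is_svd_def using U V mono q0 by (auto simp: s_def)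
  then show ?thesis by blast
qed

subsection \<open>Recovery by minimization\<close>

text \<open>Duality by a nearest point argument in place of Hahn-Banach. \<open>u\<close> minimizes
  the residual over the l1 ball of radius R b. The residual \<open>t\<close> is then normal to the
  image of that ball, and comparison with its extreme points turns \<open>LQ\<close> into |t|^2 <=
  0.\<close>

lemma dual_solve:
  fixes B :: "nat \<Rightarrow> nat \<Rightarrow> real"
  assumes LQ: "\<And>t M. (\<And>l. l < d \<Longrightarrow> \<bar>\<Sum>i<m. B i l * t i\<bar> \<le> M) \<Longrightarrow> 0 \<le> M \<Longrightarrow> (\<Sum>i<m. \<bar>t i\<bar>) \<le> R * M"
    and R: "0 \<le> R" and b: "0 \<le> b" and v: "\<And>i. i < m \<Longrightarrow> \<bar>v i\<bar> \<le> b"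
  obtains u where "\<And>l. l \<ge> d \<Longrightarrow> u l = 0" "\<And>i. i < m \<Longrightarrow> ip d (B i) u = v i" "(\<Sum>l<d. \<bar>u l\<bar>) \<le> R * b"
proof -
  define S where "S = {x :: nat \<Rightarrow> real. \<forall>i\<ge>d. x i = 0} \<inter> {x. (\<Sum>l<d. \<bar>x l\<bar>) \<le> R * b}"
  define \<phi> where "\<phi> = (\<lambda>x. \<Sum>i<m. (v i - ip d (B i) x)\<^sup>2)"
  have Rb: "0 \<le> R * b" using R b by simp
  have "closed S" unfolding S_def
    by (intro closed_Int closed_Euclidean_supp closed_Collect_le continuous_on_sum
        continuous_on_rabs continuous_on_const continuous_on_product_coordinates)
  then have "compact S"
  proof (rule compact_bounded_vectors[where n = d and r = "R * b"])
    fix x i assume x: "x \<in> S"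
    show "x i = 0" if "i \<ge> d" using x that by (simp add: S_def)
    show "\<bar>x i\<bar> \<le> R * b" if "i < d"
      using member_le_sum[of i "{..<d}" "\<lambda>i. \<bar>x i\<bar>"] x that by (simp add: S_def)
  qed
  moreover have "(\<lambda>_. 0) \<in> S" using Rb by (simp add: S_def)
  then have "S \<noteq> {}" by blast
  moreover have "continuous_on S \<phi>" unfolding \<phi>_def
    by (intro continuous_on_sum continuous_on_power continuous_on_diff continuous_on_const continuous_on_ip_const)
  ultimately obtain u where u: "u \<in> S" "\<And>y. y \<in> S \<Longrightarrow> \<phi> u \<le> \<phi> y"
    using continuous_attains_inf[of S \<phi>] by metis
  define t where "t = (\<lambda>i. v i - ip d (B i) u)"
  \<comment> \<open>First order condition for the projection, tested on (1 - c) u + c w. The choice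
    c = 1 yields 2 p <= n2, so the decisive value c = p / n2 is an admissible convex weight.\<close>
  have var: "(\<Sum>i<m. t i * ip d (B i) w) \<le> (\<Sum>i<m. t i * ip d (B i) u)" if w: "w \<in> S" for w
  proof (rule ccontr)
    define D where "D = (\<lambda>i. ip d (B i) w - ip d (B i) u)"
    assume "\<not> ?thesis"
    then have P: "(\<Sum>i<m. t i * D i) > 0"
      by (simp add: D_def algebra_simps sum_subtractf)
    define p where "p = (\<Sum>i<m. t i * D i)"
    define n2 where "n2 = (\<Sum>i<m. (D i)\<^sup>2)"
    have n2: "n2 \<ge> 0" by (simp add: n2_def sum_nonneg)
    have ineq: "2 * c * p \<le> c\<^sup>2 * n2" if c: "0 \<le> c" "c \<le> 1" for c
    proof -
      define y where "y = (\<lambda>l. (1 - c) * u l + c * w l)"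
      have "(\<Sum>l<d. \<bar>y l\<bar>) \<le> (\<Sum>l<d. (1 - c) * \<bar>u l\<bar> + c * \<bar>w l\<bar>)"
        unfolding y_def using c by (intro sum_mono order.trans[OF abs_triangle_ineq]) (simp add: abs_mult)
      also have "\<dots> = (1 - c) * (\<Sum>l<d. \<bar>u l\<bar>) + c * (\<Sum>l<d. \<bar>w l\<bar>)"
        by (simp add: sum.distrib sum_distrib_left)
      also have "\<dots> \<le> (1 - c) * (R * b) + c * (R * b)"
        using u(1) w c by (intro add_mono mult_left_mono) (auto simp: S_def)
      also have "\<dots> = R * b" by (simp add: algebra_simps)
      finally have "y \<in> S" using u(1) w by (simp add: S_def y_def)
      then have "\<phi> u \<le> \<phi> y" by (rule u(2))
      also have "\<phi> y = (\<Sum>i<m. (t i - c * D i)\<^sup>2)"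
        unfolding \<phi>_def y_def t_def D_def by (simp add: ip_linear algebra_simps)
      also have "\<dots> = (\<Sum>i<m. (t i)\<^sup>2) - 2 * c * p + c\<^sup>2 * n2"
        by (simp add: p_def n2_def power2_diff sum.distrib sum_subtractf sum_distrib_left
            power_mult_distrib mult_ac)
      also have "\<phi> u = (\<Sum>i<m. (t i)\<^sup>2)" by (simp add: \<phi>_def t_def)
      finally show ?thesis by simp
    qed
    have "2 * p \<le> n2" using ineq[of 1] by simp
    then have n2p: "n2 > 0" using P by (simp add: p_def)
    have "2 * (p / n2) * p \<le> (p / n2)\<^sup>2 * n2"
      by (rule ineq) (use \<open>2 * p \<le> n2\<close> n2p P in \<open>auto simp: p_def[symmetric] divide_le_eq\<close>)
    then have "2 * (p * p / n2) \<le> p * p / n2" using n2p by (simp add: power2_eq_square)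
    moreover have "p * p / n2 > 0" using P n2p by (simp add: p_def)
    ultimately show False by linarith
  qed
  define c where "c = (\<lambda>l. \<Sum>i<m. B i l * t i)"
  define M where "M = Max (insert 0 ((\<lambda>l. \<bar>c l\<bar>) ` {..<d}))"
  have M: "\<bar>c l\<bar> \<le> M" if "l < d" for l unfolding M_def using that by (intro Max_ge) auto
  have M0: "0 \<le> M" unfolding M_def by (intro Max_ge) auto
  have l1: "(\<Sum>i<m. \<bar>t i\<bar>) \<le> R * M" using M M0 by (intro LQ) (auto simp: c_def)
  have t0: "t i = 0" if "i < m" for i
  proof (cases "M = 0")
    case True
    then have "(\<Sum>i<m. \<bar>t i\<bar>) \<le> 0" using l1 by simp
    then have "(\<Sum>i<m. \<bar>t i\<bar>) = 0" by (intro antisym) (auto intro: sum_nonneg)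
    then show ?thesis using that by (simp add: sum_nonneg_eq_0_iff)
  next
    case False
    have "M \<in> insert 0 ((\<lambda>l. \<bar>c l\<bar>) ` {..<d})" unfolding M_def by (rule Max_in) auto
    then obtain l where l: "l < d" "M = \<bar>c l\<bar>" using False by auto
    \<comment> \<open>The vertex of the l1 ball at which the functional \<open>c\<close> attains its
      maximum over the ball, which is R b M.\<close>
    define w where "w = (\<lambda>j. if j = l then R * b * sgn (c l) else 0)"
    have ipw: "ip d x w = R * b * sgn (c l) * x l" for x
    proof -
      have "w = (\<lambda>j. (R * b * sgn (c l)) * (if j = l then 1 else 0))" by (auto simp: w_def)
      then show ?thesis using l(1) by (simp only: ip_scale_right ip_commute[of d x] ip_unit) 
    qed
    have "(\<Sum>j<d. \<bar>w j\<bar>) = (\<Sum>j<d. if j = l then R * b * \<bar>sgn (c l)\<bar> else 0)"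
      using R b by (intro sum.cong) (auto simp: w_def abs_mult)
    also have "\<dots> \<le> R * b" using l Rb by (simp add: abs_sgn_eq)
    finally have "w \<in> S" using l(1) by (auto simp: S_def w_def)
    from var[OF this] have "R * b * sgn (c l) * c l \<le> (\<Sum>i<m. t i * ip d (B i) u)"
      unfolding ipw by (simp add: c_def sum_distrib_left sum_distrib_right mult_ac)
    also have "\<dots> = (\<Sum>i<m. t i * v i) - (\<Sum>i<m. (t i)\<^sup>2)"
      by (simp add: t_def algebra_simps sum_subtractf[symmetric] power2_eq_square sum.distrib[symmetric])
    also have "R * b * sgn (c l) * c l = R * b * M" using l(2) by (simp add: abs_sgn mult_ac)
    finally have "R * b * M + (\<Sum>i<m. (t i)\<^sup>2) \<le> (\<Sum>i<m. t i * v i)" by simp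
    also have "(\<Sum>i<m. t i * v i) \<le> (\<Sum>i<m. \<bar>t i\<bar> * b)"
    proof (rule sum_mono)
      fix i assume "i \<in> {..<m}"
      then have "\<bar>t i\<bar> * \<bar>v i\<bar> \<le> \<bar>t i\<bar> * b" using v by (intro mult_left_mono) auto
      then show "t i * v i \<le> \<bar>t i\<bar> * b" using abs_ge_self[of "t i * v i"] by (simp add: abs_mult)
    qed
    also have "\<dots> \<le> R * M * b" using l1 b by (simp add: sum_distrib_right[symmetric] mult_right_mono)
    finally have "(\<Sum>i<m. (t i)\<^sup>2) \<le> 0" by (simp add: mult_ac)
    then have "(\<Sum>i<m. (t i)\<^sup>2) = 0" using sum_nonneg[of "{..<m}" "\<lambda>i. (t i)\<^sup>2"] by simp
    then show ?thesis using that by (simp add: sum_nonneg_eq_0_iff)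
  qed
  show thesis using that[of u] u(1) t0 by (auto simp: S_def t_def)
qed

lemma l1_minimizer_exists:
  assumes u: "u \<in> topspace (Euclidean_space d)" "mat_vec m d \<Phi> u = y"
  shows "\<exists>x. is_l1_minimizer m d \<Phi> y x"
proof -
  define S where "S = {x :: nat \<Rightarrow> real. \<forall>i\<ge>d. x i = 0} \<inter> (\<Inter>i\<in>{..<m}. {x. ip d (\<Phi> i) x = y i})
     \<inter> {x. (\<Sum>l<d. \<bar>x l\<bar>) \<le> (\<Sum>l<d. \<bar>u l\<bar>)}"
  have mv: "mat_vec m d \<Phi> x = y \<longleftrightarrow> (\<forall>i<m. ip d (\<Phi> i) x = y i)" for x
    unfolding u(2)[symmetric] by (auto simp: mat_vec_def ip_def fun_eq_iff)
  have "closed S" unfolding S_def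
    by (intro closed_Int closed_INT ballI closed_Euclidean_supp closed_Collect_le closed_Collect_eq continuous_on_sum
        continuous_on_rabs continuous_on_const continuous_on_product_coordinates continuous_on_ip_const)
  then have "compact S"
  proof (rule compact_bounded_vectors[where n = d and r = "\<Sum>l<d. \<bar>u l\<bar>"])
    fix x i assume x: "x \<in> S"
    show "x i = 0" if "i \<ge> d" using x that by (simp add: S_def)
    show "\<bar>x i\<bar> \<le> (\<Sum>l<d. \<bar>u l\<bar>)" if "i < d"
      using member_le_sum[of i "{..<d}" "\<lambda>i. \<bar>x i\<bar>"] x that by (simp add: S_def)
  qed
  moreover have "u \<in> S" using u by (simp add: S_def mv topspace_Euclidean_space)
  then have "S \<noteq> {}" by blast
  moreover have "continuous_on S (\<lambda>x. \<Sum>l<d. \<bar>x l\<bar>)"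
    by (intro continuous_on_sum continuous_on_rabs continuous_on_subset[OF continuous_on_product_coordinates]) auto
  ultimately obtain x where x: "x \<in> S" "\<And>z. z \<in> S \<Longrightarrow> (\<Sum>l<d. \<bar>x l\<bar>) \<le> (\<Sum>l<d. \<bar>z l\<bar>)"
    using continuous_attains_inf[of S "\<lambda>x. \<Sum>l<d. \<bar>x l\<bar>"] by metis
  have "(\<Sum>l<d. \<bar>x l\<bar>) \<le> (\<Sum>l<d. \<bar>z l\<bar>)"
    if z: "z \<in> topspace (Euclidean_space d)" "mat_vec m d \<Phi> z = y" for z
  proof (cases "z \<in> S")
    case False
    then have "(\<Sum>l<d. \<bar>u l\<bar>) < (\<Sum>l<d. \<bar>z l\<bar>)"
      using z by (auto simp: S_def mv topspace_Euclidean_space)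
    then show ?thesis using x(2)[OF \<open>u \<in> S\<close>] by simp
  qed (rule x(2))
  then show ?thesis
    using x(1) by (intro exI[of _ x]) (auto simp: is_l1_minimizer_def S_def mv topspace_Euclidean_space)
qed

text \<open>Almost minimality (slack \<open>U\<close>, which will come from the noise) bounds |h|_1
  by 2 |h_S|_1 + 2 \<tau> + U. Since a sqrt s0 <= 1/4, the term with h_S is at most half of |h|_2
  and is absorbed into the left side; this doubles what remains.\<close>

lemma l1_recovery:
  fixes x xh :: "nat \<Rightarrow> real"
  assumes width: "sqrt (ip d h h) \<le> a * (\<Sum>l<d. \<bar>h l\<bar>) + e"
    and h: "h = (\<lambda>l. xh l - x l)"
    and l1: "(\<Sum>l<d. \<bar>xh l\<bar>) \<le> (\<Sum>l<d. \<bar>x l\<bar>) + U"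
    and S: "S \<subseteq> {..<d}" "real (card S) \<le> s0" "(\<Sum>l\<in>{..<d} - S. \<bar>x l\<bar>) \<le> \<tau>"
    and a: "0 \<le> a" "a * sqrt s0 \<le> 1 / 4"
  shows "sqrt (ip d h h) \<le> 2 * a * (2 * \<tau> + U) + 2 * e"
proof -
  have fin: "finite S" using S(1) finite_subset by blast
  have split: "(\<Sum>l<d. f l) = (\<Sum>l\<in>S. f l) + (\<Sum>l\<in>{..<d} - S. f l)" for f :: "nat \<Rightarrow> real"
    using sum.subset_diff[OF S(1), of f] by simp
  have "(\<Sum>l\<in>S. \<bar>x l\<bar>) - (\<Sum>l\<in>S. \<bar>h l\<bar>) \<le> (\<Sum>l\<in>S. \<bar>xh l\<bar>)"
    unfolding sum_subtractf[symmetric] by (rule sum_mono) (simp add: h)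
  moreover have "(\<Sum>l\<in>{..<d} - S. \<bar>h l\<bar>) - (\<Sum>l\<in>{..<d} - S. \<bar>x l\<bar>) \<le> (\<Sum>l\<in>{..<d} - S. \<bar>xh l\<bar>)"
    unfolding sum_subtractf[symmetric] by (rule sum_mono) (simp add: h)
  ultimately have hl1: "(\<Sum>l<d. \<bar>h l\<bar>) \<le> 2 * (\<Sum>l\<in>S. \<bar>h l\<bar>) + 2 * \<tau> + U"
    using l1 S(3) split[of "\<lambda>l. \<bar>h l\<bar>"] split[of "\<lambda>l. \<bar>x l\<bar>"] split[of "\<lambda>l. \<bar>xh l\<bar>"] by linarith
  have "(\<Sum>l\<in>S. \<bar>h l\<bar>) \<le> sqrt s0 * sqrt (ip d h h)"
  proof -
    have "(\<Sum>l\<in>S. \<bar>h l\<bar>) = (\<Sum>l\<in>S. \<bar>h l\<bar> * \<bar>1\<bar>)" by simp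
    also have "\<dots> \<le> L2_set h S * L2_set (\<lambda>_. 1) S" by (rule L2_set_mult_ineq)
    also have "\<dots> \<le> sqrt (ip d h h) * sqrt s0"
    proof (rule mult_mono)
      have "(\<Sum>l\<in>S. (h l)\<^sup>2) \<le> (\<Sum>l<d. (h l)\<^sup>2)" by (rule sum_mono2) (use S in auto)
      then show "L2_set h S \<le> sqrt (ip d h h)" by (simp add: L2_set_def ip_self)
      show "L2_set (\<lambda>_. 1) S \<le> sqrt s0" using S(2) by (simp add: L2_set_def)
    qed auto
    finally show ?thesis by (simp add: mult.commute)
  qed
  then have "a * (\<Sum>l\<in>S. \<bar>h l\<bar>) \<le> a * (sqrt s0 * sqrt (ip d h h))" using a(1) by (rule mult_left_mono)
  also have "\<dots> \<le> 1 / 4 * sqrt (ip d h h)"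
    using mult_right_mono[OF a(2), of "sqrt (ip d h h)"] by (simp add: mult.assoc)
  finally have 1: "a * (\<Sum>l\<in>S. \<bar>h l\<bar>) \<le> 1 / 4 * sqrt (ip d h h)" .
  have "a * (\<Sum>l<d. \<bar>h l\<bar>) \<le> a * (2 * (\<Sum>l\<in>S. \<bar>h l\<bar>) + 2 * \<tau> + U)"
    using hl1 a(1) by (rule mult_left_mono)
  then have "a * (\<Sum>l<d. \<bar>h l\<bar>) \<le> 2 * (a * (\<Sum>l\<in>S. \<bar>h l\<bar>)) + a * (2 * \<tau> + U)"
    by (simp add: algebra_simps)
  then show ?thesis using width 1 by (simp add: mult.assoc)
qed

section \<open>Compressible vectors and lq quasinorms\<close>

lemma powr_split: "0 \<le> (z::real) \<Longrightarrow> z = z powr q * z powr (1 - q)"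
  by (cases "z = 0") (auto simp: powr_add[symmetric])

lemma best_sparse_approximation:
  fixes x :: "nat \<Rightarrow> real"
  assumes q: "0 < q" "q \<le> 1" and xq: "(\<Sum>l<d. \<bar>x l\<bar> powr q) \<le> Q" and Q: "0 < Q" and s0: "0 < s0"
  obtains S where "S \<subseteq> {..<d}" "real (card S) \<le> s0"
    "(\<Sum>l\<in>{..<d} - S. \<bar>x l\<bar>) \<le> Q powr (1 / q) * s0 powr (1 - 1 / q)"
proof
  \<comment> \<open>The level with T^q = Q / s0: by Markov's inequality at most s0 entries exceed
    it, and below it |x| <= |x|^q T^(1-q).\<close>
  define T where "T = (Q / s0) powr (1 / q)"
  define S where "S = {l. l < d \<and> T < \<bar>x l\<bar>}"
  have Tq: "T powr q = Q / s0" unfolding T_def using q Q s0 by (simp add: powr_powr)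
  have T0: "T > 0" using Q s0 by (simp add: T_def)
  show "S \<subseteq> {..<d}" by (auto simp: S_def)
  have "real (card S) * (Q / s0) = (\<Sum>l\<in>S. T powr q)" by (simp add: Tq)
  also have "\<dots> \<le> (\<Sum>l\<in>S. \<bar>x l\<bar> powr q)"
    using T0 q by (intro sum_mono powr_mono2) (auto simp: S_def)
  also have "\<dots> \<le> (\<Sum>l<d. \<bar>x l\<bar> powr q)" by (rule sum_mono2) (auto simp: S_def)
  also have "\<dots> \<le> Q" by (rule xq)
  finally show "real (card S) \<le> s0" using Q s0 by (simp add: field_simps)
  have "(\<Sum>l\<in>{..<d} - S. \<bar>x l\<bar>) \<le> (\<Sum>l\<in>{..<d} - S. \<bar>x l\<bar> powr q * T powr (1 - q))"
  proof (rule sum_mono)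
    fix l assume "l \<in> {..<d} - S"
    then have "\<bar>x l\<bar> powr q * \<bar>x l\<bar> powr (1 - q) \<le> \<bar>x l\<bar> powr q * T powr (1 - q)"
      using q by (intro mult_left_mono powr_mono2) (auto simp: S_def)
    then show "\<bar>x l\<bar> \<le> \<bar>x l\<bar> powr q * T powr (1 - q)" using powr_split[of "\<bar>x l\<bar>" q] by simp
  qed
  also have "\<dots> \<le> Q * T powr (1 - q)"
  proof -
    have "(\<Sum>l\<in>{..<d} - S. \<bar>x l\<bar> powr q) \<le> (\<Sum>l<d. \<bar>x l\<bar> powr q)" by (rule sum_mono2) auto
    then show ?thesis using xq by (simp add: sum_distrib_right[symmetric] mult_right_mono)
  qed
  also have "T powr (1 - q) = (Q / s0) powr (1 / q - 1)"
    unfolding T_def using q by (simp add: powr_powr diff_divide_distrib right_diff_distrib)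
  also have "Q * (Q / s0) powr (1 / q - 1) = Q powr (1 / q) * s0 powr (1 - 1 / q)"
  proof -
    have "Q * (Q / s0) powr (1 / q - 1) = Q powr 1 * Q powr (1 / q - 1) / s0 powr (1 / q - 1)"
      using Q s0 by (simp add: powr_divide)
    also have "\<dots> = Q powr (1 / q) / s0 powr (1 / q - 1)" by (simp only: powr_add[symmetric]) simp
    also have "\<dots> = Q powr (1 / q) * s0 powr (- (1 / q - 1))" by (simp only: powr_minus divide_inverse)
    finally show ?thesis by simp
  qed
  finally show "(\<Sum>l\<in>{..<d} - S. \<bar>x l\<bar>) \<le> Q powr (1 / q) * s0 powr (1 - 1 / q)" .
qed

lemma sum_le_quasinorm:
  fixes a :: "'i \<Rightarrow> real"
  assumes q: "0 < q" "q \<le> 1" and fin: "finite I"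
  shows "(\<Sum>i\<in>I. \<bar>a i\<bar>) \<le> (\<Sum>i\<in>I. \<bar>a i\<bar> powr q) powr (1 / q)"
proof -
  define s where "s = (\<Sum>i\<in>I. \<bar>a i\<bar> powr q)"
  define N where "N = s powr (1 / q)"
  have s0: "0 \<le> s" by (simp add: s_def sum_nonneg)
  have Nq: "N powr q = s" unfolding N_def using q s0 by (simp add: powr_powr)
  have N0: "0 \<le> N" by (simp add: N_def)
  have le: "\<bar>a i\<bar> \<le> N" if "i \<in> I" for i
  proof -
    have "\<bar>a i\<bar> powr q \<le> s" unfolding s_def by (rule member_le_sum) (use that fin in auto)
    then have "(\<bar>a i\<bar> powr q) powr (1 / q) \<le> N" unfolding N_def using q by (intro powr_mono2) auto
    then show ?thesis using q by (simp add: powr_powr)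
  qed
  have "(\<Sum>i\<in>I. \<bar>a i\<bar>) \<le> (\<Sum>i\<in>I. \<bar>a i\<bar> powr q * N powr (1 - q))"
  proof (rule sum_mono)
    fix i assume "i \<in> I"
    then have "\<bar>a i\<bar> powr q * \<bar>a i\<bar> powr (1 - q) \<le> \<bar>a i\<bar> powr q * N powr (1 - q)"
      using q le by (intro mult_left_mono powr_mono2) auto
    then show "\<bar>a i\<bar> \<le> \<bar>a i\<bar> powr q * N powr (1 - q)" using powr_split[of "\<bar>a i\<bar>" q] by simp
  qed
  also have "\<dots> = N powr q * N powr (1 - q)" by (simp add: sum_distrib_right[symmetric] s_def[symmetric] Nq)
  also have "\<dots> = N" using powr_split[OF N0, of q] by simp
  finally show ?thesis by (simp add: N_def s_def)
qed

lemma powr_sum_le: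
  fixes a :: "'i \<Rightarrow> real"
  assumes q: "0 < q" "q \<le> 1" and fin: "finite I"
  shows "\<bar>\<Sum>i\<in>I. a i\<bar> powr q \<le> (\<Sum>i\<in>I. \<bar>a i\<bar> powr q)"
proof -
  have "\<bar>\<Sum>i\<in>I. a i\<bar> \<le> (\<Sum>i\<in>I. \<bar>a i\<bar> powr q) powr (1 / q)"
    using sum_abs sum_le_quasinorm[OF assms, of a] by (rule order_trans)
  then have "\<bar>\<Sum>i\<in>I. a i\<bar> powr q \<le> ((\<Sum>i\<in>I. \<bar>a i\<bar> powr q) powr (1 / q)) powr q"
    using q by (intro powr_mono2) auto
  then show ?thesis using q by (simp add: powr_powr sum_nonneg)
qed

text \<open>The vector is the gradient of the ridge function. For q <= 1 the q-th power of the
  quasinorm is subadditive; after taking the q-th root this is the source of the factor k^(1/q) in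
  \<nu>2.\<close>

lemma quasinorm_combination:
  fixes A :: "nat \<Rightarrow> nat \<Rightarrow> real"
  assumes q: "0 < q" "q \<le> 1" and C: "0 < C1" "0 < C2"
    and A: "\<And>i. i < k \<Longrightarrow> (\<Sum>j<d. \<bar>A i j\<bar> powr q) powr (1 / q) \<le> C1"
    and G: "\<And>i. i < k \<Longrightarrow> \<bar>G i\<bar> \<le> C2"
  shows "(\<Sum>j<d. \<bar>\<Sum>i<k. G i * A i j\<bar> powr q) \<le> real k * (C1 * C2) powr q"
proof -
  have A': "(\<Sum>j<d. \<bar>A i j\<bar> powr q) \<le> C1 powr q" if "i < k" for i
  proof -
    have "((\<Sum>j<d. \<bar>A i j\<bar> powr q) powr (1 / q)) powr q \<le> C1 powr q"
      using q A[OF that] by (intro powr_mono2) auto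
    then show ?thesis using q by (simp add: powr_powr sum_nonneg)
  qed
  have "(\<Sum>j<d. \<bar>\<Sum>i<k. G i * A i j\<bar> powr q) \<le> (\<Sum>j<d. \<Sum>i<k. \<bar>G i * A i j\<bar> powr q)"
    by (intro sum_mono powr_sum_le q) simp
  also have "\<dots> = (\<Sum>i<k. \<bar>G i\<bar> powr q * (\<Sum>j<d. \<bar>A i j\<bar> powr q))"
    by (subst sum.swap) (simp add: abs_mult powr_mult sum_distrib_left)
  also have "\<dots> \<le> (\<Sum>i<k. C2 powr q * C1 powr q)"
    using G A' q by (intro sum_mono mult_mono powr_mono2) (auto simp: sum_nonneg)
  also have "\<dots> = real k * (C1 * C2) powr q" using C by (simp add: powr_mult mult_ac)
  finally show ?thesis .
qed

section \<open>Perturbation of the leading right singular vectors\<close>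

text \<open>\<open>X\<close> is close to a matrix of rank at most k, so its singular value with
  index \<open>k\<close> (the (k+1)-st, counting from 0) is small, as in the inequality of Eckart
  and Young. The span of the first k + 1 right singular vectors contains a unit vector
  \<open>z\<close> orthogonal to the k rows of \<open>A\<close>, and X z is bounded by the distance
  to the low rank matrix.\<close>

lemma svd_tail_small:
  assumes svd: "is_svd m d X U s V"
    and close: "\<And>j. j < m \<Longrightarrow> ip d (\<lambda>l. X j l - (\<Sum>i<k. G j i * A i l)) (\<lambda>l. X j l - (\<Sum>i<k. G j i * A i l)) \<le> \<nu>\<^sup>2"
    and w: "\<And>l. l < k \<Longrightarrow> ip d (\<lambda>j. V j l) w = 0"
  shows "(\<Sum>j<m. (ip d (X j) w)\<^sup>2) \<le> real m * \<nu>\<^sup>2 * ip d w w"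
proof -
  define p where "p = min m d"
  have U: "orthonormal_columns m p U" and V: "orthonormal_columns d d V"
    using svd by (auto simp: is_svd_def orthonormal_columns_def p_def)
  have V': "orthonormal_columns d p V" using V by (auto simp: orthonormal_columns_def p_def)
  have s: "0 \<le> s i" if "i < p" for i using svd that by (auto simp: is_svd_def p_def)
  have smono: "s j \<le> s i" if "i \<le> j" "j < p" for i j using svd that by (auto simp: is_svd_def p_def)
  have Xz: "ip d (X j) z = (\<Sum>l<p. (s l * ip d (\<lambda>j. V j l) z) * U j l)" if "j < m" for j z
  proof -
    have "ip d (X j) z = ip d (\<lambda>i. \<Sum>l<p. (U j l * s l) * V i l) z"
      using svd that by (intro ip_cong) (auto simp: is_svd_def p_def)
    then show ?thesis by (simp add: ip_linear mult_ac)
  qed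
  have nrm: "(\<Sum>j<m. (ip d (X j) z)\<^sup>2) = (\<Sum>l<p. (s l * ip d (\<lambda>j. V j l) z)\<^sup>2)" for z
  proof -
    have "(\<Sum>j<m. (ip d (X j) z)\<^sup>2) = ip m (\<lambda>j. \<Sum>l<p. (s l * ip d (\<lambda>j. V j l) z) * U j l)
       (\<lambda>j. \<Sum>l<p. (s l * ip d (\<lambda>j. V j l) z) * U j l)"
      unfolding ip_self by (rule sum.cong) (auto simp: Xz)
    then show ?thesis by (simp only: orthonormal_combination_norm[OF U])
  qed
  show ?thesis
  proof (cases "p \<le> k")
    case True
    then have "(\<Sum>j<m. (ip d (X j) w)\<^sup>2) = 0" unfolding nrm using w by simp
    then show ?thesis by simp
  next
    case False
    then have kp: "k < p" by simp
    obtain c where c: "ip (Suc k) c c = 1" "\<And>a. a < k \<Longrightarrow> ip (Suc k) (\<lambda>l. ip d (A a) (\<lambda>j. V j l)) c = 0"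
      using exists_unit_orthogonal[of k "Suc k" "\<lambda>a l. ip d (A a) (\<lambda>j. V j l)"] by (metis lessI)
    define z where "z = (\<lambda>j. \<Sum>l<Suc k. c l * V j l)"
    have Vk: "orthonormal_columns d (Suc k) V" using V' kp by (auto simp: orthonormal_columns_def)
    have zz: "ip d z z = 1"
      unfolding z_def orthonormal_combination_norm[OF Vk] using c(1) by (simp add: ip_self)
    have Az: "ip d (A a) z = 0" if "a < k" for a
      using c(2)[OF that] unfolding z_def ip_sum_right ip_scale_right
      by (simp add: ip_def[of "Suc k"] mult.commute)
    have Vz: "ip d (\<lambda>j. V j l) z = c l" if "l < Suc k" for l
    proof -
      have "ip d (\<lambda>j. V j l) z = (\<Sum>i<Suc k. if i = l then c i else 0)"
        unfolding z_def ip_sum_right ip_scale_right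
        by (rule sum.cong) (use Vk that in \<open>auto simp: orthonormal_columns_ip\<close>)
      then show ?thesis using that by simp
    qed
    have "(s k)\<^sup>2 = (\<Sum>l<Suc k. (s k)\<^sup>2 * (c l)\<^sup>2)"
      using c(1) by (simp only: sum_distrib_left[symmetric] ip_self[symmetric])
    also have "\<dots> \<le> (\<Sum>l<Suc k. (s l * ip d (\<lambda>j. V j l) z)\<^sup>2)"
      using smono kp s by (intro sum_mono) (auto simp: Vz power_mult_distrib intro!: mult_right_mono power_mono)
    also have "\<dots> \<le> (\<Sum>l<p. (s l * ip d (\<lambda>j. V j l) z)\<^sup>2)" by (rule sum_mono2) (use kp in auto)
    also have "\<dots> = (\<Sum>j<m. (ip d (X j) z)\<^sup>2)" by (rule nrm[symmetric])
    also have "\<dots> \<le> (\<Sum>j<m. \<nu>\<^sup>2)"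
    proof (rule sum_mono)
      fix j assume "j \<in> {..<m}"
      then have j: "j < m" by simp
      let ?y = "\<lambda>l. X j l - (\<Sum>i<k. G j i * A i l)"
      have "ip d (X j) z = ip d ?y z" using Az by (simp add: ip_linear)
      then show "(ip d (X j) z)\<^sup>2 \<le> \<nu>\<^sup>2" using ip_CS[of d ?y z] close[OF j] zz by simp
    qed
    finally have sk: "(s k)\<^sup>2 \<le> real m * \<nu>\<^sup>2" by simp
    have "(\<Sum>j<m. (ip d (X j) w)\<^sup>2) \<le> (\<Sum>l<p. (s k)\<^sup>2 * (ip d (\<lambda>j. V j l) w)\<^sup>2)"
      unfolding nrm
    proof (rule sum_mono)
      fix l assume "l \<in> {..<p}"
      then show "(s l * ip d (\<lambda>j. V j l) w)\<^sup>2 \<le> (s k)\<^sup>2 * (ip d (\<lambda>j. V j l) w)\<^sup>2"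
        using smono[of k l] s[of l] w[of l]
        by (cases "l < k") (auto simp: power_mult_distrib intro!: mult_right_mono power_mono)
    qed
    also have "\<dots> \<le> (s k)\<^sup>2 * ip d w w"
      unfolding sum_distrib_left[symmetric] by (intro mult_left_mono bessel[OF V']) simp
    also have "\<dots> \<le> real m * \<nu>\<^sup>2 * ip d w w" using sk by (intro mult_right_mono) auto
    finally show ?thesis .
  qed
qed

text \<open>A one-sided substitute for Wedin's theorem. The product of \<open>G j\<close> with A w
  is X_j w minus the action of the error row on w. Both have mean square at most \<nu>^2 |w|^2, and
  (a - b)^2 <= 2 a^2 + 2 b^2 gives the 4.\<close>

lemma subspace_error:
  assumes svd: "is_svd m d X U s V" and m: "0 < m"
    and close: "\<And>j. j < m \<Longrightarrow> ip d (\<lambda>l. X j l - (\<Sum>i<k. G j i * A i l)) (\<lambda>l. X j l - (\<Sum>i<k. G j i * A i l)) \<le> \<nu>\<^sup>2"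
    and lower: "\<And>u. real m * \<beta> * ip k u u \<le> (\<Sum>j<m. (ip k (G j) u)\<^sup>2)"
    and w: "\<And>l. l < k \<Longrightarrow> ip d (\<lambda>j. V j l) w = 0"
  shows "\<beta> * (\<Sum>i<k. (ip d (A i) w)\<^sup>2) \<le> 4 * \<nu>\<^sup>2 * ip d w w"
proof -
  let ?y = "\<lambda>j l. X j l - (\<Sum>i<k. G j i * A i l)"
  define u where "u = (\<lambda>i. ip d (A i) w)"
  have "real m * \<beta> * (\<Sum>i<k. (ip d (A i) w)\<^sup>2) \<le> (\<Sum>j<m. (ip k (G j) u)\<^sup>2)"
    using lower[of u] unfolding ip_self[of k u] by (simp add: u_def)
  also have "\<dots> \<le> (\<Sum>j<m. 2 * (ip d (X j) w)\<^sup>2 + 2 * (\<nu>\<^sup>2 * ip d w w))"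
  proof (rule sum_mono)
    fix j assume "j \<in> {..<m}"
    then have j: "j < m" by simp
    have "ip k (G j) u = ip d (X j) w - ip d (?y j) w"
      by (simp add: ip_linear u_def ip_def[of k])
    then have "(ip k (G j) u)\<^sup>2 \<le> 2 * (ip d (X j) w)\<^sup>2 + 2 * (ip d (?y j) w)\<^sup>2"
      using sum_squares_bound[of "ip d (X j) w" "- ip d (?y j) w"] by (simp add: power2_diff)
    also have "(ip d (?y j) w)\<^sup>2 \<le> \<nu>\<^sup>2 * ip d w w"
      using ip_CS[of d "?y j" w] mult_right_mono[OF close[OF j], of "ip d w w"] by simp
    finally show "(ip k (G j) u)\<^sup>2 \<le> 2 * (ip d (X j) w)\<^sup>2 + 2 * (\<nu>\<^sup>2 * ip d w w)" by simp
  qed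
  also have "\<dots> = 2 * (\<Sum>j<m. (ip d (X j) w)\<^sup>2) + 2 * (real m * \<nu>\<^sup>2 * ip d w w)"
    by (simp add: sum.distrib sum_distrib_left)
  also have "\<dots> \<le> 4 * (real m * \<nu>\<^sup>2 * ip d w w)"
    using svd_tail_small[OF svd close w] by linarith
  finally have "real m * (\<beta> * (\<Sum>i<k. (ip d (A i) w)\<^sup>2)) \<le> real m * (4 * \<nu>\<^sup>2 * ip d w w)"
    by (simp add: mult_ac)
  then show ?thesis using m by simp
qed

subsection \<open>Ridge functions\<close>

lemma tendsto_fun_iff:
  fixes f :: "'a \<Rightarrow> 'i \<Rightarrow> real"
  assumes "\<And>i. ((\<lambda>x. f x i) \<longlongrightarrow> l i) F"
  shows "(f \<longlongrightarrow> l) F"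
  using assms unfolding limitin_canonical_iff[symmetric] euclidean_product_topology[symmetric]
  by (subst limitin_componentwise) auto

lemma euclid_ball_iff: "x \<in> euclid_ball k r \<longleftrightarrow> (\<forall>i\<ge>k. x i = 0) \<and> L2_set x {..<k} < r"
  by (simp add: euclid_ball_def topspace_Euclidean_space)

lemma euclid_cball_iff: "x \<in> euclid_cball k r \<longleftrightarrow> (\<forall>i\<ge>k. x i = 0) \<and> L2_set x {..<k} \<le> r"
  by (simp add: euclid_cball_def topspace_Euclidean_space)

lemma ball_perturb:
  assumes y: "y \<in> euclid_ball k r"
  obtains \<delta> where "\<delta> > 0"
    "\<And>t z. \<bar>t\<bar> < \<delta> \<Longrightarrow> (\<And>i. \<bar>z i - y i\<bar> \<le> \<bar>t * v i\<bar>) \<Longrightarrow> (\<And>i. i \<ge> k \<Longrightarrow> z i = 0) \<Longrightarrow> z \<in> euclid_ball k r"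
proof
  define \<delta> where "\<delta> = (r - L2_set y {..<k}) / (L2_set v {..<k} + 1)"
  have yr: "L2_set y {..<k} < r" using y by (simp add: euclid_ball_iff)
  have pos: "L2_set v {..<k} + 1 > 0" by (simp add: add_nonneg_pos)
  show "\<delta> > 0" unfolding \<delta>_def using yr pos by simp
  fix t z assume t: "\<bar>t\<bar> < \<delta>" and z: "\<And>i. \<bar>z i - y i\<bar> \<le> \<bar>t * v i\<bar>" and z0: "\<And>i. i \<ge> k \<Longrightarrow> z i = 0"
  have "L2_set z {..<k} = L2_set (\<lambda>i. y i + (z i - y i)) {..<k}" by simp
  also have "\<dots> \<le> L2_set y {..<k} + L2_set (\<lambda>i. z i - y i) {..<k}" by (rule L2_set_triangle_ineq)
  also have "L2_set (\<lambda>i. z i - y i) {..<k} \<le> \<bar>t\<bar> * L2_set v {..<k}"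
  proof -
    have "L2_set (\<lambda>i. z i - y i) {..<k} = L2_set (\<lambda>i. \<bar>z i - y i\<bar>) {..<k}" by (simp add: L2_set_def)
    also have "\<dots> \<le> L2_set (\<lambda>i. \<bar>t * v i\<bar>) {..<k}" by (rule L2_set_mono) (use z in auto)
    also have "\<dots> = L2_set (\<lambda>i. \<bar>t\<bar> * v i) {..<k}" by (simp add: L2_set_def power_mult_distrib)
    finally show ?thesis by (simp add: L2_set_right_distrib)
  qed
  also have "\<bar>t\<bar> * L2_set v {..<k} \<le> \<bar>t\<bar> * (L2_set v {..<k} + 1)" by (simp add: mult_left_mono)
  also have "\<dots> < \<delta> * (L2_set v {..<k} + 1)" using t pos by (rule mult_strict_right_mono)
  also have "\<dots> = r - L2_set y {..<k}" unfolding \<delta>_def using pos by simp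
  finally show "z \<in> euclid_ball k r" using z0 by (simp add: euclid_ball_iff)
qed

text \<open>The common form of what \<open>C2_on_cball\<close> says about \<open>g\<close> and about
  each of its first partial derivatives, so that the same mean value arguments serve for
  both.\<close>

definition C1_ball :: "nat \<Rightarrow> real \<Rightarrow> ((nat \<Rightarrow> real) \<Rightarrow> real) \<Rightarrow> bool" where
  "C1_ball k r h \<longleftrightarrow>
     (\<forall>i<k. \<forall>x\<in>euclid_ball k r. (\<lambda>t. h (x(i := t))) field_differentiable at (x i)) \<and>
     (\<forall>i<k. \<exists>D. continuous_on (euclid_cball k r) D \<and> (\<forall>x\<in>euclid_ball k r. D x = partial_deriv i h x))"

text \<open>Existence of the partial derivatives alone would not suffice. The increment is split
  into moves along the coordinate axes, each treated by the mean value theorem, and the intermediate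
  points converge to \<open>y\<close>, where the partials are continuous.\<close>

lemma directional_derivative_0:
  assumes h: "C1_ball k r h" and y: "y \<in> euclid_ball k r" and v: "\<And>i. i \<ge> k \<Longrightarrow> v i = 0"
  shows "((\<lambda>t. h (\<lambda>l. y l + t * v l)) has_real_derivative (\<Sum>i<k. v i * partial_deriv i h y)) (at 0)"
proof -
  have y0: "y i = 0" if "i \<ge> k" for i using y that by (simp add: euclid_ball_iff)
  obtain \<delta> where \<delta>: "\<delta> > 0"
    "\<And>t z. \<bar>t\<bar> < \<delta> \<Longrightarrow> (\<And>i. \<bar>z i - y i\<bar> \<le> \<bar>t * v i\<bar>) \<Longrightarrow> (\<And>i. i \<ge> k \<Longrightarrow> z i = 0) \<Longrightarrow> z \<in> euclid_ball k r"
    using ball_perturb[OF y] by metis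
  \<comment> \<open>\<open>p l t\<close> has moved the first \<open>l\<close> coordinates;
    \<open>q l t \<theta>\<close> runs along the axis edge from \<open>p l t\<close> to
    \<open>p (Suc l) t\<close>.\<close>
  define p where "p = (\<lambda>l t i. y i + (if i < l then t * v i else 0))"
  define q where "q = (\<lambda>l t \<theta>. (p l t)(l := y l + \<theta> * (t * v l)))"
  have q_close: "\<bar>q l t \<theta> i - y i\<bar> \<le> \<bar>t * v i\<bar>" if "0 \<le> \<theta>" "\<theta> \<le> 1" for l t \<theta> i
    using that by (auto simp: q_def p_def abs_mult mult_left_le_one_le)
  have q_ball: "q l t \<theta> \<in> euclid_ball k r" if "l < k" "\<bar>t\<bar> < \<delta>" "0 \<le> \<theta>" "\<theta> \<le> 1" for l t \<theta>
    by (rule \<delta>(2)[OF that(2) q_close[OF that(3,4)]]) (use that y0 v in \<open>auto simp: q_def p_def\<close>)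
  have q0: "q l t 0 = p l t" and q1: "q l t 1 = p (Suc l) t" for l t
    by (auto simp: q_def p_def fun_eq_iff)
  have mvt: "\<exists>\<theta>. 0 \<le> \<theta> \<and> \<theta> \<le> 1 \<and> h (p (Suc l) t) - h (p l t) = t * v l * partial_deriv l h (q l t \<theta>)"
    if l: "l < k" and t: "\<bar>t\<bar> < \<delta>" for l t
  proof -
    have der: "((\<lambda>\<theta>. h (q l t \<theta>)) has_real_derivative partial_deriv l h (q l t \<theta>) * (t * v l)) (at \<theta>)"
      if \<theta>: "0 \<le> \<theta>" "\<theta> \<le> 1" for \<theta>
    proof -
      let ?z = "q l t \<theta>"
      have "(\<lambda>s. h (?z(l := s))) field_differentiable at (?z l)"
        using h q_ball[OF l t \<theta>] l by (simp add: C1_ball_def)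
      then have "((\<lambda>s. h (?z(l := s))) has_real_derivative partial_deriv l h ?z) (at (?z l))"
        unfolding partial_deriv_def by (simp add: field_differentiable_derivI)
      then have "((\<lambda>s. h (?z(l := s))) has_real_derivative partial_deriv l h ?z) (at (y l + \<theta> * (t * v l)))"
        by (simp add: q_def)
      moreover have "((\<lambda>\<theta>. y l + \<theta> * (t * v l)) has_real_derivative t * v l) (at \<theta>)"
        by (auto intro!: derivative_eq_intros)
      ultimately have "((\<lambda>\<theta>'. h (?z(l := y l + \<theta>' * (t * v l)))) has_real_derivative partial_deriv l h ?z * (t * v l)) (at \<theta>)"
        by (rule DERIV_chain2)
      then show ?thesis by (simp add: q_def)
    qed
    obtain z where "0 < z" "z < 1" "h (q l t 1) - h (q l t 0) = (1 - 0) * (partial_deriv l h (q l t z) * (t * v l))"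
      using MVT2[of 0 1 "\<lambda>\<theta>. h (q l t \<theta>)" "\<lambda>\<theta>. partial_deriv l h (q l t \<theta>) * (t * v l)"] der by auto
    then show ?thesis unfolding q0 q1 by (intro exI[of _ z]) (simp add: mult_ac)
  qed
  then have "\<forall>l t. \<exists>\<theta>. l < k \<and> \<bar>t\<bar> < \<delta> \<longrightarrow> 0 \<le> \<theta> \<and> \<theta> \<le> 1 \<and> h (p (Suc l) t) - h (p l t) = t * v l * partial_deriv l h (q l t \<theta>)"
    by blast
  then obtain \<Theta> where \<Theta>: "\<And>l t. l < k \<Longrightarrow> \<bar>t\<bar> < \<delta> \<Longrightarrow> 0 \<le> \<Theta> l t \<and> \<Theta> l t \<le> 1 \<and>
      h (p (Suc l) t) - h (p l t) = t * v l * partial_deriv l h (q l t (\<Theta> l t))"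
    by metis
  have near: "\<forall>\<^sub>F t in at 0. \<bar>t\<bar> < \<delta> \<and> t \<noteq> (0::real)"
    using \<delta>(1) by (auto simp: eventually_at intro!: exI[of _ \<delta>])
  have lim: "((\<lambda>t. partial_deriv l h (q l t (\<Theta> l t))) \<longlongrightarrow> partial_deriv l h y) (at 0)" if l: "l < k" for l
  proof -
    obtain D where D: "continuous_on (euclid_cball k r) D" "\<forall>x\<in>euclid_ball k r. D x = partial_deriv l h x"
      using h l by (auto simp: C1_ball_def)
    have "((\<lambda>t. q l t (\<Theta> l t)) \<longlongrightarrow> y) (at 0)"
    proof (rule tendsto_fun_iff)
      fix i
      have "((\<lambda>t. \<bar>t * v i\<bar>) \<longlongrightarrow> 0) (at 0)" by (auto intro!: tendsto_eq_intros)
      moreover have "\<forall>\<^sub>F t in at 0. norm (q l t (\<Theta> l t) i - y i) \<le> \<bar>t * v i\<bar>"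
        using near by eventually_elim (use q_close \<Theta>[OF l] in auto)
      ultimately have "((\<lambda>t. q l t (\<Theta> l t) i - y i) \<longlongrightarrow> 0) (at 0)"
        by (rule Lim_null_comparison[rotated])
      then show "((\<lambda>t. q l t (\<Theta> l t) i) \<longlongrightarrow> y i) (at 0)" by (rule LIM_zero_cancel)
    qed
    then have 1: "((\<lambda>t. q l t (\<Theta> l t)) \<longlongrightarrow> y) (at 0)" .
    have 2: "\<forall>\<^sub>F t in at 0. q l t (\<Theta> l t) \<in> euclid_cball k r"
      using near by eventually_elim (use q_ball[OF l] \<Theta>[OF l] in \<open>force simp: euclid_ball_iff euclid_cball_iff\<close>)
    have 3: "y \<in> euclid_cball k r" using y by (simp add: euclid_ball_iff euclid_cball_iff)
    have 4: "((\<lambda>t. D (q l t (\<Theta> l t))) \<longlongrightarrow> D y) (at 0)"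
      by (rule continuous_on_tendsto_compose[OF D(1) 1 3 2])
    have 5: "\<forall>\<^sub>F t in at 0. D (q l t (\<Theta> l t)) = partial_deriv l h (q l t (\<Theta> l t))"
      using near by eventually_elim (use q_ball[OF l] \<Theta>[OF l] D(2) in auto)
    have "D y = partial_deriv l h y" using D(2) y by blast
    then show ?thesis using Lim_transform_eventually[OF 4 5] by simp
  qed
  have "((\<lambda>t. \<Sum>l<k. v l * partial_deriv l h (q l t (\<Theta> l t))) \<longlongrightarrow> (\<Sum>l<k. v l * partial_deriv l h y)) (at 0)"
    by (intro tendsto_sum tendsto_mult tendsto_const lim) auto
  moreover have "\<forall>\<^sub>F t in at 0. (\<Sum>l<k. v l * partial_deriv l h (q l t (\<Theta> l t)))
      = (h (\<lambda>l. y l + (0 + t) * v l) - h (\<lambda>l. y l + 0 * v l)) / t"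
    using near
  proof eventually_elim
    case (elim t)
    have "h (p k t) - h (p 0 t) = (\<Sum>l<k. h (p (Suc l) t) - h (p l t))"
      by (rule sum_lessThan_telescope[symmetric])
    also have "\<dots> = (\<Sum>l<k. t * v l * partial_deriv l h (q l t (\<Theta> l t)))"
      by (rule sum.cong) (use \<Theta> elim in auto)
    also have "\<dots> = t * (\<Sum>l<k. v l * partial_deriv l h (q l t (\<Theta> l t)))"
      by (simp add: sum_distrib_left mult.assoc)
    finally have "(\<Sum>l<k. v l * partial_deriv l h (q l t (\<Theta> l t))) = (h (p k t) - h (p 0 t)) / t"
      using elim by simp
    moreover have "p k t = (\<lambda>l. y l + (0 + t) * v l)" using v by (auto simp: p_def fun_eq_iff)
    moreover have "p 0 t = (\<lambda>l. y l + 0 * v l)" by (auto simp: p_def)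
    ultimately show ?case by simp
  qed
  ultimately have "((\<lambda>t. (h (\<lambda>l. y l + (0 + t) * v l) - h (\<lambda>l. y l + 0 * v l)) / t) \<longlongrightarrow>
      (\<Sum>l<k. v l * partial_deriv l h y)) (at 0)"
    by (rule Lim_transform_eventually)
  then show ?thesis unfolding DERIV_def .
qed

lemma directional_derivative:
  assumes h: "C1_ball k r h" and y: "(\<lambda>l. y l + s * v l) \<in> euclid_ball k r" and v: "\<And>i. i \<ge> k \<Longrightarrow> v i = 0"
  shows "((\<lambda>t. h (\<lambda>l. y l + t * v l)) has_real_derivative
    (\<Sum>i<k. v i * partial_deriv i h (\<lambda>l. y l + s * v l))) (at s)"
proof -
  have "((\<lambda>t. h (\<lambda>l. (y l + s * v l) + t * v l)) has_real_derivative
    (\<Sum>i<k. v i * partial_deriv i h (\<lambda>l. y l + s * v l))) (at (s - s))"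
    using directional_derivative_0[OF h y v] by simp
  moreover have "((\<lambda>t. t - s) has_real_derivative 1) (at s)" by (auto intro!: derivative_eq_intros)
  ultimately have "((\<lambda>t. h (\<lambda>l. (y l + s * v l) + (t - s) * v l)) has_real_derivative
    (\<Sum>i<k. v i * partial_deriv i h (\<lambda>l. y l + s * v l)) * 1) (at s)"
    by (rule DERIV_chain2)
  then show ?thesis by (simp add: algebra_simps)
qed

text \<open>Strict convexity of the Euclidean ball: only the end points of a chord may lie on the sphere.\<close>

lemma segment_in_ball:
  assumes x: "x \<in> euclid_cball k r" and z: "(\<lambda>l. x l + e * v l) \<in> euclid_cball k r"
    and t: "0 < t" "t < e" and ne: "\<exists>i<k. v i \<noteq> 0" and v: "\<And>i. i \<ge> k \<Longrightarrow> v i = 0"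
  shows "(\<lambda>l. x l + t * v l) \<in> euclid_ball k r"
proof -
  let ?z = "\<lambda>l. x l + e * v l" and ?y = "\<lambda>l. x l + t * v l"
  have "L2_set x {..<k} \<le> r" using x by (simp add: euclid_cball_iff)
  then have r0: "0 \<le> r" using L2_set_nonneg[of x "{..<k}"] by linarith
  have sq: "ip k u u \<le> r\<^sup>2" if "u \<in> euclid_cball k r" for u
    using that by (simp add: euclid_cball_iff L2_set_ip sqrt_le_D)
  have "ip k v v \<noteq> 0" using ne by (simp add: ip_self_eq_0_iff)
  then have vv: "ip k v v > 0" using ip_self_nonneg[of k v] by linarith
  \<comment> \<open>Stewart's identity for a point dividing a chord; its last term makes the
    inequality strict.\<close>
  have "e * ip k ?y ?y = (e - t) * ip k x x + t * ip k ?z ?z - (e * t * (e - t)) * ip k v v"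
    unfolding ip_linear ip_commute[of k v x] by (simp add: algebra_simps)
  moreover have "(e - t) * ip k x x \<le> (e - t) * r\<^sup>2" using sq[OF x] t by (intro mult_left_mono) auto
  moreover have "t * ip k ?z ?z \<le> t * r\<^sup>2" using sq[OF z] t by (intro mult_left_mono) auto
  moreover have "(e * t * (e - t)) * ip k v v > 0" using t vv by simp
  ultimately have "e * ip k ?y ?y < (e - t) * r\<^sup>2 + t * r\<^sup>2" by linarith
  also have "\<dots> = e * r\<^sup>2" by (simp add: algebra_simps)
  finally have "ip k ?y ?y < r\<^sup>2" using t by simp
  then have "sqrt (ip k ?y ?y) < r" using r0 by (intro real_less_lsqrt) auto
  then show ?thesis using x v by (simp add: euclid_ball_iff euclid_cball_iff L2_set_ip)
qed

lemma line_continuous: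
  fixes g :: "(nat \<Rightarrow> real) \<Rightarrow> real"
  assumes g: "continuous_on S g" and y: "\<And>t. t \<in> I \<Longrightarrow> (\<lambda>l. y l + t * v l) \<in> S"
  shows "continuous_on I (\<lambda>t. g (\<lambda>l. y l + t * v l))"
proof (rule continuous_on_compose2[OF g])
  show "continuous_on I (\<lambda>t (l::nat). y l + t * v l)"
    by (intro continuous_on_coordinatewise_then_product continuous_intros)
qed (use y in auto)

lemma l1_le_sqrt_l2: "(\<Sum>l<k. \<bar>v l\<bar>) \<le> sqrt (real k) * sqrt (ip k v v)"
proof -
  have "(\<Sum>l<k. \<bar>v l\<bar>) = (\<Sum>l<k. \<bar>v l\<bar> * \<bar>1\<bar>)" by simp
  also have "\<dots> \<le> L2_set v {..<k} * L2_set (\<lambda>_. 1) {..<k}" by (rule L2_set_mult_ineq)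
  finally show ?thesis by (simp add: L2_set_ip[symmetric] L2_set_constant mult.commute)
qed

text \<open>Query points may lie on the bounding sphere, where partial derivatives are not at hand.
  The mean value theorem asks for them only at inner points of the chord, which are in the open
  ball; at the ends continuity is enough.\<close>

lemma mvt_line:
  assumes cont: "continuous_on (euclid_cball k r) h" and C1: "C1_ball k r h"
    and x: "x \<in> euclid_cball k r" and z: "(\<lambda>l. x l + e * v l) \<in> euclid_cball k r"
    and e: "0 < e" and v: "\<And>i. i \<ge> k \<Longrightarrow> v i = 0" and ne: "\<exists>i<k. v i \<noteq> 0"
  obtains t where "0 < t" "t < e" "(\<lambda>l. x l + t * v l) \<in> euclid_ball k r"
    "h (\<lambda>l. x l + e * v l) - h x = e * (\<Sum>i<k. v i * partial_deriv i h (\<lambda>l. x l + t * v l))"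
proof -
  let ?f = "\<lambda>t. h (\<lambda>l. x l + t * v l)"
  have seg: "(\<lambda>l. x l + t * v l) \<in> euclid_ball k r" if "0 < t" "t < e" for t
    by (rule segment_in_ball[OF x z that ne v])
  have seg': "(\<lambda>l. x l + t * v l) \<in> euclid_cball k r" if "t \<in> {0..e}" for t
  proof (cases "t = 0 \<or> t = e")
    case True
    then show ?thesis using x z by auto
  next
    case False
    then show ?thesis using seg[of t] that by (auto simp: euclid_ball_iff euclid_cball_iff)
  qed
  have der: "(?f has_real_derivative (\<Sum>i<k. v i * partial_deriv i h (\<lambda>l. x l + t * v l))) (at t)"
    if "0 < t" "t < e" for t
    by (rule directional_derivative[OF C1 seg[OF that] v])
  have "continuous_on {0..e} ?f" by (rule line_continuous[OF cont seg'])
  then obtain l t where t: "0 < t" "t < e" "DERIV ?f t :> l" "?f e - ?f 0 = (e - 0) * l"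
    using MVT[of 0 e ?f] e der unfolding real_differentiable_def by blast
  have "l = (\<Sum>i<k. v i * partial_deriv i h (\<lambda>l. x l + t * v l))"
    using DERIV_unique[OF t(3) der[OF t(1,2)]] .
  then show thesis using that[of t] t seg by simp
qed

lemma abs_sum_mult_le:
  assumes "\<And>i. i < k \<Longrightarrow> \<bar>a i\<bar> \<le> (C::real)"
  shows "\<bar>\<Sum>i<k. v i * a i\<bar> \<le> C * (\<Sum>i<k. \<bar>v i\<bar>)"
proof -
  have "\<bar>\<Sum>i<k. v i * a i\<bar> \<le> (\<Sum>i<k. \<bar>v i\<bar> * \<bar>a i\<bar>)"
    using sum_abs[of "\<lambda>i. v i * a i" "{..<k}"] by (simp add: abs_mult)
  also have "\<dots> \<le> (\<Sum>i<k. \<bar>v i\<bar> * C)" using assms by (intro sum_mono mult_left_mono) auto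
  finally show ?thesis by (simp only: sum_distrib_right[symmetric] mult.commute[of C])
qed

lemma lipschitz_l1:
  assumes cont: "continuous_on (euclid_cball k r) h" and C1: "C1_ball k r h"
    and bd: "\<And>i x. i < k \<Longrightarrow> x \<in> euclid_ball k r \<Longrightarrow> \<bar>partial_deriv i h x\<bar> \<le> C"
    and x: "x \<in> euclid_cball k r" and z: "z \<in> euclid_cball k r"
  shows "\<bar>h z - h x\<bar> \<le> C * (\<Sum>i<k. \<bar>z i - x i\<bar>)"
proof (cases "\<exists>i<k. z i - x i \<noteq> 0")
  case True
  have z': "(\<lambda>l. x l + 1 * (z l - x l)) \<in> euclid_cball k r" using z by simp
  have "z i - x i = 0" if "i \<ge> k" for i using x z that by (simp add: euclid_cball_iff)
  from mvt_line[OF cont C1 x z' _ this True]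
  obtain t where t: "0 < t" "(\<lambda>l. x l + t * (z l - x l)) \<in> euclid_ball k r"
    "h z - h x = (\<Sum>i<k. (z i - x i) * partial_deriv i h (\<lambda>l. x l + t * (z l - x l)))"
    by auto
  show ?thesis unfolding t(3) using bd t(2) by (intro abs_sum_mult_le) auto
next
  case False
  then have "z i = x i" for i using x z by (cases "i < k") (auto simp: euclid_cball_iff)
  then have "z = x" by auto
  then show ?thesis by simp
qed

text \<open>Two mean value steps: one for \<open>g\<close> along the segment, one for each partial
  derivative between \<open>x\<close> and the intermediate point. The l1 norm of \<open>v\<close>
  appears because the second derivatives are bounded entry by entry.\<close>

lemma taylor_bound:
  assumes cont: "continuous_on (euclid_cball k r) g" and C1: "C1_ball k r g"
    and C2: "\<And>i. i < k \<Longrightarrow> C1_ball k r (partial_deriv i g)"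
    and bd: "\<And>i j x. i < k \<Longrightarrow> j < k \<Longrightarrow> x \<in> euclid_ball k r \<Longrightarrow> \<bar>partial_deriv j (partial_deriv i g) x\<bar> \<le> C"
    and x: "x \<in> euclid_ball k r" and z: "(\<lambda>l. x l + e * v l) \<in> euclid_cball k r"
    and e: "0 < e" and v: "\<And>i. i \<ge> k \<Longrightarrow> v i = 0" and C: "0 \<le> C"
  shows "\<bar>(g (\<lambda>l. x l + e * v l) - g x) / e - (\<Sum>i<k. v i * partial_deriv i g x)\<bar> \<le> e * C * (\<Sum>i<k. \<bar>v i\<bar>)\<^sup>2"
proof (cases "\<exists>i<k. v i \<noteq> 0")
  case True
  have x': "x \<in> euclid_cball k r" using x by (auto simp: euclid_ball_iff euclid_cball_iff)
  obtain t where t: "0 < t" "t < e" "(\<lambda>l. x l + t * v l) \<in> euclid_ball k r"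
    "g (\<lambda>l. x l + e * v l) - g x = e * (\<Sum>i<k. v i * partial_deriv i g (\<lambda>l. x l + t * v l))"
    by (rule mvt_line[OF cont C1 x' z e v True])
  have lip: "\<bar>partial_deriv i g (\<lambda>l. x l + t * v l) - partial_deriv i g x\<bar> \<le> C * (e * (\<Sum>j<k. \<bar>v j\<bar>))"
    if i: "i < k" for i
  proof -
    have seg: "(\<lambda>l. x l + s * v l) \<in> euclid_ball k r" if "0 \<le> s" "s \<le> t" for s
    proof (cases "s = 0")
      case False
      then show ?thesis using that t by (intro segment_in_ball[OF x' z _ _ True v]) auto
    qed (use x in simp)
    have der: "((\<lambda>t. partial_deriv i g (\<lambda>l. x l + t * v l)) has_real_derivative
        (\<Sum>j<k. v j * partial_deriv j (partial_deriv i g) (\<lambda>l. x l + s * v l))) (at s)"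
      if "0 \<le> s" "s \<le> t" for s
      by (rule directional_derivative[OF C2[OF i] seg[OF that] v])
    obtain s where s: "0 < s" "s < t"
      "partial_deriv i g (\<lambda>l. x l + t * v l) - partial_deriv i g (\<lambda>l. x l + 0 * v l) =
       (t - 0) * (\<Sum>j<k. v j * partial_deriv j (partial_deriv i g) (\<lambda>l. x l + s * v l))"
      using MVT2[OF t(1), of "\<lambda>t. partial_deriv i g (\<lambda>l. x l + t * v l)"
          "\<lambda>s. \<Sum>j<k. v j * partial_deriv j (partial_deriv i g) (\<lambda>l. x l + s * v l)", OF der] by auto
    have "\<bar>partial_deriv i g (\<lambda>l. x l + t * v l) - partial_deriv i g x\<bar>
        = t * \<bar>\<Sum>j<k. v j * partial_deriv j (partial_deriv i g) (\<lambda>l. x l + s * v l)\<bar>"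
      using s(3) t(1) by (simp add: abs_mult)
    also have "\<dots> \<le> e * (C * (\<Sum>j<k. \<bar>v j\<bar>))"
      using t(1,2) bd[OF i _ seg[of s]] s C
      by (intro mult_mono abs_sum_mult_le mult_nonneg_nonneg sum_nonneg) auto
    finally show ?thesis by (simp add: mult_ac)
  qed
  have "(g (\<lambda>l. x l + e * v l) - g x) / e - (\<Sum>i<k. v i * partial_deriv i g x)
      = (\<Sum>i<k. v i * (partial_deriv i g (\<lambda>l. x l + t * v l) - partial_deriv i g x))"
    unfolding t(4) using e by (simp add: right_diff_distrib sum_subtractf)
  also have "\<bar>\<dots>\<bar> \<le> (C * (e * (\<Sum>j<k. \<bar>v j\<bar>))) * (\<Sum>i<k. \<bar>v i\<bar>)"
    by (rule abs_sum_mult_le[OF lip])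
  finally show ?thesis by (simp add: power2_eq_square mult_ac)
next
  case False
  then have "v i = 0" for i using v by (cases "i < k") auto
  then have "v = (\<lambda>_. 0)" by auto
  then show ?thesis by simp
qed

lemma C2_on_cball_facts:
  assumes "C2_on_cball k r g"
  shows "continuous_on (euclid_cball k r) g" "C1_ball k r g" "\<And>i. i < k \<Longrightarrow> C1_ball k r (partial_deriv i g)"
    "\<And>i. i < k \<Longrightarrow> \<exists>D. continuous_on (euclid_cball k r) D \<and> (\<forall>x\<in>euclid_ball k r. D x = partial_deriv i g x)"
proof -
  have d: "(\<lambda>t. iter_partial \<beta> g (x(i := t))) field_differentiable at (x i)"
    if "\<beta> \<in> multi_indices k 1" "i < k" "x \<in> euclid_ball k r" for \<beta> i x
    using assms that by (simp add: C2_on_cball_def)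
  have c: "\<exists>D. continuous_on (euclid_cball k r) D \<and> (\<forall>x\<in>euclid_ball k r. D x = iter_partial \<beta> g x)"
    if "\<beta> \<in> multi_indices k 2" for \<beta>
    using assms that by (simp add: C2_on_cball_def)
  show "continuous_on (euclid_cball k r) g" using assms by (simp add: C2_on_cball_def)
  show "C1_ball k r g"
    unfolding C1_ball_def using d[of "[]"] c[of "[_]"] by (simp add: multi_indices_def)
  show "C1_ball k r (partial_deriv i g)" if "i < k" for i
    unfolding C1_ball_def using d[of "[i]"] c[of "[_, i]"] that by (simp add: multi_indices_def)
  show "\<exists>D. continuous_on (euclid_cball k r) D \<and> (\<forall>x\<in>euclid_ball k r. D x = partial_deriv i g x)" if "i < k" for i
    using c[of "[i]"] that by (simp add: multi_indices_def)
qed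

lemma partial_deriv_ridge:
  assumes C1: "C1_ball k r g" and x: "mat_vec k d A x \<in> euclid_ball k r" and i: "i < d"
  shows "partial_deriv i (\<lambda>x. g (mat_vec k d A x)) x = (\<Sum>l<k. A l i * partial_deriv l g (mat_vec k d A x))"
proof -
  define v where "v = (\<lambda>l. if l < k then A l i else 0)"
  have mv: "mat_vec k d A (x(i := t)) = (\<lambda>l. mat_vec k d A x l + (t - x i) * v l)" for t
  proof
    fix l
    have "(\<Sum>j<d. A l j * (x(i := t)) j) = (\<Sum>j<d. A l j * x j + (if j = i then A l i * (t - x i) else 0))"
      by (rule sum.cong) (auto simp: algebra_simps)
    also have "\<dots> = (\<Sum>j<d. A l j * x j) + A l i * (t - x i)" using i by (simp add: sum.distrib)
    finally show "mat_vec k d A (x(i := t)) l = mat_vec k d A x l + (t - x i) * v l"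
      by (simp add: mat_vec_def v_def)
  qed
  have "((\<lambda>t. g (\<lambda>l. mat_vec k d A x l + t * v l)) has_real_derivative
     (\<Sum>l<k. v l * partial_deriv l g (mat_vec k d A x))) (at (x i - x i))"
    using directional_derivative_0[OF C1 x, of v] by (simp add: v_def)
  moreover have "((\<lambda>t. t - x i) has_real_derivative 1) (at (x i))" by (auto intro!: derivative_eq_intros)
  ultimately have "((\<lambda>t. g (\<lambda>l. mat_vec k d A x l + (t - x i) * v l)) has_real_derivative
     (\<Sum>l<k. v l * partial_deriv l g (mat_vec k d A x)) * 1) (at (x i))"
    by (rule DERIV_chain2)
  then have "deriv (\<lambda>t. g (mat_vec k d A (x(i := t)))) (x i) = (\<Sum>l<k. v l * partial_deriv l g (mat_vec k d A x))"
    unfolding mv by (simp add: DERIV_imp_deriv)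
  then show ?thesis by (simp add: partial_deriv_def v_def)
qed

subsection \<open>The second moment matrix of the gradient\<close>

lemma quadratic_nonneg_imp:
  fixes a b e :: real
  assumes nn: "\<And>c. 0 \<le> a + 2 * c * b + c\<^sup>2 * e" and e: "0 \<le> e"
  shows "b\<^sup>2 \<le> a * e"
proof (cases "e = 0")
  case True
  have "b = 0"
  proof (rule ccontr)
    assume b: "b \<noteq> 0"
    have "0 \<le> a + 2 * (- (a + 1) / (2 * b)) * b" using nn[of "- (a + 1) / (2 * b)"] True by simp
    also have "\<dots> = -1" using b by (simp add: field_simps)
    finally show False by simp
  qed
  then show ?thesis using True by simp
next
  case False
  have "0 \<le> e * (a + 2 * (- b / e) * b + (- b / e)\<^sup>2 * e)" using nn e by (intro mult_nonneg_nonneg)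
  also have "\<dots> = a * e - b\<^sup>2" using False by (simp add: field_simps power2_eq_square)
  finally show ?thesis by simp
qed

text \<open>The minimum \<open>e0\<close> of the form on the unit sphere is attained at an
  eigenvector, where |H v| = e0. Expansion by \<alpha> then gives e0 >= \<alpha>, as e0 is
  nonnegative. No full spectral decomposition is required.\<close>

lemma psd_lower_bound:
  fixes H :: "nat \<Rightarrow> nat \<Rightarrow> real"
  assumes sym: "\<And>a b. a < k \<Longrightarrow> b < k \<Longrightarrow> H a b = H b a"
    and psd: "\<And>u. 0 \<le> ip k u (\<lambda>a. ip k (H a) u)" and \<alpha>: "0 \<le> \<alpha>"
    and expand: "\<And>u. \<alpha>\<^sup>2 * ip k u u \<le> ip k (\<lambda>a. ip k (H a) u) (\<lambda>a. ip k (H a) u)"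
  shows "\<alpha> * ip k u u \<le> ip k u (\<lambda>a. ip k (H a) u)"
proof (cases "k = 0")
  case True
  then show ?thesis by (simp add: ip_def)
next
  case False
  define T where "T = (\<lambda>u a. ip k (H a) u)"
  have selfadj: "ip k u (T v) = ip k (T u) v" for u v
  proof -
    have "ip k u (T v) = (\<Sum>a<k. \<Sum>b<k. u a * (H a b * v b))"
      by (simp add: ip_def T_def sum_distrib_left)
    also have "\<dots> = (\<Sum>b<k. \<Sum>a<k. u a * (H a b * v b))" by (rule sum.swap)
    also have "\<dots> = (\<Sum>b<k. \<Sum>a<k. H b a * u a * v b)"
      by (intro sum.cong refl) (auto simp: sym mult_ac)
    finally show ?thesis by (simp add: ip_def T_def sum_distrib_right)
  qed
  define Q where "Q = (\<lambda>u. - ip k u (T u))"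
  have "continuous_on UNIV T" unfolding T_def
    by (intro continuous_on_coordinatewise_then_product continuous_on_ip_const)
  then have 1: "continuous_on UNIV Q" unfolding Q_def
    by (rule continuous_on_minus[OF continuous_on_ip[OF continuous_on_id]])
  have 2: "Q (\<lambda>l. c * x l) = c\<^sup>2 * Q x" for c x
    by (simp add: Q_def T_def ip_linear power2_eq_square)
  have 3: "Q x = Q y" if "\<And>l. l < k \<Longrightarrow> x l = y l" for x y
    using that by (simp add: Q_def T_def ip_def)
  have "1 \<le> k" using False by simp
  from greedy_orthonormal[OF 1 2 3 this] have "\<exists>V. orthonormal_columns k 1 V \<and>
    (\<forall>i<1. \<forall>x. (\<forall>p<i. ip k (\<lambda>l. V l p) x = 0) \<longrightarrow> Q x \<le> Q (\<lambda>l. V l i) * ip k x x)"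
    by simp
  then obtain V where V: "orthonormal_columns k 1 V"
    and M: "\<forall>i<1. \<forall>x. (\<forall>p<i. ip k (\<lambda>l. V l p) x = 0) \<longrightarrow> Q x \<le> Q (\<lambda>l. V l i) * ip k x x"
    by blast
  have max: "Q x \<le> Q (\<lambda>l. V l 0) * ip k x x" for x using M by simp
  define v where "v = (\<lambda>l. V l 0)"
  define e0 where "e0 = ip k v (T v)"
  have v1: "ip k v v = 1" using V by (simp add: v_def orthonormal_columns_ip)
  have min: "e0 * ip k x x \<le> ip k x (T x)" for x using max[of x] by (simp add: Q_def v_def e0_def)
  \<comment> \<open>The form of T - e0 is nonnegative and vanishes at \<open>v\<close>, so by
    Cauchy-Schwarz its bilinear form vanishes against every \<open>w\<close>.\<close>
  have eig: "ip k w (\<lambda>a. T v a - e0 * v a) = 0" for w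
  proof -
    let ?b = "ip k w (T v) - e0 * ip k w v"
    let ?e = "ip k w (T w) - e0 * ip k w w"
    have "0 \<le> 0 + 2 * c * ?b + c\<^sup>2 * ?e" for c
    proof -
      have "T (\<lambda>l. v l + c * w l) = (\<lambda>a. T v a + c * T w a)" by (simp add: T_def ip_linear)
      then have "e0 * ip k (\<lambda>l. v l + c * w l) (\<lambda>l. v l + c * w l)
          \<le> ip k (\<lambda>l. v l + c * w l) (\<lambda>a. T v a + c * T w a)"
        using min[of "\<lambda>l. v l + c * w l"] by simp
      also have "ip k (\<lambda>l. v l + c * w l) (\<lambda>a. T v a + c * T w a)
          = e0 + 2 * c * ip k w (T v) + c\<^sup>2 * ip k w (T w)"
        unfolding ip_linear e0_def selfadj[of v w] ip_commute[of k "T v" w]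
        by (simp add: algebra_simps power2_eq_square)
      also have "ip k (\<lambda>l. v l + c * w l) (\<lambda>l. v l + c * w l) = 1 + 2 * c * ip k w v + c\<^sup>2 * ip k w w"
        unfolding ip_linear ip_commute[of k v w] v1 by (simp add: algebra_simps power2_eq_square)
      finally show ?thesis by (simp add: algebra_simps)
    qed
    moreover have "0 \<le> ?e" using min[of w] by simp
    ultimately have "?b\<^sup>2 \<le> 0 * ?e" by (rule quadratic_nonneg_imp)
    then show ?thesis by (simp add: ip_linear)
  qed
  have "ip k (\<lambda>a. T v a - e0 * v a) (\<lambda>a. T v a - e0 * v a) = 0" by (rule eig)
  then have "T v a = e0 * v a" if "a < k" for a using that by (simp add: ip_self_eq_0_iff)
  then have "ip k (T v) (T v) = ip k (\<lambda>a. e0 * v a) (\<lambda>a. e0 * v a)" by (intro ip_cong)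
  then have "ip k (T v) (T v) = e0\<^sup>2" using v1 by (simp add: ip_linear power2_eq_square)
  moreover have "\<alpha>\<^sup>2 * ip k v v \<le> ip k (T v) (T v)" unfolding T_def by (rule expand)
  ultimately have "\<alpha>\<^sup>2 \<le> e0\<^sup>2" using v1 by simp
  moreover have "0 \<le> e0" using psd[of v] by (simp add: e0_def T_def)
  ultimately have "\<alpha> \<le> e0" by (rule power2_le_imp_le)
  then have "\<alpha> * ip k u u \<le> e0 * ip k u u" by (intro mult_right_mono) auto
  then show ?thesis using min[of u] by (simp add: T_def)
qed

text \<open>\<open>H\<close> is A^T Hg A. Its first k right singular vectors lie in the row span of
  \<open>A\<close>, so their coordinates \<open>W\<close> form an orthogonal k x k matrix. Hence |H
  A^T u| >= \<alpha> |u|, while |H A^T u| = |Hg u| by orthonormality of the rows of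
  \<open>A\<close>; now \<open>psd_lower_bound\<close> applies. The argument works with whichever
  decomposition is given.\<close>

lemma sandwich_singular_values:
  fixes A Hg :: "nat \<Rightarrow> nat \<Rightarrow> real"
  assumes A: "orthonormal_columns d k (mat_transpose A)"
    and H: "\<And>i j. i < d \<Longrightarrow> j < d \<Longrightarrow> H i j = (\<Sum>a<k. \<Sum>b<k. A a i * A b j * Hg a b)"
    and sym: "\<And>a b. a < k \<Longrightarrow> b < k \<Longrightarrow> Hg a b = Hg b a"
    and psd: "\<And>u. 0 \<le> ip k u (\<lambda>a. ip k (Hg a) u)"
    and sv: "has_singular_values d d H \<sigma>" and \<sigma>: "\<And>i. i < k \<Longrightarrow> \<alpha> \<le> \<sigma> i" and \<alpha>: "0 < \<alpha>"
  shows "\<alpha> * ip k u u \<le> ip k u (\<lambda>a. ip k (Hg a) u)"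
proof (rule psd_lower_bound[OF sym psd])
  fix u
  have kd: "k \<le> d" by (rule orthonormal_columns_le[OF A])
  obtain U V where svd: "is_svd d d H U \<sigma> V" using sv by (auto simp: has_singular_values_def)
  have U: "orthonormal_columns d d U" and V: "orthonormal_columns d d V" using svd by (auto simp: is_svd_def)
  have Hs: "H i j = (\<Sum>l<d. U i l * \<sigma> l * V j l)" if "i < d" "j < d" for i j
    using svd that by (simp add: is_svd_def)
  have AA: "ip d (A a) (A b) = (if a = b then 1 else 0)" if "a < k" "b < k" for a b
    using A that by (simp add: orthonormal_columns_ip mat_transpose_def)
  \<comment> \<open>The relation \<sigma>_l v_l = H^T u_l with \<sigma>_l > 0 shows that v_l is in
    the range of A^T.\<close>
  have VA: "\<exists>c. \<forall>j<d. V j l = (\<Sum>b<k. c b * A b j)" if l: "l < k" for l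
  proof (intro exI allI impI)
    fix j assume j: "j < d"
    have "(\<Sum>i<d. H i j * U i l) = (\<Sum>i<d. \<Sum>p<d. (\<sigma> p * V j p) * (U i l * U i p))"
      using j by (intro sum.cong refl) (auto simp: Hs sum_distrib_right sum_distrib_left mult_ac)
    also have "\<dots> = (\<Sum>p<d. (\<sigma> p * V j p) * ip d (\<lambda>i. U i l) (\<lambda>i. U i p))"
      by (subst sum.swap) (simp add: ip_def sum_distrib_left)
    also have "\<dots> = (\<Sum>p<d. if p = l then \<sigma> p * V j p else 0)"
      by (rule sum.cong) (use U l kd in \<open>auto simp: orthonormal_columns_ip\<close>)
    also have "\<dots> = \<sigma> l * V j l" using l kd by simp
    finally have 1: "\<sigma> l * V j l = (\<Sum>i<d. H i j * U i l)" ..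
    have "(\<Sum>i<d. H i j * U i l) = (\<Sum>i<d. \<Sum>b<k. \<Sum>a<k. A a i * A b j * Hg a b * U i l)"
    proof (rule sum.cong[OF refl])
      fix i assume "i \<in> {..<d}"
      then have "H i j * U i l = (\<Sum>a<k. \<Sum>b<k. A a i * A b j * Hg a b * U i l)"
        using j by (simp add: H sum_distrib_right)
      then show "H i j * U i l = (\<Sum>b<k. \<Sum>a<k. A a i * A b j * Hg a b * U i l)"
        by (subst sum.swap)
    qed
    also have "\<dots> = (\<Sum>b<k. (\<Sum>i<d. \<Sum>a<k. A a i * Hg a b * U i l) * A b j)"
      by (subst sum.swap) (simp add: sum_distrib_right sum_distrib_left mult_ac)
    finally have "\<sigma> l * V j l = (\<Sum>b<k. (\<Sum>i<d. \<Sum>a<k. A a i * Hg a b * U i l) * A b j)" using 1 by simp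
    moreover have "\<sigma> l > 0" using \<sigma>[OF l] \<alpha> by simp
    ultimately show "V j l = (\<Sum>b<k. ((\<Sum>i<d. \<Sum>a<k. A a i * Hg a b * U i l) / \<sigma> l) * A b j)"
      by (simp add: sum_divide_distrib[symmetric] field_simps)
  qed
  define W where "W = (\<lambda>b l. ip d (A b) (\<lambda>j. V j l))"
  have VW: "V j l = (\<Sum>b<k. W b l * A b j)" if l: "l < k" and j: "j < d" for j l
  proof -
    obtain c where c: "\<forall>j<d. V j l = (\<Sum>b<k. c b * A b j)" using VA[OF l] by blast
    have "W a l = c a" if a: "a < k" for a
    proof -
      have "W a l = ip d (A a) (\<lambda>j. \<Sum>b<k. c b * A b j)"
        unfolding W_def by (rule ip_cong) (use c in auto)
      also have "\<dots> = (\<Sum>b<k. if b = a then c b else 0)"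
        unfolding ip_linear by (rule sum.cong) (use AA a in auto)
      finally show ?thesis using a by simp
    qed
    then show ?thesis using c j by simp
  qed
  have W: "orthonormal_columns k k W"
    unfolding orthonormal_columns_ip
  proof (intro allI impI)
    fix l p assume l: "l < k" and p: "p < k"
    have "(if l = p then 1 else 0) = ip d (\<lambda>j. V j l) (\<lambda>j. V j p)"
      using V l p kd by (simp add: orthonormal_columns_ip)
    also have "\<dots> = ip d (\<lambda>j. \<Sum>b<k. W b l * A b j) (\<lambda>j. V j p)"
      by (rule ip_cong) (use VW l in auto)
    also have "\<dots> = ip k (\<lambda>b. W b l) (\<lambda>b. W b p)"
      unfolding ip_linear by (simp add: ip_def[of k] W_def)
    finally show "ip k (\<lambda>b. W b l) (\<lambda>b. W b p) = (if l = p then 1 else 0)" ..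
  qed
  define x where "x = (\<lambda>j. \<Sum>b<k. u b * A b j)"
  have Ax: "ip d (A a) x = u a" if a: "a < k" for a
  proof -
    have "ip d (A a) x = (\<Sum>b<k. if b = a then u b else 0)"
      unfolding x_def ip_linear by (rule sum.cong) (use AA a in auto)
    then show ?thesis using a by simp
  qed
  have Vx: "ip d (\<lambda>j. V j l) x = ip k (\<lambda>b. W b l) u" for l
    unfolding x_def ip_linear by (simp add: ip_def[of k] W_def ip_commute mult_ac)
  have "ip d (\<lambda>i. ip d (H i) x) (\<lambda>i. ip d (H i) x) = (\<Sum>l<d. (\<sigma> l * ip d (\<lambda>j. V j l) x)\<^sup>2)"
  proof -
    have "ip d (H i) x = (\<Sum>l<d. (\<sigma> l * ip d (\<lambda>j. V j l) x) * U i l)" if i: "i < d" for i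
    proof -
      have "ip d (H i) x = ip d (\<lambda>j. \<Sum>l<d. (U i l * \<sigma> l) * V j l) x"
        by (rule ip_cong) (use Hs i in auto)
      then show ?thesis by (simp add: ip_linear mult_ac)
    qed
    then have "ip d (\<lambda>i. ip d (H i) x) (\<lambda>i. ip d (H i) x) =
      ip d (\<lambda>i. \<Sum>l<d. (\<sigma> l * ip d (\<lambda>j. V j l) x) * U i l) (\<lambda>i. \<Sum>l<d. (\<sigma> l * ip d (\<lambda>j. V j l) x) * U i l)"
      by (intro ip_cong)
    then show ?thesis by (simp only: orthonormal_combination_norm[OF U])
  qed
  moreover have "\<alpha>\<^sup>2 * ip k u u = (\<Sum>l<k. \<alpha>\<^sup>2 * (ip k (\<lambda>b. W b l) u)\<^sup>2)"
    unfolding parseval[OF W, of u] by (rule sum_distrib_left)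
  moreover have "\<dots> \<le> (\<Sum>l<k. (\<sigma> l * ip d (\<lambda>j. V j l) x)\<^sup>2)"
    using \<sigma> \<alpha> by (intro sum_mono) (auto simp: Vx power_mult_distrib intro!: mult_right_mono power_mono)
  moreover have "\<dots> \<le> (\<Sum>l<d. (\<sigma> l * ip d (\<lambda>j. V j l) x)\<^sup>2)" by (rule sum_mono2) (use kd in auto)
  moreover have "ip d (\<lambda>i. ip d (H i) x) (\<lambda>i. ip d (H i) x) = ip k (\<lambda>a. ip k (Hg a) u) (\<lambda>a. ip k (Hg a) u)"
  proof -
    have Hx: "ip d (H i) x = (\<Sum>a<k. ip k (Hg a) u * A a i)" if i: "i < d" for i
    proof -
      have "ip d (H i) x = ip d (\<lambda>j. \<Sum>a<k. \<Sum>b<k. (A a i * Hg a b) * A b j) x"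
        by (rule ip_cong) (use H i in \<open>auto simp: mult_ac\<close>)
      also have "\<dots> = (\<Sum>a<k. \<Sum>b<k. (A a i * Hg a b) * ip d (A b) x)"
        by (simp add: ip_linear)
      also have "\<dots> = (\<Sum>a<k. \<Sum>b<k. (A a i * Hg a b) * u b)"
        by (intro sum.cong refl) (auto simp: Ax)
      finally show ?thesis by (simp add: ip_def[of k] sum_distrib_left mult_ac)
    qed
    have "ip d (\<lambda>i. ip d (H i) x) (\<lambda>i. ip d (H i) x) =
      ip d (\<lambda>i. \<Sum>a<k. ip k (Hg a) u * mat_transpose A i a) (\<lambda>i. \<Sum>a<k. ip k (Hg a) u * mat_transpose A i a)"
      by (rule ip_cong) (auto simp: Hx mat_transpose_def)
    then show ?thesis by (simp only: orthonormal_combination_norm[OF A]) (simp add: ip_self)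
  qed
  ultimately show "\<alpha>\<^sup>2 * ip k u u \<le> ip k (\<lambda>a. ip k (Hg a) u) (\<lambda>a. ip k (Hg a) u)" by linarith
qed (use \<alpha> in auto)

subsection \<open>Powers of symmetric matrices\<close>

primrec mpow :: "nat \<Rightarrow> (nat \<Rightarrow> nat \<Rightarrow> real) \<Rightarrow> nat \<Rightarrow> (nat \<Rightarrow> real) \<Rightarrow> nat \<Rightarrow> real" where
  "mpow k A 0 v = v"
| "mpow k A (Suc n) v = (\<lambda>i. ip k (A i) (mpow k A n v))"

definition unit_vec :: "nat \<Rightarrow> nat \<Rightarrow> real" where
  "unit_vec i = (\<lambda>l. if l = i then 1 else 0)"

definition trace_pow :: "nat \<Rightarrow> (nat \<Rightarrow> nat \<Rightarrow> real) \<Rightarrow> nat \<Rightarrow> real" where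
  "trace_pow k A n = (\<Sum>i<k. ip k (unit_vec i) (mpow k A n (unit_vec i)))"

definition symm_mat :: "nat \<Rightarrow> (nat \<Rightarrow> nat \<Rightarrow> real) \<Rightarrow> bool" where
  "symm_mat k A \<longleftrightarrow> (\<forall>i<k. \<forall>j<k. A i j = A j i)"

lemma mpow_add: "mpow k A (m + n) v = mpow k A m (mpow k A n v)"
  by (induction m) auto

lemma ip_symm_mat:
  assumes "symm_mat k A"
  shows "ip k u (\<lambda>i. ip k (A i) v) = ip k (\<lambda>i. ip k (A i) u) v"
proof -
  have "ip k u (\<lambda>i. ip k (A i) v) = (\<Sum>a<k. \<Sum>b<k. u a * (A a b * v b))"
    by (simp add: ip_def sum_distrib_left)
  also have "\<dots> = (\<Sum>b<k. \<Sum>a<k. u a * (A a b * v b))" by (rule sum.swap)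
  also have "\<dots> = (\<Sum>b<k. \<Sum>a<k. A b a * u a * v b)"
    using assms by (intro sum.cong refl) (auto simp: symm_mat_def mult_ac)
  finally show ?thesis by (simp add: ip_def sum_distrib_right)
qed

lemma ip_mpow_symm:
  assumes "symm_mat k A"
  shows "ip k u (mpow k A n v) = ip k (mpow k A n u) v"
proof (induction n arbitrary: u v)
  case (Suc n)
  have "mpow k A (Suc n) v = mpow k A n (\<lambda>i. ip k (A i) v)"
    using mpow_add[of k A n 1 v] by simp
  then have "ip k u (mpow k A (Suc n) v) = ip k (mpow k A n u) (\<lambda>i. ip k (A i) v)" using Suc by simp
  also have "\<dots> = ip k (mpow k A (Suc n) u) v" using ip_symm_mat[OF assms] by simp
  finally show ?case .
qed simp

lemma ip_mpow_add:
  assumes "symm_mat k A"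
  shows "ip k (mpow k A m u) (mpow k A n v) = ip k u (mpow k A (m + n) v)"
  by (simp add: ip_mpow_symm[OF assms] mpow_add)

lemma ip_psd_CS:
  assumes S: "symm_mat k A" and psd: "\<And>v. 0 \<le> ip k v (\<lambda>i. ip k (A i) v)"
  shows "(ip k u (\<lambda>i. ip k (A i) v))\<^sup>2 \<le> ip k u (\<lambda>i. ip k (A i) u) * ip k v (\<lambda>i. ip k (A i) v)"
proof (rule quadratic_nonneg_imp)
  fix c
  have "0 \<le> ip k (\<lambda>l. u l + c * v l) (\<lambda>i. ip k (A i) (\<lambda>l. u l + c * v l))" by (rule psd)
  also have "\<dots> = ip k u (\<lambda>i. ip k (A i) u) + 2 * c * ip k u (\<lambda>i. ip k (A i) v) + c\<^sup>2 * ip k v (\<lambda>i. ip k (A i) v)"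
    using ip_symm_mat[OF S, of v u] ip_commute[of k v "\<lambda>i. ip k (A i) u"] ip_commute[of k u "\<lambda>i. ip k (A i) v"]
    by (simp add: ip_linear algebra_simps power2_eq_square)
  finally show "0 \<le> ip k u (\<lambda>i. ip k (A i) u) + 2 * c * ip k u (\<lambda>i. ip k (A i) v) + c\<^sup>2 * ip k v (\<lambda>i. ip k (A i) v)" .
qed (rule psd)

text \<open>Cauchy-Schwarz after distributing the powers over both arguments. Even \<open>n\<close>
  uses the inner product, odd \<open>n\<close> the nonnegative form of \<open>A\<close>, so no
  square root of \<open>A\<close> is formed.\<close>

lemma moments_log_convex:
  assumes S: "symm_mat k A" and psd: "\<And>v. 0 \<le> ip k v (\<lambda>i. ip k (A i) v)"
  shows "(ip k x (mpow k A (Suc n) x))\<^sup>2 \<le> ip k x (mpow k A n x) * ip k x (mpow k A (Suc (Suc n)) x)"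
    and "0 \<le> ip k x (mpow k A n x)"
proof -
  have ev: "ip k x (mpow k A (p + q) x) = ip k (mpow k A p x) (mpow k A q x)" for p q
    by (rule ip_mpow_add[OF S, symmetric])
  have od: "ip k x (mpow k A (Suc (p + q)) x) = ip k (mpow k A p x) (\<lambda>i. ip k (A i) (mpow k A q x))" for p q
    using ev[of p "Suc q"] by simp
  show "0 \<le> ip k x (mpow k A n x)"
  proof (cases "even n")
    case True
    then obtain p where "n = p + p" by (auto elim!: evenE simp: mult_2)
    then show ?thesis by (simp only: ev) simp
  next
    case False
    then obtain p where "n = Suc (p + p)" by (auto elim!: oddE simp: mult_2)
    then show ?thesis by (simp only: od psd)
  qed
  show "(ip k x (mpow k A (Suc n) x))\<^sup>2 \<le> ip k x (mpow k A n x) * ip k x (mpow k A (Suc (Suc n)) x)"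
  proof (cases "even n")
    case True
    then obtain p where n: "n = p + p" by (auto elim!: evenE simp: mult_2)
    have eq: "Suc (p + p) = p + Suc p" "Suc (p + Suc p) = Suc p + Suc p" by auto
    show ?thesis unfolding n unfolding eq unfolding ev by (rule ip_CS)
  next
    case False
    then obtain p where n: "n = Suc (p + p)" by (auto elim!: oddE simp: mult_2)
    have eq: "Suc (Suc (p + p)) = Suc (p + Suc p)" "Suc (Suc (p + Suc p)) = Suc (Suc p + Suc p)" by auto
    show ?thesis unfolding n unfolding eq unfolding od by (rule ip_psd_CS[OF S psd])
  qed
qed

text \<open>Everything follows from the monotonicity of the ratios m (n+1) / m n. The third claim is
  a correlation inequality of Chebyshev's type; it stands in for trace inequalities in
  \<open>trace_step\<close>.\<close>

lemma log_convex_sequence: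
  fixes m :: "nat \<Rightarrow> real"
  assumes lc: "\<And>n. (m (Suc n))\<^sup>2 \<le> m n * m (Suc (Suc n))" and nn: "\<And>n. 0 \<le> m n"
    and m0: "0 < m 0" and c: "0 < c" and m1: "c * m 0 \<le> m 1"
  shows "0 < m n" "c * m n \<le> m (Suc n)" "m a * m b \<le> m 0 * m (a + b)" "c ^ n * m 0 \<le> m n"
proof -
  have pos2: "0 < m n \<and> 0 < m (Suc n)" for n
  proof (induction n)
    case 0
    have "0 < c * m 0" using c m0 by simp
    then show ?case using m0 m1 by simp
  next
    case (Suc n)
    then have "0 < (m (Suc n))\<^sup>2" by simp
    then have "0 < m n * m (Suc (Suc n))" using lc[of n] by linarith
    then show ?case using Suc by (simp add: zero_less_mult_iff)
  qed
  then show pos: "0 < m n" for n by blast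
  have ratio1: "m (Suc n) / m n \<le> m (Suc (Suc n)) / m (Suc n)" for n
    using lc[of n] pos[of n] pos[of "Suc n"] by (simp add: field_simps power2_eq_square)
  have ratio: "m (Suc n) / m n \<le> m (Suc (n + b)) / m (n + b)" for n b
    by (induction b) (auto intro: order_trans[OF _ ratio1])
  show rc: "c * m n \<le> m (Suc n)" for n
  proof -
    have "c \<le> m (Suc 0) / m 0" using m1 m0 by (simp add: pos_le_divide_eq)
    also have "\<dots> \<le> m (Suc n) / m n" using ratio[of 0 n] by simp
    finally show ?thesis using pos[of n] by (simp add: pos_le_divide_eq)
  qed
  show "m a * m b \<le> m 0 * m (a + b)"
  proof (induction a)
    case (Suc a)
    have "m (Suc a) * m b = m a * m b * (m (Suc a) / m a)" using pos[of a] by simp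
    also have "\<dots> \<le> m 0 * m (a + b) * (m (Suc (a + b)) / m (a + b))"
      using Suc ratio[of a b] pos by (intro mult_mono[of "m a * m b" "m 0 * m (a + b)"]) (auto intro: less_imp_le)
    also have "\<dots> = m 0 * m (Suc (a + b))" using pos[of "a + b"] by simp
    finally show ?case by simp
  qed simp
  show "c ^ n * m 0 \<le> m n"
  proof (induction n)
    case (Suc n)
    have "c * (c ^ n * m 0) \<le> c * m n" using Suc c by (intro mult_left_mono) auto
    then show ?case using rc[of n] by (simp add: mult.assoc)
  qed simp
qed

lemma ip_unit_vec: "i < k \<Longrightarrow> ip k (unit_vec i) v = v i"
  unfolding unit_vec_def by (rule ip_unit)

definition rank_one_update :: "(nat \<Rightarrow> nat \<Rightarrow> real) \<Rightarrow> (nat \<Rightarrow> real) \<Rightarrow> real \<Rightarrow> nat \<Rightarrow> nat \<Rightarrow> real" where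
  "rank_one_update A x t = (\<lambda>i j. A i j - t * x i * x j)"

lemma symm_rank_one_update: "symm_mat k A \<Longrightarrow> symm_mat k (rank_one_update A x t)"
  by (simp add: symm_mat_def rank_one_update_def mult_ac)

lemma ip_rank_one_update:
  "ip k (rank_one_update A x t i) v = ip k (A i) v - t * x i * ip k x v"
  unfolding rank_one_update_def ip_diff_left ip_scale_left by simp

lemma mpow_has_derivative:
  "((\<lambda>t. mpow k (rank_one_update A x t) n v i) has_real_derivative
    - (\<Sum>b<n. ip k x (mpow k (rank_one_update A x t) b v) * mpow k (rank_one_update A x t) (n - 1 - b) x i)) (at t)"
proof (induction n arbitrary: i)
  case 0
  then show ?case by simp
next
  case (Suc n)
  let ?M = "rank_one_update A x t"
  let ?D = "\<lambda>j. - (\<Sum>b<n. ip k x (mpow k ?M b v) * mpow k ?M (n - 1 - b) x j)"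
  have "((\<lambda>t. \<Sum>j<k. rank_one_update A x t i j * mpow k (rank_one_update A x t) n v j) has_real_derivative
     (\<Sum>j<k. (- (x i * x j)) * mpow k ?M n v j + ?D j * ?M i j)) (at t)"
  proof (rule DERIV_sum, rule DERIV_mult)
    fix j
    show "((\<lambda>t. rank_one_update A x t i j) has_real_derivative - (x i * x j)) (at t)"
      unfolding rank_one_update_def by (auto intro!: derivative_eq_intros)
    show "((\<lambda>t. mpow k (rank_one_update A x t) n v j) has_real_derivative ?D j) (at t)" by (rule Suc)
  qed
  moreover have "(\<Sum>j<k. (- (x i * x j)) * mpow k ?M n v j + ?D j * ?M i j)
    = - (\<Sum>b<Suc n. ip k x (mpow k ?M b v) * mpow k ?M (Suc n - 1 - b) x i)"
  proof -
    have "(\<Sum>j<k. ?D j * ?M i j) = - (\<Sum>b<n. ip k x (mpow k ?M b v) * (\<Sum>j<k. ?M i j * mpow k ?M (n - 1 - b) x j))"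
    proof -
      have "(\<Sum>j<k. ?D j * ?M i j) = - (\<Sum>j<k. \<Sum>b<n. ip k x (mpow k ?M b v) * (?M i j * mpow k ?M (n - 1 - b) x j))"
        by (simp add: sum_negf sum_distrib_left mult_ac)
      also have "\<dots> = - (\<Sum>b<n. \<Sum>j<k. ip k x (mpow k ?M b v) * (?M i j * mpow k ?M (n - 1 - b) x j))"
        by (subst sum.swap) simp
      finally show ?thesis by (simp add: sum_distrib_left)
    qed
    also have "\<dots> = - (\<Sum>b<n. ip k x (mpow k ?M b v) * mpow k ?M (n - b) x i)"
    proof (intro arg_cong[where f = uminus] sum.cong refl)
      fix b assume "b \<in> {..<n}"
      then have "n - b = Suc (n - 1 - b)" by auto
      then show "ip k x (mpow k ?M b v) * (\<Sum>j<k. ?M i j * mpow k ?M (n - 1 - b) x j)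
        = ip k x (mpow k ?M b v) * mpow k ?M (n - b) x i"
        by (simp add: ip_def[of k "?M i"])
    qed
    finally have 1: "(\<Sum>j<k. ?D j * ?M i j) = - (\<Sum>b<n. ip k x (mpow k ?M b v) * mpow k ?M (n - b) x i)" .
    have 2: "(\<Sum>j<k. (- (x i * x j)) * mpow k ?M n v j) = - (ip k x (mpow k ?M n v) * x i)"
      by (simp add: ip_def sum_negf sum_distrib_left mult_ac)
    show ?thesis unfolding sum.distrib 1 2 by simp
  qed
  ultimately show ?case by (simp add: ip_def[of k "rank_one_update A x _ i"])
qed

lemma ip_mpow_has_derivative:
  "((\<lambda>t. ip k u (mpow k (rank_one_update A x t) n v)) has_real_derivative
    - (\<Sum>b<n. ip k x (mpow k (rank_one_update A x t) b v) * ip k u (mpow k (rank_one_update A x t) (n - 1 - b) x))) (at t)"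
proof -
  let ?M = "rank_one_update A x t"
  let ?D = "\<lambda>j. - (\<Sum>b<n. ip k x (mpow k ?M b v) * mpow k ?M (n - 1 - b) x j)"
  have "((\<lambda>t. \<Sum>j<k. u j * mpow k (rank_one_update A x t) n v j) has_real_derivative (\<Sum>j<k. u j * ?D j)) (at t)"
    by (intro DERIV_sum DERIV_cmult mpow_has_derivative)
  moreover have "(\<Sum>j<k. u j * ?D j) = - (\<Sum>b<n. ip k x (mpow k ?M b v) * ip k u (mpow k ?M (n - 1 - b) x))"
  proof -
    have "(\<Sum>j<k. u j * ?D j) = - (\<Sum>j<k. \<Sum>b<n. ip k x (mpow k ?M b v) * (u j * mpow k ?M (n - 1 - b) x j))"
      by (simp add: sum_negf sum_distrib_left mult_ac)
    also have "\<dots> = - (\<Sum>b<n. \<Sum>j<k. ip k x (mpow k ?M b v) * (u j * mpow k ?M (n - 1 - b) x j))"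
      by (subst sum.swap) simp
    finally show ?thesis by (simp add: sum_distrib_left ip_def[of k u])
  qed
  ultimately show ?thesis by (simp add: ip_def[of k u])
qed

text \<open>The derivative replaces each of the n + 1 factors in turn by - x x^T; under the trace
  all these terms coincide.\<close>

lemma trace_pow_has_derivative:
  assumes S: "symm_mat k A"
  shows "((\<lambda>t. trace_pow k (rank_one_update A x t) (Suc n)) has_real_derivative
    - (real (Suc n) * ip k x (mpow k (rank_one_update A x t) n x))) (at t)"
proof -
  let ?M = "rank_one_update A x t"
  have S': "symm_mat k ?M" by (rule symm_rank_one_update[OF S])
  have "((\<lambda>t. trace_pow k (rank_one_update A x t) (Suc n)) has_real_derivative
    (\<Sum>i<k. - (\<Sum>b<Suc n. ip k x (mpow k ?M b (unit_vec i)) * ip k (unit_vec i) (mpow k ?M (Suc n - 1 - b) x)))) (at t)"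
    unfolding trace_pow_def by (intro DERIV_sum ip_mpow_has_derivative)
  note a = this
  have b: "(\<Sum>i<k. - (\<Sum>b<Suc n. ip k x (mpow k ?M b (unit_vec i)) * ip k (unit_vec i) (mpow k ?M (Suc n - 1 - b) x)))
    = - (\<Sum>b<Suc n. ip k (mpow k ?M b x) (mpow k ?M (n - b) x))"
  proof -
    have "(\<Sum>i<k. - (\<Sum>b<Suc n. ip k x (mpow k ?M b (unit_vec i)) * ip k (unit_vec i) (mpow k ?M (Suc n - 1 - b) x)))
      = - (\<Sum>i<k. \<Sum>b<Suc n. mpow k ?M b x i * mpow k ?M (n - b) x i)"
      unfolding sum_negf
    proof (intro arg_cong[where f = uminus] sum.cong refl)
      fix i b assume "i \<in> {..<k}"
      then have i: "i < k" by simp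
      have "ip k x (mpow k ?M b (unit_vec i)) = mpow k ?M b x i"
        unfolding ip_mpow_symm[OF S'] by (subst ip_commute) (rule ip_unit_vec[OF i])
      then show "ip k x (mpow k ?M b (unit_vec i)) * ip k (unit_vec i) (mpow k ?M (Suc n - 1 - b) x)
        = mpow k ?M b x i * mpow k ?M (n - b) x i"
        by (simp add: ip_unit_vec[OF i])
    qed
    also have "\<dots> = - (\<Sum>b<Suc n. \<Sum>i<k. mpow k ?M b x i * mpow k ?M (n - b) x i)"
      by (subst sum.swap) (rule refl)
    finally show ?thesis by (simp only: ip_def[of k "mpow k ?M _ x"])
  qed
  have c: "(\<Sum>b<Suc n. ip k (mpow k ?M b x) (mpow k ?M (n - b) x)) = real (Suc n) * ip k x (mpow k ?M n x)"
  proof -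
    have "(\<Sum>b<Suc n. ip k (mpow k ?M b x) (mpow k ?M (n - b) x)) = (\<Sum>b<Suc n. ip k x (mpow k ?M n x))"
      by (rule sum.cong) (auto simp: ip_mpow_add[OF S'])
    then show ?thesis by simp
  qed
  show ?thesis using a unfolding b c .
qed

text \<open>With N = 2 p + 1, the derivative of the trace in \<open>t\<close> is - N \<psi> t, where
  \<psi> t is an even moment of the updated matrix. Since \<psi> decays at most at the rate N R / c,
  integration up to \<open>w\<close> gives the stated decrease in terms of \<psi> 0. The odd
  exponent is chosen so that \<psi> 0 is |A^p x|^2.\<close>

lemma trace_step:
  assumes S: "symm_mat k A" and c: "0 < c" and R: "0 < R" and w: "0 \<le> w"
    and lower: "\<And>t v. 0 \<le> t \<Longrightarrow> t \<le> w \<Longrightarrow> c * ip k v v \<le> ip k v (\<lambda>i. ip k (rank_one_update A x t i) v)"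
    and xR: "ip k x x \<le> R"
  shows "trace_pow k (rank_one_update A x w) (Suc (2 * p)) \<le> trace_pow k A (Suc (2 * p))
    - (1 - exp (- (real (Suc (2 * p)) * (R / c) * w))) / (R / c) * ip k (mpow k A p x) (mpow k A p x)"
proof -
  let ?M = "rank_one_update A x"
  define \<rho> where "\<rho> = R / c"
  define N where "N = real (Suc (2 * p))"
  have \<rho>: "0 < \<rho>" using R c by (simp add: \<rho>_def)
  define \<psi> where "\<psi> = (\<lambda>t. ip k x (mpow k (?M t) (2 * p) x))"
  have psd: "0 \<le> ip k v (\<lambda>i. ip k (?M t i) v)" if "0 \<le> t" "t \<le> w" for t v
    using order_trans[OF _ lower[OF that, of v]] c by simp
  have \<psi>nn: "0 \<le> \<psi> t" if "0 \<le> t" "t \<le> w" for t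
    unfolding \<psi>_def by (rule moments_log_convex(2)[OF symm_rank_one_update[OF S] psd[OF that]])
  define \<psi>' where "\<psi>' = (\<lambda>t. - (\<Sum>b<2 * p. ip k x (mpow k (?M t) b x) * ip k x (mpow k (?M t) (2 * p - 1 - b) x)))"
  have d\<psi>: "(\<psi> has_real_derivative \<psi>' t) (at t)" for t
    unfolding \<psi>_def \<psi>'_def by (rule ip_mpow_has_derivative)
  have \<psi>': "0 \<le> \<psi>' t + N * \<rho> * \<psi> t" if t: "0 \<le> t" "t \<le> w" for t
  proof -
    define m where "m = (\<lambda>n. ip k x (mpow k (?M t) n x))"
    \<comment> \<open>Correlation inequality m_b m_(2p-1-b) <= m_0 m_(2p-1), then m_0 <= R, then c
      m_(2p-1) <= m_(2p).\<close>
    have le: "m b * m (2 * p - 1 - b) \<le> \<rho> * \<psi> t" if b: "b < 2 * p" for b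
    proof (cases "ip k x x = 0")
      case True
      then have "\<And>l. l < k \<Longrightarrow> x l = 0" by (simp only: ip_self_eq_0_iff)
      then have "m b = 0" unfolding m_def by (simp add: ip_def)
      then show ?thesis using \<rho> \<psi>nn[OF t] by simp
    next
      case False
      then have m0: "0 < m 0" using ip_self_nonneg[of k x] by (simp add: m_def less_le)
      have lc: "(m (Suc n))\<^sup>2 \<le> m n * m (Suc (Suc n))" and nn: "0 \<le> m n" for n
        unfolding m_def by (rule moments_log_convex[OF symm_rank_one_update[OF S] psd[OF t]])+
      have m1: "c * m 0 \<le> m 1" using lower[OF t, of x] by (simp add: m_def)
      note seq = log_convex_sequence[of m c, OF lc nn m0 c m1]
      have eq: "b + (2 * p - 1 - b) = 2 * p - 1" "Suc (2 * p - 1) = 2 * p" using b by auto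
      have "m b * m (2 * p - 1 - b) \<le> m 0 * m (2 * p - 1)" using seq(3)[of b "2 * p - 1 - b"] unfolding eq .
      also have "\<dots> \<le> R * m (2 * p - 1)" using xR nn by (intro mult_right_mono) (auto simp: m_def)
      also have "\<dots> = \<rho> * (c * m (2 * p - 1))" using c by (simp add: \<rho>_def)
      also have "\<dots> \<le> \<rho> * m (2 * p)" using seq(2)[of "2 * p - 1"] \<rho> unfolding eq by (intro mult_left_mono) auto
      finally show ?thesis by (simp add: \<psi>_def m_def)
    qed
    have "(\<Sum>b<2 * p. m b * m (2 * p - 1 - b)) \<le> (\<Sum>b<2 * p. \<rho> * \<psi> t)" using le by (intro sum_mono) auto
    also have "\<dots> = real (2 * p) * \<rho> * \<psi> t" by simp
    also have "\<dots> \<le> N * \<rho> * \<psi> t" using \<rho> \<psi>nn[OF t] by (intro mult_right_mono) (auto simp: N_def)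
    finally show ?thesis by (simp add: \<psi>'_def m_def)
  qed
  have grow: "\<psi> 0 * exp (- (N * \<rho> * t)) \<le> \<psi> t" if t: "0 \<le> t" "t \<le> w" for t
  proof -
    have "\<psi> 0 * exp (N * \<rho> * 0) \<le> \<psi> t * exp (N * \<rho> * t)"
    proof (rule DERIV_nonneg_imp_nondecreasing[OF t(1)])
      fix s assume s: "0 \<le> s" "s \<le> t"
      have "((\<lambda>t. \<psi> t * exp (N * \<rho> * t)) has_real_derivative (\<psi>' s + N * \<rho> * \<psi> s) * exp (N * \<rho> * s)) (at s)"
        by (rule derivative_eq_intros d\<psi> refl | simp add: algebra_simps)+
      moreover have "0 \<le> (\<psi>' s + N * \<rho> * \<psi> s) * exp (N * \<rho> * s)" using \<psi>'[of s] s t by simp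
      ultimately show "\<exists>y. ((\<lambda>t. \<psi> t * exp (N * \<rho> * t)) has_real_derivative y) (at s) \<and> 0 \<le> y" by blast
    qed
    then have "\<psi> 0 * exp (- (N * \<rho> * t)) \<le> \<psi> t * exp (N * \<rho> * t) * exp (- (N * \<rho> * t))"
      by (intro mult_right_mono) auto
    then show ?thesis by (simp add: mult.assoc exp_add[symmetric])
  qed
  define F where "F = (\<lambda>t. trace_pow k (?M t) (Suc (2 * p)))"
  \<comment> \<open>The subtracted function is an antiderivative of the bound - N \<psi> 0 exp (- N
    \<rho> t) for the derivative of \<open>F\<close>.\<close>
  have "F w - (- \<psi> 0 / \<rho>) * (- exp (- (N * \<rho> * w))) \<le> F 0 - (- \<psi> 0 / \<rho>) * (- exp (- (N * \<rho> * 0)))"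
  proof (rule DERIV_nonpos_imp_nonincreasing[OF w])
    fix s assume s: "0 \<le> s" "s \<le> w"
    have "(F has_real_derivative - (N * \<psi> s)) (at s)"
      unfolding F_def \<psi>_def N_def by (rule trace_pow_has_derivative[OF S])
    then have "((\<lambda>t. F t - (- \<psi> 0 / \<rho>) * (- exp (- (N * \<rho> * t)))) has_real_derivative
      - (N * \<psi> s) + N * (\<psi> 0 * exp (- (N * \<rho> * s)))) (at s)"
      using \<rho> by (auto intro!: derivative_eq_intros simp: field_simps)
    moreover have "- (N * \<psi> s) + N * (\<psi> 0 * exp (- (N * \<rho> * s))) \<le> 0"
      using mult_left_mono[OF grow[OF s], of N] by (simp add: N_def)
    ultimately show "\<exists>y. ((\<lambda>t. F t - (- \<psi> 0 / \<rho>) * (- exp (- (N * \<rho> * t)))) has_real_derivative y) (at s) \<and> y \<le> 0"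
      by blast
  qed
  then have "F w - \<psi> 0 / \<rho> * exp (- (N * \<rho> * w)) \<le> F 0 - \<psi> 0 / \<rho>" by simp
  then have "F w \<le> F 0 - (1 - exp (- (N * \<rho> * w))) / \<rho> * \<psi> 0"
  proof -
    have "(1 - exp (- (N * \<rho> * w))) / \<rho> * \<psi> 0 = \<psi> 0 / \<rho> - \<psi> 0 / \<rho> * exp (- (N * \<rho> * w))"
      by (simp add: diff_divide_distrib algebra_simps)
    then show ?thesis using \<open>F w - \<psi> 0 / \<rho> * exp (- (N * \<rho> * w)) \<le> F 0 - \<psi> 0 / \<rho>\<close> by simp
  qed
  moreover have "?M 0 = A" by (simp add: rank_one_update_def)
  moreover have "ip k (mpow k A p x) (mpow k A p x) = ip k x (mpow k A (2 * p) x)"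
    using ip_mpow_add[OF S, of p x p x] by (simp add: mult_2)
  ultimately show ?thesis by (simp add: F_def \<psi>_def N_def \<rho>_def)
qed

text \<open>The second claim uses A <= I to lower the exponent from 2 p + 1 to 2 p, as needed to
  close the induction in \<open>expected_trace_bound\<close>. The third replaces the comparison of
  the largest eigenvalue with the trace; it follows from |B_ab| <= sqrt (B_aa B_bb) for B =
  A^n.\<close>

lemma trace_pow_facts:
  assumes S: "symm_mat k A" and psd: "\<And>v. 0 \<le> ip k v (\<lambda>i. ip k (A i) v)"
    and le1: "\<And>v. ip k v (\<lambda>i. ip k (A i) v) \<le> ip k v v"
  shows "0 \<le> trace_pow k A n"
    and "trace_pow k A (Suc (2 * p)) \<le> (\<Sum>i<k. ip k (mpow k A p (unit_vec i)) (mpow k A p (unit_vec i)))"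
    and "ip k v (mpow k A n v) \<le> ip k v v * trace_pow k A n"
proof -
  show nn: "0 \<le> trace_pow k A n" for n
    unfolding trace_pow_def by (intro sum_nonneg moments_log_convex(2)[OF S psd])
  show "trace_pow k A (Suc (2 * p)) \<le> (\<Sum>i<k. ip k (mpow k A p (unit_vec i)) (mpow k A p (unit_vec i)))"
    unfolding trace_pow_def
  proof (rule sum_mono)
    fix i
    let ?u = "mpow k A p (unit_vec i)"
    have "ip k (unit_vec i) (mpow k A (Suc (2 * p)) (unit_vec i)) = ip k ?u (mpow k A (Suc p) (unit_vec i))"
      unfolding ip_mpow_add[OF S] by (simp add: mult_2)
    also have "\<dots> \<le> ip k ?u ?u" using le1[of ?u] by simp
    finally show "ip k (unit_vec i) (mpow k A (Suc (2 * p)) (unit_vec i)) \<le> ip k ?u ?u" .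
  qed
  show "ip k v (mpow k A n v) \<le> ip k v v * trace_pow k A n"
  proof -
    define B where "B = (\<lambda>a b. ip k (unit_vec a) (mpow k A n (unit_vec b)))"
    have lin: "mpow k A n (\<lambda>l. \<Sum>a<k. z a * unit_vec a l) i = (\<Sum>a<k. z a * mpow k A n (unit_vec a) i)" for z i
    proof (induction n arbitrary: i)
      case (Suc n)
      have "mpow k A n (\<lambda>l. \<Sum>a<k. z a * unit_vec a l) = (\<lambda>i. \<Sum>a<k. z a * mpow k A n (unit_vec a) i)"
        using Suc by blast
      then show ?case by (simp add: ip_linear)
    qed simp
    have vexp: "v l = (\<Sum>a<k. v a * unit_vec a l)" if "l < k" for l
      using that by (simp add: unit_vec_def if_distrib[of "\<lambda>x. _ * x"] cong: if_cong)
    have mcong: "mpow k A n u i = mpow k A n u' i" if "\<And>l. l < k \<Longrightarrow> u l = u' l" "i < k" for u u' i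
    proof (cases n)
      case 0
      then show ?thesis using that by simp
    next
      case (Suc n')
      have "ip k (A i) (mpow k A n' u) = ip k (A i) (mpow k A n' u')" for i
        by (induction n' arbitrary: i) (use that(1) in \<open>auto simp: ip_def\<close>)
      then show ?thesis using Suc by simp
    qed
    have Bsym: "B a b = B b a" for a b
      unfolding B_def ip_mpow_symm[OF S, of "unit_vec a"] by (rule ip_commute)
    have quad: "ip k (\<lambda>l. \<Sum>a<k. z a * unit_vec a l) (mpow k A n (\<lambda>l. \<Sum>a<k. z a * unit_vec a l))
        = (\<Sum>a<k. \<Sum>b<k. z a * z b * B a b)" for z
    proof -
      have "mpow k A n (\<lambda>l. \<Sum>a<k. z a * unit_vec a l) = (\<lambda>i. \<Sum>b<k. z b * mpow k A n (unit_vec b) i)"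
        using lin by blast
      then show ?thesis
        by (simp add: ip_linear B_def sum_distrib_left mult.assoc) (subst sum.swap, simp add: mult_ac)
    qed
    \<comment> \<open>The 2 x 2 minors of A^n are nonnegative, by Cauchy-Schwarz for the inner
      product or, if n is odd, for the form of \<open>A\<close>.\<close>
    have B2: "B a b * B a b \<le> B a a * B b b" if "a < k" "b < k" for a b
    proof (cases "even n")
      case True
      then obtain p where n: "n = p + p" by (auto elim!: evenE simp: mult_2)
      show ?thesis unfolding B_def n ip_mpow_add[OF S, symmetric]
        using ip_CS[of k "mpow k A p (unit_vec a)" "mpow k A p (unit_vec b)"] by (simp only: power2_eq_square)
    next
      case False
      then obtain p where n: "n = Suc (p + p)" by (auto elim!: oddE simp: mult_2)
      have eq: "Suc (p + p) = p + Suc p" by simp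
      show ?thesis unfolding B_def n eq ip_mpow_add[OF S, symmetric] mpow.simps
        using ip_psd_CS[OF S psd, of "mpow k A p (unit_vec a)" "mpow k A p (unit_vec b)"] by (simp only: power2_eq_square)
    qed
    have Bnn: "0 \<le> B a a" for a unfolding B_def by (rule moments_log_convex(2)[OF S psd])
    have "ip k v (mpow k A n v) = ip k (\<lambda>l. \<Sum>a<k. v a * unit_vec a l) (mpow k A n (\<lambda>l. \<Sum>a<k. v a * unit_vec a l))"
      by (rule ip_cong) (use vexp in \<open>auto intro!: mcong\<close>)
    also have "\<dots> \<le> (\<Sum>a<k. \<Sum>b<k. (\<bar>v a\<bar> * sqrt (B a a)) * (\<bar>v b\<bar> * sqrt (B b b)))"
      unfolding quad
    proof (intro sum_mono)
      fix a b assume "a \<in> {..<k}" "b \<in> {..<k}"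
      then have "\<bar>B a b\<bar> \<le> sqrt (B a a * B b b)"
        using B2[of a b] by (simp add: real_le_rsqrt power2_eq_square)
      then have "\<bar>v a * v b\<bar> * \<bar>B a b\<bar> \<le> \<bar>v a * v b\<bar> * sqrt (B a a * B b b)" by (rule mult_left_mono) simp
      then show "v a * v b * B a b \<le> (\<bar>v a\<bar> * sqrt (B a a)) * (\<bar>v b\<bar> * sqrt (B b b))"
        using abs_ge_self[of "v a * v b * B a b"] by (simp add: abs_mult real_sqrt_mult mult_ac)
    qed
    also have "\<dots> = (\<Sum>a<k. \<bar>v a\<bar> * sqrt (B a a))\<^sup>2"
      by (simp add: power2_eq_square sum_product)
    also have "\<dots> \<le> (\<Sum>a<k. \<bar>v a\<bar>\<^sup>2) * (\<Sum>a<k. (sqrt (B a a))\<^sup>2)"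
      by (rule Cauchy_Schwarz_ineq_sum)
    also have "\<dots> = ip k v v * trace_pow k A n"
      using Bnn by (simp add: ip_self trace_pow_def B_def)
    finally show ?thesis .
  qed
qed

subsection \<open>A lower Chernoff bound for sums of rank-one matrices\<close>

text \<open>The matrix \<open>I - w (x\<^sub>0 x\<^sub>0\<^sup>T + \<dots> + x\<^sub>n\<^sub>-\<^sub>1 x\<^sub>n\<^sub>-\<^sub>1\<^sup>T)\<close>. With \<open>w = \<theta> / N\<close>, the trace of its \<open>N\<close>-th power
  replaces the trace exponential of the usual proof of the matrix Chernoff bound, and the log-convexity
  of the moments \<open>\<langle>x, M\<^sup>i x\<rangle>\<close> replaces the trace inequalities for exponentials.\<close>

definition gram_mat :: "('a \<Rightarrow> nat \<Rightarrow> real) \<Rightarrow> real \<Rightarrow> nat \<Rightarrow> (nat \<Rightarrow> 'a) \<Rightarrow> nat \<Rightarrow> nat \<Rightarrow> real" where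
  "gram_mat X w n om = (\<lambda>i j. (if i = j then 1 else 0) - w * (\<Sum>l<n. X (om l) i * X (om l) j))"

lemma symm_gram_mat: "symm_mat k (gram_mat X w n om)"
  by (simp add: symm_mat_def gram_mat_def mult.commute)

lemma gram_mat_Suc:
  "gram_mat X w (Suc n) (om(n := y)) = rank_one_update (gram_mat X w n om) (X y) w"
  by (simp add: gram_mat_def rank_one_update_def fun_eq_iff algebra_simps)

lemma gram_mat_quadratic:
  "ip k v (\<lambda>i. ip k (gram_mat X w n om i) v) = ip k v v - w * (\<Sum>l<n. (ip k (X (om l)) v)\<^sup>2)"
proof -
  have row: "ip k (gram_mat X w n om i) v = v i - w * (\<Sum>l<n. X (om l) i * ip k (X (om l)) v)" if "i < k" for i
  proof -
    have "ip k (gram_mat X w n om i) v = ip k (\<lambda>j. (if j = i then 1 else 0) - w * (\<Sum>l<n. X (om l) i * X (om l) j)) v"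
      by (rule ip_cong) (auto simp: gram_mat_def)
    then show ?thesis by (simp add: ip_linear ip_unit that)
  qed
  have "ip k v (\<lambda>i. ip k (gram_mat X w n om i) v)
    = ip k v (\<lambda>i. v i - w * (\<Sum>l<n. ip k (X (om l)) v * X (om l) i))"
    by (rule ip_cong) (auto simp: row mult.commute)
  also have "\<dots> = ip k v v - w * (\<Sum>l<n. ip k (X (om l)) v * ip k v (X (om l)))"
    unfolding ip_diff_right ip_scale_right ip_sum_right ..
  finally show ?thesis by (simp add: power2_eq_square ip_commute[of k v "X _"])
qed

lemma rank_one_quadratic:
  "ip k v (\<lambda>i. ip k (rank_one_update A x t i) v) = ip k v (\<lambda>i. ip k (A i) v) - t * (ip k x v)\<^sup>2"
proof -
  have "ip k v (\<lambda>i. ip k (rank_one_update A x t i) v) = ip k v (\<lambda>i. ip k (A i) v - (t * ip k x v) * x i)"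
    by (rule ip_cong) (auto simp: ip_rank_one_update)
  then show ?thesis unfolding ip_linear ip_commute[of k v x] by (simp add: power2_eq_square)
qed

text \<open>For y = A u, Cauchy-Schwarz in the form of \<open>A\<close> gives |y|^4 <= |y|^2 |u|^2,
  since the form is below the squared norm.\<close>

lemma mpow_contraction:
  assumes S: "symm_mat k A" and psd: "\<And>v. 0 \<le> ip k v (\<lambda>i. ip k (A i) v)"
    and le1: "\<And>v. ip k v (\<lambda>i. ip k (A i) v) \<le> ip k v v"
  shows "ip k (mpow k A p v) (mpow k A p v) \<le> ip k v v"
proof (induction p)
  case (Suc p)
  define u where "u = mpow k A p v"
  define y where "y = (\<lambda>i. ip k (A i) u)"
  have "(ip k y y)\<^sup>2 \<le> ip k y (\<lambda>i. ip k (A i) y) * ip k u (\<lambda>i. ip k (A i) u)"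
    using ip_psd_CS[OF S psd, of y u] by (simp add: y_def)
  also have "\<dots> \<le> ip k y y * ip k u u" by (intro mult_mono le1 psd) auto
  finally have "ip k y y \<le> ip k u u"
    using ip_self_nonneg[of k y] by (cases "ip k y y = 0") (auto simp: power2_eq_square)
  then show ?case using Suc by (simp add: u_def y_def)
qed simp

lemma trace_pow_le_dim:
  assumes S: "symm_mat k A" and psd: "\<And>v. 0 \<le> ip k v (\<lambda>i. ip k (A i) v)"
    and le1: "\<And>v. ip k v (\<lambda>i. ip k (A i) v) \<le> ip k v v"
  shows "trace_pow k A (Suc (2 * p)) \<le> real k"
proof -
  have "trace_pow k A (Suc (2 * p)) \<le> (\<Sum>i<k. ip k (mpow k A p (unit_vec i)) (mpow k A p (unit_vec i)))"
    by (rule trace_pow_facts(2)[OF S psd le1])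
  also have "\<dots> \<le> (\<Sum>i<k. ip k (unit_vec i) (unit_vec i))"
    by (intro sum_mono mpow_contraction[OF S psd le1])
  also have "\<dots> = real k" by (simp add: ip_unit_vec) (simp add: unit_vec_def)
  finally show ?thesis .
qed

lemma borel_measurable_mpow:
  assumes "\<And>i j. i < k \<Longrightarrow> j < k \<Longrightarrow> (\<lambda>z. A z i j) \<in> borel_measurable M"
    and "\<And>i. i < k \<Longrightarrow> (\<lambda>z. v z i) \<in> borel_measurable M"
  shows "i < k \<Longrightarrow> (\<lambda>z. mpow k (A z) n (v z) i) \<in> borel_measurable M"
proof (induction n arbitrary: i)
  case (Suc n)
  then show ?case using assms(1) by (auto simp: ip_def intro!: borel_measurable_sum borel_measurable_times)
qed (use assms(2) in simp)

lemma borel_measurable_trace_pow: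
  assumes "\<And>i j. i < k \<Longrightarrow> j < k \<Longrightarrow> (\<lambda>z. A z i j) \<in> borel_measurable M"
  shows "(\<lambda>z. trace_pow k (A z) n) \<in> borel_measurable M"
  unfolding trace_pow_def ip_def
  by (intro borel_measurable_sum borel_measurable_times borel_measurable_const borel_measurable_mpow assms) auto

context
  fixes \<mu> :: "'a measure" and X :: "'a \<Rightarrow> nat \<Rightarrow> real" and k :: nat and R \<alpha> :: real
  assumes prob: "prob_space \<mu>"
    and Xm: "\<And>i. i < k \<Longrightarrow> (\<lambda>om. X om i) \<in> borel_measurable \<mu>"
    and XR: "\<And>om. om \<in> space \<mu> \<Longrightarrow> ip k (X om) (X om) \<le> R"
    and R: "0 < R" and \<alpha>: "0 < \<alpha>" "\<alpha> \<le> R"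
    and second: "\<And>v. \<alpha> * ip k v v \<le> (\<integral>om. (ip k (X om) v)\<^sup>2 \<partial>\<mu>)"
begin

lemma gram_mat_lower:
  assumes om: "\<And>l. l < n \<Longrightarrow> om l \<in> space \<mu>" and w: "0 \<le> w"
  shows "(1 - w * real n * R) * ip k v v \<le> ip k v (\<lambda>i. ip k (gram_mat X w n om i) v)"
proof -
  have "(\<Sum>l<n. (ip k (X (om l)) v)\<^sup>2) \<le> (\<Sum>l<n. R * ip k v v)"
  proof (rule sum_mono)
    fix l assume "l \<in> {..<n}"
    then have "ip k (X (om l)) (X (om l)) * ip k v v \<le> R * ip k v v"
      using XR om by (intro mult_right_mono) auto
    then show "(ip k (X (om l)) v)\<^sup>2 \<le> R * ip k v v" using ip_CS[of k "X (om l)" v] by linarith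
  qed
  then have "w * (\<Sum>l<n. (ip k (X (om l)) v)\<^sup>2) \<le> w * (real n * (R * ip k v v))"
    using w by (intro mult_left_mono) auto
  then show ?thesis unfolding gram_mat_quadratic by (simp add: algebra_simps)
qed

lemma gram_mat_le1:
  assumes w: "0 \<le> w"
  shows "ip k v (\<lambda>i. ip k (gram_mat X w n om i) v) \<le> ip k v v"
  unfolding gram_mat_quadratic using w by (simp add: sum_nonneg)

lemma space_PiM_lessThan:
  "om \<in> space (Pi\<^sub>M {..<n} (\<lambda>_. \<mu>)) \<Longrightarrow> l < n \<Longrightarrow> om l \<in> space \<mu>"
  by (auto simp: space_PiM PiE_iff)

lemma trace_gram_measurable:
  "(\<lambda>om. trace_pow k (gram_mat X w n om) N) \<in> borel_measurable (Pi\<^sub>M {..<n} (\<lambda>_. \<mu>))"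
proof (rule borel_measurable_trace_pow)
  have comp: "(\<lambda>om. X (om l) i) \<in> borel_measurable (Pi\<^sub>M {..<n} (\<lambda>_. \<mu>))" if "l \<in> {..<n}" "i < k" for l i
    by (rule measurable_compose[OF _ Xm[OF that(2)]]) (rule measurable_component_singleton[OF that(1)])
  fix i j assume "i < k" "j < k"
  then show "(\<lambda>om. gram_mat X w n om i j) \<in> borel_measurable (Pi\<^sub>M {..<n} (\<lambda>_. \<mu>))"
    unfolding gram_mat_def
    by (intro borel_measurable_diff borel_measurable_times borel_measurable_const borel_measurable_sum comp) auto
qed

text \<open>Integration over the last sample: \<open>trace_step\<close> removes \<kappa> |A^p x|^2,
  whose mean is at least \<alpha> times the sum of |A^p e_i|^2, hence at least \<alpha> times the
  trace before the step. Every sample thus contributes a factor 1 - \<alpha> \<kappa>. The constant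
  \<open>c\<close> keeps all intermediate matrices positive definite.\<close>

lemma expected_trace_bound:
  fixes p :: nat
  assumes w: "0 \<le> w" and c: "0 < c" "c \<le> 1 - w * real nm * R"
  defines "\<kappa> \<equiv> (1 - exp (- (real (Suc (2 * p)) * (R / c) * w))) / (R / c)"
  shows "n \<le> nm \<Longrightarrow> integrable (Pi\<^sub>M {..<n} (\<lambda>_. \<mu>)) (\<lambda>om. trace_pow k (gram_mat X w n om) (Suc (2 * p))) \<and>
    (\<integral>om. trace_pow k (gram_mat X w n om) (Suc (2 * p)) \<partial>(Pi\<^sub>M {..<n} (\<lambda>_. \<mu>))) \<le> real k * (1 - \<alpha> * \<kappa>) ^ n"
proof (induction n)
  interpret prob_space \<mu> by (rule prob)
  interpret P: product_sigma_finite "\<lambda>_::nat. \<mu>" by standard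
  define N where "N = Suc (2 * p)"
  have lower: "c * ip k v v \<le> ip k v (\<lambda>i. ip k (gram_mat X w n om i) v)"
    if "n \<le> nm" "\<And>l. l < n \<Longrightarrow> om l \<in> space \<mu>" for n om v
  proof -
    have "w * real n * R \<le> w * real nm * R" using that(1) w R by (intro mult_right_mono mult_left_mono) auto
    then have "c * ip k v v \<le> (1 - w * real n * R) * ip k v v" using c(2) by (intro mult_right_mono) auto
    also have "\<dots> \<le> ip k v (\<lambda>i. ip k (gram_mat X w n om i) v)" by (rule gram_mat_lower[OF that(2) w])
    finally show ?thesis .
  qed
  have psd: "0 \<le> ip k v (\<lambda>i. ip k (gram_mat X w n om i) v)"
    if "n \<le> nm" "\<And>l. l < n \<Longrightarrow> om l \<in> space \<mu>" for n om v
  proof -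
    have "0 \<le> c * ip k v v" using c(1) by simp
    also have "\<dots> \<le> ip k v (\<lambda>i. ip k (gram_mat X w n om i) v)" by (rule lower[OF that])
    finally show ?thesis .
  qed
  have Tbd: "\<bar>trace_pow k (gram_mat X w n om) N\<bar> \<le> real k"
    if "n \<le> nm" "\<And>l. l < n \<Longrightarrow> om l \<in> space \<mu>" for n om
  proof -
    have p: "0 \<le> ip k v (\<lambda>i. ip k (gram_mat X w n om i) v)" for v by (rule psd[OF that])
    have "0 \<le> trace_pow k (gram_mat X w n om) N" by (rule trace_pow_facts(1)[OF symm_gram_mat p gram_mat_le1[OF w]])
    moreover have "trace_pow k (gram_mat X w n om) N \<le> real k"
      unfolding N_def by (rule trace_pow_le_dim[OF symm_gram_mat p gram_mat_le1[OF w]])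
    ultimately show ?thesis by simp
  qed
  have PS: "prob_space (Pi\<^sub>M {..<n} (\<lambda>_. \<mu>))" for n :: nat by (intro prob_space_PiM prob)
  have Tint: "integrable (Pi\<^sub>M {..<n} (\<lambda>_. \<mu>)) (\<lambda>om. trace_pow k (gram_mat X w n om) N)" if n: "n \<le> nm" for n
  proof -
    interpret PP: prob_space "Pi\<^sub>M {..<n} (\<lambda>_. \<mu>)" by (rule PS)
    show ?thesis
    proof (rule PP.integrable_const_bound[where B = "real k"])
      show "AE om in Pi\<^sub>M {..<n} (\<lambda>_. \<mu>). norm (trace_pow k (gram_mat X w n om) N) \<le> real k"
        unfolding real_norm_def by (intro AE_I2 Tbd[OF n] space_PiM_lessThan)
    qed (rule trace_gram_measurable)
  qed
  have \<kappa>: "0 \<le> \<kappa>" "\<alpha> * \<kappa> \<le> 1"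
  proof -
    have nn: "0 \<le> real (Suc (2 * p)) * (R / c) * w" using R c(1) w by simp
    then show "0 \<le> \<kappa>" unfolding \<kappa>_def using R c(1) by (intro divide_nonneg_pos) auto
    have "c \<le> 1" using c w R by (smt (verit) mult_nonneg_nonneg of_nat_0_le_iff)
    have "\<kappa> \<le> 1 / (R / c)" unfolding \<kappa>_def using R c(1) by (intro divide_right_mono) auto
    also have "\<dots> = c / R" by simp
    also have "\<dots> \<le> 1 / R" using \<open>c \<le> 1\<close> R by (intro divide_right_mono) auto
    finally have "\<alpha> * \<kappa> \<le> \<alpha> * (1 / R)" using \<alpha> by (intro mult_left_mono) auto
    also have "\<dots> \<le> 1" using \<alpha> R by simp
    finally show "\<alpha> * \<kappa> \<le> 1" .
  qed
  {
    case 0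
    interpret PP: prob_space "Pi\<^sub>M {..<0} (\<lambda>_::nat. \<mu>)" by (rule PS)
    have "(\<integral>om. trace_pow k (gram_mat X w 0 om) N \<partial>(Pi\<^sub>M {..<0} (\<lambda>_. \<mu>))) \<le> (\<integral>om. real k \<partial>(Pi\<^sub>M {..<0::nat} (\<lambda>_. \<mu>)))"
    proof (rule integral_mono[OF Tint])
      fix om assume "om \<in> space (Pi\<^sub>M {..<0} (\<lambda>_::nat. \<mu>))"
      show "trace_pow k (gram_mat X w 0 om) N \<le> real k" using Tbd[of 0 om] by simp
    qed (simp_all only: PP.integrable_const le0)
    also have "\<dots> = real k" using PP.prob_space by simp
    finally show ?case using Tint[of 0] by (simp add: N_def)
  next
    case (Suc n)
    then have n: "n \<le> nm" by simp
    have IH: "(\<integral>om. trace_pow k (gram_mat X w n om) N \<partial>(Pi\<^sub>M {..<n} (\<lambda>_. \<mu>))) \<le> real k * (1 - \<alpha> * \<kappa>) ^ n"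
      using Suc by (simp add: N_def)
    let ?T = "\<lambda>n om. trace_pow k (gram_mat X w n om) N"
    have step: "(\<integral>y. ?T (Suc n) (om(n := y)) \<partial>\<mu>) \<le> (1 - \<alpha> * \<kappa>) * ?T n om"
      if om: "om \<in> space (Pi\<^sub>M {..<n} (\<lambda>_. \<mu>))" for om
    proof -
      define A where "A = gram_mat X w n om"
      have om': "\<And>l. l < n \<Longrightarrow> om l \<in> space \<mu>" using om by (rule space_PiM_lessThan)
      have S: "symm_mat k A" by (simp add: A_def symm_gram_mat)
      have Apsd: "\<And>v. 0 \<le> ip k v (\<lambda>i. ip k (A i) v)" unfolding A_def by (rule psd[OF n om'])
      have Ale1: "\<And>v. ip k v (\<lambda>i. ip k (A i) v) \<le> ip k v v" unfolding A_def by (rule gram_mat_le1[OF w])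
      \<comment> \<open>|A^p X|^2 written so that \<open>second\<close> applies with the fixed
        vectors A^p e_i.\<close>
      define q where "q = (\<lambda>y. \<Sum>i<k. (ip k (X y) (mpow k A p (unit_vec i)))\<^sup>2)"
      have q_eq: "ip k (mpow k A p (X y)) (mpow k A p (X y)) = q y" for y
        unfolding q_def ip_self
      proof (rule sum.cong[OF refl])
        fix i assume "i \<in> {..<k}"
        then have "mpow k A p (X y) i = ip k (unit_vec i) (mpow k A p (X y))" by (simp add: ip_unit_vec)
        also have "\<dots> = ip k (X y) (mpow k A p (unit_vec i))"
          unfolding ip_mpow_symm[OF S, of "unit_vec i"] by (rule ip_commute)
        finally show "(mpow k A p (X y) i)\<^sup>2 = (ip k (X y) (mpow k A p (unit_vec i)))\<^sup>2" by simp
      qed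
      have bd: "?T (Suc n) (om(n := y)) \<le> ?T n om - \<kappa> * q y" if y: "y \<in> space \<mu>" for y
        unfolding gram_mat_Suc A_def[symmetric] q_eq[symmetric] \<kappa>_def N_def
      proof (rule trace_step[OF S c(1) R w])
        fix t v assume t: "0 \<le> t" "t \<le> w"
        have "c * ip k v v \<le> ip k v (\<lambda>i. ip k (gram_mat X w (Suc n) (om(n := y)) i) v)"
          by (rule lower) (use Suc.prems om' y in \<open>auto simp: less_Suc_eq\<close>)
        also have "\<dots> = ip k v (\<lambda>i. ip k (A i) v) - w * (ip k (X y) v)\<^sup>2"
          unfolding gram_mat_Suc A_def[symmetric] by (rule rank_one_quadratic)
        also have "\<dots> \<le> ip k v (\<lambda>i. ip k (A i) v) - t * (ip k (X y) v)\<^sup>2"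
          using t by (simp add: mult_right_mono)
        also have "\<dots> = ip k v (\<lambda>i. ip k (rank_one_update A (X y) t i) v)" by (rule rank_one_quadratic[symmetric])
        finally show "c * ip k v v \<le> ip k v (\<lambda>i. ip k (rank_one_update A (X y) t i) v)" .
      qed (rule XR[OF y])
      have qi: "integrable \<mu> (\<lambda>y. (ip k (X y) v)\<^sup>2)" for v
      proof (rule integrable_const_bound[where B = "R * ip k v v"])
        show "AE y in \<mu>. norm ((ip k (X y) v)\<^sup>2) \<le> R * ip k v v"
        proof (rule AE_I2)
          fix y assume "y \<in> space \<mu>"
          then have "ip k (X y) (X y) * ip k v v \<le> R * ip k v v" using XR by (intro mult_right_mono) auto
          then show "norm ((ip k (X y) v)\<^sup>2) \<le> R * ip k v v" using ip_CS[of k "X y" v] by simp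
        qed
        show "(\<lambda>y. (ip k (X y) v)\<^sup>2) \<in> borel_measurable \<mu>"
          unfolding ip_def by (intro borel_measurable_power borel_measurable_sum borel_measurable_times Xm) auto
      qed
      have Ti: "integrable \<mu> (\<lambda>y. ?T (Suc n) (om(n := y)))"
      proof (rule integrable_const_bound[where B = "real k"])
        show "AE y in \<mu>. norm (?T (Suc n) (om(n := y))) \<le> real k"
        proof (rule AE_I2)
          fix y assume "y \<in> space \<mu>"
          then show "norm (?T (Suc n) (om(n := y))) \<le> real k"
            unfolding real_norm_def by (intro Tbd) (use Suc.prems om' in \<open>auto simp: less_Suc_eq\<close>)
        qed
        show "(\<lambda>y. ?T (Suc n) (om(n := y))) \<in> borel_measurable \<mu>"
          unfolding gram_mat_Suc
          by (rule borel_measurable_trace_pow) (auto simp: rank_one_update_def intro!: borel_measurable_diff borel_measurable_times Xm)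
      qed
      have "(\<integral>y. ?T (Suc n) (om(n := y)) \<partial>\<mu>) \<le> (\<integral>y. ?T n om - \<kappa> * q y \<partial>\<mu>)"
        by (rule integral_mono[OF Ti]) (use qi bd in \<open>auto simp: q_def\<close>)
      also have "\<dots> = ?T n om - \<kappa> * (\<Sum>i<k. (\<integral>y. (ip k (X y) (mpow k A p (unit_vec i)))\<^sup>2 \<partial>\<mu>))"
        unfolding q_def using qi prob_space by simp
      also have "\<dots> \<le> ?T n om - \<kappa> * (\<Sum>i<k. \<alpha> * ip k (mpow k A p (unit_vec i)) (mpow k A p (unit_vec i)))"
        using \<kappa>(1) by (intro diff_left_mono mult_left_mono sum_mono second) auto
      also have "\<dots> \<le> ?T n om - \<kappa> * (\<alpha> * ?T n om)"
      proof -
        have "?T n om \<le> (\<Sum>i<k. ip k (mpow k A p (unit_vec i)) (mpow k A p (unit_vec i)))"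
          unfolding N_def A_def[symmetric] by (rule trace_pow_facts(2)[OF S Apsd Ale1])
        then show ?thesis using \<kappa>(1) \<alpha>
          by (simp only: sum_distrib_left[symmetric]) (intro diff_left_mono mult_left_mono, auto)
      qed
      finally show ?thesis by (simp add: algebra_simps)
    qed
    have "(\<integral>om. ?T (Suc n) om \<partial>(Pi\<^sub>M {..<Suc n} (\<lambda>_. \<mu>)))
      = (\<integral>om. (\<integral>y. ?T (Suc n) (om(n := y)) \<partial>\<mu>) \<partial>(Pi\<^sub>M {..<n} (\<lambda>_. \<mu>)))"
      unfolding lessThan_Suc
      by (rule P.product_integral_insert) (use Tint[OF Suc.prems] in \<open>auto simp: lessThan_Suc\<close>)
    also have "\<dots> \<le> (\<integral>om. (1 - \<alpha> * \<kappa>) * ?T n om \<partial>(Pi\<^sub>M {..<n} (\<lambda>_. \<mu>)))"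
    proof (rule integral_mono_AE')
      show "integrable (Pi\<^sub>M {..<n} (\<lambda>_. \<mu>)) (\<lambda>om. (1 - \<alpha> * \<kappa>) * ?T n om)" using Tint[OF n] by simp
      show "AE om in Pi\<^sub>M {..<n} (\<lambda>_. \<mu>). (\<integral>y. ?T (Suc n) (om(n := y)) \<partial>\<mu>) \<le> (1 - \<alpha> * \<kappa>) * ?T n om"
        using step by (intro AE_I2)
      show "AE om in Pi\<^sub>M {..<n} (\<lambda>_. \<mu>). 0 \<le> (1 - \<alpha> * \<kappa>) * ?T n om"
      proof (rule AE_I2, rule mult_nonneg_nonneg)
        fix om assume om: "om \<in> space (Pi\<^sub>M {..<n} (\<lambda>_. \<mu>))"
        have "0 \<le> ip k v (\<lambda>i. ip k (gram_mat X w n om i) v)" for v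
          by (rule psd[OF n space_PiM_lessThan[OF om]])
        then show "0 \<le> ?T n om" by (rule trace_pow_facts(1)[OF symm_gram_mat _ gram_mat_le1[OF w]])
      qed (use \<kappa>(2) in simp)
    qed
    also have "\<dots> \<le> (1 - \<alpha> * \<kappa>) * (real k * (1 - \<alpha> * \<kappa>) ^ n)"
      using IH \<kappa>(2) by (simp add: mult_left_mono)
    finally show ?case using Tint[OF Suc.prems] by (simp add: N_def mult_ac)
  }
qed

text \<open>Markov's inequality for the trace power, followed by the limit of infinite exponent. In
  the limit \<kappa> becomes s / R and the bound becomes k (1 - \<alpha> s / R)^n exp (\<theta> z);
  the claim then follows from s^2 / 2 <= s + (1 - s) ln (1 - s).\<close>

lemma matrix_chernoff:
  assumes s: "0 < s" "s < 1"
  shows "\<exists>E \<in> sets (Pi\<^sub>M {..<n} (\<lambda>_. \<mu>)).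
    1 - real k * exp (- (real n * \<alpha> * s\<^sup>2) / (2 * R)) \<le> measure (Pi\<^sub>M {..<n} (\<lambda>_. \<mu>)) E \<and>
    (\<forall>\<xi>\<in>E. \<forall>v. real n * (\<alpha> * (1 - s)) * ip k v v \<le> (\<Sum>j<n. (ip k (X (\<xi> j)) v)\<^sup>2))"
proof -
  let ?M = "Pi\<^sub>M {..<n} (\<lambda>_. \<mu>)"
  interpret PP: prob_space ?M by (intro prob_space_PiM prob)
  \<comment> \<open>The usual Chernoff parameter, chosen so that exp (- \<theta> R) = 1 - s.\<close>
  define \<theta> where "\<theta> = - ln (1 - s) / R"
  define z where "z = real n * (\<alpha> * (1 - s))"
  have \<theta>: "0 < \<theta>" unfolding \<theta>_def using s R by (intro divide_pos_pos) (auto simp: ln_less_zero)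
  have z: "0 \<le> z" using s \<alpha> by (simp add: z_def)
  define N where "N = (\<lambda>p. real (Suc (2 * p)))"
  define T where "T = (\<lambda>p om. trace_pow k (gram_mat X (\<theta> / N p) n om) (Suc (2 * p)))"
  define c where "c = (\<lambda>p. 1 - \<theta> / N p * real n * R)"
  define \<kappa> where "\<kappa> = (\<lambda>p. (1 - exp (- (N p * (R / c p) * (\<theta> / N p)))) / (R / c p))"
  \<comment> \<open>A vector whose quadratic form falls below z |v|^2 forces the trace power to
    reach this value, which tends to exp (- \<theta> z).\<close>
  define thr where "thr = (\<lambda>p. (1 - \<theta> * z / N p) ^ Suc (2 * p))"
  define bad where "bad = (\<lambda>p. {om \<in> space ?M. thr p \<le> T p om})"
  have Npos: "0 < N p" for p by (simp add: N_def)
  have Nlim: "filterlim N at_top sequentially"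
    unfolding N_def
    by (intro filterlim_compose[OF filterlim_real_sequentially] filterlim_subseq) (auto simp: strict_mono_def)
  have N0: "(\<lambda>p. a / N p) \<longlonglongrightarrow> 0" for a by (intro tendsto_divide_0[OF tendsto_const] filterlim_at_top_imp_at_infinity Nlim)
  have "eventually (\<lambda>p. N p > \<theta> * real n * R + \<theta> * z) sequentially"
    using Nlim by (simp add: filterlim_at_top_dense)
  then obtain p0 where p0: "\<And>p. p \<ge> p0 \<Longrightarrow> N p > \<theta> * real n * R + \<theta> * z"
    by (auto simp: eventually_sequentially)
  have p0a: "0 < c p" "0 < 1 - \<theta> * z / N p" if "p \<ge> p0" for p
  proof -
    have "0 \<le> \<theta> * real n * R" "0 \<le> \<theta> * z" using \<theta> R z by auto
    then have "\<theta> * real n * R < N p" "\<theta> * z < N p" using p0[OF that] by auto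
    then show "0 < c p" "0 < 1 - \<theta> * z / N p" using Npos[of p] by (auto simp: c_def field_simps)
  qed
  have thr_pos: "0 < thr p" if "p \<ge> p0" for p using p0a[OF that] by (simp add: thr_def)
  have bad_meas: "bad p \<in> sets ?M" for p
    unfolding bad_def T_def using trace_gram_measurable[of "\<theta> / N p" n "Suc (2 * p)"] by measurable
  define b where "b = (\<lambda>p. real k * (1 - \<alpha> * \<kappa> p) ^ n / thr p)"
  have bad_le: "measure ?M (bad p) \<le> b p" if p: "p \<ge> p0" for p
  proof -
    have w0: "0 \<le> \<theta> / N p" using \<theta> Npos[of p] by simp
    have 1: "integrable ?M (T p)" "(\<integral>om. T p om \<partial>?M) \<le> real k * (1 - \<alpha> * \<kappa> p) ^ n"
    proof -
      have "c p \<le> 1 - \<theta> / N p * real n * R" by (simp add: c_def)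
      note B = expected_trace_bound[where p = p, OF w0 p0a(1)[OF p] this order_refl]
      show "integrable ?M (T p)" using B unfolding T_def by (rule conjunct1)
      show "(\<integral>om. T p om \<partial>?M) \<le> real k * (1 - \<alpha> * \<kappa> p) ^ n"
        using B[THEN conjunct2] unfolding T_def \<kappa>_def N_def .
    qed
    have nn: "0 \<le> T p om" if om: "om \<in> space ?M" for om
    proof -
      have psd: "0 \<le> ip k v (\<lambda>i. ip k (gram_mat X (\<theta> / N p) n om i) v)" for v
      proof -
        have "0 \<le> c p * ip k v v" using p0a(1)[OF p] by simp
        also have "\<dots> \<le> ip k v (\<lambda>i. ip k (gram_mat X (\<theta> / N p) n om i) v)"
          unfolding c_def by (rule gram_mat_lower[OF space_PiM_lessThan[OF om] w0])
        finally show ?thesis .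
      qed
      show ?thesis unfolding T_def by (rule trace_pow_facts(1)[OF symm_gram_mat psd gram_mat_le1[OF w0]])
    qed
    have "measure ?M (bad p) \<le> (\<integral>om. T p om \<partial>?M) / thr p"
      unfolding bad_def by (rule integral_Markov_inequality_measure[OF 1(1), of "{}"]) (use nn thr_pos[OF p] in auto)
    also have "\<dots> \<le> b p" unfolding b_def using 1(2) thr_pos[OF p] by (intro divide_right_mono) auto
    finally show ?thesis .
  qed
  \<comment> \<open>A single event for all exponents: at least one p >= p0 certifies the lower
    bound. Its measure is at least 1 - b p for each such p, so the limit may be taken in the bound
    alone.\<close>
  define E where "E = space ?M - (\<Inter>p\<in>{p0..}. bad p)"
  have Esets: "E \<in> sets ?M" unfolding E_def by (intro sets.Diff sets.top sets.countable_INT') (auto intro: bad_meas)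
  have Emeas: "1 - b p \<le> measure ?M E" if p: "p \<ge> p0" for p
  proof -
    have "space ?M - bad p \<subseteq> E" unfolding E_def using p by auto
    then have "measure ?M (space ?M - bad p) \<le> measure ?M E" by (rule PP.finite_measure_mono[OF _ Esets])
    moreover have "measure ?M (space ?M - bad p) = 1 - measure ?M (bad p)" by (rule PP.prob_compl[OF bad_meas])
    ultimately show ?thesis using bad_le[OF p] by linarith
  qed
  have blim: "b \<longlonglongrightarrow> real k * (1 - \<alpha> * (s / R)) ^ n / exp (- (\<theta> * z))"
  proof -
    have "(\<lambda>p. 1 - \<theta> * real n * R / N p) \<longlonglongrightarrow> 1 - 0" by (intro tendsto_diff tendsto_const N0)
    then have clim: "c \<longlonglongrightarrow> 1" by (simp add: c_def)
    have "\<kappa> = (\<lambda>p. (1 - exp (- (R / c p * \<theta>))) / (R / c p))"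
      using Npos by (auto simp: \<kappa>_def fun_eq_iff less_le)
    moreover have "(\<lambda>p. (1 - exp (- (R / c p * \<theta>))) / (R / c p)) \<longlonglongrightarrow> (1 - exp (- (R / 1 * \<theta>))) / (R / 1)"
      using R by (intro tendsto_intros clim) auto
    moreover have "exp (- (R * \<theta>)) = 1 - s" using R s by (simp add: \<theta>_def)
    ultimately have "\<kappa> \<longlonglongrightarrow> s / R" by simp
    moreover have "thr \<longlonglongrightarrow> exp (- (\<theta> * z))"
    proof -
      have "(\<lambda>m. (1 + (- (\<theta> * z)) / real m) ^ m) \<longlonglongrightarrow> exp (- (\<theta> * z))" by (rule tendsto_exp_limit_sequentially)
      moreover have "filterlim (\<lambda>p. Suc (2 * p)) sequentially sequentially"
        by (intro filterlim_subseq) (auto simp: strict_mono_def)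
      ultimately have "(\<lambda>p. (1 + (- (\<theta> * z)) / real (Suc (2 * p))) ^ Suc (2 * p)) \<longlonglongrightarrow> exp (- (\<theta> * z))"
        by (rule filterlim_compose)
      then show ?thesis by (simp only: thr_def N_def minus_divide_left[symmetric] diff_conv_add_uminus)
    qed
    ultimately show ?thesis unfolding b_def by (intro tendsto_intros) auto
  qed
  have final: "real k * (1 - \<alpha> * (s / R)) ^ n / exp (- (\<theta> * z)) \<le> real k * exp (- (real n * \<alpha> * s\<^sup>2) / (2 * R))"
  proof -
    have sR: "0 \<le> 1 - \<alpha> * (s / R)"
    proof -
      have "\<alpha> * s \<le> R * 1" using \<alpha> s R by (intro mult_mono) auto
      then show ?thesis using R by (simp add: field_simps)
    qed
    have "(1 - \<alpha> * (s / R)) ^ n \<le> exp (- (\<alpha> * (s / R))) ^ n"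
      using sR exp_ge_add_one_self[of "- (\<alpha> * (s / R))"] by (intro power_mono) auto
    also have "\<dots> = exp (- (real n * \<alpha> * s / R))" by (simp add: exp_of_nat_mult[symmetric] algebra_simps)
    finally have "(1 - \<alpha> * (s / R)) ^ n / exp (- (\<theta> * z)) \<le> exp (- (real n * \<alpha> * s / R)) / exp (- (\<theta> * z))"
      by (intro divide_right_mono) auto
    also have "\<dots> = exp (\<theta> * z - real n * \<alpha> * s / R)" by (simp add: exp_diff exp_minus field_simps)
    also have "\<theta> * z - real n * \<alpha> * s / R = (real n * \<alpha> / R) * - (s + (1 - s) * ln (1 - s))"
      using R by (simp add: \<theta>_def z_def field_simps)
    also have "exp \<dots> \<le> exp ((real n * \<alpha> / R) * - (s\<^sup>2 / 2))"
    proof -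
      have "s\<^sup>2 / 2 \<le> s + (1 - s) * ln (1 - s)"
      proof -
        let ?h = "\<lambda>s::real. s + (1 - s) * ln (1 - s) - s\<^sup>2 / 2"
        have "?h 0 \<le> ?h s"
        proof (rule DERIV_nonneg_imp_nondecreasing[where f = ?h])
          show "0 \<le> s" using s by simp
          fix x assume x: "0 \<le> x" "x \<le> s"
          then have x1: "x < 1" using s by simp
          have d1: "((\<lambda>s. 1 - s) has_real_derivative -1) (at x)" by (auto intro!: derivative_eq_intros)
          have d2: "((\<lambda>s. ln (1 - s)) has_real_derivative -1 / (1 - x)) (at x)"
            using x1 by (auto intro!: derivative_eq_intros)
          have d3: "((\<lambda>s. s\<^sup>2 / 2) has_real_derivative x) (at x)" by (auto intro!: derivative_eq_intros)
          have "(?h has_real_derivative 1 + (-1 * ln (1 - x) + -1 / (1 - x) * (1 - x)) - x) (at x)"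
            by (rule DERIV_diff[OF DERIV_add[OF DERIV_ident DERIV_mult[OF d1 d2]] d3])
          moreover have "1 + (-1 * ln (1 - x) + -1 / (1 - x) * (1 - x)) - x = - ln (1 - x) - x"
            using x1 by simp
          ultimately have "(?h has_real_derivative - ln (1 - x) - x) (at x)" by simp
          moreover have "0 \<le> - ln (1 - x) - x" using ln_le_minus_one[of "1 - x"] x1 by simp
          ultimately show "\<exists>y. (?h has_real_derivative y) (at x) \<and> 0 \<le> y" by blast
        qed
        then show ?thesis by simp
      qed
      then show ?thesis using \<alpha> R by (intro iffD2[OF exp_le_cancel_iff] mult_left_mono) auto
    qed
    finally have "(1 - \<alpha> * (s / R)) ^ n / exp (- (\<theta> * z)) \<le> exp (- (real n * \<alpha> * s\<^sup>2) / (2 * R))"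
      by (simp add: field_simps)
    then have "real k * ((1 - \<alpha> * (s / R)) ^ n / exp (- (\<theta> * z))) \<le> real k * exp (- (real n * \<alpha> * s\<^sup>2) / (2 * R))"
      by (rule mult_left_mono) simp
    then show ?thesis by simp
  qed
  have "1 - real k * (1 - \<alpha> * (s / R)) ^ n / exp (- (\<theta> * z)) \<le> measure ?M E"
  proof (rule LIMSEQ_le_const2)
    show "(\<lambda>p. 1 - b p) \<longlonglongrightarrow> 1 - real k * (1 - \<alpha> * (s / R)) ^ n / exp (- (\<theta> * z))"
      by (intro tendsto_diff tendsto_const blim)
    show "\<exists>N. \<forall>p\<ge>N. 1 - b p \<le> measure ?M E" using Emeas by blast
  qed
  then have "1 - real k * exp (- (real n * \<alpha> * s\<^sup>2) / (2 * R)) \<le> measure ?M E" using final by linarith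
  moreover have "z * ip k v v \<le> (\<Sum>j<n. (ip k (X (\<xi> j)) v)\<^sup>2)" if \<xi>: "\<xi> \<in> E" for \<xi> v
  proof (rule ccontr)
    assume "\<not> ?thesis"
    then have lt: "(\<Sum>j<n. (ip k (X (\<xi> j)) v)\<^sup>2) < z * ip k v v" by simp
    obtain p where p: "p \<ge> p0" "\<xi> \<in> space ?M" "T p \<xi> < thr p"
      using \<xi> by (auto simp: E_def bad_def not_le)
    define w where "w = \<theta> / N p"
    have w0: "0 < w" using \<theta> Npos[of p] by (simp add: w_def)
    define A where "A = gram_mat X w n \<xi>"
    have S: "symm_mat k A" by (simp add: A_def symm_gram_mat)
    have psd: "0 \<le> ip k v (\<lambda>i. ip k (A i) v)" for v
    proof -
      have "0 \<le> c p * ip k v v" using p0a(1)[OF p(1)] by simp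
      also have "\<dots> \<le> ip k v (\<lambda>i. ip k (A i) v)"
        unfolding A_def c_def w_def
        by (rule gram_mat_lower[OF space_PiM_lessThan[OF p(2)]]) (use w0 in \<open>auto simp: w_def\<close>)
      finally show ?thesis .
    qed
    have le1: "ip k v (\<lambda>i. ip k (A i) v) \<le> ip k v v" for v
      unfolding A_def by (rule gram_mat_le1) (use w0 in simp)
    define m where "m = (\<lambda>j. ip k v (mpow k A j v))"
    have "0 < z * ip k v v" using lt sum_nonneg[of "{..<n}" "\<lambda>j. (ip k (X (\<xi> j)) v)\<^sup>2"] by simp
    then have vpos: "0 < m 0" using z ip_self_nonneg[of k v] by (simp add: m_def zero_less_mult_iff)
    define r where "r = 1 - \<theta> * z / N p"
    have rpos: "0 < r" using p0a(2)[OF p(1)] by (simp add: r_def)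
    have "w * (\<Sum>j<n. (ip k (X (\<xi> j)) v)\<^sup>2) \<le> w * (z * ip k v v)" using lt w0 by simp
    then have "r * m 0 \<le> m 1"
      by (simp add: m_def A_def gram_mat_quadratic r_def w_def algebra_simps)
    have lc: "(m (Suc j))\<^sup>2 \<le> m j * m (Suc (Suc j))" and nn: "0 \<le> m j" for j
      unfolding m_def by (rule moments_log_convex[OF S psd])+
    \<comment> \<open>The violated lower bound at \<open>v\<close> says m 1 >= r m 0; log-convexity
      propagates it to the exponent 2 p + 1, against the small trace.\<close>
    have "r ^ Suc (2 * p) * m 0 \<le> m (Suc (2 * p))"
      by (rule log_convex_sequence(4)[of m r, OF lc nn vpos rpos \<open>r * m 0 \<le> m 1\<close>])
    also have "\<dots> \<le> ip k v v * trace_pow k A (Suc (2 * p))"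
      unfolding m_def by (rule trace_pow_facts(3)[OF S psd le1])
    also have "\<dots> = m 0 * T p \<xi>" by (simp add: m_def T_def A_def w_def)
    also have "\<dots> < m 0 * thr p" using p(3) vpos by simp
    finally show False by (simp add: thr_def r_def mult.commute)
  qed
  ultimately show ?thesis using Esets unfolding z_def by blast
qed

end

subsection \<open>Averages over signs\<close>

text \<open>Estimates for the random matrix are averages over this finite set, where every event is
  measurable; \<open>matrix_measure_sprob\<close> carries them over to the product measure.\<close>

definition signs :: "'i set \<Rightarrow> ('i \<Rightarrow> real) set" where
  "signs I = PiE I (\<lambda>_. {-1, 1})"

definition avg :: "'i set \<Rightarrow> (('i \<Rightarrow> real) \<Rightarrow> real) \<Rightarrow> real" where
  "avg I F = (\<Sum>b\<in>signs I. F b) / 2 ^ card I"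

definition sprob :: "'i set \<Rightarrow> (('i \<Rightarrow> real) \<Rightarrow> bool) \<Rightarrow> real" where
  "sprob I P = avg I (\<lambda>b. of_bool (P b))"

text \<open>Independence enters through this notion: averages of functions with disjoint coordinate
  sets multiply. It ranges over all real families, so values outside the index set are irrelevant as
  well.\<close>

definition depends_on :: "'i set \<Rightarrow> (('i \<Rightarrow> real) \<Rightarrow> 'b) \<Rightarrow> bool" where
  "depends_on I F \<longleftrightarrow> (\<forall>b b'. (\<forall>i\<in>I. b i = b' i) \<longrightarrow> F b = F b')"

lemma depends_onD: "depends_on I F \<Longrightarrow> (\<And>i. i \<in> I \<Longrightarrow> b i = b' i) \<Longrightarrow> F b = F b'"
  by (simp add: depends_on_def)

lemma finite_signs: "finite I \<Longrightarrow> finite (signs I)"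
  by (simp add: signs_def finite_PiE)

lemma card_signs: "finite I \<Longrightarrow> card (signs I) = 2 ^ card I"
  by (simp add: signs_def card_PiE numeral_2_eq_2)

lemma signs_cases: "b \<in> signs I \<Longrightarrow> i \<in> I \<Longrightarrow> b i = -1 \<or> b i = 1"
  by (auto simp: signs_def PiE_iff)

lemma signs_square: "b \<in> signs I \<Longrightarrow> i \<in> I \<Longrightarrow> b i * b i = 1"
  using signs_cases by fastforce

lemma avg_mono: "(\<And>b. b \<in> signs I \<Longrightarrow> F b \<le> G b) \<Longrightarrow> avg I F \<le> avg I G"
  unfolding avg_def by (intro divide_right_mono sum_mono) auto

lemma avg_cong: "(\<And>b. b \<in> signs I \<Longrightarrow> F b = G b) \<Longrightarrow> avg I F = avg I G"
  unfolding avg_def by simp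

lemma avg_add: "avg I (\<lambda>b. F b + G b) = avg I F + avg I G"
  by (simp add: avg_def sum.distrib add_divide_distrib)

lemma avg_cmult: "avg I (\<lambda>b. c * F b) = c * avg I F"
  by (simp add: avg_def sum_distrib_left)

lemma avg_const: "finite I \<Longrightarrow> avg I (\<lambda>b. c) = c"
  by (simp add: avg_def card_signs)

lemma avg_sum: "avg I (\<lambda>b. \<Sum>z\<in>Z. F z b) = (\<Sum>z\<in>Z. avg I (F z))"
  unfolding avg_def by (subst sum.swap) (simp add: sum_divide_distrib)

lemma avg_nonneg: "(\<And>b. b \<in> signs I \<Longrightarrow> 0 \<le> F b) \<Longrightarrow> 0 \<le> avg I F"
  unfolding avg_def by (intro divide_nonneg_nonneg sum_nonneg) auto

lemma sprob_markov:
  assumes "\<And>b. b \<in> signs I \<Longrightarrow> 0 \<le> F b" "\<And>b. b \<in> signs I \<Longrightarrow> P b \<Longrightarrow> 1 \<le> F b"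
  shows "sprob I P \<le> avg I F"
  unfolding sprob_def by (rule avg_mono) (use assms in auto)

lemma sprob_markov_scaled:
  assumes "\<And>b. b \<in> signs I \<Longrightarrow> 0 \<le> F b" "\<And>b. b \<in> signs I \<Longrightarrow> P b \<Longrightarrow> c \<le> F b" and c: "0 < c"
  shows "sprob I P \<le> avg I F / c"
proof -
  have "sprob I P \<le> avg I (\<lambda>b. inverse c * F b)"
    by (rule sprob_markov) (use assms in \<open>auto simp: field_simps\<close>)
  then show ?thesis unfolding avg_cmult by (simp add: divide_inverse mult.commute)
qed

lemma sprob_mono: "(\<And>b. b \<in> signs I \<Longrightarrow> P b \<Longrightarrow> Q b) \<Longrightarrow> sprob I P \<le> sprob I Q"
  unfolding sprob_def by (rule avg_mono) auto

lemma sprob_union: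
  assumes "finite Z"
  shows "sprob I (\<lambda>b. \<exists>z\<in>Z. P z b) \<le> (\<Sum>z\<in>Z. sprob I (P z))"
proof -
  have "sprob I (\<lambda>b. \<exists>z\<in>Z. P z b) \<le> avg I (\<lambda>b. \<Sum>z\<in>Z. of_bool (P z b))"
  proof (rule sprob_markov)
    fix b assume "\<exists>z\<in>Z. P z b"
    then obtain z where "z \<in> Z" "P z b" by blast
    then show "(1::real) \<le> (\<Sum>z\<in>Z. of_bool (P z b))"
      using member_le_sum[of z Z "\<lambda>z. of_bool (P z b) :: real"] assms by simp
  qed (simp add: sum_nonneg)
  then show ?thesis by (simp add: avg_sum sprob_def)
qed

lemma sprob_union_card:
  assumes "finite Z" "\<And>z. z \<in> Z \<Longrightarrow> sprob I (P z) \<le> p" "real (card Z) \<le> K" "0 \<le> p"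
  shows "sprob I (\<lambda>b. \<exists>z\<in>Z. P z b) \<le> K * p"
proof -
  have "sprob I (\<lambda>b. \<exists>z\<in>Z. P z b) \<le> (\<Sum>z\<in>Z. sprob I (P z))" by (rule sprob_union[OF assms(1)])
  also have "\<dots> \<le> (\<Sum>z\<in>Z. p)" by (rule sum_mono) (rule assms(2))
  also have "\<dots> \<le> K * p" using assms by (simp add: mult_right_mono)
  finally show ?thesis .
qed

lemma sprob_disj: "sprob I (\<lambda>b. P b \<or> Q b) \<le> sprob I P + sprob I Q"
  unfolding sprob_def avg_add[symmetric] by (rule avg_mono) auto

lemma avg_insert:
  assumes "finite I" "i \<notin> I"
  shows "avg (insert i I) F = (avg I (\<lambda>b. F (b(i := 1))) + avg I (\<lambda>b. F (b(i := -1)))) / 2"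
proof -
  have inj: "inj_on (\<lambda>(y, g). g(i := y)) ({-1, 1::real} \<times> signs I)"
    unfolding signs_def using assms(2) by (rule inj_combinator)
  have "signs (insert i I) = (\<lambda>(y, g). g(i := y)) ` ({-1, 1::real} \<times> signs I)"
    unfolding signs_def by (rule PiE_insert_eq)
  then have "(\<Sum>b\<in>signs (insert i I). F b) = (\<Sum>(y, g)\<in>{-1, 1} \<times> signs I. F (g(i := y)))"
    by (simp only: sum.reindex[OF inj]) (simp add: case_prod_beta)
  also have "\<dots> = (\<Sum>y\<in>{-1, 1}. \<Sum>g\<in>signs I. F (g(i := y)))"
    by (rule sum.cartesian_product[symmetric])
  finally show ?thesis using assms by (simp add: avg_def field_simps)
qed

lemma signs_empty: "signs {} = {\<lambda>_. undefined}"
  by (simp add: signs_def)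

lemma avg_split:
  assumes "finite I" "finite J" "I \<inter> J = {}"
  shows "avg (I \<union> J) F = avg I (\<lambda>b. avg J (\<lambda>c. F (\<lambda>i. if i \<in> J then c i else b i)))"
  using assms(2,3)
proof (induction J arbitrary: F rule: finite_induct)
  case empty
  then show ?case by (simp add: avg_def[of "{}"] signs_empty)
next
  case (insert j J)
  have j: "j \<notin> I \<union> J" "finite (I \<union> J)" using insert assms(1) by auto
  have IJ: "I \<inter> J = {}" using insert by auto
  have upd: "(\<lambda>i. if i \<in> J then c i else b i)(j := y) = (\<lambda>i. if i \<in> insert j J then (c(j := y)) i else b i)"
    for c b :: "'a \<Rightarrow> real" and y using insert.hyps by auto
  have "avg (I \<union> insert j J) F = (avg (I \<union> J) (\<lambda>b. F (b(j := 1))) + avg (I \<union> J) (\<lambda>b. F (b(j := -1)))) / 2"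
    using avg_insert[OF j(2,1)] by simp
  also have "\<dots> = avg I (\<lambda>b. avg (insert j J) (\<lambda>c. F (\<lambda>i. if i \<in> insert j J then c i else b i)))"
    unfolding insert.IH[OF IJ] avg_insert[OF insert.hyps] upd by (simp only: avg_add[symmetric])
      (simp add: avg_def sum_divide_distrib[symmetric])
  finally show ?case .
qed

lemma avg_restrict:
  assumes "finite I" "finite J" "I \<inter> J = {}" "depends_on J F"
  shows "avg (I \<union> J) F = avg J F"
proof -
  have "F (\<lambda>i. if i \<in> J then c i else b i) = F c" for b c by (rule depends_onD[OF assms(4)]) auto
  then show ?thesis using avg_split[OF assms(1-3)] assms(1) by (simp add: avg_const)
qed

lemma avg_subset:
  assumes "finite I" "J \<subseteq> I" "depends_on J F"
  shows "avg I F = avg J F"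
proof -
  have "(I - J) \<inter> J = {}" "(I - J) \<union> J = I" using assms(2) by auto
  then show ?thesis
    using avg_restrict[of "I - J" J F] assms finite_subset[OF assms(2,1)] by simp
qed

lemma avg_mult:
  assumes "finite I" "finite J" "I \<inter> J = {}" "depends_on I F" "depends_on J G"
  shows "avg (I \<union> J) (\<lambda>b. F b * G b) = avg I F * avg J G"
proof -
  have 1: "F (\<lambda>i. if i \<in> J then c i else b i) = F b" for b c
    by (rule depends_onD[OF assms(4)]) (use assms(3) in auto)
  have 2: "G (\<lambda>i. if i \<in> J then c i else b i) = G c" for b c
    by (rule depends_onD[OF assms(5)]) auto
  have "avg (I \<union> J) (\<lambda>b. F b * G b) = avg I (\<lambda>b. avg J G * F b)"
    unfolding avg_split[OF assms(1-3)] 1 2 by (simp only: avg_cmult mult.commute[of "avg J G"])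
  then show ?thesis by (simp add: avg_cmult)
qed

lemma avg_prod:
  fixes K :: "'j \<Rightarrow> 'i set" and F :: "'j \<Rightarrow> ('i \<Rightarrow> real) \<Rightarrow> real"
  assumes "finite J" "\<And>j. j \<in> J \<Longrightarrow> finite (K j)"
    and "\<And>i j. i \<in> J \<Longrightarrow> j \<in> J \<Longrightarrow> i \<noteq> j \<Longrightarrow> K i \<inter> K j = {}"
    and "\<And>j. j \<in> J \<Longrightarrow> depends_on (K j) (F j)"
  shows "avg (\<Union>j\<in>J. K j) (\<lambda>b. \<Prod>j\<in>J. F j b) = (\<Prod>j\<in>J. avg (K j) (F j))"
  using assms
proof (induction J rule: finite_induct)
  case empty
  then show ?case by (simp add: avg_def signs_empty)
next
  case (insert j J)
  have 1: "K j \<inter> (\<Union>j\<in>J. K j) = {}" using insert.prems(2) insert.hyps by fastforce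
  have 2: "depends_on (\<Union>j\<in>J. K j) (\<lambda>b. \<Prod>j\<in>J. F j b)"
    unfolding depends_on_def
  proof (intro allI impI prod.cong refl)
    fix b b' :: "'i \<Rightarrow> real" and i assume "\<forall>i\<in>\<Union>j\<in>J. K j. b i = b' i" "i \<in> J"
    then show "F i b = F i b'" by (intro depends_onD[OF insert.prems(3)]) auto
  qed
  have "avg (\<Union>j\<in>insert j J. K j) (\<lambda>b. \<Prod>j\<in>insert j J. F j b)
    = avg (K j \<union> (\<Union>j\<in>J. K j)) (\<lambda>b. F j b * (\<Prod>j\<in>J. F j b))"
    using insert.hyps by simp
  also have "\<dots> = avg (K j) (F j) * avg (\<Union>j\<in>J. K j) (\<lambda>b. \<Prod>j\<in>J. F j b)"
    by (rule avg_mult[OF _ _ 1 _ 2]) (use insert in auto)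
  finally show ?case using insert by simp
qed

section \<open>Exponential and moment inequalities for sign sums\<close>

text \<open>exp (- y^2 / 2) cosh y is nonincreasing for y >= 0, because sinh y <= y cosh y
  there.\<close>

lemma cosh_le_exp_square: "(exp y + exp (- y)) / 2 \<le> exp (y\<^sup>2 / 2)" for y :: real
proof -
  have ge: "(exp y + exp (- y)) / 2 \<le> exp (y\<^sup>2 / 2)" if y: "0 \<le> y" for y :: real
  proof -
    define h where "h = (\<lambda>y::real. exp (y\<^sup>2 / 2) - (exp y + exp (- y)) / 2)"
    define h1 where "h1 = (\<lambda>y::real. y * exp (y\<^sup>2 / 2) - (exp y - exp (- y)) / 2)"
    define G where "G = (\<lambda>y::real. exp (- (y\<^sup>2 / 2)) * ((exp y + exp (- y)) / 2))"
    have th: "(exp y - exp (- y)) / 2 \<le> y * ((exp y + exp (- y)) / 2)" if "0 \<le> y" for y :: real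
    proof -
      have "0 * ((exp 0 + exp (- 0)) / 2) - (exp 0 - exp (- 0)) / 2 \<le> y * ((exp y + exp (- y)) / 2) - (exp y - exp (- y)) / 2"
      proof (rule DERIV_nonneg_imp_nondecreasing[OF that, where f = "\<lambda>y. y * ((exp y + exp (- y)) / 2) - (exp y - exp (- y)) / 2"])
        fix x :: real assume x: "0 \<le> x" "x \<le> y"
        have "((\<lambda>y. y * ((exp y + exp (- y)) / 2) - (exp y - exp (- y)) / 2) has_real_derivative
            x * ((exp x - exp (- x)) / 2)) (at x)"
          by (auto intro!: derivative_eq_intros simp: field_simps)
        moreover have "0 \<le> x * ((exp x - exp (- x)) / 2)" using x by simp
        ultimately show "\<exists>y. ((\<lambda>y. y * ((exp y + exp (- y)) / 2) - (exp y - exp (- y)) / 2) has_real_derivative y) (at x) \<and> 0 \<le> y"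
          by blast
      qed
      then show ?thesis by simp
    qed
    have "G y \<le> G 0"
    proof (rule DERIV_nonpos_imp_nonincreasing[OF y])
      fix x :: real assume x: "0 \<le> x" "x \<le> y"
      have "(G has_real_derivative exp (- (x\<^sup>2 / 2)) * ((exp x - exp (- x)) / 2 - x * ((exp x + exp (- x)) / 2))) (at x)"
        unfolding G_def by (auto intro!: derivative_eq_intros simp: field_simps)
      moreover have "exp (- (x\<^sup>2 / 2)) * ((exp x - exp (- x)) / 2 - x * ((exp x + exp (- x)) / 2)) \<le> 0"
        using th[OF x(1)] by (intro mult_nonneg_nonpos) auto
      ultimately show "\<exists>y. (G has_real_derivative y) (at x) \<and> y \<le> 0" by blast
    qed
    then have "exp (y\<^sup>2 / 2) * G y \<le> exp (y\<^sup>2 / 2) * 1" by (intro mult_left_mono) (auto simp: G_def)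
    then show ?thesis by (simp add: G_def mult.assoc[symmetric] exp_add[symmetric])
  qed
  show ?thesis using ge[of y] ge[of "- y"] by (cases "0 \<le> y") (auto simp: add.commute)
qed

lemma depends_on_linear: "depends_on I (\<lambda>b. G (\<Sum>i\<in>I. b i * y i))"
  unfolding depends_on_def by (auto intro!: arg_cong[where f = G] sum.cong)

lemma sum_insert_upd:
  assumes "finite I" "i \<notin> I"
  shows "(\<Sum>j\<in>insert i I. (b(i := x)) j * y j) = x * y i + (\<Sum>j\<in>I. b j * (y j :: real))"
proof -
  have "(\<Sum>j\<in>I. (b(i := x)) j * y j) = (\<Sum>j\<in>I. b j * y j)"
    by (rule sum.cong) (use assms in auto)
  then show ?thesis using assms by simp
qed

lemma avg_exp_linear:
  assumes "finite I"
  shows "avg I (\<lambda>b. exp (\<Sum>i\<in>I. b i * y i)) \<le> exp ((\<Sum>i\<in>I. (y i)\<^sup>2) / 2)"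
  using assms
proof (induction I rule: finite_induct)
  case empty
  then show ?case by (simp add: avg_def signs_empty)
next
  case (insert i I)
  let ?S = "avg I (\<lambda>b. exp (\<Sum>i\<in>I. b i * y i))"
  have "avg (insert i I) (\<lambda>b. exp (\<Sum>j\<in>insert i I. b j * y j)) = (exp (y i) * ?S + exp (- y i) * ?S) / 2"
    unfolding avg_insert[OF insert.hyps] sum_insert_upd[OF insert.hyps] exp_add avg_cmult by simp
  also have "\<dots> = ((exp (y i) + exp (- y i)) / 2) * ?S" by (simp add: field_simps)
  also have "\<dots> \<le> exp ((y i)\<^sup>2 / 2) * exp ((\<Sum>i\<in>I. (y i)\<^sup>2) / 2)"
    using insert.IH by (intro mult_mono cosh_le_exp_square avg_nonneg) auto
  finally show ?case using insert.hyps by (simp add: exp_add[symmetric] add_divide_distrib)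
qed

lemma avg_linear_moments:
  assumes "finite I"
  shows "avg I (\<lambda>b. \<Sum>i\<in>I. b i * y i) = 0"
    and "avg I (\<lambda>b. (\<Sum>i\<in>I. b i * y i)\<^sup>2) = (\<Sum>i\<in>I. (y i)\<^sup>2)"
    and "avg I (\<lambda>b. (\<Sum>i\<in>I. b i * y i) ^ 4) \<le> 3 * (\<Sum>i\<in>I. (y i)\<^sup>2)\<^sup>2"
  using assms
proof (induction I rule: finite_induct)
  case empty
  {
    case 1 then show ?case by (simp add: avg_def signs_empty)
  next
    case 2 then show ?case by (simp add: avg_def signs_empty)
  next
    case 3 then show ?case by (simp add: avg_def signs_empty)
  }
next
  case (insert i I)
  define Z where "Z = (\<lambda>b. \<Sum>i\<in>I. b i * y i)"
  define s where "s = (\<Sum>i\<in>I. (y i)\<^sup>2)"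
  have IH: "avg I Z = 0" "avg I (\<lambda>b. (Z b)\<^sup>2) = s" "avg I (\<lambda>b. (Z b) ^ 4) \<le> 3 * s\<^sup>2"
    using insert by (simp_all add: Z_def s_def)
  have s': "(\<Sum>i\<in>insert i I. (y i)\<^sup>2) = (y i)\<^sup>2 + s" using insert.hyps by (simp add: s_def)
  have ins: "avg (insert i I) (\<lambda>b. G (\<Sum>j\<in>insert i I. b j * y j)) = avg I (\<lambda>b. 1 / 2 * (G (y i + Z b) + G (- y i + Z b)))" for G
  proof -
    have "avg (insert i I) (\<lambda>b. G (\<Sum>j\<in>insert i I. b j * y j)) = (avg I (\<lambda>b. G (1 * y i + Z b)) + avg I (\<lambda>b. G (- 1 * y i + Z b))) / 2"
      unfolding avg_insert[OF insert.hyps] sum_insert_upd[OF insert.hyps] Z_def ..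
    then show ?thesis unfolding avg_cmult avg_add by simp
  qed
  {
    case 1
    have "avg (insert i I) (\<lambda>b. \<Sum>j\<in>insert i I. b j * y j) = avg I Z"
      using ins[of "\<lambda>x. x"] by simp
    then show ?case using IH by simp
  next
    case 2
    have "avg (insert i I) (\<lambda>b. (\<Sum>j\<in>insert i I. b j * y j)\<^sup>2) = avg I (\<lambda>b. (y i)\<^sup>2 + (Z b)\<^sup>2)"
      unfolding ins[of "\<lambda>x. x\<^sup>2"] by (simp add: power2_eq_square algebra_simps)
    then show ?case unfolding s' avg_add avg_const[OF insert.hyps(1)] IH .
  next
    case 3
    have "avg (insert i I) (\<lambda>b. (\<Sum>j\<in>insert i I. b j * y j) ^ 4) = avg I (\<lambda>b. (y i) ^ 4 + (6 * (y i)\<^sup>2 * (Z b)\<^sup>2 + (Z b) ^ 4))"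
      unfolding ins[of "\<lambda>x. x ^ 4"] by (rule avg_cong) (simp add: power4_eq_xxxx power2_eq_square algebra_simps)
    also have "\<dots> = (y i) ^ 4 + (6 * (y i)\<^sup>2 * s + avg I (\<lambda>b. (Z b) ^ 4))"
      unfolding avg_add avg_const[OF insert.hyps(1)] avg_cmult IH ..
    also have "\<dots> \<le> (y i) ^ 4 + (6 * (y i)\<^sup>2 * s + 3 * s\<^sup>2)" using IH by simp
    also have "\<dots> \<le> 3 * ((y i)\<^sup>2 + s)\<^sup>2"
    proof -
      have "3 * ((y i)\<^sup>2 + s)\<^sup>2 = (y i) ^ 4 + (6 * (y i)\<^sup>2 * s + 3 * s\<^sup>2) + 2 * (y i) ^ 4"
        by (simp add: power4_eq_xxxx power2_eq_square algebra_simps)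
      then show ?thesis by simp
    qed
    finally show ?case unfolding s' .
  }
qed

lemma exp_minus_le_quadratic: "0 \<le> x \<Longrightarrow> exp (- x) \<le> 1 - x + x\<^sup>2 / 2" for x :: real
proof -
  assume x: "0 \<le> x"
  have "exp (- 0) - (1 - 0 + 0\<^sup>2 / 2) \<ge> exp (- x) - (1 - x + x\<^sup>2 / 2)"
  proof (rule DERIV_nonpos_imp_nonincreasing[OF x, where f = "\<lambda>x. exp (- x) - (1 - x + x\<^sup>2 / 2)"])
    fix z :: real assume "0 \<le> z" "z \<le> x"
    have "((\<lambda>x. exp (- x) - (1 - x + x\<^sup>2 / 2)) has_real_derivative - exp (- z) + 1 - z) (at z)"
      by (auto intro!: derivative_eq_intros)
    moreover have "- exp (- z) + 1 - z \<le> 0" using exp_ge_add_one_self[of "- z"] by simp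
    ultimately show "\<exists>y. ((\<lambda>x. exp (- x) - (1 - x + x\<^sup>2 / 2)) has_real_derivative y) (at z) \<and> y \<le> 0" by blast
  qed
  then show ?thesis by simp
qed

lemma avg_exp_minus_square:
  assumes "finite I" "0 \<le> \<theta>"
  shows "avg I (\<lambda>b. exp (- (\<theta> * (\<Sum>i\<in>I. b i * y i)\<^sup>2)))
    \<le> 1 - \<theta> * (\<Sum>i\<in>I. (y i)\<^sup>2) + 3 / 2 * (\<theta> * (\<Sum>i\<in>I. (y i)\<^sup>2))\<^sup>2"
proof -
  let ?Z = "\<lambda>b. \<Sum>i\<in>I. b i * y i"
  have "avg I (\<lambda>b. exp (- (\<theta> * (?Z b)\<^sup>2))) \<le> avg I (\<lambda>b. 1 + ((- \<theta>) * (?Z b)\<^sup>2 + (\<theta>\<^sup>2 / 2) * (?Z b) ^ 4))"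
  proof (rule avg_mono)
    fix b
    show "exp (- (\<theta> * (?Z b)\<^sup>2)) \<le> 1 + ((- \<theta>) * (?Z b)\<^sup>2 + (\<theta>\<^sup>2 / 2) * (?Z b) ^ 4)"
      using exp_minus_le_quadratic[of "\<theta> * (?Z b)\<^sup>2"] assms(2)
      by (simp add: power_mult_distrib power4_eq_xxxx power2_eq_square mult_ac)
  qed
  also have "\<dots> = 1 + ((- \<theta>) * (\<Sum>i\<in>I. (y i)\<^sup>2) + (\<theta>\<^sup>2 / 2) * avg I (\<lambda>b. (?Z b) ^ 4))"
    unfolding avg_add avg_const[OF assms(1)] avg_cmult avg_linear_moments(2)[OF assms(1)] ..
  also have "\<dots> \<le> 1 + ((- \<theta>) * (\<Sum>i\<in>I. (y i)\<^sup>2) + (\<theta>\<^sup>2 / 2) * (3 * (\<Sum>i\<in>I. (y i)\<^sup>2)\<^sup>2))"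
    by (intro add_left_mono mult_left_mono avg_linear_moments(3)[OF assms(1)]) auto
  finally show ?thesis by (simp add: power_mult_distrib)
qed

lemma avg_uminus:
  assumes "finite I" "depends_on I F"
  shows "avg I (\<lambda>b. F (\<lambda>i. - b i)) = avg I F"
  using assms
proof (induction I arbitrary: F rule: finite_induct)
  case empty
  then have "F (\<lambda>i. - undefined) = F (\<lambda>_. undefined)" by (intro depends_onD[OF empty]) auto
  then show ?case by (simp add: avg_def signs_empty)
next
  case (insert i I)
  have neg: "(\<lambda>j. - (b(i := x)) j) = (\<lambda>j. - b j)(i := - x)" for b :: "'a \<Rightarrow> real" and x by auto
  have dep: "depends_on I (\<lambda>b. F (b(i := x)))" for x
    unfolding depends_on_def by (auto intro!: depends_onD[OF insert.prems])
  show ?case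
    unfolding avg_insert[OF insert.hyps] neg minus_minus insert.IH[OF dep] by simp
qed

text \<open>With variance s and fourth moment at most 3 s^2, averaging a pointwise inequality gives
  s <= s/4 + 3 s/8 + 2 s P (|Z| >= r), where the last probability is at most twice the one-sided one
  by symmetry. This is where 3/32 comes from.\<close>

lemma paley_zygmund_signs:
  assumes I: "finite I"
  shows "3 / 32 \<le> sprob I (\<lambda>b. sqrt (\<Sum>i\<in>I. (y i)\<^sup>2) / 2 \<le> (\<Sum>i\<in>I. b i * y i))"
proof -
  define s where "s = (\<Sum>i\<in>I. (y i)\<^sup>2)"
  define Z where "Z = (\<lambda>b. \<Sum>i\<in>I. b i * y i)"
  define r where "r = sqrt s / 2"
  have s0: "0 \<le> s" by (simp add: s_def sum_nonneg)
  have "3 / 32 \<le> sprob I (\<lambda>b. r \<le> Z b)"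
  proof (cases "s = 0")
    case True
    then have "\<forall>i\<in>I. y i = 0" using I by (simp add: s_def sum_nonneg_eq_0_iff)
    then have "Z b = 0" for b by (simp add: Z_def)
    then show ?thesis using True I by (simp add: sprob_def r_def avg_const)
  next
    case False
    then have sp: "0 < s" using s0 by simp
    have "s = avg I (\<lambda>b. (Z b)\<^sup>2)" using avg_linear_moments(2)[OF I] by (simp add: Z_def s_def)
    \<comment> \<open>The fourth power pays for large values of Z through (Z^2 - 4 s)^2 >= 0; this
      takes the place of the Cauchy-Schwarz step of Paley and Zygmund.\<close>
    also have "\<dots> \<le> avg I (\<lambda>b. s / 4 + ((1 / (8 * s)) * (Z b) ^ 4 + (2 * s) * (of_bool (r \<le> Z b) + of_bool (r \<le> - Z b))))"
    proof (rule avg_mono)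
      fix b
      have r2: "r\<^sup>2 = s / 4" using s0 by (simp add: r_def power_divide)
      have nn: "0 \<le> (1 / (8 * s)) * (Z b) ^ 4" using sp by simp
      show "(Z b)\<^sup>2 \<le> s / 4 + ((1 / (8 * s)) * (Z b) ^ 4 + (2 * s) * (of_bool (r \<le> Z b) + of_bool (r \<le> - Z b)))"
      proof (cases "r \<le> Z b \<or> r \<le> - Z b")
        case True
        then have "1 \<le> (of_bool (r \<le> Z b) + of_bool (r \<le> - Z b) :: real)" by auto
        then have "2 * s * 1 \<le> (2 * s) * (of_bool (r \<le> Z b) + of_bool (r \<le> - Z b))" using sp by (intro mult_left_mono) auto
        moreover have "(Z b)\<^sup>2 \<le> (1 / (8 * s)) * (Z b) ^ 4 + 2 * s"
        proof -
          have "0 \<le> ((Z b)\<^sup>2 - 4 * s)\<^sup>2 / (8 * s)" using sp by simp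
          also have "\<dots> = (1 / (8 * s)) * (Z b) ^ 4 + 2 * s - (Z b)\<^sup>2"
            using sp by (simp add: power4_eq_xxxx power2_eq_square field_simps)
          finally show ?thesis by simp
        qed
        ultimately show ?thesis using s0 by linarith
      next
        case False
        then have "\<bar>Z b\<bar> \<le> r" by linarith
        then have "(Z b)\<^sup>2 \<le> r\<^sup>2" by (metis abs_ge_zero power2_abs power_mono)
        then show ?thesis using False r2 nn by simp
      qed
    qed
    also have "\<dots> = s / 4 + ((1 / (8 * s)) * avg I (\<lambda>b. (Z b) ^ 4) + (2 * s) * (sprob I (\<lambda>b. r \<le> Z b) + sprob I (\<lambda>b. r \<le> - Z b)))"
      unfolding avg_add avg_cmult avg_const[OF I] sprob_def ..
    also have "sprob I (\<lambda>b. r \<le> - Z b) = sprob I (\<lambda>b. r \<le> Z b)"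
    proof -
      have "depends_on I (\<lambda>b. of_bool (r \<le> Z b) :: real)"
        unfolding Z_def by (rule depends_on_linear)
      from avg_uminus[OF I this] show ?thesis by (simp add: sprob_def Z_def sum_negf)
    qed
    also have "(1 / (8 * s)) * avg I (\<lambda>b. (Z b) ^ 4) \<le> (1 / (8 * s)) * (3 * s\<^sup>2)"
      using avg_linear_moments(3)[OF I, of y] sp by (intro mult_left_mono) (auto simp: Z_def s_def)
    also have "(1 / (8 * s)) * (3 * s\<^sup>2) = 3 / 8 * s" using sp by (simp add: power2_eq_square)
    finally have "3 / 8 * s \<le> 4 * s * sprob I (\<lambda>b. r \<le> Z b)" by simp
    then show ?thesis using sp by (simp add: field_simps)
  qed
  then show ?thesis by (simp add: r_def s_def Z_def)
qed

subsection \<open>Projections of sign matrices\<close>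

lemma gaussian_integral:
  assumes v: "v < (1::real)"
  shows "has_bochner_integral lborel (\<lambda>x. std_normal_density x * exp (u * x + v * x\<^sup>2 / 2))
    (exp (u\<^sup>2 / (2 * (1 - v))) / sqrt (1 - v))"
proof -
  define \<sigma> where "\<sigma> = 1 / sqrt (1 - v)"
  define m where "m = u / (1 - v)"
  have \<sigma>: "0 < \<sigma>" "\<sigma>\<^sup>2 = 1 / (1 - v)" using v by (auto simp: \<sigma>_def power_divide)
  have eq: "std_normal_density x * exp (u * x + v * x\<^sup>2 / 2) = (exp (u\<^sup>2 / (2 * (1 - v))) * \<sigma>) * normal_density m \<sigma> x" for x
  proof -
    have sq: "sqrt (2 * pi * \<sigma>\<^sup>2) = sqrt (2 * pi) * \<sigma>" using \<sigma>(1) by (simp add: real_sqrt_mult)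
    have ex: "- (x - m)\<^sup>2 / (2 * \<sigma>\<^sup>2) = - x\<^sup>2 / 2 + (u * x + v * x\<^sup>2 / 2) - u\<^sup>2 / (2 * (1 - v))"
    proof -
      define w where "w = 1 - v"
      have w: "0 < w" using v by (simp add: w_def)
      have "w * (x - u / w)\<^sup>2 = w * x\<^sup>2 - 2 * u * x + u\<^sup>2 / w"
        using w by (simp add: field_simps power2_eq_square)
      moreover have "- (x - m)\<^sup>2 / (2 * \<sigma>\<^sup>2) = - (w * (x - u / w)\<^sup>2) / 2"
        using w by (simp add: \<sigma>(2) m_def w_def[symmetric] mult.commute)
      moreover have "v * x\<^sup>2 = x\<^sup>2 - w * x\<^sup>2" by (simp add: w_def algebra_simps)
      ultimately show ?thesis by (simp add: w_def[symmetric] diff_divide_distrib add_divide_distrib)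
    qed
    have "(exp (u\<^sup>2 / (2 * (1 - v))) * \<sigma>) * normal_density m \<sigma> x
      = exp (u\<^sup>2 / (2 * (1 - v))) * (1 / sqrt (2 * pi)) * exp (- (x - m)\<^sup>2 / (2 * \<sigma>\<^sup>2))"
      unfolding normal_density_def sq using \<sigma>(1) by simp
    also have "\<dots> = (1 / sqrt (2 * pi)) * (exp (u\<^sup>2 / (2 * (1 - v))) * exp (- x\<^sup>2 / 2 + (u * x + v * x\<^sup>2 / 2) - u\<^sup>2 / (2 * (1 - v))))"
      unfolding ex by simp
    also have "\<dots> = (1 / sqrt (2 * pi)) * (exp (- x\<^sup>2 / 2) * exp (u * x + v * x\<^sup>2 / 2))"
      unfolding exp_add[symmetric] by simp
    also have "\<dots> = std_normal_density x * exp (u * x + v * x\<^sup>2 / 2)"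
      by (simp add: std_normal_density_def)
    finally show ?thesis ..
  qed
  have "has_bochner_integral lborel (normal_density m \<sigma>) 1"
    using \<sigma>(1) integrable_normal_density integral_normal_density by (auto simp: has_bochner_integral_iff)
  then have "has_bochner_integral lborel (\<lambda>x. (exp (u\<^sup>2 / (2 * (1 - v))) * \<sigma>) * normal_density m \<sigma> x)
    ((exp (u\<^sup>2 / (2 * (1 - v))) * \<sigma>) * 1)"
    by (rule has_bochner_integral_mult_right)
  then show ?thesis unfolding eq by (simp add: \<sigma>_def)
qed

text \<open>The square in the exponent is linearised by \<open>exp (a\<^sup>2 z\<^sup>2 / 2) = E exp (a \<gamma> z)\<close> for a standard
  Gaussian \<open>\<gamma>\<close>; orthogonality makes the Gaussian shifts along different columns independent.\<close>

lemma subgaussian_projection: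
  assumes sub: "\<And>y. avg I (\<lambda>b. exp (ip d (X b) y)) \<le> exp (s\<^sup>2 / 2 * ip d y y)"
    and V: "orthonormal_columns d r V" and l: "0 \<le> l" "2 * l * s\<^sup>2 < 1"
  shows "avg I (\<lambda>b. exp (l * (\<Sum>i<r. (ip d (\<lambda>j. V j i) (X b))\<^sup>2) + ip d (X b) y)) \<le>
    (1 / sqrt (1 - 2 * l * s\<^sup>2)) ^ r *
    exp (s\<^sup>2 / 2 * ip d y y + (2 * l * s ^ 4 / (1 - 2 * l * s\<^sup>2)) / 2 * (\<Sum>i<r. (ip d (\<lambda>j. V j i) y)\<^sup>2))"
  using V
proof (induction r arbitrary: y)
  case 0
  then show ?case using sub by simp
next
  case (Suc r)
  define a where "a = sqrt (2 * l)"
  define v where "v = 2 * l * s\<^sup>2"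
  \<comment> \<open>The value that makes the claim an equality for a Gaussian vector with covariance
    s^2 I; it is therefore reproduced by the induction.\<close>
  define \<kappa> where "\<kappa> = 2 * l * s ^ 4 / (1 - v)"
  define C where "C = 1 / sqrt (1 - v)"
  define q where "q = (\<lambda>j. V j r)"
  define S where "S = (\<lambda>y. \<Sum>i<r. (ip d (\<lambda>j. V j i) y)\<^sup>2)"
  have a2: "a * a = 2 * l" using l by (simp add: a_def)
  have v1: "v < 1" using l by (simp add: v_def)
  have Vr: "orthonormal_columns d r V" using Suc.prems by (simp add: orthonormal_columns_def)
  have qq: "ip d q q = 1" using Suc.prems by (simp add: orthonormal_columns_ip q_def)
  have Vq: "ip d (\<lambda>j. V j i) q = 0" if "i < r" for i using Suc.prems that by (simp add: orthonormal_columns_ip q_def)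
  have IH: "avg I (\<lambda>b. exp (l * S (X b) + ip d (X b) y)) \<le> C ^ r * exp (s\<^sup>2 / 2 * ip d y y + \<kappa> / 2 * S y)" for y
    using Suc.IH[OF Vr] unfolding S_def C_def \<kappa>_def v_def .
  define yg where "yg = (\<lambda>g j. y j + a * g * q j)"
  have int1: "has_bochner_integral lborel (\<lambda>g. std_normal_density g * exp (l * S (X b) + ip d (X b) (yg g)))
      (exp (l * S (X b) + ip d (X b) y) * exp (l * (ip d q (X b))\<^sup>2))" for b
  proof -
    have "has_bochner_integral lborel (\<lambda>g. std_normal_density g * exp ((a * ip d q (X b)) * g + 0 * g\<^sup>2 / 2))
        (exp ((a * ip d q (X b))\<^sup>2 / (2 * (1 - 0))) / sqrt (1 - 0))"
      by (rule gaussian_integral) simp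
    then have A: "has_bochner_integral lborel (\<lambda>g. exp (l * S (X b) + ip d (X b) y) * (std_normal_density g * exp ((a * ip d q (X b)) * g + 0 * g\<^sup>2 / 2)))
        (exp (l * S (X b) + ip d (X b) y) * (exp ((a * ip d q (X b))\<^sup>2 / (2 * (1 - 0))) / sqrt (1 - 0)))"
      by (rule has_bochner_integral_mult_right)
    have B: "(a * ip d q (X b))\<^sup>2 / (2 * (1 - 0)) = l * (ip d q (X b))\<^sup>2"
      using a2 by (simp add: power_mult_distrib power2_eq_square)
    have C: "exp (l * S (X b) + ip d (X b) y) * (std_normal_density g * exp ((a * ip d q (X b)) * g + 0 * g\<^sup>2 / 2))
      = std_normal_density g * exp (l * S (X b) + ip d (X b) (yg g))" for g
      unfolding yg_def ip_linear by (simp add: exp_add ip_commute mult_ac)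
    show ?thesis using A unfolding B C by simp
  qed
  have int2: "has_bochner_integral lborel (\<lambda>g. avg I (\<lambda>b. std_normal_density g * exp (l * S (X b) + ip d (X b) (yg g))))
      (avg I (\<lambda>b. exp (l * S (X b) + ip d (X b) y) * exp (l * (ip d q (X b))\<^sup>2)))"
    unfolding avg_def by (intro has_bochner_integral_divide_zero has_bochner_integral_sum int1)
  define D where "D = C ^ r * exp (s\<^sup>2 / 2 * ip d y y + \<kappa> / 2 * S y)"
  have int3: "has_bochner_integral lborel (\<lambda>g. D * (std_normal_density g * exp ((s\<^sup>2 * a * ip d q y) * g + v * g\<^sup>2 / 2)))
      (D * (exp ((s\<^sup>2 * a * ip d q y)\<^sup>2 / (2 * (1 - v))) / sqrt (1 - v)))"
    by (intro has_bochner_integral_mult_right gaussian_integral v1)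
  have le: "avg I (\<lambda>b. std_normal_density g * exp (l * S (X b) + ip d (X b) (yg g)))
      \<le> D * (std_normal_density g * exp ((s\<^sup>2 * a * ip d q y) * g + v * g\<^sup>2 / 2))" for g
  proof -
    have e1: "S (yg g) = S y"
      unfolding S_def yg_def by (rule sum.cong) (auto simp: ip_linear Vq)
    have e2: "s\<^sup>2 / 2 * ip d (yg g) (yg g) = s\<^sup>2 / 2 * ip d y y + ((s\<^sup>2 * a * ip d q y) * g + v * g\<^sup>2 / 2)"
    proof -
      have "ip d (yg g) (yg g) = ip d y y + 2 * (a * g) * ip d q y + (a * a) * g\<^sup>2"
        unfolding yg_def ip_linear qq ip_commute[of d y q] by (simp add: algebra_simps power2_eq_square)
      then show ?thesis unfolding a2 by (simp add: v_def algebra_simps)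
    qed
    have "avg I (\<lambda>b. exp (l * S (X b) + ip d (X b) (yg g)))
      \<le> C ^ r * exp (s\<^sup>2 / 2 * ip d y y + ((s\<^sup>2 * a * ip d q y) * g + v * g\<^sup>2 / 2) + \<kappa> / 2 * S y)"
      using IH[of "yg g"] unfolding e1 e2 .
    also have "\<dots> = D * exp ((s\<^sup>2 * a * ip d q y) * g + v * g\<^sup>2 / 2)"
      by (simp add: D_def exp_add mult_ac)
    finally have "std_normal_density g * avg I (\<lambda>b. exp (l * S (X b) + ip d (X b) (yg g)))
      \<le> std_normal_density g * (D * exp ((s\<^sup>2 * a * ip d q y) * g + v * g\<^sup>2 / 2))"
      by (rule mult_left_mono) simp
    then show ?thesis by (simp add: avg_cmult mult_ac)
  qed
  have "avg I (\<lambda>b. exp (l * (\<Sum>i<Suc r. (ip d (\<lambda>j. V j i) (X b))\<^sup>2) + ip d (X b) y))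
    = avg I (\<lambda>b. exp (l * S (X b) + ip d (X b) y) * exp (l * (ip d q (X b))\<^sup>2))"
    by (simp add: S_def q_def exp_add[symmetric] algebra_simps)
  also have "\<dots> = (\<integral>g. avg I (\<lambda>b. std_normal_density g * exp (l * S (X b) + ip d (X b) (yg g))) \<partial>lborel)"
    using int2 by (simp add: has_bochner_integral_iff)
  also have "\<dots> \<le> (\<integral>g. D * (std_normal_density g * exp ((s\<^sup>2 * a * ip d q y) * g + v * g\<^sup>2 / 2)) \<partial>lborel)"
    using int2 int3 le by (intro integral_mono) (auto simp: has_bochner_integral_iff)
  also have "\<dots> = D * (exp ((s\<^sup>2 * a * ip d q y)\<^sup>2 / (2 * (1 - v))) / sqrt (1 - v))"
    using int3 by (simp add: has_bochner_integral_iff)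
  also have "(s\<^sup>2 * a * ip d q y)\<^sup>2 / (2 * (1 - v)) = \<kappa> / 2 * (ip d q y)\<^sup>2"
    unfolding \<kappa>_def power_mult_distrib power2_eq_square[of a] a2 using v1
    by (simp add: power_mult_distrib power2_eq_square power4_eq_xxxx mult_ac)
  also have "D * (exp (\<kappa> / 2 * (ip d q y)\<^sup>2) / sqrt (1 - v)) = C ^ Suc r * exp (s\<^sup>2 / 2 * ip d y y + \<kappa> / 2 * (S y + (ip d q y)\<^sup>2))"
    by (simp add: D_def C_def exp_add algebra_simps)
  also have "S y + (ip d q y)\<^sup>2 = (\<Sum>i<Suc r. (ip d (\<lambda>j. V j i) y)\<^sup>2)" by (simp add: S_def q_def)
  finally show ?case by (simp only: C_def \<kappa>_def v_def)
qed

lemma avg_exp_linear_scaled: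
  assumes "finite I"
  shows "avg I (\<lambda>b. exp (t * (\<Sum>i\<in>I. b i * y i))) \<le> exp (t\<^sup>2 * (\<Sum>i\<in>I. (y i)\<^sup>2) / 2)"
  using avg_exp_linear[OF assms, of "\<lambda>i. t * y i"]
  by (simp add: sum_distrib_left power_mult_distrib mult_ac)

text \<open>The one-dimensional case of \<open>subgaussian_projection\<close>, with constant
  vectors.\<close>

lemma avg_exp_square:
  assumes I: "finite I" and l: "0 \<le> l" "2 * l * (\<Sum>i\<in>I. (y i)\<^sup>2) < 1"
  shows "avg I (\<lambda>b. exp (l * (\<Sum>i\<in>I. b i * y i)\<^sup>2)) \<le> 1 / sqrt (1 - 2 * l * (\<Sum>i\<in>I. (y i)\<^sup>2))"
proof -
  define s where "s = sqrt (\<Sum>i\<in>I. (y i)\<^sup>2)"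
  have s2: "s\<^sup>2 = (\<Sum>i\<in>I. (y i)\<^sup>2)" by (simp add: s_def sum_nonneg)
  have sub: "avg I (\<lambda>b. exp (ip 1 (\<lambda>_. \<Sum>i\<in>I. b i * y i) z)) \<le> exp (s\<^sup>2 / 2 * ip 1 z z)" for z
    using avg_exp_linear_scaled[OF I, of "z 0" y] unfolding s2[symmetric]
    by (simp add: ip_def power2_eq_square mult_ac)
  have "orthonormal_columns 1 1 (\<lambda>_ _. 1)" by (simp add: orthonormal_columns_def)
  from subgaussian_projection[OF sub this l(1), of "\<lambda>_. 0"] show ?thesis
    using l(2) by (simp add: ip_def s2)
qed

lemma sum_row: "(\<Sum>p\<in>{i} \<times> C. f p) = (\<Sum>l\<in>C. f (i, l))"
  by (simp add: sum.cartesian_product')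

lemma sum_col: "(\<Sum>p\<in>R \<times> {l}. f p) = (\<Sum>i\<in>R. f (i, l))"
  by (simp add: sum.cartesian_product')

lemma sum_squares_upper:
  fixes K :: "'j \<Rightarrow> 'i set"
  assumes J: "finite J" "\<And>j. j \<in> J \<Longrightarrow> finite (K j)"
    "\<And>i j. i \<in> J \<Longrightarrow> j \<in> J \<Longrightarrow> i \<noteq> j \<Longrightarrow> K i \<inter> K j = {}"
    and s: "\<And>j. j \<in> J \<Longrightarrow> (\<Sum>i\<in>K j. (y i)\<^sup>2) = s" "0 < s"
  shows "sprob (\<Union>j\<in>J. K j) (\<lambda>b. c * s * real (card J) \<le> (\<Sum>j\<in>J. (\<Sum>i\<in>K j. b i * y i)\<^sup>2))
    \<le> (sqrt 2 * exp (- c / 4)) ^ card J"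
proof -
  \<comment> \<open>This choice makes 2 l s = 1/2, so that each block contributes the factor sqrt
    2.\<close>
  define l where "l = 1 / (4 * s)"
  have l: "0 \<le> l" "2 * l * s = 1 / 2" using s(2) by (auto simp: l_def)
  let ?Q = "\<lambda>b. \<Sum>j\<in>J. (\<Sum>i\<in>K j. b i * y i)\<^sup>2"
  have "sprob (\<Union>j\<in>J. K j) (\<lambda>b. c * s * real (card J) \<le> ?Q b)
    \<le> avg (\<Union>j\<in>J. K j) (\<lambda>b. \<Prod>j\<in>J. exp (l * (\<Sum>i\<in>K j. b i * y i)\<^sup>2)) / exp (c / 4 * real (card J))"
  proof (rule sprob_markov_scaled)
    fix b assume "c * s * real (card J) \<le> ?Q b"
    then have "l * (c * s * real (card J)) \<le> l * ?Q b" using l(1) by (rule mult_left_mono)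
    then have "c / 4 * real (card J) \<le> (\<Sum>j\<in>J. l * (\<Sum>i\<in>K j. b i * y i)\<^sup>2)"
      using s(2) by (simp add: l_def sum_distrib_left)
    then show "exp (c / 4 * real (card J)) \<le> (\<Prod>j\<in>J. exp (l * (\<Sum>i\<in>K j. b i * y i)\<^sup>2))"
      by (simp add: exp_sum[OF J(1), symmetric])
  qed (auto intro: prod_nonneg)
  also have "avg (\<Union>j\<in>J. K j) (\<lambda>b. \<Prod>j\<in>J. exp (l * (\<Sum>i\<in>K j. b i * y i)\<^sup>2))
    = (\<Prod>j\<in>J. avg (K j) (\<lambda>b. exp (l * (\<Sum>i\<in>K j. b i * y i)\<^sup>2)))"
    by (intro avg_prod) (use J depends_on_linear[where G = "\<lambda>x. exp (l * x\<^sup>2)"] in auto)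
  also have "\<dots> \<le> (\<Prod>j\<in>J. sqrt 2)"
  proof (rule prod_mono, intro conjI avg_nonneg)
    fix j assume j: "j \<in> J"
    have "avg (K j) (\<lambda>b. exp (l * (\<Sum>i\<in>K j. b i * y i)\<^sup>2)) \<le> 1 / sqrt (1 - 2 * l * s)"
    proof -
      have "2 * l * (\<Sum>i\<in>K j. (y i)\<^sup>2) < 1" unfolding s(1)[OF j] l(2) by simp
      from avg_exp_square[OF J(2)[OF j] l(1) this] show ?thesis unfolding s(1)[OF j] .
    qed
    also have "\<dots> = sqrt 2" unfolding l(2) by (simp add: real_sqrt_divide)
    finally show "avg (K j) (\<lambda>b. exp (l * (\<Sum>i\<in>K j. b i * y i)\<^sup>2)) \<le> sqrt 2" .
  qed auto
  also have "(\<Prod>j\<in>J. sqrt 2) = sqrt 2 ^ card J" by simp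
  also have "sqrt 2 ^ card J / exp (c / 4 * real (card J)) = (sqrt 2 * exp (- c / 4)) ^ card J"
  proof -
    have e: "exp (- c / 4) ^ card J = exp (- (c / 4 * real (card J)))"
      by (subst exp_of_nat_mult[symmetric]) (simp add: mult.commute)
    show ?thesis unfolding power_mult_distrib e by (simp only: exp_minus divide_inverse)
  qed
  finally show ?thesis by (simp add: divide_right_mono)
qed

lemma sum_squares_lower:
  fixes K :: "'j \<Rightarrow> 'i set"
  assumes J: "finite J" "\<And>j. j \<in> J \<Longrightarrow> finite (K j)"
    "\<And>i j. i \<in> J \<Longrightarrow> j \<in> J \<Longrightarrow> i \<noteq> j \<Longrightarrow> K i \<inter> K j = {}"
    and s: "\<And>j. j \<in> J \<Longrightarrow> (\<Sum>i\<in>K j. (y i)\<^sup>2) = s" "0 < s" and th: "0 \<le> \<theta>"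
  shows "sprob (\<Union>j\<in>J. K j) (\<lambda>b. (\<Sum>j\<in>J. (\<Sum>i\<in>K j. b i * y i)\<^sup>2) \<le> c * s * real (card J))
    \<le> (exp (- \<theta> + 3 / 2 * \<theta>\<^sup>2 + \<theta> * c)) ^ card J"
proof -
  define l where "l = \<theta> / s"
  have l: "0 \<le> l" "l * s = \<theta>" using s(2) th by (auto simp: l_def)
  let ?Q = "\<lambda>b. \<Sum>j\<in>J. (\<Sum>i\<in>K j. b i * y i)\<^sup>2"
  have "sprob (\<Union>j\<in>J. K j) (\<lambda>b. ?Q b \<le> c * s * real (card J))
    \<le> avg (\<Union>j\<in>J. K j) (\<lambda>b. \<Prod>j\<in>J. exp (- (l * (\<Sum>i\<in>K j. b i * y i)\<^sup>2))) / exp (- (\<theta> * c * real (card J)))"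
  proof (rule sprob_markov_scaled)
    fix b assume "?Q b \<le> c * s * real (card J)"
    then have "l * ?Q b \<le> l * (c * s * real (card J))" using l(1) by (rule mult_left_mono)
    then have "(\<Sum>j\<in>J. l * (\<Sum>i\<in>K j. b i * y i)\<^sup>2) \<le> \<theta> * c * real (card J)"
      unfolding l(2)[symmetric] by (simp add: sum_distrib_left mult_ac)
    then show "exp (- (\<theta> * c * real (card J))) \<le> (\<Prod>j\<in>J. exp (- (l * (\<Sum>i\<in>K j. b i * y i)\<^sup>2)))"
      by (simp add: exp_sum[OF J(1), symmetric] sum_negf)
  qed (auto intro: prod_nonneg)
  also have "avg (\<Union>j\<in>J. K j) (\<lambda>b. \<Prod>j\<in>J. exp (- (l * (\<Sum>i\<in>K j. b i * y i)\<^sup>2)))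
    = (\<Prod>j\<in>J. avg (K j) (\<lambda>b. exp (- (l * (\<Sum>i\<in>K j. b i * y i)\<^sup>2))))"
    by (intro avg_prod) (use J depends_on_linear[where G = "\<lambda>x. exp (- (l * x\<^sup>2))"] in auto)
  also have "\<dots> \<le> (\<Prod>j\<in>J. exp (- \<theta> + 3 / 2 * \<theta>\<^sup>2))"
  proof (rule prod_mono, intro conjI avg_nonneg)
    fix j assume j: "j \<in> J"
    have "avg (K j) (\<lambda>b. exp (- (l * (\<Sum>i\<in>K j. b i * y i)\<^sup>2))) \<le> 1 + (- \<theta> + 3 / 2 * \<theta>\<^sup>2)"
      using avg_exp_minus_square[OF J(2)[OF j] l(1), of y] s(1)[OF j] l(2) by simp
    also have "\<dots> \<le> exp (- \<theta> + 3 / 2 * \<theta>\<^sup>2)" by (rule exp_ge_add_one_self)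
    finally show "avg (K j) (\<lambda>b. exp (- (l * (\<Sum>i\<in>K j. b i * y i)\<^sup>2))) \<le> exp (- \<theta> + 3 / 2 * \<theta>\<^sup>2)" .
  qed auto
  also have "(\<Prod>j\<in>J. exp (- \<theta> + 3 / 2 * \<theta>\<^sup>2)) = exp (- \<theta> + 3 / 2 * \<theta>\<^sup>2) ^ card J" by simp
  also have "exp (- \<theta> + 3 / 2 * \<theta>\<^sup>2) ^ card J / exp (- (\<theta> * c * real (card J))) = (exp (- \<theta> + 3 / 2 * \<theta>\<^sup>2 + \<theta> * c)) ^ card J"
    unfolding exp_of_nat_mult[symmetric] exp_diff[symmetric]
    by (rule arg_cong[where f = exp]) (simp add: algebra_simps)
  finally show ?thesis by (simp add: divide_right_mono)
qed

subsection \<open>Integer vectors of bounded norm\<close>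

definition int_vectors :: "'i set \<Rightarrow> real \<Rightarrow> ('i \<Rightarrow> int) set" where
  "int_vectors I M = {z \<in> PiE I (\<lambda>_. UNIV). (\<Sum>i\<in>I. \<bar>real_of_int (z i)\<bar>) \<le> M}"

lemma symmetric_geometric_sum:
  assumes x: "0 < x" "x < (1::real)"
  shows "(\<Sum>k\<in>{- int N..int N}. x ^ nat \<bar>k\<bar>) \<le> (1 + x) / (1 - x)"
proof -
  have "(1 - x) * (\<Sum>k\<in>{- int N..int N}. x ^ nat \<bar>k\<bar>) = 1 + x - 2 * x ^ Suc N"
  proof (induction N)
    case (Suc N)
    have "{- int (Suc N)..int (Suc N)} = insert (- int (Suc N)) (insert (int (Suc N)) {- int N..int N})" by auto
    then have "(\<Sum>k\<in>{- int (Suc N)..int (Suc N)}. x ^ nat \<bar>k\<bar>) = 2 * x ^ Suc N + (\<Sum>k\<in>{- int N..int N}. x ^ nat \<bar>k\<bar>)"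
      by (simp add: nat_add_distrib)
    then have "(1 - x) * (\<Sum>k\<in>{- int (Suc N)..int (Suc N)}. x ^ nat \<bar>k\<bar>)
      = (1 - x) * (2 * x ^ Suc N) + (1 - x) * (\<Sum>k\<in>{- int N..int N}. x ^ nat \<bar>k\<bar>)"
      by (simp only: distrib_left)
    also have "\<dots> = (1 - x) * (2 * x ^ Suc N) + (1 + x - 2 * x ^ Suc N)" by (simp only: Suc)
    finally show ?case by (simp add: algebra_simps)
  qed (simp add: algebra_simps)
  also have "\<dots> \<le> 1 + x" using x by simp
  finally show ?thesis using x by (simp add: field_simps)
qed

text \<open>Counting by exponential weights: each vector of l1 norm at most M has weight exp
  (\<beta> (M - |z|_1)) >= 1, and the sum of the weights factors into geometric series. The free
  parameter \<beta> is adapted to the ratio of M to the dimension.\<close>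

lemma card_int_vectors:
  assumes I: "finite I" and b: "0 < \<beta>"
  shows "finite (int_vectors I M)"
    and "real (card (int_vectors I M)) \<le> exp (\<beta> * M) * ((1 + exp (- \<beta>)) / (1 - exp (- \<beta>))) ^ card I"
proof -
  define N where "N = nat \<lfloor>M\<rfloor>"
  define P where "P = PiE I (\<lambda>_. {- int N..int N})"
  have finP: "finite P" unfolding P_def using I by (intro finite_PiE) auto
  have sub: "int_vectors I M \<subseteq> P"
  proof
    fix z assume z: "z \<in> int_vectors I M"
    have "z i \<in> {- int N..int N}" if "i \<in> I" for i
    proof -
      have "\<bar>real_of_int (z i)\<bar> \<le> (\<Sum>i\<in>I. \<bar>real_of_int (z i)\<bar>)"
        using that I by (intro member_le_sum) auto
      also have "\<dots> \<le> M" using z by (simp add: int_vectors_def)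
      finally have "real_of_int \<bar>z i\<bar> \<le> M" by simp
      then have "\<bar>z i\<bar> \<le> \<lfloor>M\<rfloor>" by (simp only: le_floor_iff)
      then have le: "\<bar>z i\<bar> \<le> int N" unfolding N_def by linarith
      then show ?thesis by (simp add: abs_le_iff)
    qed
    then show "z \<in> P" using z by (auto simp: P_def int_vectors_def PiE_iff)
  qed
  show fin: "finite (int_vectors I M)" using sub finP finite_subset by blast
  have "real (card (int_vectors I M)) = (\<Sum>z\<in>int_vectors I M. 1)" by simp
  also have "\<dots> \<le> (\<Sum>z\<in>int_vectors I M. exp (\<beta> * M) * (\<Prod>i\<in>I. exp (- \<beta>) ^ nat \<bar>z i\<bar>))"
  proof (rule sum_mono)
    fix z assume z: "z \<in> int_vectors I M"
    have "exp (\<beta> * M) * (\<Prod>i\<in>I. exp (- \<beta>) ^ nat \<bar>z i\<bar>) = exp (\<beta> * M) * exp (\<Sum>i\<in>I. - \<beta> * \<bar>real_of_int (z i)\<bar>)"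
      unfolding exp_sum[OF I] by (simp add: exp_of_nat_mult[symmetric] mult.commute)
    also have "\<dots> = exp (\<beta> * (M - (\<Sum>i\<in>I. \<bar>real_of_int (z i)\<bar>)))"
      by (simp add: exp_add[symmetric] sum_distrib_left[symmetric] sum_negf algebra_simps)
    also have "\<dots> \<ge> 1" using z b by (simp add: int_vectors_def)
    finally show "1 \<le> exp (\<beta> * M) * (\<Prod>i\<in>I. exp (- \<beta>) ^ nat \<bar>z i\<bar>)" .
  qed
  also have "\<dots> \<le> (\<Sum>z\<in>P. exp (\<beta> * M) * (\<Prod>i\<in>I. exp (- \<beta>) ^ nat \<bar>z i\<bar>))"
    by (rule sum_mono2[OF finP sub]) (intro mult_nonneg_nonneg prod_nonneg zero_le_power exp_ge_zero)
  also have "\<dots> = exp (\<beta> * M) * (\<Prod>i\<in>I. \<Sum>k\<in>{- int N..int N}. exp (- \<beta>) ^ nat \<bar>k\<bar>)"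
    unfolding P_def sum_distrib_left[symmetric] using I by (subst prod_sum_PiE) auto
  also have "\<dots> \<le> exp (\<beta> * M) * (\<Prod>i\<in>I. (1 + exp (- \<beta>)) / (1 - exp (- \<beta>)))"
    using b by (intro mult_left_mono prod_mono conjI symmetric_geometric_sum sum_nonneg) auto
  finally show "real (card (int_vectors I M)) \<le> exp (\<beta> * M) * ((1 + exp (- \<beta>)) / (1 - exp (- \<beta>))) ^ card I"
    by simp
qed

text \<open>Rounding towards zero, unlike rounding to the nearest integer or down, never increases
  the l1 norm and leaves a remainder bounded by both 1 and |x|.\<close>

definition truncate :: "real \<Rightarrow> int" where
  "truncate x = (if 0 \<le> x then \<lfloor>x\<rfloor> else \<lceil>x\<rceil>)"

lemma truncate_bounds:
  "\<bar>real_of_int (truncate x)\<bar> \<le> \<bar>x\<bar>" "\<bar>x - real_of_int (truncate x)\<bar> \<le> 1"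
  "\<bar>x - real_of_int (truncate x)\<bar> \<le> \<bar>x\<bar>"
proof -
  have 1: "0 \<le> real_of_int \<lfloor>x\<rfloor>" if "0 \<le> x" using that by simp
  have 2: "real_of_int \<lceil>x\<rceil> \<le> 0" if "\<not> 0 \<le> x" using that by simp
  have 3: "real_of_int \<lfloor>x\<rfloor> \<le> x" "x < real_of_int \<lfloor>x\<rfloor> + 1" by linarith+
  have 4: "x \<le> real_of_int \<lceil>x\<rceil>" "real_of_int \<lceil>x\<rceil> < x + 1" by linarith+
  have "\<bar>real_of_int (truncate x)\<bar> \<le> \<bar>x\<bar> \<and> \<bar>x - real_of_int (truncate x)\<bar> \<le> 1 \<and>
    \<bar>x - real_of_int (truncate x)\<bar> \<le> \<bar>x\<bar>"
  proof (cases "0 \<le> x")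
    case True
    then have "real_of_int (truncate x) = real_of_int \<lfloor>x\<rfloor>" by (simp add: truncate_def)
    then show ?thesis using 1[OF True] 3 True by linarith
  next
    case False
    then have "real_of_int (truncate x) = real_of_int \<lceil>x\<rceil>" by (simp add: truncate_def)
    then show ?thesis using 2[OF False] 4 False by linarith
  qed
  then show "\<bar>real_of_int (truncate x)\<bar> \<le> \<bar>x\<bar>" "\<bar>x - real_of_int (truncate x)\<bar> \<le> 1"
    "\<bar>x - real_of_int (truncate x)\<bar> \<le> \<bar>x\<bar>" by auto
qed

lemma truncate_vector:
  assumes "(\<Sum>i\<in>I. \<bar>t i\<bar>) \<le> M"
  shows "restrict (\<lambda>i. truncate (t i)) I \<in> int_vectors I M"
proof -
  have "(\<Sum>i\<in>I. \<bar>real_of_int (truncate (t i))\<bar>) \<le> (\<Sum>i\<in>I. \<bar>t i\<bar>)"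
    by (intro sum_mono truncate_bounds)
  then show ?thesis using assms by (auto simp: int_vectors_def)
qed

subsection \<open>Restricted isometry of sign matrices\<close>

definition bmul :: "nat \<Rightarrow> (nat \<times> nat \<Rightarrow> real) \<Rightarrow> (nat \<Rightarrow> real) \<Rightarrow> nat \<Rightarrow> real" where
  "bmul d b h = (\<lambda>i. \<Sum>l<d. b (i, l) * h l)"

definition bmul_t :: "nat set \<Rightarrow> (nat \<times> nat \<Rightarrow> real) \<Rightarrow> (nat \<Rightarrow> real) \<Rightarrow> nat \<Rightarrow> real" where
  "bmul_t g b t = (\<lambda>l. \<Sum>i\<in>g. b (i, l) * t i)"

lemma top_subset_exists:
  fixes a :: "'i \<Rightarrow> real"
  assumes I: "finite I" and K: "K \<le> card I"
  obtains S where "S \<subseteq> I" "card S = K" "\<And>l l'. l \<in> S \<Longrightarrow> l' \<in> I - S \<Longrightarrow> a l' \<le> a l"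
proof -
  define F where "F = {S. S \<subseteq> I \<and> card S = K}"
  have finF: "finite F" unfolding F_def using I by auto
  have "F \<noteq> {}" unfolding F_def using obtain_subset_with_card_n[OF K] by blast
  then have "Max (sum a ` F) \<in> sum a ` F" using finF by (intro Max_in) auto
  then obtain S where S1: "S \<in> F" "sum a S = Max (sum a ` F)" by auto
  then have S: "S \<in> F" "\<And>T. T \<in> F \<Longrightarrow> sum a T \<le> sum a S" using finF by auto
  have "a l' \<le> a l" if l: "l \<in> S" "l' \<in> I - S" for l l'
  proof -
    have finS: "finite S" using S(1) I finite_subset by (auto simp: F_def)
    have "insert l' (S - {l}) \<in> F"
      using S(1) l finS by (auto simp: F_def card_insert_if card_Diff_singleton Suc_diff_le)
        (metis Suc_pred card_gt_0_iff empty_iff)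
    then have "sum a (insert l' (S - {l})) \<le> sum a S" by (rule S(2))
    then show ?thesis using l finS by (simp add: sum_diff1)
  qed
  then show thesis using that[of S] S(1) by (auto simp: F_def)
qed

text \<open>Vectors with \<open>\<bar>r\<bar>\<^sub>\<infinity> \<le> 1\<close> and \<open>\<bar>r\<bar>\<^sub>1 \<le> K\<close> are convex combinations of \<open>K\<close>-sparse sign vectors;
  only the resulting bound on linear functionals is needed.\<close>

lemma sparse_hull_bound:
  fixes a r :: "'i \<Rightarrow> real"
  assumes I: "finite I" and r: "\<And>l. l \<in> I \<Longrightarrow> \<bar>r l\<bar> \<le> 1" "(\<Sum>l\<in>I. \<bar>r l\<bar>) \<le> real K"
  obtains S where "S \<subseteq> I" "card S \<le> K" "(\<Sum>l\<in>I. r l * a l) \<le> (\<Sum>l\<in>S. \<bar>a l\<bar>)"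
proof (cases "K \<le> card I")
  case False
  have "(\<Sum>l\<in>I. r l * a l) \<le> (\<Sum>l\<in>I. \<bar>a l\<bar>)"
  proof (rule sum_mono)
    fix l assume "l \<in> I"
    then have "\<bar>r l\<bar> * \<bar>a l\<bar> \<le> 1 * \<bar>a l\<bar>" using r(1) by (intro mult_right_mono) auto
    then show "r l * a l \<le> \<bar>a l\<bar>" using abs_ge_self[of "r l * a l"] by (simp add: abs_mult)
  qed
  then show thesis using that[of I] False by simp
next
  case True
  then obtain S where S: "S \<subseteq> I" "card S = K" "\<And>l l'. l \<in> S \<Longrightarrow> l' \<in> I - S \<Longrightarrow> \<bar>a l'\<bar> \<le> \<bar>a l\<bar>"
    using top_subset_exists[OF I True, of "\<lambda>l. \<bar>a l\<bar>"] by metis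
  have finS: "finite S" using S(1) I finite_subset by blast
  define \<tau> where "\<tau> = (if S = {} then Max (insert 0 ((\<lambda>l. \<bar>a l\<bar>) ` I)) else Min ((\<lambda>l. \<bar>a l\<bar>) ` S))"
  have \<tau>S: "\<tau> \<le> \<bar>a l\<bar>" if "l \<in> S" for l unfolding \<tau>_def using that finS by auto
  have \<tau>out: "\<bar>a l\<bar> \<le> \<tau>" if "l \<in> I - S" for l
  proof (cases "S = {}")
    case True
    then show ?thesis unfolding \<tau>_def using that I by simp
  next
    case False
    then have "Min ((\<lambda>l. \<bar>a l\<bar>) ` S) \<in> (\<lambda>l. \<bar>a l\<bar>) ` S" using finS by (intro Min_in) auto
    then show ?thesis unfolding \<tau>_def using False S(3)[OF _ that] by auto
  qed
  have \<tau>0: "0 \<le> \<tau>"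
  proof (cases "S = {}")
    case False
    then have "Min ((\<lambda>l. \<bar>a l\<bar>) ` S) \<in> (\<lambda>l. \<bar>a l\<bar>) ` S" using finS by (intro Min_in) auto
    then show ?thesis unfolding \<tau>_def using False by auto
  qed (use I in \<open>simp add: \<tau>_def\<close>)
  have "(\<Sum>l\<in>I. r l * a l) \<le> (\<Sum>l\<in>I. \<bar>r l\<bar> * \<bar>a l\<bar>)"
    by (rule sum_mono) (metis abs_ge_self abs_mult)
  also have "\<dots> = (\<Sum>l\<in>S. \<bar>r l\<bar> * \<bar>a l\<bar>) + (\<Sum>l\<in>I - S. \<bar>r l\<bar> * \<bar>a l\<bar>)"
    using sum.subset_diff[OF S(1) I, of "\<lambda>l. \<bar>r l\<bar> * \<bar>a l\<bar>"] by simp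
  also have "(\<Sum>l\<in>I - S. \<bar>r l\<bar> * \<bar>a l\<bar>) \<le> (\<Sum>l\<in>I - S. \<bar>r l\<bar> * \<tau>)"
    using \<tau>out by (intro sum_mono mult_left_mono) auto
  also have "(\<Sum>l\<in>I - S. \<bar>r l\<bar> * \<tau>) \<le> (\<Sum>l\<in>S. (1 - \<bar>r l\<bar>) * \<tau>)"
  proof -
    have "(\<Sum>l\<in>I - S. \<bar>r l\<bar>) \<le> (\<Sum>l\<in>S. 1 - \<bar>r l\<bar>)"
      using r(2) sum.subset_diff[OF S(1) I, of "\<lambda>l. \<bar>r l\<bar>"] S(2) by (simp add: sum_subtractf)
    then show ?thesis using \<tau>0 by (simp add: sum_distrib_right[symmetric] mult_right_mono)
  qed
  also have "(\<Sum>l\<in>S. \<bar>r l\<bar> * \<bar>a l\<bar>) + (\<Sum>l\<in>S. (1 - \<bar>r l\<bar>) * \<tau>) \<le> (\<Sum>l\<in>S. \<bar>a l\<bar>)"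
    unfolding sum.distrib[symmetric]
  proof (rule sum_mono)
    fix l assume l: "l \<in> S"
    then have "(1 - \<bar>r l\<bar>) * \<tau> \<le> (1 - \<bar>r l\<bar>) * \<bar>a l\<bar>" using r(1)[of l] S(1) \<tau>S by (intro mult_left_mono) auto
    then show "\<bar>r l\<bar> * \<bar>a l\<bar> + (1 - \<bar>r l\<bar>) * \<tau> \<le> \<bar>a l\<bar>" by (simp add: algebra_simps)
  qed
  finally show thesis using that[of S] S by simp
qed

text \<open>A restricted isometry property. Every vector is close to the sum of an integer vector with small
  \<open>l\<^sub>1\<close> norm and a vector with entries in \<open>[-1, 1]\<close>, so it suffices to control finitely many vectors.\<close>

definition good_on_grid :: "nat \<Rightarrow> nat \<Rightarrow> nat \<Rightarrow> (nat \<times> nat \<Rightarrow> real) \<Rightarrow> bool" where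
  "good_on_grid m d K b \<longleftrightarrow> (\<forall>z \<in> int_vectors {..<d} (real K). 0 < (\<Sum>l<d. (real_of_int (z l))\<^sup>2) \<longrightarrow>
     real m / 4 * (\<Sum>l<d. (real_of_int (z l))\<^sup>2) < (\<Sum>i<m. (bmul d b (\<lambda>l. real_of_int (z l)) i)\<^sup>2) \<and>
     (\<Sum>i<m. (bmul d b (\<lambda>l. real_of_int (z l)) i)\<^sup>2) < 4 * real m * (\<Sum>l<d. (real_of_int (z l))\<^sup>2))"

lemma L2_scale: "L2_set (\<lambda>i. c * f i) A = \<bar>c\<bar> * L2_set f A"
  by (simp add: L2_set_def power_mult_distrib sum_distrib_left[symmetric] real_sqrt_mult)

lemma L2_triangle_diff: "L2_set (\<lambda>i. f i - g i) A \<le> L2_set f A + L2_set g A"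
proof -
  have "L2_set (\<lambda>i. f i + - 1 * g i) A \<le> L2_set f A + L2_set (\<lambda>i. - 1 * g i) A"
    by (rule L2_set_triangle_ineq)
  then show ?thesis unfolding L2_scale by simp
qed

text \<open>After scaling to |h|_1 = K, write h = z + r with z integer. The grid gives |B z| >= sqrt
  m |z| / 2, and |B r| <= 2 sqrt (m K) by duality with a sparse sign vector. This yields |z| <= 2 |B
  h| / sqrt m + 4 sqrt K, and |r| <= sqrt K makes the constant 5.\<close>

lemma kernel_width:
  assumes good: "good_on_grid m d K b" and K: "0 < K" and m: "0 < m"
  shows "L2_set h {..<d} \<le> 5 / sqrt (real K) * (\<Sum>l<d. \<bar>h l\<bar>) + 2 / sqrt (real m) * L2_set (bmul d b h) {..<m}"
proof -
  have main: "L2_set h {..<d} \<le> 5 * sqrt (real K) + 2 / sqrt (real m) * L2_set (bmul d b h) {..<m}"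
    if hK: "(\<Sum>l<d. \<bar>h l\<bar>) = real K" for h
  proof -
    define z where "z = restrict (\<lambda>l. truncate (h l)) {..<d}"
    define zr where "zr = (\<lambda>l. real_of_int (z l))"
    define r where "r = (\<lambda>l. h l - zr l)"
    have zI: "z \<in> int_vectors {..<d} (real K)" unfolding z_def by (rule truncate_vector) (use hK in simp)
    have r1: "\<bar>r l\<bar> \<le> 1" "\<bar>r l\<bar> \<le> \<bar>h l\<bar>" if "l < d" for l
      using truncate_bounds[of "h l"] that by (auto simp: r_def zr_def z_def)
    have rK: "(\<Sum>l<d. \<bar>r l\<bar>) \<le> real K" unfolding hK[symmetric] by (rule sum_mono) (use r1 in auto)
    have r2: "L2_set r {..<d} \<le> sqrt (real K)"
    proof -
      have "(\<Sum>l<d. (r l)\<^sup>2) \<le> (\<Sum>l<d. \<bar>r l\<bar>)"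
      proof (rule sum_mono)
        fix l assume "l \<in> {..<d}"
        then have "\<bar>r l\<bar> * \<bar>r l\<bar> \<le> \<bar>r l\<bar> * 1" using r1 by (intro mult_left_mono) auto
        then show "(r l)\<^sup>2 \<le> \<bar>r l\<bar>" by (simp add: power2_eq_square)
      qed
      then show ?thesis using rK by (simp add: L2_set_def)
    qed
    define y where "y = bmul d b r"
    define a where "a = (\<lambda>l. \<Sum>i<m. b (i, l) * y i)"
    have pair: "(\<Sum>i<m. bmul d b x i * y i) = (\<Sum>l<d. x l * a l)" for x
    proof -
      have "(\<Sum>i<m. bmul d b x i * y i) = (\<Sum>i<m. \<Sum>l<d. b (i, l) * x l * y i)"
        by (simp add: bmul_def sum_distrib_right)
      also have "\<dots> = (\<Sum>l<d. \<Sum>i<m. b (i, l) * x l * y i)" by (rule sum.swap)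
      finally show ?thesis by (simp add: a_def sum_distrib_left mult_ac)
    qed
    obtain S where S: "S \<subseteq> {..<d}" "card S \<le> K" "(\<Sum>l<d. r l * a l) \<le> (\<Sum>l\<in>S. \<bar>a l\<bar>)"
      using sparse_hull_bound[of "{..<d}" r K a] r1(1) rK by auto
    \<comment> \<open>The extremal sparse sign vector is itself an integer vector of l1 norm at most
      K, so the upper bound on the same grid covers it.\<close>
    define e where "e = restrict (\<lambda>l. if l \<in> S then (if 0 \<le> a l then 1 else - 1) else (0::int)) {..<d}"
    define er where "er = (\<lambda>l. real_of_int (e l))"
    have finS: "finite S" using S(1) finite_subset by blast
    have ea: "er l * a l = (if l \<in> S then \<bar>a l\<bar> else 0)" and e2: "(er l)\<^sup>2 = (if l \<in> S then 1 else 0)"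
      and eabs: "\<bar>er l\<bar> = (if l \<in> S then 1 else 0)" if "l < d" for l
      using that by (auto simp: er_def e_def)
    have Int: "{..<d} \<inter> S = S" using S(1) by blast
    have sumS: "(\<Sum>l<d. if l \<in> S then f l else 0) = sum f S" for f :: "nat \<Rightarrow> real"
      by (simp add: sum.inter_restrict[symmetric] Int)
    have eI: "e \<in> int_vectors {..<d} (real K)"
    proof -
      have "(\<Sum>l<d. \<bar>er l\<bar>) = (\<Sum>l<d. if l \<in> S then 1 else 0)" by (rule sum.cong) (auto simp: eabs)
      then show ?thesis using S(2) unfolding sumS by (auto simp: int_vectors_def er_def e_def)
    qed
    have es: "(\<Sum>l<d. (er l)\<^sup>2) = real (card S)"
    proof -
      have "(\<Sum>l<d. (er l)\<^sup>2) = (\<Sum>l<d. if l \<in> S then 1 else 0)" by (rule sum.cong) (auto simp: e2)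
      then show ?thesis unfolding sumS by simp
    qed
    have Be: "L2_set (bmul d b er) {..<m} \<le> 2 * sqrt (real m) * sqrt (real K)"
    proof (cases "card S = 0")
      case True
      then have "er l = 0" if "l < d" for l using e2[OF that] finS by auto
      then have "bmul d b er = (\<lambda>_. 0)" by (auto simp: bmul_def)
      then show ?thesis by (simp add: L2_set_def)
    next
      case False
      then have "0 < (\<Sum>l<d. (er l)\<^sup>2)" unfolding es by simp
      then have "(\<Sum>i<m. (bmul d b er i)\<^sup>2) \<le> 4 * real m * real (card S)"
        using good eI unfolding good_on_grid_def er_def[symmetric] es[symmetric] by (auto simp: er_def)
      also have "\<dots> \<le> 4 * real m * real K" using S(2) by (intro mult_left_mono) auto
      finally have "L2_set (bmul d b er) {..<m} \<le> sqrt (4 * real m * real K)" by (simp add: L2_set_def)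
      then show ?thesis by (simp add: real_sqrt_mult)
    qed
    have yb: "L2_set y {..<m} \<le> 2 * sqrt (real m) * sqrt (real K)"
    proof -
      have "(L2_set y {..<m})\<^sup>2 = (\<Sum>i<m. bmul d b r i * y i)"
        by (simp add: L2_set_def sum_nonneg y_def power2_eq_square)
      also have "\<dots> \<le> (\<Sum>l\<in>S. \<bar>a l\<bar>)" unfolding pair by (rule S(3))
      also have "\<dots> = (\<Sum>l<d. er l * a l)" unfolding sumS[symmetric] by (rule sum.cong) (auto simp: ea)
      also have "\<dots> = (\<Sum>i<m. bmul d b er i * y i)" by (rule pair[symmetric])
      also have "\<dots> \<le> (\<Sum>i<m. \<bar>bmul d b er i\<bar> * \<bar>y i\<bar>)" by (rule sum_mono) (metis abs_ge_self abs_mult)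
      also have "\<dots> \<le> L2_set (bmul d b er) {..<m} * L2_set y {..<m}" by (rule L2_set_mult_ineq)
      also have "\<dots> \<le> 2 * sqrt (real m) * sqrt (real K) * L2_set y {..<m}" using Be by (intro mult_right_mono) auto
      finally have "L2_set y {..<m} * L2_set y {..<m} \<le> 2 * sqrt (real m) * sqrt (real K) * L2_set y {..<m}"
        by (simp add: power2_eq_square)
      then show ?thesis using L2_set_nonneg[of y "{..<m}"] by (cases "L2_set y {..<m} = 0") auto
    qed
    have zb: "sqrt (real m) / 2 * L2_set zr {..<d} \<le> L2_set (bmul d b zr) {..<m}"
    proof (cases "0 < (\<Sum>l<d. (zr l)\<^sup>2)")
      case True
      then have "real m / 4 * (\<Sum>l<d. (zr l)\<^sup>2) \<le> (\<Sum>i<m. (bmul d b zr i)\<^sup>2)"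
        using good zI unfolding good_on_grid_def zr_def by fastforce
      then have "sqrt (real m / 4 * (\<Sum>l<d. (zr l)\<^sup>2)) \<le> L2_set (bmul d b zr) {..<m}"
        unfolding L2_set_def by (rule real_sqrt_le_mono)
      then show ?thesis by (simp add: real_sqrt_mult real_sqrt_divide L2_set_def)
    next
      case False
      then have "(\<Sum>l<d. (zr l)\<^sup>2) = 0" using sum_nonneg[of "{..<d}" "\<lambda>l. (zr l)\<^sup>2"] by simp
      then show ?thesis by (simp add: L2_set_def[of zr])
    qed
    have "bmul d b zr = (\<lambda>i. bmul d b h i - y i)"
      by (simp add: y_def r_def bmul_def sum_subtractf[symmetric] algebra_simps)
    then have "L2_set (bmul d b zr) {..<m} \<le> L2_set (bmul d b h) {..<m} + L2_set y {..<m}"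
      by (simp add: L2_triangle_diff)
    then have "sqrt (real m) / 2 * L2_set zr {..<d} \<le> L2_set (bmul d b h) {..<m} + 2 * sqrt (real m) * sqrt (real K)"
      using zb yb by linarith
    then have "2 / sqrt (real m) * (sqrt (real m) / 2 * L2_set zr {..<d})
      \<le> 2 / sqrt (real m) * (L2_set (bmul d b h) {..<m} + 2 * sqrt (real m) * sqrt (real K))"
      by (rule mult_left_mono) simp
    then have zz: "L2_set zr {..<d} \<le> 2 / sqrt (real m) * L2_set (bmul d b h) {..<m} + 4 * sqrt (real K)"
      using m by (simp add: algebra_simps)
    have "L2_set h {..<d} = L2_set (\<lambda>l. zr l + r l) {..<d}" by (simp add: r_def)
    also have "\<dots> \<le> L2_set zr {..<d} + L2_set r {..<d}" by (rule L2_set_triangle_ineq)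
    finally show ?thesis using zz r2 by linarith
  qed
  define s where "s = (\<Sum>l<d. \<bar>h l\<bar>)"
  have s0: "0 \<le> s" by (simp add: s_def sum_nonneg)
  show ?thesis
  proof (cases "s = 0")
    case True
    then have "\<forall>l<d. h l = 0" by (simp add: s_def sum_nonneg_eq_0_iff)
    then have "L2_set h {..<d} = 0" by (simp add: L2_set_0')
    then show ?thesis using s0 by (simp add: s_def)
  next
    case False
    then have sp: "0 < s" using s0 by simp
    define c where "c = real K / s"
    have c0: "0 < c" using sp K by (simp add: c_def)
    have "(\<Sum>l<d. \<bar>c * h l\<bar>) = real K"
      using c0 sp by (simp add: abs_mult sum_distrib_left[symmetric] s_def[symmetric]) (simp add: c_def)
    from main[OF this] have "c * L2_set h {..<d} \<le> 5 * sqrt (real K) + 2 / sqrt (real m) * (c * L2_set (bmul d b h) {..<m})"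
    proof -
      have "bmul d b (\<lambda>l. c * h l) = (\<lambda>i. c * bmul d b h i)" by (simp add: bmul_def sum_distrib_left mult_ac)
      then show ?thesis using main[OF \<open>(\<Sum>l<d. \<bar>c * h l\<bar>) = real K\<close>] c0 by (simp add: L2_scale)
    qed
    also have "5 * sqrt (real K) = c * (5 / sqrt (real K) * s)"
      using K sp by (simp add: c_def field_simps)
    finally have "c * L2_set h {..<d} \<le> c * (5 / sqrt (real K) * s + 2 / sqrt (real m) * L2_set (bmul d b h) {..<m})"
      by (simp add: algebra_simps)
    then show ?thesis using c0 by (simp add: s_def)
  qed
qed

section \<open>Probability of the restricted isometry\<close>

lemma sqrt2_le_exp: "sqrt 2 \<le> exp (25 / 72)"
proof (rule real_le_lsqrt)
  have "2 = exp (ln 2 :: real)" by simp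
  also have "\<dots> \<le> exp (25 / 36)" using ln2_le_25_over_36 by (simp only: exp_le_cancel_iff)
  also have "\<dots> = (exp (25 / 72))\<^sup>2" by (simp add: power2_eq_square exp_add[symmetric])
  finally show "2 \<le> (exp (25 / 72 :: real))\<^sup>2" .
qed auto

lemma sprob_disj2: "sprob I P \<le> p \<Longrightarrow> sprob I Q \<le> p \<Longrightarrow> sprob I (\<lambda>b. P b \<or> Q b) \<le> 2 * p"
  using sprob_disj[of I P Q] by linarith

lemma grid_rows: "{..<m::nat} \<times> C = (\<Union>i\<in>{..<m}. {i} \<times> C)"
  by auto

lemma grid_cols: "R \<times> {..<d::nat} = (\<Union>l\<in>{..<d}. R \<times> {l})"
  by auto

lemma bmul_row: "(\<Sum>p\<in>{i} \<times> {..<d}. b p * h (snd p)) = bmul d b h i"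
  by (simp add: sum_row bmul_def)

lemma bmul_t_col: "(\<Sum>p\<in>g \<times> {l}. b p * t (fst p)) = bmul_t g b t l"
  by (simp add: sum_col bmul_t_def)

lemma row_norm_lower_prob:
  assumes z: "0 < (\<Sum>l<d. (z l)\<^sup>2)"
  shows "sprob ({..<m} \<times> {..<d}) (\<lambda>b. (\<Sum>i<m. (bmul d b z i)\<^sup>2) \<le> real m / 4 * (\<Sum>l<d. (z l)\<^sup>2)) \<le> exp (- 1 / 12) ^ m"
proof -
  have "sprob (\<Union>i\<in>{..<m}. {i} \<times> {..<d}) (\<lambda>b. (\<Sum>i\<in>{..<m}. (\<Sum>p\<in>{i} \<times> {..<d}. b p * z (snd p))\<^sup>2)
      \<le> 1 / 4 * (\<Sum>l<d. (z l)\<^sup>2) * real (card {..<m}))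
    \<le> exp (- (1 / 3) + 3 / 2 * (1 / 3)\<^sup>2 + 1 / 3 * (1 / 4)) ^ card {..<m}"
    by (rule sum_squares_lower) (use z in \<open>auto simp: sum_row\<close>)
  also have "- (1 / 3) + 3 / 2 * (1 / 3)\<^sup>2 + 1 / 3 * (1 / 4) = (- 1 / 12 :: real)" by (simp add: power2_eq_square)
  finally show ?thesis unfolding grid_rows bmul_row by (simp add: mult_ac)
qed

lemma row_norm_upper_prob:
  assumes z: "0 < (\<Sum>l<d. (z l)\<^sup>2)"
  shows "sprob ({..<m} \<times> {..<d}) (\<lambda>b. 4 * real m * (\<Sum>l<d. (z l)\<^sup>2) \<le> (\<Sum>i<m. (bmul d b z i)\<^sup>2)) \<le> exp (- 1 / 12) ^ m"
proof -
  have "sprob (\<Union>i\<in>{..<m}. {i} \<times> {..<d}) (\<lambda>b. 4 * (\<Sum>l<d. (z l)\<^sup>2) * real (card {..<m})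
      \<le> (\<Sum>i\<in>{..<m}. (\<Sum>p\<in>{i} \<times> {..<d}. b p * z (snd p))\<^sup>2))
    \<le> (sqrt 2 * exp (- 4 / 4)) ^ card {..<m}"
    by (rule sum_squares_upper) (use z in \<open>auto simp: sum_row\<close>)
  also have "\<dots> \<le> exp (- 1 / 12) ^ m"
  proof -
    have "sqrt 2 * exp (- 4 / 4) \<le> exp (25 / 72) * exp (- 4 / 4)" using sqrt2_le_exp by (rule mult_right_mono) simp
    also have "\<dots> \<le> exp (- 1 / 12)" unfolding exp_add[symmetric] by simp
    finally show ?thesis by (simp add: power_mono)
  qed
  finally show ?thesis unfolding grid_rows bmul_row by (simp add: mult_ac)
qed

lemma good_on_grid_prob:
  assumes card: "real (card (int_vectors {..<d} (real K))) \<le> N"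
  shows "sprob ({..<m} \<times> {..<d}) (\<lambda>b. \<not> good_on_grid m d K b) \<le> N * (2 * exp (- 1 / 12) ^ m)"
proof -
  define Z where "Z = {z \<in> int_vectors {..<d} (real K). 0 < (\<Sum>l<d. (real_of_int (z l))\<^sup>2)}"
  define P where "P = (\<lambda>z b. (\<Sum>i<m. (bmul d b (\<lambda>l. real_of_int (z l)) i)\<^sup>2) \<le> real m / 4 * (\<Sum>l<d. (real_of_int (z l))\<^sup>2) \<or>
     4 * real m * (\<Sum>l<d. (real_of_int (z l))\<^sup>2) \<le> (\<Sum>i<m. (bmul d b (\<lambda>l. real_of_int (z l)) i)\<^sup>2))"
  have fin: "finite (int_vectors {..<d} (real K))" by (rule card_int_vectors(1)[of _ 1]) auto
  have finZ: "finite Z" unfolding Z_def using fin by simp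
  have "card Z \<le> card (int_vectors {..<d} (real K))" unfolding Z_def by (rule card_mono[OF fin]) auto
  then have cZ: "real (card Z) \<le> N" using card by linarith
  have "sprob ({..<m} \<times> {..<d}) (\<lambda>b. \<exists>z\<in>Z. P z b) \<le> N * (2 * exp (- 1 / 12) ^ m)"
  proof (rule sprob_union_card[OF finZ _ cZ])
    fix z assume "z \<in> Z"
    then have z: "0 < (\<Sum>l<d. (real_of_int (z l))\<^sup>2)" by (simp add: Z_def)
    show "sprob ({..<m} \<times> {..<d}) (P z) \<le> 2 * exp (- 1 / 12) ^ m"
      unfolding P_def by (rule sprob_disj2[OF row_norm_lower_prob[OF z] row_norm_upper_prob[OF z]])
  qed simp
  moreover have "sprob ({..<m} \<times> {..<d}) (\<lambda>b. \<not> good_on_grid m d K b) \<le> sprob ({..<m} \<times> {..<d}) (\<lambda>b. \<exists>z\<in>Z. P z b)"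
    by (rule sprob_mono) (force simp: good_on_grid_def Z_def P_def not_less)
  ultimately show ?thesis by linarith
qed

lemma card_int_vectors_log:
  assumes K: "real K \<le> K0" "0 < K0" "2 * K0 \<le> real d"
  shows "real (card (int_vectors {..<d} (real K))) \<le> exp (K0 * (3 + ln (real d / K0)))"
proof -
  define x where "x = K0 / real d"
  have dpos: "0 < real d" using K by linarith
  have x: "0 < x" "x \<le> 1 / 2" using K dpos by (auto simp: x_def field_simps)
  \<comment> \<open>With exp (- \<beta>) = K0 / d the d geometric factors contribute only exp (3
    K0), and exp (\<beta> K0) supplies the logarithmic entropy.\<close>
  define \<beta> where "\<beta> = ln (real d / K0)"
  have eb: "exp (- \<beta>) = x" using K(2) dpos by (simp add: \<beta>_def x_def exp_minus)
  have b0: "0 < \<beta>" unfolding \<beta>_def using K dpos by (intro ln_gt_zero) (simp add: field_simps)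
  have "real (card (int_vectors {..<d} (real K))) \<le> exp (\<beta> * real K) * ((1 + exp (- \<beta>)) / (1 - exp (- \<beta>))) ^ card {..<d}"
    by (rule card_int_vectors(2)) (use b0 in auto)
  also have "\<dots> \<le> exp (\<beta> * K0) * exp (3 * x) ^ d"
  proof (rule mult_mono)
    show "exp (\<beta> * real K) \<le> exp (\<beta> * K0)" using K b0 by simp
    have "(1 + x) / (1 - x) \<le> exp (3 * x)"
    proof -
      have 1: "exp (- (2 * x)) \<le> 1 - x"
      proof -
        have "exp (- (2 * x)) \<le> 1 - 2 * x + (2 * x)\<^sup>2 / 2" by (rule exp_minus_le_quadratic) (use x in simp)
        also have "\<dots> \<le> 1 - x"
        proof -
          have "x * (2 * x) \<le> x * 1" using x by (intro mult_left_mono) auto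
          then show ?thesis by (simp add: power2_eq_square)
        qed
        finally show ?thesis .
      qed
      have "1 + x \<le> exp x" by (rule exp_ge_add_one_self)
      also have "exp x = exp (3 * x) * exp (- (2 * x))" by (simp add: exp_add[symmetric])
      also have "\<dots> \<le> exp (3 * x) * (1 - x)" using 1 by (rule mult_left_mono) simp
      finally show ?thesis using x by (simp add: pos_divide_le_eq)
    qed
    then show "((1 + exp (- \<beta>)) / (1 - exp (- \<beta>))) ^ card {..<d} \<le> exp (3 * x) ^ d"
      unfolding eb using x by (simp add: power_mono)
  qed (use x eb in auto)
  also have "exp (3 * x) ^ d = exp (3 * K0)" using dpos by (simp add: exp_of_nat_mult[symmetric] x_def)
  also have "exp (\<beta> * K0) * exp (3 * K0) = exp (K0 * (3 + ln (real d / K0)))"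
    by (simp add: exp_add[symmetric] \<beta>_def algebra_simps)
  finally show ?thesis .
qed

text \<open>The ratio 289/100 is 1.7^2: since ln 6 >= 1.7, the hypothesis m <= d / (ln 6)^2 gives d
  / m >= 2.89 > e. The logarithm is thus bounded away from 0.\<close>

lemma ln_ratio_ge_1:
  assumes "289 * real m \<le> 100 * real d" "0 < m"
  shows "1 \<le> ln (real d / real m)"
proof -
  have "exp 1 \<le> 289 / (100::real)" using e_less_272 by simp
  also have "\<dots> \<le> real d / real m" using assms by (simp add: field_simps)
  finally have "exp 1 \<le> real d / real m" .
  then show ?thesis using assms by (subst ln_ge_iff) (auto intro: less_le_trans[OF exp_gt_zero])
qed

text \<open>The order of sparsity that m measurements can resolve. The factor 10000 makes the
  entropy of the integer vectors at most m / 24, half of the exponent m / 12 for a single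
  vector.\<close>

definition sparsity :: "nat \<Rightarrow> nat \<Rightarrow> real" where
  "sparsity m d = real m / (10000 * ln (real d / real m))"

lemma width_prob:
  assumes md: "289 * real m \<le> 100 * real d" and m: "0 < m" and K: "K = nat \<lfloor>sparsity m d\<rfloor>"
  shows "sprob ({..<m} \<times> {..<d}) (\<lambda>b. \<not> good_on_grid m d K b) \<le> 2 * exp (- real m / 24)"
proof -
  define D where "D = real d / real m"
  define K0 where "K0 = sparsity m d"
  have lD: "1 \<le> ln D" unfolding D_def by (rule ln_ratio_ge_1[OF md m])
  have D1: "1 < D" using md m by (simp add: D_def field_simps)
  have K0: "0 < K0" unfolding K0_def sparsity_def D_def[symmetric] using lD m by (intro divide_pos_pos) auto
  have K0m: "10000 * K0 * ln D = real m" unfolding K0_def sparsity_def D_def[symmetric] using lD by (simp add: field_simps)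
  have "10000 * K0 * 1 \<le> 10000 * K0 * ln D" using lD K0 by (intro mult_left_mono) auto
  then have K0le: "10000 * K0 \<le> real m" using K0m by simp
  have KK: "real K \<le> K0" unfolding K K0_def[symmetric] using K0 by linarith
  have c1: "real (card (int_vectors {..<d} (real K))) \<le> exp (K0 * (3 + ln (real d / K0)))"
    by (rule card_int_vectors_log[OF KK K0]) (use K0le md K0 in linarith)
  have "real d / K0 = D * (10000 * ln D)"
    using K0m K0 m unfolding D_def by (simp add: field_simps)
  then have "ln (real d / K0) = ln D + (ln 10000 + ln (ln D))"
    using D1 lD by (simp add: ln_mult)
  also have "ln (ln D) \<le> ln D" using ln_le_minus_one[of "ln D"] lD by linarith
  also have "ln (10000::real) \<le> 36"
  proof -
    have "ln (10000::real) = ln (10 ^ 4)" by simp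
    also have "\<dots> = 4 * ln 10" by (subst ln_realpow) auto
    also have "ln (10::real) \<le> 9" using ln_le_minus_one[of "10::real"] by simp
    finally show ?thesis by simp
  qed
  finally have "3 + ln (real d / K0) \<le> 39 + 2 * ln D" by simp
  then have "K0 * (3 + ln (real d / K0)) \<le> K0 * (39 * ln D + 2 * ln D)"
    using K0 lD by (intro mult_left_mono) auto
  also have "\<dots> = 41 / 10000 * (10000 * K0 * ln D)" by simp
  also have "\<dots> \<le> real m / 24" unfolding K0m by simp
  finally have "exp (K0 * (3 + ln (real d / K0))) \<le> exp (real m / 24)" by simp
  then have "real (card (int_vectors {..<d} (real K))) \<le> exp (real m / 24)" using c1 by linarith
  from good_on_grid_prob[OF this, of m]
  have "sprob ({..<m} \<times> {..<d}) (\<lambda>b. \<not> good_on_grid m d K b) \<le> exp (real m / 24) * (2 * exp (- 1 / 12) ^ m)" .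
  also have "\<dots> = 2 * exp (- real m / 24)"
    unfolding exp_of_nat_mult[symmetric] by (simp add: exp_add[symmetric])
  finally show ?thesis .
qed

subsection \<open>The quotient property of sign matrices\<close>

text \<open>The dual form of the \<open>l\<^sub>1\<close> quotient property: by duality every \<open>y\<close> is the image of some \<open>u\<close>
  with \<open>\<bar>u\<bar>\<^sub>1 \<le> R \<bar>y\<bar>\<^sub>\<infinity>\<close>, so that measurement errors can be absorbed into the vector to be recovered.\<close>

definition quotient_property :: "nat \<Rightarrow> nat \<Rightarrow> real \<Rightarrow> (nat \<times> nat \<Rightarrow> real) \<Rightarrow> bool" where
  "quotient_property m d R b \<longleftrightarrow> (\<forall>t M. 0 \<le> M \<longrightarrow> (\<forall>l<d. \<bar>bmul_t {..<m} b t l\<bar> \<le> M) \<longrightarrow> (\<Sum>i<m. \<bar>t i\<bar>) \<le> R * M)"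

text \<open>Needed for rounding remainders, which lie in the cube; sign vectors are its vertices, so
  finitely many conditions are enough (\<open>col_bound_sup\<close>).\<close>

definition col_bound :: "nat set \<Rightarrow> nat \<Rightarrow> (nat \<times> nat \<Rightarrow> real) \<Rightarrow> bool" where
  "col_bound g d b \<longleftrightarrow> (\<forall>e\<in>signs g. (\<Sum>l<d. (bmul_t g b e l)\<^sup>2) < 8 * real (card g) * real d)"

lemma col_bound_prob:
  assumes g: "finite g" "g \<noteq> {}"
  shows "sprob (g \<times> {..<d}) (\<lambda>b. \<not> col_bound g d b) \<le> 2 ^ card g * exp (- 3 / 2 * real d)"
proof -
  have cg: "0 < card g" using g by (simp add: card_gt_0_iff)
  have "sprob (g \<times> {..<d}) (\<lambda>b. \<exists>e\<in>signs g. 8 * real (card g) * real d \<le> (\<Sum>l<d. (bmul_t g b e l)\<^sup>2))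
    \<le> 2 ^ card g * exp (- 3 / 2 * real d)"
  proof (rule sprob_union_card)
    fix e assume e: "e \<in> signs g"
    have "(\<Sum>i\<in>g. (e i)\<^sup>2) = real (card g)" using signs_square[OF e] by (simp add: power2_eq_square)
    then have "sprob (\<Union>l\<in>{..<d}. g \<times> {l}) (\<lambda>b. 8 * real (card g) * real (card {..<d}) \<le> (\<Sum>l\<in>{..<d}. (\<Sum>p\<in>g \<times> {l}. b p * e (fst p))\<^sup>2))
      \<le> (sqrt 2 * exp (- 8 / 4)) ^ card {..<d}"
      by (intro sum_squares_upper) (use g cg in \<open>auto simp: sum_col\<close>)
    also have "\<dots> \<le> exp (- 3 / 2) ^ d"
    proof -
      have "sqrt 2 * exp (- 8 / 4) \<le> exp (25 / 72) * exp (- 8 / 4)" using sqrt2_le_exp by (rule mult_right_mono) simp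
      also have "\<dots> \<le> exp (- 3 / 2)" unfolding exp_add[symmetric] by simp
      finally show ?thesis by (simp add: power_mono)
    qed
    also have "exp (- 3 / 2) ^ d = exp (- 3 / 2 * real d)" by (simp add: exp_of_nat_mult[symmetric] mult.commute)
    finally show "sprob (g \<times> {..<d}) (\<lambda>b. 8 * real (card g) * real d \<le> (\<Sum>l<d. (bmul_t g b e l)\<^sup>2)) \<le> exp (- 3 / 2 * real d)"
      unfolding grid_cols bmul_t_col by simp
  qed (use g in \<open>auto simp: finite_signs card_signs\<close>)
  moreover have "(\<lambda>b. \<not> col_bound g d b) = (\<lambda>b. \<exists>e\<in>signs g. 8 * real (card g) * real d \<le> (\<Sum>l<d. (bmul_t g b e l)\<^sup>2))"
    by (auto simp: col_bound_def not_less)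
  ultimately show ?thesis by simp
qed

lemma bmul_t_pairing:
  "(\<Sum>l<d. bmul_t g b t l * y l) = (\<Sum>i\<in>g. t i * (\<Sum>l<d. b (i, l) * y l))"
proof -
  have "(\<Sum>l<d. bmul_t g b t l * y l) = (\<Sum>l<d. \<Sum>i\<in>g. b (i, l) * t i * y l)"
    by (simp add: bmul_t_def sum_distrib_right)
  also have "\<dots> = (\<Sum>i\<in>g. \<Sum>l<d. b (i, l) * t i * y l)" by (rule sum.swap)
  finally show ?thesis by (simp add: sum_distrib_left mult_ac)
qed

text \<open>A norm is maximal on a cube at a vertex. The vertex \<open>e\<close> is selected by the
  functional dual to the image of \<open>r\<close> itself, and one factor of the norm is cancelled
  at the end.\<close>

lemma col_bound_sup:
  assumes g: "finite g" and cb: "col_bound g d b" and r: "\<And>i. i \<in> g \<Longrightarrow> \<bar>r i\<bar> \<le> 1"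
  shows "L2_set (bmul_t g b r) {..<d} \<le> sqrt (8 * real (card g) * real d)"
proof -
  define y where "y = bmul_t g b r"
  define a where "a = (\<lambda>i. \<Sum>l<d. b (i, l) * y l)"
  define e where "e = restrict (\<lambda>i. if 0 \<le> a i then 1 else - 1 :: real) g"
  have eS: "e \<in> signs g" by (auto simp: e_def signs_def)
  have "(L2_set y {..<d})\<^sup>2 = (\<Sum>l<d. y l * y l)" by (simp add: L2_set_def sum_nonneg power2_eq_square)
  also have "\<dots> = (\<Sum>i\<in>g. r i * a i)" unfolding a_def by (subst (1) y_def) (rule bmul_t_pairing)
  also have "\<dots> \<le> (\<Sum>i\<in>g. e i * a i)"
  proof (rule sum_mono)
    fix i assume i: "i \<in> g"
    have "\<bar>r i\<bar> * \<bar>a i\<bar> \<le> 1 * \<bar>a i\<bar>" using r[OF i] by (rule mult_right_mono) simp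
    moreover have "e i * a i = \<bar>a i\<bar>" using i by (simp add: e_def)
    ultimately show "r i * a i \<le> e i * a i" using abs_ge_self[of "r i * a i"] by (simp add: abs_mult)
  qed
  also have "\<dots> = (\<Sum>l<d. bmul_t g b e l * y l)" unfolding a_def by (rule bmul_t_pairing[symmetric])
  also have "\<dots> \<le> (\<Sum>l<d. \<bar>bmul_t g b e l\<bar> * \<bar>y l\<bar>)" by (rule sum_mono) (metis abs_ge_self abs_mult)
  also have "\<dots> \<le> L2_set (bmul_t g b e) {..<d} * L2_set y {..<d}" by (rule L2_set_mult_ineq)
  also have "\<dots> \<le> sqrt (8 * real (card g) * real d) * L2_set y {..<d}"
  proof (rule mult_right_mono)
    show "L2_set (bmul_t g b e) {..<d} \<le> sqrt (8 * real (card g) * real d)"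
      unfolding L2_set_def using cb eS by (intro real_sqrt_le_mono) (auto simp: col_bound_def less_imp_le)
  qed simp
  finally have "L2_set y {..<d} * L2_set y {..<d} \<le> sqrt (8 * real (card g) * real d) * L2_set y {..<d}"
    by (simp add: power2_eq_square)
  then have "L2_set y {..<d} \<le> sqrt (8 * real (card g) * real d)"
    by (cases "L2_set y {..<d} = 0") (auto simp: less_le)
  then show ?thesis by (simp add: y_def)
qed

text \<open>The distance of combinations of the rows in \<open>g\<close> from the span of the other rows.\<close>

definition block_far :: "nat \<Rightarrow> nat set \<Rightarrow> nat \<Rightarrow> (nat \<times> nat \<Rightarrow> real) \<Rightarrow> bool" where
  "block_far m g d b \<longleftrightarrow> (\<forall>z\<in>int_vectors g (10 * real (card g)). \<forall>u. 0 < (\<Sum>i\<in>g. (real_of_int (z i))\<^sup>2) \<longrightarrow>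
     1 / 5 * (\<Sum>i\<in>g. (real_of_int (z i))\<^sup>2) * real d <
     (\<Sum>l<d. (bmul_t g b (\<lambda>i. real_of_int (z i)) l + bmul_t ({..<m} - g) b u l)\<^sup>2))"

lemma combination_far:
  assumes V: "orthonormal_columns d r V" and w: "\<And>l. l < d \<Longrightarrow> w l = (\<Sum>i<r. c i * V l i)"
  shows "ip d x x - (\<Sum>i<r. (ip d (\<lambda>l. V l i) x)\<^sup>2) \<le> ip d (\<lambda>l. x l + w l) (\<lambda>l. x l + w l)"
proof -
  have xw: "ip d x w = (\<Sum>i<r. c i * ip d (\<lambda>l. V l i) x)"
  proof -
    have "ip d x w = ip d x (\<lambda>l. \<Sum>i<r. c i * V l i)" by (rule ip_cong) (use w in auto)
    then show ?thesis by (simp add: ip_linear ip_commute[of d x])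
  qed
  have ww: "ip d w w = (\<Sum>i<r. (c i)\<^sup>2)"
  proof -
    have "ip d w w = ip d (\<lambda>l. \<Sum>i<r. c i * V l i) (\<lambda>l. \<Sum>i<r. c i * V l i)" by (rule ip_cong) (use w in auto)
    then show ?thesis by (simp only: orthonormal_combination_norm[OF V])
  qed
  have "ip d (\<lambda>l. x l + w l) (\<lambda>l. x l + w l) = ip d x x + 2 * ip d x w + ip d w w"
    by (simp add: ip_linear ip_commute[of d w x])
  also have "\<dots> - (ip d x x - (\<Sum>i<r. (ip d (\<lambda>l. V l i) x)\<^sup>2)) = (\<Sum>i<r. (ip d (\<lambda>l. V l i) x + c i)\<^sup>2)"
    unfolding xw ww by (simp add: power2_sum sum.distrib sum_distrib_left mult_ac)
  moreover have "\<dots> \<ge> 0" by (simp add: sum_nonneg)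
  ultimately show ?thesis by linarith
qed

text \<open>The squared norm has mean s d and its projection to r dimensions has mean s r, with r <=
  100 d / 289. The norm is kept above 4/5 s d and the projection below 3/5 s d, which leaves 1/5 s d
  for the residual.\<close>

lemma block_far_fixed:
  assumes g: "finite g" and V: "orthonormal_columns d r V" and r: "289 * real r \<le> 100 * real d"
    and z: "0 < (\<Sum>i\<in>g. (z i)\<^sup>2)"
  shows "sprob (g \<times> {..<d}) (\<lambda>b. ip d (bmul_t g b z) (bmul_t g b z) - (\<Sum>i<r. (ip d (\<lambda>l. V l i) (bmul_t g b z))\<^sup>2)
      \<le> 1 / 5 * (\<Sum>i\<in>g. (z i)\<^sup>2) * real d) \<le> 2 * exp (- real d / 150)"
proof -
  define s where "s = (\<Sum>i\<in>g. (z i)\<^sup>2)"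
  have s0: "0 < s" using z by (simp add: s_def)
  let ?X = "\<lambda>b. bmul_t g b z"
  have A: "sprob (g \<times> {..<d}) (\<lambda>b. ip d (?X b) (?X b) \<le> 4 / 5 * s * real d) \<le> exp (- real d / 150)"
  proof -
    have "sprob (\<Union>l\<in>{..<d}. g \<times> {l}) (\<lambda>b. (\<Sum>l\<in>{..<d}. (\<Sum>p\<in>g \<times> {l}. b p * z (fst p))\<^sup>2) \<le> 4 / 5 * s * real (card {..<d}))
      \<le> exp (- (1 / 15) + 3 / 2 * (1 / 15)\<^sup>2 + 1 / 15 * (4 / 5)) ^ card {..<d}"
      by (rule sum_squares_lower) (use g s0 in \<open>auto simp: sum_col s_def\<close>)
    also have "- (1 / 15) + 3 / 2 * (1 / 15)\<^sup>2 + 1 / 15 * (4 / 5) = (- 1 / 150 :: real)" by (simp add: power2_eq_square)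
    also have "exp (- 1 / 150) ^ card {..<d} = exp (- real d / 150)" by (simp add: exp_of_nat_mult[symmetric])
    finally show ?thesis unfolding grid_cols bmul_t_col ip_self by simp
  qed
  have B: "sprob (g \<times> {..<d}) (\<lambda>b. 3 / 5 * s * real d \<le> (\<Sum>i<r. (ip d (\<lambda>l. V l i) (?X b))\<^sup>2)) \<le> exp (- real d / 150)"
  proof -
    define l where "l = 1 / (4 * s)"
    have l: "0 \<le> l" "2 * l * (sqrt s)\<^sup>2 = 1 / 2" using s0 by (auto simp: l_def)
    have l2: "2 * l * (sqrt s)\<^sup>2 < 1" unfolding l(2) by simp
    have sub: "avg (g \<times> {..<d}) (\<lambda>b. exp (ip d (?X b) y)) \<le> exp ((sqrt s)\<^sup>2 / 2 * ip d y y)" for y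
    proof -
      have "ip d (?X b) y = (\<Sum>p\<in>g \<times> {..<d}. b p * (z (fst p) * y (snd p)))" for b
      proof -
        have "ip d (?X b) y = (\<Sum>l<d. \<Sum>i\<in>g. b (i, l) * (z i * y l))"
          by (simp add: ip_def bmul_t_def sum_distrib_left sum_distrib_right mult_ac)
        also have "\<dots> = (\<Sum>i\<in>g. \<Sum>l<d. b (i, l) * (z i * y l))" by (rule sum.swap)
        finally show ?thesis by (simp add: sum.cartesian_product')
      qed
      then have "avg (g \<times> {..<d}) (\<lambda>b. exp (ip d (?X b) y)) \<le> exp ((\<Sum>p\<in>g \<times> {..<d}. (z (fst p) * y (snd p))\<^sup>2) / 2)"
        using avg_exp_linear[of "g \<times> {..<d}" "\<lambda>p. z (fst p) * y (snd p)"] g by simp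
      also have "(\<Sum>p\<in>g \<times> {..<d}. (z (fst p) * y (snd p))\<^sup>2) = s * ip d y y"
        by (simp add: sum.cartesian_product' s_def ip_self sum_product power_mult_distrib)
      finally show ?thesis using s0 by simp
    qed
    have E: "avg (g \<times> {..<d}) (\<lambda>b. exp (l * (\<Sum>i<r. (ip d (\<lambda>j. V j i) (?X b))\<^sup>2))) \<le> sqrt 2 ^ r"
    proof -
      have "avg (g \<times> {..<d}) (\<lambda>b. exp (l * (\<Sum>i<r. (ip d (\<lambda>j. V j i) (?X b))\<^sup>2) + ip d (?X b) (\<lambda>_. 0)))
        \<le> (1 / sqrt (1 - 2 * l * (sqrt s)\<^sup>2)) ^ r *
        exp ((sqrt s)\<^sup>2 / 2 * ip d (\<lambda>_. 0) (\<lambda>_. 0) + (2 * l * (sqrt s) ^ 4 / (1 - 2 * l * (sqrt s)\<^sup>2)) / 2 * (\<Sum>i<r. (ip d (\<lambda>j. V j i) (\<lambda>_. 0))\<^sup>2))"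
        by (rule subgaussian_projection[OF sub V l(1) l2])
      moreover have "ip d x (\<lambda>_. 0) = 0" for x by (simp add: ip_def)
      moreover have "1 / sqrt (1 - 2 * l * (sqrt s)\<^sup>2) = sqrt 2" unfolding l(2) by (simp add: real_sqrt_divide)
      ultimately show ?thesis by simp
    qed
    have "sprob (g \<times> {..<d}) (\<lambda>b. 3 / 5 * s * real d \<le> (\<Sum>i<r. (ip d (\<lambda>l. V l i) (?X b))\<^sup>2))
      \<le> avg (g \<times> {..<d}) (\<lambda>b. exp (l * (\<Sum>i<r. (ip d (\<lambda>j. V j i) (?X b))\<^sup>2))) / exp (3 / 20 * real d)"
    proof (rule sprob_markov_scaled)
      fix b assume "3 / 5 * s * real d \<le> (\<Sum>i<r. (ip d (\<lambda>l. V l i) (?X b))\<^sup>2)"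
      then have "l * (3 / 5 * s * real d) \<le> l * (\<Sum>i<r. (ip d (\<lambda>l. V l i) (?X b))\<^sup>2)" using l(1) by (rule mult_left_mono)
      then show "exp (3 / 20 * real d) \<le> exp (l * (\<Sum>i<r. (ip d (\<lambda>j. V j i) (?X b))\<^sup>2))"
        using s0 by (simp add: l_def)
    qed auto
    also have "\<dots> \<le> exp (25 / 72) ^ r / exp (3 / 20 * real d)"
      using E power_mono[OF sqrt2_le_exp, of r] by (intro divide_right_mono) auto
    also have "\<dots> = exp (25 / 72 * real r - 3 / 20 * real d)"
      by (simp add: exp_diff exp_of_nat_mult[symmetric] mult.commute)
    also have "\<dots> \<le> exp (- real d / 150)" using r by simp
    finally show ?thesis .
  qed
  have "sprob (g \<times> {..<d}) (\<lambda>b. ip d (?X b) (?X b) - (\<Sum>i<r. (ip d (\<lambda>l. V l i) (?X b))\<^sup>2) \<le> 1 / 5 * s * real d)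
    \<le> sprob (g \<times> {..<d}) (\<lambda>b. ip d (?X b) (?X b) \<le> 4 / 5 * s * real d \<or> 3 / 5 * s * real d \<le> (\<Sum>i<r. (ip d (\<lambda>l. V l i) (?X b))\<^sup>2))"
    by (rule sprob_mono) linarith
  also have "\<dots> \<le> 2 * exp (- real d / 150)"
    by (rule sprob_disj2[OF A B])
  finally show ?thesis by (simp add: s_def)
qed

text \<open>With \<beta> = 1/10 the radius contributes exp (card g), and each coordinate at most 25
  <= exp 4.\<close>

lemma card_int_vectors_tenth:
  assumes "finite g"
  shows "real (card (int_vectors g (10 * real (card g)))) \<le> exp (5 * real (card g))"
proof -
  have "real (card (int_vectors g (10 * real (card g)))) \<le> exp (1 / 10 * (10 * real (card g))) * ((1 + exp (- (1 / 10))) / (1 - exp (- (1 / 10)))) ^ card g"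
    by (rule card_int_vectors(2)[OF assms]) simp
  also have "\<dots> \<le> exp (1 / 10 * (10 * real (card g))) * (exp 4) ^ card g"
  proof (rule mult_left_mono[OF power_mono])
    have e1: "exp (- (1 / 10)) \<le> (1 - 1 / 10 + (1 / 10)\<^sup>2 / 2 :: real)" by (rule exp_minus_le_quadratic) simp
    then have e2: "exp (- (1 / 10)) \<le> (905 / 1000 :: real)" by (simp add: power2_eq_square)
    have "(1 + exp (- (1 / 10))) / (1 - exp (- (1 / 10))) \<le> (25::real)"
      using e2 by (subst pos_divide_le_eq) (auto intro: le_less_trans[OF e2])
    also have "(25::real) \<le> exp 4"
    proof -
      have "(5::real) \<le> exp 2" using exp_lower_Taylor_quadratic[of 2] by simp
      then have "(5::real) * 5 \<le> exp 2 * exp 2" by (intro mult_mono) auto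
      then show ?thesis by (simp add: exp_add[symmetric])
    qed
    finally show "(1 + exp (- (1 / 10))) / (1 - exp (- (1 / 10))) \<le> exp (4::real)" .
    show "0 \<le> (1 + exp (- (1 / 10))) / (1 - exp (- (1 / 10 :: real)))" by simp
  qed simp
  also have "\<dots> = exp (5 * real (card g))"
    by (simp add: exp_of_nat_mult[symmetric] exp_add[symmetric])
  finally show ?thesis .
qed

text \<open>The rows outside \<open>g\<close> are frozen; their span has dimension at most m and
  does not depend on the rows in \<open>g\<close>. This is why \<open>block_far\<close> can allow
  arbitrary real coefficients \<open>u\<close> outside \<open>g\<close> without any discretization
  of them.\<close>

lemma block_far_prob:
  assumes g: "g \<subseteq> {..<m}" and md: "289 * real m \<le> 100 * real d"
  shows "sprob ({..<m} \<times> {..<d}) (\<lambda>b. \<not> block_far m g d b) \<le> exp (5 * real (card g)) * (2 * exp (- real d / 150))"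
proof -
  have fg: "finite g" using g finite_subset by blast
  define og where "og = {..<m} - g"
  have fo: "finite og" by (simp add: og_def)
  define Z where "Z = {z \<in> int_vectors g (10 * real (card g)). 0 < (\<Sum>i\<in>g. (real_of_int (z i))\<^sup>2)}"
  have finI: "finite (int_vectors g (10 * real (card g)))" by (rule card_int_vectors(1)[OF fg, of 1]) simp
  have finZ: "finite Z" using finI by (simp add: Z_def)
  have "card Z \<le> card (int_vectors g (10 * real (card g)))" unfolding Z_def by (rule card_mono[OF finI]) auto
  then have cZ: "real (card Z) \<le> exp (5 * real (card g))" using card_int_vectors_tenth[OF fg] by linarith
  have split: "{..<m} \<times> {..<d} = (og \<times> {..<d}) \<union> (g \<times> {..<d})" using g by (auto simp: og_def)
  have disj: "(og \<times> {..<d}) \<inter> (g \<times> {..<d}) = {}" by (auto simp: og_def)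
  have inner: "sprob (g \<times> {..<d}) (\<lambda>c. \<not> block_far m g d (\<lambda>i. if i \<in> g \<times> {..<d} then c i else b i))
    \<le> exp (5 * real (card g)) * (2 * exp (- real d / 150))" for b
  proof -
    obtain ix where ix: "bij_betw ix {..<card og} og" using fo ex_bij_betw_nat_finite[OF fo] by (auto simp: atLeast0LessThan)
    obtain r V where r: "r \<le> card og" and V: "orthonormal_columns d r V"
      and sp: "\<forall>a<card og. \<exists>c. \<forall>l<d. b (ix a, l) = (\<Sum>i<r. c i * V l i)"
      using orthonormal_span_exists[of "card og" d "\<lambda>a l. b (ix a, l)"] by auto
    have "card og \<le> m" unfolding og_def using card_mono[of "{..<m}" "{..<m} - g"] by auto
    then have rd: "289 * real r \<le> 100 * real d" using r md by linarith
    obtain cc where cc: "\<And>a l. a < card og \<Longrightarrow> l < d \<Longrightarrow> b (ix a, l) = (\<Sum>i<r. cc a i * V l i)"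
      using sp by metis
    have comb: "\<exists>c. \<forall>l<d. bmul_t og b u l = (\<Sum>i<r. c i * V l i)" for u
    proof (intro exI allI impI)
      fix l assume l: "l < d"
      have "bmul_t og b u l = (\<Sum>a<card og. b (ix a, l) * u (ix a))"
        unfolding bmul_t_def by (rule sum.reindex_bij_betw[OF ix, symmetric])
      also have "\<dots> = (\<Sum>a<card og. \<Sum>i<r. cc a i * u (ix a) * V l i)"
        using l by (simp add: cc sum_distrib_left sum_distrib_right mult_ac)
      also have "\<dots> = (\<Sum>i<r. \<Sum>a<card og. cc a i * u (ix a) * V l i)" by (rule sum.swap)
      finally show "bmul_t og b u l = (\<Sum>i<r. (\<Sum>a<card og. cc a i * u (ix a)) * V l i)"
        by (simp add: sum_distrib_right)
    qed
    let ?m = "\<lambda>c i. if i \<in> g \<times> {..<d} then c i else b i"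
    let ?P = "\<lambda>z c. ip d (bmul_t g c (\<lambda>i. real_of_int (z i))) (bmul_t g c (\<lambda>i. real_of_int (z i)))
      - (\<Sum>i<r. (ip d (\<lambda>l. V l i) (bmul_t g c (\<lambda>i. real_of_int (z i))))\<^sup>2) \<le> 1 / 5 * (\<Sum>i\<in>g. (real_of_int (z i))\<^sup>2) * real d"
    have "sprob (g \<times> {..<d}) (\<lambda>c. \<not> block_far m g d (?m c)) \<le> sprob (g \<times> {..<d}) (\<lambda>c. \<exists>z\<in>Z. ?P z c)"
    proof (rule sprob_mono)
      fix c assume "\<not> block_far m g d (?m c)"
      then have "\<exists>z\<in>Z. \<exists>u. \<not> (1 / 5 * (\<Sum>i\<in>g. (real_of_int (z i))\<^sup>2) * real d
          < (\<Sum>l<d. (bmul_t g (?m c) (\<lambda>i. real_of_int (z i)) l + bmul_t og (?m c) u l)\<^sup>2))"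
        unfolding block_far_def og_def Z_def by blast
      then obtain z u where z: "z \<in> Z" and le: "(\<Sum>l<d. (bmul_t g (?m c) (\<lambda>i. real_of_int (z i)) l + bmul_t og (?m c) u l)\<^sup>2)
          \<le> 1 / 5 * (\<Sum>i\<in>g. (real_of_int (z i))\<^sup>2) * real d"
        using not_less by blast
      let ?x = "bmul_t g c (\<lambda>i. real_of_int (z i))" and ?w = "bmul_t og b u"
      obtain c' where c': "\<And>l. l < d \<Longrightarrow> ?w l = (\<Sum>i<r. c' i * V l i)" using comb[of u] by blast
      have e1: "bmul_t g (?m c) (\<lambda>i. real_of_int (z i)) l = ?x l" if "l < d" for l
        unfolding bmul_t_def using that by (intro sum.cong) auto
      have e2: "bmul_t og (?m c) u l = ?w l" if "l < d" for l
        unfolding bmul_t_def by (intro sum.cong) (auto simp: og_def)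
      have "(\<Sum>l<d. (bmul_t g (?m c) (\<lambda>i. real_of_int (z i)) l + bmul_t og (?m c) u l)\<^sup>2) = ip d (\<lambda>l. ?x l + ?w l) (\<lambda>l. ?x l + ?w l)"
        unfolding ip_self by (rule sum.cong) (auto simp: e1 e2)
      then have "?P z c" using combination_far[OF V c', of ?x] le by linarith
      then show "\<exists>z\<in>Z. ?P z c" using z by blast
    qed
    also have "\<dots> \<le> exp (5 * real (card g)) * (2 * exp (- real d / 150))"
    proof (rule sprob_union_card[OF finZ _ cZ])
      fix z assume "z \<in> Z"
      then have "0 < (\<Sum>i\<in>g. (real_of_int (z i))\<^sup>2)" by (simp add: Z_def)
      then show "sprob (g \<times> {..<d}) (?P z) \<le> 2 * exp (- real d / 150)" by (rule block_far_fixed[OF fg V rd])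
    qed simp
    finally show ?thesis .
  qed
  have "sprob ({..<m} \<times> {..<d}) (\<lambda>b. \<not> block_far m g d b)
    = avg (og \<times> {..<d}) (\<lambda>b. sprob (g \<times> {..<d}) (\<lambda>c. \<not> block_far m g d (\<lambda>i. if i \<in> g \<times> {..<d} then c i else b i)))"
    unfolding sprob_def split by (rule avg_split) (use fo fg disj in auto)
  also have "\<dots> \<le> avg (og \<times> {..<d}) (\<lambda>b. exp (5 * real (card g)) * (2 * exp (- real d / 150)))"
    by (rule avg_mono) (rule inner)
  also have "\<dots> = exp (5 * real (card g)) * (2 * exp (- real d / 150))" using fo by (simp add: avg_const)
  finally show ?thesis .
qed

lemma bmul_t_scale: "bmul_t g b (\<lambda>i. c * t i) l = c * bmul_t g b t l"
  by (simp add: bmul_t_def sum_distrib_left mult_ac)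

lemma bmul_t_split:
  assumes "g \<subseteq> {..<m}"
  shows "bmul_t {..<m} b t l = bmul_t g b t l + bmul_t ({..<m} - g) b t l"
  unfolding bmul_t_def using sum.subset_diff[OF assms, of "\<lambda>i. b (i, l) * t i"] by simp

text \<open>Let |t|_1 = n on the block of n rows and round 10 t. The integer part has squared norm
  at least 81 n, so its distance from the other rows is at least 4 sqrt (n d), as 81 / 5 > 16. The
  rounding remainder moves the image by at most 3 sqrt (n d). What is left, sqrt (n d) >= n, bounds
  10 |B^T t| from below.\<close>

lemma block_lower_bound:
  assumes far: "block_far m g d b" and cb: "col_bound g d b" and g: "g \<subseteq> {..<m}" and md: "m \<le> d"
  shows "(\<Sum>i\<in>g. \<bar>t i\<bar>) \<le> 10 * L2_set (bmul_t {..<m} b t) {..<d}"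
proof -
  have fg: "finite g" using g finite_subset by blast
  define n where "n = card g"
  have nd: "real n \<le> real d" using card_mono[OF _ g] md by (simp add: n_def)
  have main: "real n \<le> 10 * L2_set (bmul_t {..<m} b t) {..<d}"
    if tn: "(\<Sum>i\<in>g. \<bar>t i\<bar>) = real n" and npos: "0 < n" for t
  proof -
    define z where "z = restrict (\<lambda>i. truncate (10 * t i)) g"
    define zr where "zr = (\<lambda>i. real_of_int (z i))"
    define r where "r = (\<lambda>i. 10 * t i - zr i)"
    define u where "u = (\<lambda>i. 10 * t i)"
    have zI: "z \<in> int_vectors g (10 * real (card g))" unfolding z_def
      by (rule truncate_vector) (simp add: abs_mult sum_distrib_left[symmetric] tn n_def)
    have r1: "\<bar>r i\<bar> \<le> 1" if "i \<in> g" for i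
      using truncate_bounds[of "10 * t i"] that by (simp add: r_def zr_def z_def)
    define s where "s = (\<Sum>i\<in>g. (zr i)\<^sup>2)"
    have "10 * real n - real n \<le> (\<Sum>i\<in>g. \<bar>zr i\<bar>)"
    proof -
      have "(\<Sum>i\<in>g. 10 * \<bar>t i\<bar> - 1) \<le> (\<Sum>i\<in>g. \<bar>zr i\<bar>)"
        by (rule sum_mono) (use r1 in \<open>force simp: r_def\<close>)
      then show ?thesis by (simp add: sum_subtractf sum_distrib_left[symmetric] tn n_def)
    qed
    then have z9: "9 * real n \<le> (\<Sum>i\<in>g. \<bar>zr i\<bar>)" by simp
    have "(\<Sum>i\<in>g. \<bar>zr i\<bar>)\<^sup>2 \<le> s * real n"
      using Cauchy_Schwarz_ineq_sum[of "\<lambda>i. \<bar>zr i\<bar>" "\<lambda>_. 1" g] by (simp add: s_def n_def)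
    then have "(9 * real n)\<^sup>2 \<le> s * real n" using power_mono[OF z9, of 2] by simp
    then have s81: "81 * real n \<le> s" using npos by (simp add: power2_eq_square)
    have s0: "0 < s" using s81 npos by simp
    have far': "1 / 5 * s * real d < (\<Sum>l<d. (bmul_t g b zr l + bmul_t ({..<m} - g) b u l)\<^sup>2)"
      using far zI s0 unfolding block_far_def s_def zr_def by blast
    have "16 * (real n * real d) \<le> 1 / 5 * s * real d"
      using s81 mult_right_mono[of "80 * real n" s "real d"] by simp
    then have "sqrt (16 * (real n * real d)) \<le> L2_set (\<lambda>l. bmul_t g b zr l + bmul_t ({..<m} - g) b u l) {..<d}"
      using far' unfolding L2_set_def by (intro real_sqrt_le_mono) simp
    then have big: "4 * sqrt (real n * real d) \<le> L2_set (\<lambda>l. bmul_t g b zr l + bmul_t ({..<m} - g) b u l) {..<d}"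
      by (simp add: real_sqrt_mult)
    have "L2_set (bmul_t g b r) {..<d} \<le> sqrt (8 * real (card g) * real d)" by (rule col_bound_sup[OF fg cb r1])
    also have "\<dots> \<le> sqrt (9 * (real n * real d))" by (intro real_sqrt_le_mono) (simp add: n_def)
    finally have small: "L2_set (bmul_t g b r) {..<d} \<le> 3 * sqrt (real n * real d)"
      by (simp add: real_sqrt_mult)
    have dec: "bmul_t g b zr l + bmul_t ({..<m} - g) b u l = bmul_t {..<m} b u l - bmul_t g b r l" for l
    proof -
      have "bmul_t g b u l = bmul_t g b zr l + bmul_t g b r l"
        unfolding bmul_t_def sum.distrib[symmetric] by (simp add: u_def r_def algebra_simps)
      then show ?thesis unfolding bmul_t_split[OF g, of b u] by simp
    qed
    have "4 * sqrt (real n * real d) \<le> L2_set (bmul_t {..<m} b u) {..<d} + L2_set (bmul_t g b r) {..<d}"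
      using big L2_triangle_diff[of "bmul_t {..<m} b u" "bmul_t g b r" "{..<d}"] unfolding dec by linarith
    moreover have "L2_set (bmul_t {..<m} b u) {..<d} = 10 * L2_set (bmul_t {..<m} b t) {..<d}"
      unfolding u_def bmul_t_scale L2_scale by simp
    moreover have "real n \<le> sqrt (real n * real d)"
      by (rule real_le_rsqrt) (use nd in \<open>simp add: power2_eq_square mult_left_mono\<close>)
    ultimately show ?thesis using small by linarith
  qed
  define S where "S = (\<Sum>i\<in>g. \<bar>t i\<bar>)"
  show ?thesis
  proof (cases "S = 0")
    case True
    then show ?thesis by (simp add: S_def)
  next
    case False
    then have S: "0 < S" unfolding S_def by (simp add: less_le sum_nonneg)
    have "g \<noteq> {}" using False by (auto simp: S_def)
    then have npos: "0 < n" using fg by (simp add: n_def card_gt_0_iff)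
    define c where "c = real n / S"
    have c: "0 < c" "c * S = real n" using S npos by (auto simp: c_def)
    have "(\<Sum>i\<in>g. \<bar>c * t i\<bar>) = real n" using c by (simp add: abs_mult sum_distrib_left[symmetric] S_def)
    from main[OF this npos] have "c * S \<le> c * (10 * L2_set (bmul_t {..<m} b t) {..<d})"
      unfolding bmul_t_scale L2_scale c(2) using c(1) by simp
    then show ?thesis using c(1) by (simp add: S_def)
  qed
qed

definition residue_block :: "nat \<Rightarrow> nat \<Rightarrow> nat \<Rightarrow> nat set" where
  "residue_block m T c = {i \<in> {..<m}. i mod T = c}"

lemma residue_block_facts:
  assumes T: "0 < T"
  shows "(\<Union>c\<in>{..<T}. residue_block m T c) = {..<m}" "finite (residue_block m T c)"
    "c \<noteq> c' \<Longrightarrow> residue_block m T c \<inter> residue_block m T c' = {}"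
    "card (residue_block m T c) \<le> m div T + 1"
    "(\<Sum>i<m. f i) = (\<Sum>c<T. \<Sum>i\<in>residue_block m T c. f i :: real)"
proof -
  show U: "(\<Union>c\<in>{..<T}. residue_block m T c) = {..<m}" using T by (auto simp: residue_block_def)
  show fin: "finite (residue_block m T c)" for c by (simp add: residue_block_def)
  show disj: "c \<noteq> c' \<Longrightarrow> residue_block m T c \<inter> residue_block m T c' = {}" for c c'
    by (auto simp: residue_block_def)
  have "inj_on (\<lambda>i. i div T) (residue_block m T c)"
    by (rule inj_onI) (metis (mono_tags, lifting) div_mult_mod_eq mem_Collect_eq residue_block_def)
  moreover have "(\<lambda>i. i div T) ` residue_block m T c \<subseteq> {..m div T}"
    by (auto simp: residue_block_def div_le_mono)
  ultimately have "card (residue_block m T c) \<le> card {..m div T}" by (rule card_inj_on_le) simp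
  then show "card (residue_block m T c) \<le> m div T + 1" by simp
  show "(\<Sum>i<m. f i) = (\<Sum>c<T. \<Sum>i\<in>residue_block m T c. f i)"
    unfolding U[symmetric] by (rule sum.UNION_disjoint) (use fin disj in auto)
qed

text \<open>Treating all rows at once would set entropy 5 m against the exponent d / 150, which
  fails when d is only about 3 m. Splitting the rows into blocks makes the entropy small and costs a
  constant factor, since the l1 norms of the blocks are added.\<close>

lemma quotient_property_moderate:
  assumes md: "289 * real m \<le> 100 * real d"
  shows "sprob ({..<m} \<times> {..<d}) (\<lambda>b. \<not> quotient_property m d (6000 * sqrt (real d)) b)
    \<le> 1800 * exp (5 - real m / 100)"
proof -
  \<comment> \<open>Blocks have at most m / 600 + 1 rows, so 5 card g <= m / 120 + 5, while d / 150
    >= 2.89 m / 150; the difference is at most 5 - m / 100. The factor 6000 is 600 times the 10 of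
    \<open>block_lower_bound\<close>.\<close>
  define T where "T = (600::nat)"
  have T: "0 < T" by (simp add: T_def)
  define J where "J = {c \<in> {..<T}. residue_block m T c \<noteq> {}}"
  define bad where "bad = (\<lambda>c b. \<not> block_far m (residue_block m T c) d b \<or> \<not> col_bound (residue_block m T c) d b)"
  have md': "m \<le> d" using md by linarith
  have sub: "residue_block m T c \<subseteq> {..<m}" for c by (auto simp: residue_block_def)
  have "sprob ({..<m} \<times> {..<d}) (\<lambda>b. \<not> quotient_property m d (6000 * sqrt (real d)) b)
    \<le> sprob ({..<m} \<times> {..<d}) (\<lambda>b. \<exists>c\<in>J. bad c b)"
  proof (rule sprob_mono, rule ccontr)
    fix b assume nq: "\<not> quotient_property m d (6000 * sqrt (real d)) b" and "\<not> (\<exists>c\<in>J. bad c b)"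
    then have good: "block_far m (residue_block m T c) d b" "col_bound (residue_block m T c) d b" if "c \<in> J" for c
      using that by (auto simp: bad_def)
    have "quotient_property m d (6000 * sqrt (real d)) b"
      unfolding quotient_property_def
    proof (intro allI impI)
      fix t M assume M: "0 \<le> M" "\<forall>l<d. \<bar>bmul_t {..<m} b t l\<bar> \<le> M"
      have "(\<Sum>l<d. (bmul_t {..<m} b t l)\<^sup>2) \<le> (\<Sum>l<d. M\<^sup>2)"
        using M by (intro sum_mono) (auto simp: abs_le_square_iff[symmetric])
      then have L: "L2_set (bmul_t {..<m} b t) {..<d} \<le> sqrt (real d) * M"
        unfolding L2_set_def using M(1) by (intro real_le_lsqrt) (auto simp: power_mult_distrib)
      have "(\<Sum>i<m. \<bar>t i\<bar>) = (\<Sum>c<T. \<Sum>i\<in>residue_block m T c. \<bar>t i\<bar>)" by (rule residue_block_facts(5)[OF T])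
      also have "\<dots> \<le> (\<Sum>c<T. 10 * L2_set (bmul_t {..<m} b t) {..<d})"
      proof (rule sum_mono)
        fix c assume c: "c \<in> {..<T}"
        show "(\<Sum>i\<in>residue_block m T c. \<bar>t i\<bar>) \<le> 10 * L2_set (bmul_t {..<m} b t) {..<d}"
        proof (cases "c \<in> J")
          case True
          then show ?thesis by (intro block_lower_bound good sub md')
        next
          case False
          then have "residue_block m T c = {}" using c by (simp add: J_def)
          then show ?thesis by simp
        qed
      qed
      also have "\<dots> = 6000 * L2_set (bmul_t {..<m} b t) {..<d}" by (simp add: T_def)
      also have "\<dots> \<le> 6000 * sqrt (real d) * M" using L by simp
      finally show "(\<Sum>i<m. \<bar>t i\<bar>) \<le> 6000 * sqrt (real d) * M" .
    qed
    then show False using nq by blast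
  qed
  also have "\<dots> \<le> real T * (3 * exp (5 - real m / 100))"
  proof (rule sprob_union_card)
    show "finite J" by (simp add: J_def)
    have "card J \<le> card {..<T}" unfolding J_def by (rule card_mono) auto
    then show "real (card J) \<le> real T" by simp
    fix c assume c: "c \<in> J"
    define g where "g = residue_block m T c"
    have g: "finite g" "g \<noteq> {}" "g \<subseteq> {..<m}" using c sub by (auto simp: g_def J_def residue_block_def)
    have "card g \<le> m div T + 1" unfolding g_def by (rule residue_block_facts(4)[OF T])
    moreover have "real (m div T) \<le> real m / 600" using of_nat_div_le_of_nat[where ?n = m and ?x = T and ?'a = real] by (simp add: T_def)
    ultimately have cg: "real (card g) \<le> real m / 600 + 1" by linarith
    have "sprob ({..<m} \<times> {..<d}) (\<lambda>b. \<not> block_far m g d b) \<le> exp (5 * real (card g)) * (2 * exp (- real d / 150))"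
      by (rule block_far_prob[OF g(3) md])
    also have "\<dots> = 2 * exp (5 * real (card g) - real d / 150)" by (simp add: exp_add[symmetric])
    also have "\<dots> \<le> 2 * exp (5 - real m / 100)" using cg md by simp
    finally have 1: "sprob ({..<m} \<times> {..<d}) (\<lambda>b. \<not> block_far m g d b) \<le> 2 * exp (5 - real m / 100)" .
    have "sprob ({..<m} \<times> {..<d}) (\<lambda>b. \<not> col_bound g d b) = sprob (g \<times> {..<d}) (\<lambda>b. \<not> col_bound g d b)"
      unfolding sprob_def
    proof (rule avg_subset)
      show "depends_on (g \<times> {..<d}) (\<lambda>b. of_bool (\<not> col_bound g d b) :: real)"
        unfolding depends_on_def
      proof (intro allI impI)
        fix b b' :: "nat \<times> nat \<Rightarrow> real" assume "\<forall>i\<in>g \<times> {..<d}. b i = b' i"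
        then have "bmul_t g b e l = bmul_t g b' e l" if "l < d" for e l
          unfolding bmul_t_def using that by (intro sum.cong) auto
        then have "col_bound g d b = col_bound g d b'" unfolding col_bound_def by simp
        then show "of_bool (\<not> col_bound g d b) = (of_bool (\<not> col_bound g d b') :: real)" by simp
      qed
    qed (use g in auto)
    also have "\<dots> \<le> 2 ^ card g * exp (- 3 / 2 * real d)" by (rule col_bound_prob[OF g(1,2)])
    also have "\<dots> \<le> exp 1 ^ card g * exp (- 3 / 2 * real d)"
      using exp_ge_add_one_self[of 1] by (intro mult_right_mono power_mono) auto
    also have "\<dots> = exp (real (card g) - 3 / 2 * real d)"
      by (simp add: exp_of_nat_mult[symmetric] exp_add[symmetric])
    also have "\<dots> \<le> exp (5 - real m / 100)" using cg md by simp
    finally have 2: "sprob ({..<m} \<times> {..<d}) (\<lambda>b. \<not> col_bound g d b) \<le> exp (5 - real m / 100)" .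
    show "sprob ({..<m} \<times> {..<d}) (bad c) \<le> 3 * exp (5 - real m / 100)"
      unfolding bad_def g_def[symmetric]
      using sprob_disj[of "{..<m} \<times> {..<d}" "\<lambda>b. \<not> block_far m g d b" "\<lambda>b. \<not> col_bound g d b"] 1 2 by linarith
  qed simp
  finally show ?thesis by (simp add: T_def)
qed

subsection \<open>Very wide sign matrices\<close>

text \<open>A lower bound for the upper tail of a sign sum. On each of \<beta> blocks the partial
  sum reaches half its l2 norm with probability at least 3/32, independently; if all blocks do, the
  sum gains a factor of order sqrt \<beta> over its typical size. Blocks have at most 2 m / \<beta>
  rows, which relates their l2 and l1 norms.\<close>

lemma column_large_prob:
  assumes m: "0 < m" and \<beta>: "0 < \<beta>" "\<beta> \<le> m"
  shows "(3 / 32) ^ \<beta> \<le> sprob ({..<m} \<times> {l}) (\<lambda>b. 1 / 2 * (\<Sum>i<m. \<bar>t i\<bar>) * sqrt (real \<beta> / (2 * real m)) \<le> bmul_t {..<m} b t l)"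
proof -
  define G where "G = residue_block m \<beta>"
  note GF = residue_block_facts[OF \<beta>(1), where m = m, folded G_def]
  define s where "s = (\<lambda>c. sqrt (\<Sum>i\<in>G c. (t i)\<^sup>2))"
  have un: "{..<m} \<times> {l} = (\<Union>c\<in>{..<\<beta>}. G c \<times> {l})" using GF(1) by blast
  have disj: "(G c \<times> {l}) \<inter> (G c' \<times> {l}) = {}" if "c \<noteq> c'" for c c' using GF(3)[OF that] by blast
  have one: "3 / 32 \<le> avg (G c \<times> {l}) (\<lambda>b. of_bool (s c / 2 \<le> (\<Sum>p\<in>G c \<times> {l}. b p * t (fst p))))" for c
  proof -
    have "finite (G c \<times> {l})" using GF(2) by simp
    from paley_zygmund_signs[OF this, of "\<lambda>p. t (fst p)"] show ?thesis
      by (simp add: sprob_def s_def sum_col)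
  qed
  have "(3 / 32) ^ \<beta> = (\<Prod>c\<in>{..<\<beta>}. 3 / 32 :: real)" by simp
  also have "\<dots> \<le> (\<Prod>c\<in>{..<\<beta>}. avg (G c \<times> {l}) (\<lambda>b. of_bool (s c / 2 \<le> (\<Sum>p\<in>G c \<times> {l}. b p * t (fst p)))))"
    by (rule prod_mono) (use one in auto)
  also have "\<dots> = avg (\<Union>c\<in>{..<\<beta>}. G c \<times> {l}) (\<lambda>b. \<Prod>c\<in>{..<\<beta>}. of_bool (s c / 2 \<le> (\<Sum>p\<in>G c \<times> {l}. b p * t (fst p))))"
    by (rule avg_prod[symmetric]) (use GF(2) disj depends_on_linear in auto)
  also have "\<dots> \<le> sprob (\<Union>c\<in>{..<\<beta>}. G c \<times> {l}) (\<lambda>b. 1 / 2 * (\<Sum>i<m. \<bar>t i\<bar>) * sqrt (real \<beta> / (2 * real m)) \<le> bmul_t {..<m} b t l)"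
    unfolding sprob_def
  proof (rule avg_mono)
    fix b
    show "(\<Prod>c\<in>{..<\<beta>}. of_bool (s c / 2 \<le> (\<Sum>p\<in>G c \<times> {l}. b p * t (fst p))))
      \<le> (of_bool (1 / 2 * (\<Sum>i<m. \<bar>t i\<bar>) * sqrt (real \<beta> / (2 * real m)) \<le> bmul_t {..<m} b t l) :: real)"
    proof (cases "\<forall>c<\<beta>. s c / 2 \<le> (\<Sum>p\<in>G c \<times> {l}. b p * t (fst p))")
      case False
      then have eq: "(\<Prod>c\<in>{..<\<beta>}. of_bool (s c / 2 \<le> (\<Sum>p\<in>G c \<times> {l}. b p * t (fst p)))) = (0::real)"
        by (intro prod_zero) auto
      show ?thesis unfolding eq by simp
    next
      case True
      have l1: "(\<Sum>i\<in>G c. \<bar>t i\<bar>) * sqrt (real \<beta> / (2 * real m)) \<le> s c" for c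
      proof -
        have "(\<Sum>i\<in>G c. \<bar>t i\<bar>) = (\<Sum>i\<in>G c. \<bar>t i\<bar> * \<bar>1\<bar>)" by simp
        also have "\<dots> \<le> L2_set t (G c) * L2_set (\<lambda>_. 1) (G c)" by (rule L2_set_mult_ineq)
        also have "\<dots> = s c * sqrt (real (card (G c)))" by (simp add: L2_set_def s_def)
        also have "\<dots> \<le> s c * sqrt (2 * real m / real \<beta>)"
        proof (intro mult_left_mono real_sqrt_le_mono)
          have "real (card (G c)) \<le> real (m div \<beta>) + 1" using GF(4)[of c] by linarith
          also have "\<dots> \<le> real m / real \<beta> + real m / real \<beta>"
            using of_nat_div_le_of_nat[where ?n = m and ?x = \<beta> and ?'a = real] \<beta> by (intro add_mono) auto
          finally show "real (card (G c)) \<le> 2 * real m / real \<beta>" by simp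
        qed (simp add: s_def sum_nonneg)
        finally have "(\<Sum>i\<in>G c. \<bar>t i\<bar>) * sqrt (real \<beta> / (2 * real m))
          \<le> s c * sqrt (2 * real m / real \<beta>) * sqrt (real \<beta> / (2 * real m))" by (rule mult_right_mono) simp
        also have "\<dots> = s c * sqrt (2 * real m / real \<beta> * (real \<beta> / (2 * real m)))" by (simp only: real_sqrt_mult mult.assoc)
        also have "2 * real m / real \<beta> * (real \<beta> / (2 * real m)) = 1" using m \<beta> by simp
        finally show ?thesis by simp
      qed
      have "1 / 2 * (\<Sum>i<m. \<bar>t i\<bar>) * sqrt (real \<beta> / (2 * real m)) = (\<Sum>c<\<beta>. ((\<Sum>i\<in>G c. \<bar>t i\<bar>) * sqrt (real \<beta> / (2 * real m))) / 2)"
        unfolding GF(5)[of "\<lambda>i. \<bar>t i\<bar>"] by (simp add: sum_distrib_right sum_distrib_left sum_divide_distrib)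
      also have "\<dots> \<le> (\<Sum>c<\<beta>. \<Sum>p\<in>G c \<times> {l}. b p * t (fst p))"
      proof (rule sum_mono)
        fix c assume "c \<in> {..<\<beta>}"
        then have "s c / 2 \<le> (\<Sum>p\<in>G c \<times> {l}. b p * t (fst p))" using True by blast
        then show "((\<Sum>i\<in>G c. \<bar>t i\<bar>) * sqrt (real \<beta> / (2 * real m))) / 2 \<le> (\<Sum>p\<in>G c \<times> {l}. b p * t (fst p))"
          using l1[of c] by linarith
      qed
      also have "\<dots> = bmul_t {..<m} b t l"
        unfolding bmul_t_def GF(5)[of "\<lambda>i. b (i, l) * t i"] by (simp add: sum_col)
      finally show ?thesis by (simp add: of_bool_def prod_le_1)
    qed
  qed
  finally show ?thesis unfolding un .
qed

text \<open>Lower Chernoff bound for independent events. The parameter ln 2 makes the exponential of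
  an indicator equal to 1 - 1/2 of that indicator, and (ln 2 - 1) / 2 <= - 11/72.\<close>

lemma count_columns_prob:
  fixes A :: "nat \<Rightarrow> (nat \<times> nat \<Rightarrow> real) \<Rightarrow> bool"
  assumes dep: "\<And>l. l < d \<Longrightarrow> depends_on ({..<m::nat} \<times> {l}) (A l)" and p: "\<And>l. l < d \<Longrightarrow> p \<le> sprob ({..<m} \<times> {l}) (A l)"
    and p0: "0 \<le> p"
  shows "sprob ({..<m} \<times> {..<d}) (\<lambda>b. (\<Sum>l<d. of_bool (A l b)) \<le> p * real d / 2) \<le> exp (- 11 / 72 * (p * real d))"
proof -
  have "sprob ({..<m} \<times> {..<d}) (\<lambda>b. (\<Sum>l<d. of_bool (A l b)) \<le> p * real d / 2)
    \<le> avg ({..<m} \<times> {..<d}) (\<lambda>b. \<Prod>l\<in>{..<d}. exp (- (ln 2 * of_bool (A l b)))) / exp (- (ln 2 * (p * real d / 2)))"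
  proof (rule sprob_markov_scaled)
    fix b assume "(\<Sum>l<d. of_bool (A l b)) \<le> p * real d / 2"
    then have "ln 2 * (\<Sum>l<d. of_bool (A l b)) \<le> ln 2 * (p * real d / 2)" by (intro mult_left_mono) auto
    then show "exp (- (ln 2 * (p * real d / 2))) \<le> (\<Prod>l\<in>{..<d}. exp (- (ln 2 * of_bool (A l b))))"
      by (simp add: exp_sum[symmetric] sum_negf sum_distrib_left)
  qed (auto intro: prod_nonneg)
  also have "avg ({..<m} \<times> {..<d}) (\<lambda>b. \<Prod>l\<in>{..<d}. exp (- (ln 2 * of_bool (A l b))))
    = (\<Prod>l\<in>{..<d}. avg ({..<m} \<times> {l}) (\<lambda>b. exp (- (ln 2 * of_bool (A l b)))))"
    unfolding grid_cols
  proof (rule avg_prod)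
    fix l assume "l \<in> {..<d}"
    then show "depends_on ({..<m} \<times> {l}) (\<lambda>b. exp (- (ln 2 * of_bool (A l b))))"
      using dep[of l] unfolding depends_on_def by (auto dest: spec)
  qed auto
  also have "\<dots> \<le> (\<Prod>l\<in>{..<d}. exp (- (p / 2)))"
  proof (rule prod_mono, intro conjI avg_nonneg)
    fix l assume l: "l \<in> {..<d}"
    have "avg ({..<m} \<times> {l}) (\<lambda>b. exp (- (ln 2 * of_bool (A l b)))) = avg ({..<m} \<times> {l}) (\<lambda>b. 1 + (- 1 / 2) * of_bool (A l b))"
      by (rule avg_cong) (auto simp: exp_minus of_bool_def)
    also have "\<dots> = 1 + (- 1 / 2) * sprob ({..<m} \<times> {l}) (A l)"
      unfolding avg_add avg_cmult sprob_def by (simp add: avg_const)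
    also have "\<dots> \<le> 1 + - (p / 2)" using p l by simp
    also have "\<dots> \<le> exp (- (p / 2))" by (rule exp_ge_add_one_self)
    finally show "avg ({..<m} \<times> {l}) (\<lambda>b. exp (- (ln 2 * of_bool (A l b)))) \<le> exp (- (p / 2))" .
  qed auto
  also have "(\<Prod>l\<in>{..<d}. exp (- (p / 2))) / exp (- (ln 2 * (p * real d / 2))) = exp ((ln 2 - 1) * (p * real d / 2))"
    by (simp add: exp_of_nat_mult[symmetric] exp_diff[symmetric] algebra_simps)
  also have "\<dots> \<le> exp (- 11 / 72 * (p * real d))"
  proof -
    have "(ln 2 - 1) * (p * real d / 2) \<le> (25 / 36 - 1) * (p * real d / 2)"
      using ln2_le_25_over_36 p0 by (intro mult_right_mono) auto
    then show ?thesis by simp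
  qed
  finally show ?thesis by (simp add: divide_right_mono)
qed

lemma exp1_bounds: "(5/2 :: real) \<le> exp 1" "exp 2 \<le> (10::real)" "32 / 3 \<le> exp (3::real)" "(200::real) \<le> exp 6"
proof -
  show 1: "(5/2 :: real) \<le> exp 1" using exp_lower_Taylor_quadratic[of 1] by simp
  have "exp 2 = exp 1 * exp (1::real)" by (simp add: exp_add[symmetric])
  also have "\<dots> \<le> 272 / 100 * (272 / 100)" using e_less_272 by (intro mult_mono) auto
  finally show "exp 2 \<le> (10::real)" by simp
  have "(29 / 8 :: real) \<le> exp (3 / 2)" using exp_lower_Taylor_quadratic[of "3 / 2"] by (simp add: power2_eq_square)
  then have "(29 / 8 :: real) * (29 / 8) \<le> exp (3 / 2) * exp (3 / 2)" by (intro mult_mono) auto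
  then show "32 / 3 \<le> exp (3::real)" by (simp add: exp_add[symmetric])
  have "(5/2 :: real) ^ 6 \<le> exp 1 ^ 6" using 1 by (rule power_mono) simp
  then show "(200::real) \<le> exp 6" by (simp add: exp_of_nat_mult[symmetric] power_divide)
qed

lemma count_large_sum:
  fixes f :: "nat \<Rightarrow> real"
  assumes "\<And>l. l < d \<Longrightarrow> P l \<Longrightarrow> a \<le> (f l)\<^sup>2"
  shows "(\<Sum>l<d. of_bool (P l)) * a \<le> (\<Sum>l<d. (f l)\<^sup>2)"
  unfolding sum_distrib_right by (rule sum_mono) (use assms in \<open>auto simp: of_bool_def\<close>)

context
  fixes m d :: nat
  assumes m: "0 < m" and wide: "10 ^ 8 * real m \<le> real d" and lnd: "ln (real d) \<le> real m"
begin

definition log_ratio :: real where "log_ratio = ln (real d / real m)"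

text \<open>As 32/3 <= exp 3, this number gives (3/32)^\<beta> >= exp (- log_ratio / 2), which is
  sqrt (m / d): about sqrt (m d) columns can be expected to be large. The hypothesis ln d <= m
  ensures that there are not more blocks than rows.\<close>

definition block_number :: nat where "block_number = nat \<lfloor>log_ratio / 6\<rfloor>"

text \<open>Rounding t / mesh has to be so fine that the remainder cannot be large on a fraction exp
  (- log_ratio / 2) of the columns. Hence mesh^2 is proportional to that fraction; 2500 exceeds the
  2048 that arises in \<open>many_large_imp\<close>.\<close>

definition mesh :: real where "mesh = exp (- log_ratio / 4) / 50"

lemma log_ratio_bounds: "16 \<le> log_ratio" "log_ratio \<le> real m" "real d = real m * exp log_ratio"
proof -
  have r: "10 ^ 8 \<le> real d / real m" using wide m by (simp add: field_simps)
  have "8 * 2 \<le> 8 * ln (10::real)"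
    using exp1_bounds(2) by (simp add: ln_ge_iff)
  also have "\<dots> = ln (10 ^ 8)" using ln_realpow[of "10::real" 8] by simp
  also have "\<dots> \<le> log_ratio" unfolding log_ratio_def using r by (intro iffD2[OF ln_le_cancel_iff]) auto
  finally show "16 \<le> log_ratio" by simp
  have "real d / real m \<le> real d / 1" using m by (intro divide_left_mono) auto
  then have "log_ratio \<le> ln (real d)" unfolding log_ratio_def using r
    by (intro iffD2[OF ln_le_cancel_iff]) auto
  then show "log_ratio \<le> real m" using lnd by simp
  have "exp log_ratio = real d / real m" unfolding log_ratio_def using r by (intro exp_ln) auto
  then show "real d = real m * exp log_ratio" using m by simp
qed

lemma block_number_bounds: "0 < block_number" "block_number \<le> m" "log_ratio \<le> 12 * real block_number"
    "exp (- log_ratio / 2) \<le> (3 / 32) ^ block_number"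
proof -
  have f: "real_of_int \<lfloor>log_ratio / 6\<rfloor> \<le> log_ratio / 6" "log_ratio / 6 < real_of_int \<lfloor>log_ratio / 6\<rfloor> + 1" by linarith+
  have f0: "1 \<le> \<lfloor>log_ratio / 6\<rfloor>" using log_ratio_bounds(1) by (simp add: le_floor_iff)
  have bn: "real block_number = real_of_int \<lfloor>log_ratio / 6\<rfloor>" unfolding block_number_def using f0 by simp
  show "0 < block_number" unfolding block_number_def using f0 by simp
  have "real block_number \<le> real m" using bn f log_ratio_bounds by linarith
  then show "block_number \<le> m" by simp
  have "1 \<le> real block_number" unfolding bn using f0 by simp
  then show "log_ratio \<le> 12 * real block_number" using bn f by linarith
  have "exp (- log_ratio / 2) \<le> exp (- 3 * real block_number)" using bn f by simp
  also have "\<dots> = exp (- 3) ^ block_number" by (simp add: exp_of_nat_mult[symmetric] mult.commute)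
  also have "\<dots> \<le> (3 / 32) ^ block_number"
  proof (rule power_mono)
    have "exp (- 3) = 1 / exp (3::real)" by (simp add: exp_minus divide_inverse)
    also have "\<dots> \<le> 1 / (32 / 3)" using exp1_bounds(3) by (intro divide_left_mono) auto
    finally show "exp (- 3) \<le> (3 / 32 :: real)" by simp
  qed simp
  finally show "exp (- log_ratio / 2) \<le> (3 / 32) ^ block_number" .
qed

lemma mesh_bounds: "0 < mesh" "mesh \<le> 1 / 50" "mesh * mesh = exp (- log_ratio / 2) / 2500"
proof -
  show "0 < mesh" by (simp add: mesh_def)
  show "mesh \<le> 1 / 50" using log_ratio_bounds(1) by (simp add: mesh_def)
  show "mesh * mesh = exp (- log_ratio / 2) / 2500" by (simp add: mesh_def exp_add[symmetric])
qed

text \<open>The threshold of \<open>column_large_prob\<close> for vectors with l1 norm m / (2 mesh),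
  the least norm in \<open>fine_vectors\<close>.\<close>

definition level :: real where
  "level = real m / (4 * mesh) * sqrt (real block_number / (2 * real m))"

definition fine_vectors :: "(nat \<Rightarrow> int) set" where
  "fine_vectors = {z \<in> int_vectors {..<m} (real m / mesh). real m / (2 * mesh) \<le> (\<Sum>i<m. \<bar>real_of_int (z i)\<bar>)}"

definition many_large :: "(nat \<times> nat \<Rightarrow> real) \<Rightarrow> bool" where
  "many_large b \<longleftrightarrow> (\<forall>z\<in>fine_vectors. exp (- log_ratio / 2) * real d / 2 <
     (\<Sum>l<d. of_bool (level \<le> bmul_t {..<m} b (\<lambda>i. real_of_int (z i)) l)))"

text \<open>If all entries of B^T t were below mesh * level / 2, the rounding remainder would have
  to compensate on every column where the rounded vector is large, with size at least level / 2.
  That is too much square mass for \<open>col_bound\<close>.\<close>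

lemma many_large_imp:
  assumes ml: "many_large b" and cb: "col_bound {..<m} d b"
  shows "quotient_property m d (40 * sqrt (real m / log_ratio)) b"
proof -
  have lr0: "0 < log_ratio" using log_ratio_bounds(1) by simp
  have m0: "0 < real m" using m by simp
  have main: "real m \<le> 40 * sqrt (real m / log_ratio) * M"
    if tn: "(\<Sum>i<m. \<bar>t i\<bar>) = real m" and M: "\<And>l. l < d \<Longrightarrow> \<bar>bmul_t {..<m} b t l\<bar> \<le> M" for t M
  proof -
    define z where "z = restrict (\<lambda>i. truncate (t i / mesh)) {..<m}"
    define zr where "zr = (\<lambda>i. real_of_int (z i))"
    define r where "r = (\<lambda>i. t i / mesh - zr i)"
    have r1: "\<bar>r i\<bar> \<le> 1" if "i < m" for i
      using truncate_bounds[of "t i / mesh"] that by (simp add: r_def zr_def z_def)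
    have tm: "(\<Sum>i<m. \<bar>t i / mesh\<bar>) = real m / mesh"
      using mesh_bounds(1) by (simp add: abs_divide sum_divide_distrib[symmetric] tn)
    have "z \<in> int_vectors {..<m} (real m / mesh)" unfolding z_def by (rule truncate_vector) (simp only: tm order_refl)
    moreover have "real m / (2 * mesh) \<le> (\<Sum>i<m. \<bar>zr i\<bar>)"
    proof -
      have "(\<Sum>i<m. \<bar>t i / mesh\<bar> - 1) \<le> (\<Sum>i<m. \<bar>zr i\<bar>)"
      proof (rule sum_mono)
        fix i assume "i \<in> {..<m}"
        then have "\<bar>t i / mesh - zr i\<bar> \<le> 1" using r1[of i] by (simp add: r_def)
        then show "\<bar>t i / mesh\<bar> - 1 \<le> \<bar>zr i\<bar>" by linarith
      qed
      then have "real m / mesh - real m \<le> (\<Sum>i<m. \<bar>zr i\<bar>)" unfolding sum_subtractf tm by simp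
      moreover have "real m / (2 * mesh) + real m \<le> real m / mesh"
        using mesh_bounds m0 by (simp add: field_simps)
      ultimately show ?thesis by linarith
    qed
    ultimately have zf: "z \<in> fine_vectors" by (simp add: fine_vectors_def zr_def)
    have lev0: "0 < level" unfolding level_def using m0 mesh_bounds(1) block_number_bounds(1) by simp
    have "mesh * level / 2 \<le> M"
    proof (rule ccontr)
      assume "\<not> mesh * level / 2 \<le> M"
      then have Mlt: "M < mesh * (level / 2)" by simp
      have big: "(level / 2)\<^sup>2 \<le> (bmul_t {..<m} b r l)\<^sup>2" if l: "l < d" and A: "level \<le> bmul_t {..<m} b zr l" for l
      proof -
        have "bmul_t {..<m} b r l = bmul_t {..<m} b (\<lambda>i. (1 / mesh) * t i) l - bmul_t {..<m} b zr l"
          unfolding bmul_t_def sum_subtractf[symmetric] by (simp add: r_def algebra_simps)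
        also have "\<dots> = bmul_t {..<m} b t l / mesh - bmul_t {..<m} b zr l" unfolding bmul_t_scale by simp
        also have "bmul_t {..<m} b t l / mesh < level / 2"
          using M[OF l] Mlt mesh_bounds(1) by (simp add: pos_divide_less_eq mult.commute)
        finally have "bmul_t {..<m} b r l < - (level / 2)" using A by linarith
        then have "\<bar>level / 2\<bar> \<le> \<bar>bmul_t {..<m} b r l\<bar>" using lev0 by linarith
        then show ?thesis by (simp only: abs_le_square_iff)
      qed
      have "exp (- log_ratio / 2) * real d / 2 * (level / 2)\<^sup>2 \<le> (\<Sum>l<d. of_bool (level \<le> bmul_t {..<m} b zr l)) * (level / 2)\<^sup>2"
        by (rule mult_right_mono[OF less_imp_le[OF bspec[OF ml[unfolded many_large_def] zf, folded zr_def]]]) simp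
      also have "\<dots> \<le> (\<Sum>l<d. (bmul_t {..<m} b r l)\<^sup>2)" by (rule count_large_sum) (rule big)
      also have "\<dots> \<le> 8 * real m * real d"
      proof -
        have "L2_set (bmul_t {..<m} b r) {..<d} \<le> sqrt (8 * real (card {..<m}) * real d)"
          by (rule col_bound_sup[OF _ cb]) (use r1 in auto)
        then show ?thesis by (simp add: L2_set_def)
      qed
      finally have "exp (- log_ratio / 2) * real d / 2 * (level / 2)\<^sup>2 \<le> 8 * real m * real d" .
      moreover have "(level / 2)\<^sup>2 = real m * real block_number / (128 * (mesh * mesh))"
        using m0 mesh_bounds(1) by (simp add: level_def power_mult_distrib power_divide power2_eq_square field_simps)
      moreover have "0 < real d" using log_ratio_bounds(3) m0 by simp
      ultimately have "exp (- log_ratio / 2) / 2 * (real m * real block_number / (128 * (mesh * mesh))) * real d \<le> 8 * real m * real d"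
        by (simp add: mult_ac)
      then have "exp (- log_ratio / 2) / 2 * (real m * real block_number / (128 * (mesh * mesh))) \<le> 8 * real m"
        using \<open>0 < real d\<close> by (rule mult_right_le_imp_le)
      then have "exp (- log_ratio / 2) * real block_number \<le> 2048 * (mesh * mesh)"
        using m0 mesh_bounds(1) by (simp add: field_simps)
      also have "\<dots> < exp (- log_ratio / 2) * 1" unfolding mesh_bounds(3) by simp
      also have "\<dots> \<le> exp (- log_ratio / 2) * real block_number"
        using block_number_bounds(1) by (intro mult_left_mono) auto
      finally show False by simp
    qed
    moreover have "mesh * level / 2 = real m / 8 * sqrt (real block_number / (2 * real m))"
      using mesh_bounds(1) by (simp add: level_def)
    ultimately have Mge: "real m / 8 * sqrt (real block_number / (2 * real m)) \<le> M" by simp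
    have "1 \<le> 5 * sqrt (real block_number / (2 * log_ratio))"
    proof -
      have "(1 / 5)\<^sup>2 \<le> real block_number / (2 * log_ratio)"
        using block_number_bounds(3) lr0 by (simp add: field_simps power2_eq_square)
      then have "1 / 5 \<le> sqrt (real block_number / (2 * log_ratio))" by (rule real_le_rsqrt)
      then show ?thesis by simp
    qed
    then have "real m * 1 \<le> real m * (5 * sqrt (real block_number / (2 * log_ratio)))" by (rule mult_left_mono) simp
    also have "\<dots> = 40 * sqrt (real m / log_ratio) * (real m / 8 * sqrt (real block_number / (2 * real m)))"
    proof -
      have "sqrt (real m / log_ratio) * sqrt (real block_number / (2 * real m)) = sqrt (real block_number / (2 * log_ratio))"
        unfolding real_sqrt_mult[symmetric] using m0 lr0 by (simp add: field_simps)
      then have "40 * sqrt (real m / log_ratio) * (real m / 8 * sqrt (real block_number / (2 * real m)))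
        = 5 * real m * sqrt (real block_number / (2 * log_ratio))" by (simp add: mult_ac)
      then show ?thesis by (simp only: mult_ac)
    qed
    also have "\<dots> \<le> 40 * sqrt (real m / log_ratio) * M" using Mge lr0 by (intro mult_left_mono) auto
    finally show ?thesis by simp
  qed
  show ?thesis unfolding quotient_property_def
  proof (intro allI impI)
    fix t M assume M: "0 \<le> M" "\<forall>l<d. \<bar>bmul_t {..<m} b t l\<bar> \<le> M"
    define S where "S = (\<Sum>i<m. \<bar>t i\<bar>)"
    show "(\<Sum>i<m. \<bar>t i\<bar>) \<le> 40 * sqrt (real m / log_ratio) * M"
    proof (cases "S = 0")
      case True
      then show ?thesis using M(1) lr0 by (simp add: S_def)
    next
      case False
      then have S: "0 < S" unfolding S_def by (simp add: less_le sum_nonneg)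
      define c where "c = real m / S"
      have c: "0 < c" "c * S = real m" using S m0 by (auto simp: c_def)
      have tn: "(\<Sum>i<m. \<bar>c * t i\<bar>) = real m" using c by (simp add: abs_mult sum_distrib_left[symmetric] S_def)
      have "\<bar>bmul_t {..<m} b (\<lambda>i. c * t i) l\<bar> \<le> c * M" if "l < d" for l
        unfolding bmul_t_scale using M(2) that c(1) by (simp add: abs_mult)
      from main[OF tn this] have "c * S \<le> c * (40 * sqrt (real m / log_ratio) * M)" unfolding c(2) by (simp add: mult_ac)
      then show ?thesis using c(1) by (simp add: S_def)
    qed
  qed
qed

text \<open>The entropy of the grid is m (7 + u / 4), while the failure exponent of one vector is of
  order p d = m exp (u / 2). The second wins because u >= 16.\<close>

lemma many_large_prob: "sprob ({..<m} \<times> {..<d}) (\<lambda>b. \<not> many_large b) \<le> exp (- 2 * real m)"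
proof -
  define u where "u = log_ratio"
  define p where "p = exp (- u / 2)"
  have fin: "finite (int_vectors {..<m} (real m / mesh))" by (rule card_int_vectors(1)[of _ 1]) auto
  have finF: "finite fine_vectors" using fin by (simp add: fine_vectors_def)
  have pd: "p * real d = real m * exp (u / 2)"
    unfolding log_ratio_bounds(3) u_def[symmetric] p_def by (simp add: mult.left_commute exp_add[symmetric])
  have card: "real (card fine_vectors) \<le> exp (real m * (7 + u / 4))"
  proof -
    have "card fine_vectors \<le> card (int_vectors {..<m} (real m / mesh))"
      unfolding fine_vectors_def by (rule card_mono[OF fin]) auto
    then have "real (card fine_vectors) \<le> real (card (int_vectors {..<m} (real m / mesh)))" by simp
    also have "\<dots> \<le> exp (mesh * (real m / mesh)) * ((1 + exp (- mesh)) / (1 - exp (- mesh))) ^ card {..<m}"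
      by (rule card_int_vectors(2)) (use mesh_bounds in auto)
    also have "\<dots> \<le> exp (real m) * exp (6 + u / 4) ^ m"
    proof (rule mult_mono)
      show "exp (mesh * (real m / mesh)) \<le> exp (real m)" using mesh_bounds(1) by simp
      have le: "exp (- mesh) \<le> 1 - mesh / 2"
      proof -
        have "exp (- mesh) \<le> 1 - mesh + mesh\<^sup>2 / 2" by (rule exp_minus_le_quadratic) (use mesh_bounds in simp)
        moreover have "mesh * mesh \<le> mesh * 1" using mesh_bounds by (intro mult_left_mono) auto
        ultimately show ?thesis by (simp add: power2_eq_square)
      qed
      have e1: "exp (- mesh) < 1" using mesh_bounds(1) by simp
      have "(1 + exp (- mesh)) / (1 - exp (- mesh)) \<le> 2 / (mesh / 2)"
        using le e1 mesh_bounds(1) by (intro frac_le) auto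
      also have "\<dots> = 200 * exp (u / 4)" unfolding mesh_def u_def by (simp add: exp_minus field_simps)
      also have "\<dots> \<le> exp (6 + u / 4)" unfolding exp_add using exp1_bounds(4) by (intro mult_right_mono) auto
      finally show "((1 + exp (- mesh)) / (1 - exp (- mesh))) ^ card {..<m} \<le> exp (6 + u / 4) ^ m"
        using e1 by (simp add: power_mono)
      show "0 \<le> ((1 + exp (- mesh)) / (1 - exp (- mesh))) ^ card {..<m}" using e1 by simp
    qed simp
    also have "\<dots> = exp (real m * (7 + u / 4))"
      by (simp add: exp_of_nat_mult[symmetric] exp_add[symmetric] algebra_simps)
    finally show ?thesis .
  qed
  have "sprob ({..<m} \<times> {..<d}) (\<lambda>b. \<exists>z\<in>fine_vectors.
      (\<Sum>l<d. of_bool (level \<le> bmul_t {..<m} b (\<lambda>i. real_of_int (z i)) l)) \<le> p * real d / 2)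
    \<le> exp (real m * (7 + u / 4)) * exp (- 11 / 72 * (p * real d))"
  proof (rule sprob_union_card[OF finF _ card])
    fix z assume z: "z \<in> fine_vectors"
    show "sprob ({..<m} \<times> {..<d}) (\<lambda>b. (\<Sum>l<d. of_bool (level \<le> bmul_t {..<m} b (\<lambda>i. real_of_int (z i)) l)) \<le> p * real d / 2)
      \<le> exp (- 11 / 72 * (p * real d))"
    proof (rule count_columns_prob)
      fix l
      show "depends_on ({..<m} \<times> {l}) (\<lambda>b. level \<le> bmul_t {..<m} b (\<lambda>i. real_of_int (z i)) l)"
        unfolding depends_on_def bmul_t_def by (auto intro!: arg_cong[where f = "\<lambda>x. level \<le> x"] sum.cong)
      have "p \<le> (3 / 32) ^ block_number" unfolding p_def u_def by (rule block_number_bounds(4))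
      also have "\<dots> \<le> sprob ({..<m} \<times> {l}) (\<lambda>b. 1 / 2 * (\<Sum>i<m. \<bar>real_of_int (z i)\<bar>) * sqrt (real block_number / (2 * real m)) \<le> bmul_t {..<m} b (\<lambda>i. real_of_int (z i)) l)"
        by (rule column_large_prob[OF m block_number_bounds(1,2)])
      also have "\<dots> \<le> sprob ({..<m} \<times> {l}) (\<lambda>b. level \<le> bmul_t {..<m} b (\<lambda>i. real_of_int (z i)) l)"
      proof (rule sprob_mono)
        fix b assume "1 / 2 * (\<Sum>i<m. \<bar>real_of_int (z i)\<bar>) * sqrt (real block_number / (2 * real m)) \<le> bmul_t {..<m} b (\<lambda>i. real_of_int (z i)) l"
        moreover have "level \<le> 1 / 2 * (\<Sum>i<m. \<bar>real_of_int (z i)\<bar>) * sqrt (real block_number / (2 * real m))"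
          unfolding level_def using z by (intro mult_right_mono) (auto simp: fine_vectors_def)
        ultimately show "level \<le> bmul_t {..<m} b (\<lambda>i. real_of_int (z i)) l" by linarith
      qed
      finally show "p \<le> sprob ({..<m} \<times> {l}) (\<lambda>b. level \<le> bmul_t {..<m} b (\<lambda>i. real_of_int (z i)) l)" .
    qed (simp add: p_def)
  qed simp
  also have "\<dots> = exp (real m * (7 + u / 4 - 11 / 72 * exp (u / 2)))"
    unfolding pd by (simp add: exp_add[symmetric] algebra_simps)
  also have "\<dots> \<le> exp (- 2 * real m)"
  proof -
    have u16: "16 \<le> u" using log_ratio_bounds(1) by (simp add: u_def)
    define y where "y = u / 4"
    have y4: "4 \<le> y" using u16 by (simp add: y_def)
    have q: "1 + y + y\<^sup>2 / 2 \<le> exp y" by (rule exp_lower_Taylor_quadratic) (use y4 in simp)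
    have y2: "4 * y \<le> y\<^sup>2" using y4 by (simp add: power2_eq_square)
    have e1: "13 \<le> exp y" and e2: "1 + 3 * y \<le> exp y" using q y2 y4 by linarith+
    have "13 * (1 + 3 * y) \<le> exp y * exp y" using e1 e2 y4 by (intro mult_mono) auto
    then have "13 * (1 + 3 * y) \<le> exp (u / 2)" by (simp add: exp_add[symmetric] y_def)
    then have "7 + u / 4 - 11 / 72 * exp (u / 2) \<le> - 2" using y4 by (simp add: y_def)
    then have "real m * (7 + u / 4 - 11 / 72 * exp (u / 2)) \<le> real m * - 2" by (rule mult_left_mono) simp
    then show ?thesis by simp
  qed
  finally have "sprob ({..<m} \<times> {..<d}) (\<lambda>b. \<exists>z\<in>fine_vectors.
      (\<Sum>l<d. of_bool (level \<le> bmul_t {..<m} b (\<lambda>i. real_of_int (z i)) l)) \<le> p * real d / 2) \<le> exp (- 2 * real m)" .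
  moreover have "(\<lambda>b. \<not> many_large b) = (\<lambda>b. \<exists>z\<in>fine_vectors.
      (\<Sum>l<d. of_bool (level \<le> bmul_t {..<m} b (\<lambda>i. real_of_int (z i)) l)) \<le> p * real d / 2)"
    by (simp add: many_large_def not_less p_def u_def)
  ultimately show ?thesis by simp
qed

lemma quotient_property_wide:
  "sprob ({..<m} \<times> {..<d}) (\<lambda>b. \<not> quotient_property m d (40 * sqrt (real m / ln (real d / real m))) b) \<le> exp (- real m)"
proof -
  have "sprob ({..<m} \<times> {..<d}) (\<lambda>b. \<not> quotient_property m d (40 * sqrt (real m / ln (real d / real m))) b)
    \<le> sprob ({..<m} \<times> {..<d}) (\<lambda>b. \<not> many_large b \<or> \<not> col_bound {..<m} d b)"
    by (rule sprob_mono) (use many_large_imp in \<open>auto simp: log_ratio_def\<close>)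
  also have "\<dots> \<le> 2 * exp (- 2 * real m)"
  proof (rule sprob_disj2[OF many_large_prob])
    have "sprob ({..<m} \<times> {..<d}) (\<lambda>b. \<not> col_bound {..<m} d b) \<le> 2 ^ card {..<m} * exp (- 3 / 2 * real d)"
      by (rule col_bound_prob) (use m in auto)
    also have "\<dots> \<le> exp 1 ^ m * exp (- 3 / 2 * real d)"
      using exp_ge_add_one_self[of 1] by (simp add: power_mono)
    also have "\<dots> = exp (real m - 3 / 2 * real d)" by (simp add: exp_of_nat_mult[symmetric] exp_add[symmetric])
    also have "\<dots> \<le> exp (- 2 * real m)" using wide by simp
    finally show "sprob ({..<m} \<times> {..<d}) (\<lambda>b. \<not> col_bound {..<m} d b) \<le> exp (- 2 * real m)" .
  qed
  also have "\<dots> \<le> exp (- real m)"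
  proof -
    have "2 \<le> exp (real m)" using exp_ge_add_one_self[of "real m"] m by linarith
    then have "2 * exp (- 2 * real m) \<le> exp (real m) * exp (- 2 * real m)" by (rule mult_right_mono) simp
    then show ?thesis by (simp add: exp_add[symmetric])
  qed
  finally show ?thesis .
qed

end

text \<open>If the sparsity level is below 1 and \<open>d / m\<close> is bounded, then only finitely many pairs \<open>(m, d)\<close> remain.
  For these it is enough that \<open>\<Phi>\<close> has full rank with positive probability.\<close>

lemma quotient_property_triangular:
  assumes m: "0 < m" "m \<le> d"
  shows "\<exists>b\<in>signs ({..<m} \<times> {..<d}). quotient_property m d (2 * real m) b"
proof
  define b :: "nat \<times> nat \<Rightarrow> real" where "b = restrict (\<lambda>(i, l). if i \<le> l then 1 else - 1) ({..<m} \<times> {..<d})"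
  show "b \<in> signs ({..<m} \<times> {..<d})" by (auto simp: b_def signs_def split: if_splits)
  have bil: "b (i, l) = (if i \<le> l then 1 else - 1)" if "i < m" "l < d" for i l using that by (simp add: b_def)
  show "quotient_property m d (2 * real m) b"
    unfolding quotient_property_def
  proof (intro allI impI)
    fix t M assume M: "0 \<le> M" "\<forall>l<d. \<bar>bmul_t {..<m} b t l\<bar> \<le> M"
    let ?c = "bmul_t {..<m} b t"
    \<comment> \<open>Adjacent columns differ in a single row, so one difference isolates 2 t_l;
      only t_0 needs the first column.\<close>
    have step: "\<bar>t l\<bar> \<le> M" if l: "0 < l" "l < m" for l
    proof -
      have "?c l - ?c (l - 1) = (\<Sum>i<m. (b (i, l) - b (i, l - 1)) * t i)"
        by (simp add: bmul_t_def sum_subtractf[symmetric] left_diff_distrib)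
      also have "\<dots> = (\<Sum>i<m. if i = l then 2 * t l else 0)"
        by (rule sum.cong) (use l m in \<open>auto simp: bil\<close>)
      also have "\<dots> = 2 * t l" using l by simp
      finally have "2 * t l = ?c l - ?c (l - 1)" ..
      moreover have "\<bar>?c l\<bar> \<le> M" "\<bar>?c (l - 1)\<bar> \<le> M" using M(2) l m by auto
      ultimately show ?thesis by linarith
    qed
    have split: "(\<Sum>i<m. f i) = f 0 + (\<Sum>i\<in>{1..<m}. f i)" for f :: "nat \<Rightarrow> real"
      using m(1) by (simp add: lessThan_atLeast0 sum.atLeast_Suc_lessThan)
    have rest: "(\<Sum>i\<in>{1..<m}. \<bar>t i\<bar>) \<le> real (m - 1) * M"
      using sum_mono[of "{1..<m}" "\<lambda>i. \<bar>t i\<bar>" "\<lambda>_. M"] step by simp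
    have "?c 0 = t 0 - (\<Sum>i\<in>{1..<m}. t i)"
    proof -
      have "?c 0 = b (0, 0) * t 0 + (\<Sum>i\<in>{1..<m}. b (i, 0) * t i)" unfolding bmul_t_def by (rule split)
      also have "(\<Sum>i\<in>{1..<m}. b (i, 0) * t i) = (\<Sum>i\<in>{1..<m}. - t i)"
        by (rule sum.cong) (use m in \<open>auto simp: bil\<close>)
      also have "b (0, 0) = 1" using m by (simp add: bil)
      finally show ?thesis by (simp add: sum_negf)
    qed
    moreover have "\<bar>?c 0\<bar> \<le> M" using M(2) m by auto
    moreover have "\<bar>\<Sum>i\<in>{1..<m}. t i\<bar> \<le> (\<Sum>i\<in>{1..<m}. \<bar>t i\<bar>)" by (rule sum_abs)
    ultimately have "\<bar>t 0\<bar> \<le> M + real (m - 1) * M" using rest by linarith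
    then have "(\<Sum>i<m. \<bar>t i\<bar>) \<le> M + 2 * (real (m - 1) * M)" unfolding split[of "\<lambda>i. \<bar>t i\<bar>"] using rest by simp
    also have "\<dots> \<le> 2 * real m * M" using M(1) m(1) by (simp add: of_nat_diff algebra_simps)
    finally show "(\<Sum>i<m. \<bar>t i\<bar>) \<le> 2 * real m * M" .
  qed
qed

section \<open>Probability of a good matrix in all regimes\<close>

lemma sprob_not_le:
  assumes I: "finite I" and b: "b \<in> signs I" "P b"
  shows "sprob I (\<lambda>b. \<not> P b) \<le> 1 - 1 / 2 ^ card I"
proof -
  have "1 / 2 ^ card I \<le> sprob I P"
  proof -
    have "1 \<le> (\<Sum>b\<in>signs I. of_bool (P b) :: real)"
      using member_le_sum[of b "signs I" "\<lambda>b. of_bool (P b) :: real"] b finite_signs[OF I] by simp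
    then show ?thesis unfolding sprob_def avg_def by (intro divide_right_mono) auto
  qed
  moreover have "sprob I P + sprob I (\<lambda>b. \<not> P b) = avg I (\<lambda>_. 1)"
    unfolding sprob_def avg_add[symmetric] by (rule avg_cong) auto
  ultimately show ?thesis using I by (simp add: avg_const)
qed

lemma quotient_property_mono:
  "quotient_property m d R b \<Longrightarrow> R \<le> R' \<Longrightarrow> quotient_property m d R' b"
  unfolding quotient_property_def by (meson mult_right_mono order_trans)

text \<open>For sparsity below 1 the error bound exceeds \<open>C\<^sub>2\<close>, and only the solvability of
  \<open>\<Phi> z = y\<close> is required.\<close>

definition good_matrix :: "nat \<Rightarrow> nat \<Rightarrow> real \<Rightarrow> (nat \<times> nat \<Rightarrow> real) \<Rightarrow> bool" where
  "good_matrix m d C b \<longleftrightarrow> (\<exists>R\<ge>0. quotient_property m d R b) \<and>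
     (1 \<le> sparsity m d \<longrightarrow> good_on_grid m d (nat \<lfloor>sparsity m d\<rfloor>) b \<and>
        quotient_property m d (C * sqrt (real m / ln (real d / real m))) b)"

text \<open>Sparsity at least 1 forces m >= 10000, and the factors of the union bounds disappear in
  the drop of the rate to 1/1000. The threshold d / m = 10^8 decides which quotient property is
  used.\<close>

lemma good_matrix_prob_sparse:
  assumes m: "0 < m" and md: "289 * real m \<le> 100 * real d" and ld: "ln (real d) \<le> real m"
    and sp: "1 \<le> sparsity m d"
  shows "sprob ({..<m} \<times> {..<d}) (\<lambda>b. \<not> good_matrix m d (540000000) b) \<le> exp (- real m / 1000)"
proof -
  define u where "u = ln (real d / real m)"
  define R where "R = 540000000 * sqrt (real m / u)"
  have u1: "1 \<le> u" unfolding u_def by (rule ln_ratio_ge_1[OF md m])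
  have "10000 * u \<le> real m" using sp u1 unfolding sparsity_def u_def[symmetric] by (simp add: field_simps)
  then have m4: "10000 \<le> real m" using u1 by linarith
  have R0: "0 \<le> R" using u1 by (simp add: R_def)
  have Q: "sprob ({..<m} \<times> {..<d}) (\<lambda>b. \<not> quotient_property m d R b) \<le> 1 / 2 * exp (- real m / 1000)"
  proof (cases "10 ^ 8 * real m \<le> real d")
    case True
    have "40 * sqrt (real m / u) \<le> R" unfolding R_def using u1 by (intro mult_right_mono) auto
    then have "sprob ({..<m} \<times> {..<d}) (\<lambda>b. \<not> quotient_property m d R b)
      \<le> sprob ({..<m} \<times> {..<d}) (\<lambda>b. \<not> quotient_property m d (40 * sqrt (real m / u)) b)"
      by (intro sprob_mono) (auto dest: quotient_property_mono)
    also have "\<dots> \<le> exp (- real m)" unfolding u_def by (rule quotient_property_wide[OF m True ld])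
    also have "\<dots> \<le> 1 / 2 * exp (- real m / 1000)"
    proof -
      have "2 \<le> exp (real m - real m / 1000)" using exp_ge_add_one_self[of "real m - real m / 1000"] m4 by linarith
      then have "2 * exp (- real m) \<le> exp (real m - real m / 1000) * exp (- real m)" by (rule mult_right_mono) simp
      then show ?thesis by (simp add: exp_add[symmetric])
    qed
    finally show ?thesis .
  next
    case False
    have d0: "0 < real d" using md m by simp
    \<comment> \<open>For bounded d / m the logarithm is at most 81, so sqrt d <= 90000 sqrt (m /
      u); the constant 540000000 is 6000 times 90000.\<close>
    have "6000 * sqrt (real d) \<le> R"
    proof -
      have "real d / real m \<le> 10 ^ 8" using False m by (simp add: field_simps)
      then have "u \<le> ln (10 ^ 8)" unfolding u_def using d0 m by (intro iffD2[OF ln_le_cancel_iff]) auto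
      also have "\<dots> = 8 * ln 10" using ln_realpow[of "10::real" 8] by simp
      also have "ln (10::real) \<le> 9" using ln_le_minus_one[of "10::real"] by simp
      finally have u72: "u \<le> 81" by simp
      have "real d \<le> (10 ^ 4 * 9)\<^sup>2 * (real m / u)"
      proof -
        have "real d * u \<le> (10 ^ 8 * real m) * 81" using False u72 u1 by (intro mult_mono) auto
        then show ?thesis using u1 by (simp add: field_simps)
      qed
      then have "sqrt (real d) \<le> sqrt ((10 ^ 4 * 9)\<^sup>2 * (real m / u))" by (rule real_sqrt_le_mono)
      also have "\<dots> = 90000 * sqrt (real m / u)" unfolding real_sqrt_mult by simp
      finally show ?thesis by (simp add: R_def)
    qed
    then have "sprob ({..<m} \<times> {..<d}) (\<lambda>b. \<not> quotient_property m d R b)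
      \<le> sprob ({..<m} \<times> {..<d}) (\<lambda>b. \<not> quotient_property m d (6000 * sqrt (real d)) b)"
      by (intro sprob_mono) (auto dest: quotient_property_mono)
    also have "\<dots> \<le> 1800 * exp (5 - real m / 100)" by (rule quotient_property_moderate[OF md])
    also have "\<dots> \<le> 1 / 2 * exp (- real m / 1000)"
    proof -
      have "3600 \<le> exp (85::real)" using exp_lower_Taylor_quadratic[of 85] by simp
      also have "\<dots> \<le> exp (9 / 1000 * real m - 5)" using m4 by simp
      finally have "3600 * exp (5 - real m / 100) \<le> exp (9 / 1000 * real m - 5) * exp (5 - real m / 100)"
        by (rule mult_right_mono) simp
      then show ?thesis by (simp add: exp_add[symmetric])
    qed
    finally show ?thesis .
  qed
  have W: "sprob ({..<m} \<times> {..<d}) (\<lambda>b. \<not> good_on_grid m d (nat \<lfloor>sparsity m d\<rfloor>) b) \<le> 1 / 2 * exp (- real m / 1000)"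
  proof -
    have "sprob ({..<m} \<times> {..<d}) (\<lambda>b. \<not> good_on_grid m d (nat \<lfloor>sparsity m d\<rfloor>) b) \<le> 2 * exp (- real m / 24)"
      by (rule width_prob[OF md m]) simp
    also have "\<dots> \<le> 1 / 2 * exp (- real m / 1000)"
    proof -
      have "4 \<le> exp (real m / 24 - real m / 1000)" using exp_ge_add_one_self[of "real m / 24 - real m / 1000"] m4 by linarith
      then have "4 * exp (- real m / 24) \<le> exp (real m / 24 - real m / 1000) * exp (- real m / 24)" by (rule mult_right_mono) simp
      then show ?thesis by (simp add: exp_add[symmetric])
    qed
    finally show ?thesis .
  qed
  have "sprob ({..<m} \<times> {..<d}) (\<lambda>b. \<not> good_matrix m d 540000000 b)
    \<le> sprob ({..<m} \<times> {..<d}) (\<lambda>b. \<not> good_on_grid m d (nat \<lfloor>sparsity m d\<rfloor>) b \<or> \<not> quotient_property m d R b)"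
    by (rule sprob_mono) (use R0 in \<open>auto simp: good_matrix_def R_def u_def\<close>)
  then show ?thesis using sprob_disj2[OF W Q] by simp
qed

text \<open>With sparsity below 1 only some quotient property is required. For large d / m the wide
  case provides it with probability 1 - exp (- m). Otherwise m and d are bounded, and a single good
  sign matrix among 2^(m d) suffices once c1 is small enough.\<close>

lemma good_matrix_prob:
  "\<exists>c1>0. \<forall>m d. 0 < m \<longrightarrow> 289 * real m \<le> 100 * real d \<longrightarrow> ln (real d) \<le> real m \<longrightarrow>
     sprob ({..<m} \<times> {..<d}) (\<lambda>b. \<not> good_matrix m d 540000000 b) \<le> exp (- c1 * real m)"
proof -
  \<comment> \<open>Sparsity below 1 and a logarithm of at most 81 give m < 810000. \<open>B\<close>
    bounds m d, so that one sign matrix has probability at least 1 / 2^B.\<close>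
  obtain N :: nat where N: "real N \<ge> 810000" using real_arch_simple by blast
  obtain B :: nat where B: "real B \<ge> real N * (10 ^ 8 * real N)" using real_arch_simple by blast
  define c1 where "c1 = min (1 / 1000) (1 / (real N * 2 ^ B))"
  have N0: "0 < real N" using N by linarith
  have c1: "0 < c1" "c1 \<le> 1 / 1000" "c1 \<le> 1 / (real N * 2 ^ B)" using N0 by (auto simp: c1_def)
  have "sprob ({..<m} \<times> {..<d}) (\<lambda>b. \<not> good_matrix m d 540000000 b) \<le> exp (- c1 * real m)"
    if m: "0 < m" and md: "289 * real m \<le> 100 * real d" and ld: "ln (real d) \<le> real m" for m d :: nat
  proof -
    have u1: "1 \<le> ln (real d / real m)" by (rule ln_ratio_ge_1[OF md m])
    have weaken: "exp (- real m / 1000) \<le> exp (- c1 * real m)"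
      using mult_right_mono[OF c1(2), of "real m"] by simp
    consider (a) "1 \<le> sparsity m d" | (b) "sparsity m d < 1" "10 ^ 8 * real m \<le> real d" | (c) "sparsity m d < 1" "real d < 10 ^ 8 * real m"
      by linarith
    then show ?thesis
    proof cases
      case a
      then show ?thesis using good_matrix_prob_sparse[OF m md ld] weaken by linarith
    next
      case b
      have "sprob ({..<m} \<times> {..<d}) (\<lambda>b. \<not> good_matrix m d 540000000 b)
        \<le> sprob ({..<m} \<times> {..<d}) (\<lambda>b. \<not> quotient_property m d (40 * sqrt (real m / ln (real d / real m))) b)"
      proof (rule sprob_mono, rule notI)
        fix b assume ng: "\<not> good_matrix m d 540000000 b"
          and "quotient_property m d (40 * sqrt (real m / ln (real d / real m))) b"
        moreover have "0 \<le> 40 * sqrt (real m / ln (real d / real m))" using u1 by simp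
        ultimately have "\<exists>R\<ge>0. quotient_property m d R b" by blast
        then show False using ng b(1) by (simp add: good_matrix_def)
      qed
      also have "\<dots> \<le> exp (- real m)" by (rule quotient_property_wide[OF m b(2) ld])
      also have "\<dots> \<le> exp (- real m / 1000)" by simp
      finally show ?thesis using weaken by linarith
    next
      case c
      have d0: "0 < real d" using md m by simp
      have mdle: "m \<le> d" using md by linarith
      have "real d / real m \<le> 10 ^ 8" using c(2) m by (simp add: field_simps)
      then have "ln (real d / real m) \<le> ln (10 ^ 8)" using d0 m by (intro iffD2[OF ln_le_cancel_iff]) auto
      also have "\<dots> = 8 * ln 10" using ln_realpow[of "10::real" 8] by simp
      also have "ln (10::real) \<le> 9" using ln_le_minus_one[of "10::real"] by simp
      finally have "ln (real d / real m) \<le> 81" by simp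
      moreover have "real m < 10000 * ln (real d / real m)" using c(1) u1 by (simp add: sparsity_def field_simps)
      ultimately have mN: "real m \<le> real N" using N by linarith
      have "real (m * d) \<le> real B"
      proof -
        have "real m * real d \<le> real N * (10 ^ 8 * real N)" using c(2) mN by (intro mult_mono) auto
        then show ?thesis using B by simp
      qed
      then have mdB: "m * d \<le> B" by (simp only: of_nat_le_iff)
      obtain b where b: "b \<in> signs ({..<m} \<times> {..<d})" "quotient_property m d (2 * real m) b"
        using quotient_property_triangular[OF m mdle] by blast
      have "\<exists>R\<ge>0. quotient_property m d R b" using b(2) by (intro exI[of _ "2 * real m"]) simp
      then have "good_matrix m d 540000000 b" using c(1) by (simp add: good_matrix_def)
      then have "sprob ({..<m} \<times> {..<d}) (\<lambda>b. \<not> good_matrix m d 540000000 b) \<le> 1 - 1 / 2 ^ card ({..<m} \<times> {..<d})"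
        by (intro sprob_not_le[OF _ b(1)]) auto
      also have "\<dots> = 1 + - (1 / 2 ^ (m * d))" by (simp add: card_cartesian_product)
      also have "\<dots> \<le> exp (- (1 / 2 ^ (m * d)))" by (rule exp_ge_add_one_self)
      also have "\<dots> \<le> exp (- c1 * real m)"
      proof -
        have "c1 * real m \<le> 1 / (real N * 2 ^ B) * real N" using c1 mN by (intro mult_mono) auto
        also have "\<dots> = 1 / 2 ^ B" using N0 by simp
        also have "\<dots> \<le> 1 / 2 ^ (m * d)" using mdB by (intro divide_left_mono power_increasing) auto
        finally show ?thesis by simp
      qed
      finally show ?thesis .
    qed
  qed
  then show ?thesis using c1(1) by blast
qed

subsection \<open>The random draw and the algorithm\<close>

text \<open>Finiteness, measurable points and equal masses are exactly what passes from the factor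
  to the product, so the lemma can be applied first to a row and then to the whole matrix.\<close>

lemma point_measure_PiM:
  assumes N: "prob_space N" "finite (space N)" and I: "finite I"
    and pt: "\<And>x. x \<in> space N \<Longrightarrow> {x} \<in> sets N \<and> measure N {x} = c"
  shows "prob_space (PiM I (\<lambda>_. N))" "finite (space (PiM I (\<lambda>_. N)))"
    "\<And>x. x \<in> space (PiM I (\<lambda>_. N)) \<Longrightarrow> {x} \<in> sets (PiM I (\<lambda>_. N)) \<and> measure (PiM I (\<lambda>_. N)) {x} = c ^ card I"
proof -
  interpret N: prob_space N by (rule N)
  interpret P: finite_product_prob_space "\<lambda>_. N" I by standard (rule I)
  show "prob_space (PiM I (\<lambda>_. N))" by (intro prob_space_PiM N)
  show "finite (space (PiM I (\<lambda>_. N)))" using N I by (simp add: space_PiM finite_PiE)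
  fix x assume x: "x \<in> space (PiM I (\<lambda>_. N))"
  then have xi: "x i \<in> space N" if "i \<in> I" for i using that by (auto simp: space_PiM PiE_iff)
  have eq: "{x} = PiE I (\<lambda>i. {x i})"
  proof (rule set_eqI)
    fix y
    have "y = x" if "y \<in> PiE I (\<lambda>i. {x i})"
      by (rule extensionalityI[of _ I]) (use x that in \<open>auto simp: space_PiM PiE_iff\<close>)
    then show "y \<in> {x} \<longleftrightarrow> y \<in> PiE I (\<lambda>i. {x i})" using x by (auto simp: space_PiM PiE_iff)
  qed
  have s: "{x i} \<in> sets N" if "i \<in> I" for i using pt[OF xi[OF that]] by blast
  have "measure (PiM I (\<lambda>_. N)) {x} = (\<Prod>i\<in>I. measure N {x i})"
    unfolding eq by (rule P.prob_times) (use s in auto)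
  also have "\<dots> = (\<Prod>i\<in>I. c)" by (rule prod.cong) (use pt xi in auto)
  finally have "measure (PiM I (\<lambda>_. N)) {x} = c ^ card I" by simp
  moreover have "{x} \<in> sets (PiM I (\<lambda>_. N))" unfolding eq by (rule sets_PiM_I_finite[OF I]) (use s in auto)
  ultimately show "{x} \<in> sets (PiM I (\<lambda>_. N)) \<and> measure (PiM I (\<lambda>_. N)) {x} = c ^ card I" by blast
qed

definition sign_matrix :: "nat \<Rightarrow> (nat \<Rightarrow> nat \<Rightarrow> real) \<Rightarrow> nat \<times> nat \<Rightarrow> real" where
  "sign_matrix m \<Phi> = (\<lambda>(i, l). sqrt (real m) * \<Phi> i l)"

abbreviation matrix_measure :: "nat \<Rightarrow> nat \<Rightarrow> (nat \<Rightarrow> nat \<Rightarrow> real) measure" where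
  "matrix_measure m d \<equiv> \<Pi>\<^sub>M i\<in>{..<m}. \<Pi>\<^sub>M j\<in>{..<d}. uniform_count_measure {1 / sqrt (real m), - 1 / sqrt (real m)}"

lemma space_matrix_measure:
  "space (matrix_measure m d) = PiE {..<m} (\<lambda>_. PiE {..<d} (\<lambda>_. {1 / sqrt (real m), - 1 / sqrt (real m)}))"
  by (simp add: space_PiM space_uniform_count_measure)

lemma matrix_entries:
  assumes "\<Phi> \<in> space (matrix_measure m d)" "i < m" "l < d"
  shows "\<bar>\<Phi> i l\<bar> = 1 / sqrt (real m)" "sqrt (real m) * \<Phi> i l \<in> {-1, 1}"
proof -
  have "\<Phi> i \<in> PiE {..<d} (\<lambda>_. {1 / sqrt (real m), - 1 / sqrt (real m)})"
    using assms(1,2) unfolding space_matrix_measure by (auto simp: PiE_iff)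
  then have "\<Phi> i l = 1 / sqrt (real m) \<or> \<Phi> i l = - 1 / sqrt (real m)" using assms(3) by (auto simp: PiE_iff)
  then show "\<bar>\<Phi> i l\<bar> = 1 / sqrt (real m)" "sqrt (real m) * \<Phi> i l \<in> {-1, 1}" using assms(2) by auto
qed

text \<open>All points have mass 1 / 2^(m d), so measuring a failure event is counting it. Rescaling
  by sqrt m and restricting to the index grid injects it into the sign vectors.\<close>

lemma matrix_measure_sprob:
  assumes m: "0 < m" and dep: "depends_on ({..<m} \<times> {..<d}) P"
    and p: "sprob ({..<m} \<times> {..<d}) (\<lambda>b. \<not> P b) \<le> p"
  shows "{\<Phi> \<in> space (matrix_measure m d). P (sign_matrix m \<Phi>)} \<in> sets (matrix_measure m d)"
    and "1 - p \<le> measure (matrix_measure m d) {\<Phi> \<in> space (matrix_measure m d). P (sign_matrix m \<Phi>)}"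
    and "prob_space (matrix_measure m d)"
proof -
  let ?S = "{1 / sqrt (real m), - 1 / sqrt (real m)}"
  let ?N = "uniform_count_measure ?S" and ?M = "matrix_measure m d"
  let ?G = "{..<m} \<times> {..<d}"
  have ne: "1 / sqrt (real m) \<noteq> - 1 / sqrt (real m)" using m by (simp add: field_simps)
  have cS: "card ?S = 2" using ne by simp
  have N1: "prob_space ?N" by (rule prob_space_uniform_count_measure) auto
  have N2: "finite (space ?N)" by (simp add: space_uniform_count_measure)
  have N3: "{x} \<in> sets ?N \<and> measure ?N {x} = 1 / 2" if "x \<in> space ?N" for x
  proof -
    have x: "x \<in> ?S" using that by (simp add: space_uniform_count_measure)
    then have "measure ?N {x} = real (card {x}) / real (card ?S)" by (intro measure_uniform_count_measure) auto
    then show ?thesis using x unfolding cS by (simp add: sets_uniform_count_measure)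
  qed
  let ?R = "\<Pi>\<^sub>M j\<in>{..<d}. ?N"
  have R1: "prob_space ?R" by (rule point_measure_PiM(1)[OF N1 N2 finite_lessThan]) (rule N3)
  have R2: "finite (space ?R)" by (rule point_measure_PiM(2)[OF N1 N2 finite_lessThan]) (rule N3)
  have R3: "{x} \<in> sets ?R \<and> measure ?R {x} = (1 / 2) ^ card {..<d}" if "x \<in> space ?R" for x
    by (rule point_measure_PiM(3)[OF N1 N2 finite_lessThan N3 that])
  have MM3: "{x} \<in> sets ?M \<and> measure ?M {x} = ((1 / 2) ^ card {..<d}) ^ card {..<m}" if "x \<in> space ?M" for x
    by (rule point_measure_PiM(3)[OF R1 R2 finite_lessThan R3 that])
  show prob: "prob_space ?M" by (rule point_measure_PiM(1)[OF R1 R2 finite_lessThan]) (rule R3)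
  interpret M: prob_space ?M by (rule prob)
  have fin: "finite (space ?M)" by (rule point_measure_PiM(2)[OF R1 R2 finite_lessThan]) (rule R3)
  have pt: "{x} \<in> sets ?M" "measure ?M {x} = 1 / 2 ^ (m * d)" if "x \<in> space ?M" for x
  proof -
    show "{x} \<in> sets ?M" using MM3[OF that] by blast
    have "measure ?M {x} = ((1 / 2) ^ card {..<d}) ^ card {..<m}" using MM3[OF that] by blast
    then show "measure ?M {x} = 1 / 2 ^ (m * d)" by (simp add: power_mult[symmetric] power_one_over mult.commute)
  qed
  have sub: "A \<in> sets ?M" if "A \<subseteq> space ?M" for A
  proof -
    have "finite A" using that fin finite_subset by blast
    then have "(\<Union>x\<in>A. {x}) \<in> sets ?M" by (intro sets.finite_UN) (use that pt(1) in auto)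
    then show ?thesis by simp
  qed
  define G where "G = {\<Phi> \<in> space ?M. P (sign_matrix m \<Phi>)}"
  define B where "B = {\<Phi> \<in> space ?M. \<not> P (sign_matrix m \<Phi>)}"
  have GS: "G \<in> sets ?M" and BS: "B \<in> sets ?M" unfolding G_def B_def by (intro sub; blast)+
  have finB: "finite B" unfolding B_def using fin by simp
  have "measure ?M B = (\<Sum>x\<in>B. measure ?M {x})"
  proof -
    have "measure ?M (\<Union>x\<in>B. {x}) = (\<Sum>x\<in>B. measure ?M {x})"
      by (rule M.finite_measure_finite_Union[OF finB]) (use pt(1) in \<open>auto simp: B_def disjoint_family_on_def\<close>)
    then show ?thesis by simp
  qed
  also have "\<dots> = (\<Sum>x\<in>B. 1 / 2 ^ (m * d))"
  proof (rule sum.cong[OF refl])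
    fix x assume "x \<in> B"
    then have "x \<in> space ?M" unfolding B_def by blast
    then show "measure ?M {x} = 1 / 2 ^ (m * d)" by (rule pt(2))
  qed
  also have "\<dots> = real (card B) / 2 ^ (m * d)" by simp
  also have "\<dots> \<le> sprob ?G (\<lambda>b. \<not> P b)"
  proof -
    define q where "q = (\<lambda>\<Phi>. restrict (sign_matrix m \<Phi>) ?G)"
    define T where "T = {b \<in> signs ?G. \<not> P b}"
    have "inj_on q B"
    proof (rule inj_onI)
      fix \<Phi> \<Psi> assume PB: "\<Phi> \<in> B" "\<Psi> \<in> B" and eq: "q \<Phi> = q \<Psi>"
      have "\<Phi> i l = \<Psi> i l" if "i < m" "l < d" for i l
        using fun_cong[OF eq, of "(i, l)"] that m by (simp add: q_def sign_matrix_def)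
      then have "\<Phi> i = \<Psi> i" if i: "i < m" for i
        using PB i unfolding B_def space_matrix_measure
        by (intro extensionalityI[of _ "{..<d}"]) (auto simp: PiE_iff)
      then show "\<Phi> = \<Psi>"
        using PB unfolding B_def space_matrix_measure
        by (intro extensionalityI[of \<Phi> "{..<m}" \<Psi>]) (simp_all add: PiE_iff)
    qed
    moreover have "q ` B \<subseteq> T"
    proof
      fix b assume "b \<in> q ` B"
      then obtain \<Phi> where \<Phi>: "\<Phi> \<in> B" "b = q \<Phi>" by blast
      have "P (q \<Phi>) = P (sign_matrix m \<Phi>)" by (rule depends_onD[OF dep]) (simp add: q_def)
      moreover have "q \<Phi> \<in> signs ?G"
      proof -
        have "sqrt (real m) * \<Phi> i l \<in> {-1, 1}" if "i < m" "l < d" for i l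
        proof -
          have "\<Phi> \<in> space ?M" using \<Phi>(1) unfolding B_def by blast
          then show ?thesis using that by (rule matrix_entries(2))
        qed
        then show ?thesis by (auto simp: q_def signs_def sign_matrix_def)
      qed
      ultimately show "b \<in> T" using \<Phi> by (simp add: T_def B_def)
    qed
    moreover have finT: "finite T" unfolding T_def using finite_signs[of ?G] by simp
    ultimately have "card B \<le> card T" by (rule card_inj_on_le)
    moreover have "sprob ?G (\<lambda>b. \<not> P b) = real (card T) / 2 ^ (m * d)"
    proof -
      have "(\<Sum>b\<in>signs ?G. of_bool (\<not> P b)) = real (card T)"
        unfolding T_def using finite_signs[of ?G] by (simp add: Int_def)
      then show ?thesis by (simp add: sprob_def avg_def card_cartesian_product)
    qed
    ultimately show ?thesis by (simp add: divide_right_mono)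
  qed
  finally have "measure ?M B \<le> p" using p by linarith
  moreover have "measure ?M G = 1 - measure ?M B"
  proof -
    have "G = space ?M - B" by (auto simp: G_def B_def)
    then show ?thesis using M.prob_compl[OF BS] by simp
  qed
  ultimately show "1 - p \<le> measure ?M {\<Phi> \<in> space ?M. P (sign_matrix m \<Phi>)}" by (simp add: G_def)
  show "{\<Phi> \<in> space ?M. P (sign_matrix m \<Phi>)} \<in> sets ?M" using GS by (simp add: G_def)
qed

lemma good_matrix_depends: "depends_on ({..<m} \<times> {..<d}) (good_matrix m d C)"
  unfolding depends_on_def
proof (intro allI impI)
  fix b b' :: "nat \<times> nat \<Rightarrow> real" assume eq: "\<forall>i\<in>{..<m} \<times> {..<d}. b i = b' i"
  have 1: "bmul_t {..<m} b t l = bmul_t {..<m} b' t l" if "l < d" for t l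
    unfolding bmul_t_def using eq that by (intro sum.cong) auto
  have 2: "bmul d b h i = bmul d b' h i" if "i < m" for h i
    unfolding bmul_def using eq that by (intro sum.cong) auto
  have "quotient_property m d R b = quotient_property m d R b'" for R
    unfolding quotient_property_def by (simp add: 1)
  moreover have "good_on_grid m d K b = good_on_grid m d K b'" for K
    unfolding good_on_grid_def by (simp add: 2)
  ultimately show "good_matrix m d C b = good_matrix m d C b'" unfolding good_matrix_def by simp
qed

section \<open>Query points, existence of an output, and recovery of a gradient\<close>

lemma mat_vec_norm_le:
  assumes "orthonormal_columns d k (mat_transpose A)"
  shows "L2_set (mat_vec k d A x) {..<k} \<le> L2_set x {..<d}"
proof -
  have "ip k (mat_vec k d A x) (mat_vec k d A x) = (\<Sum>i<k. (ip d (\<lambda>l. mat_transpose A l i) x)\<^sup>2)"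
    unfolding ip_self[of k] by (rule sum.cong) (auto simp: mat_vec_def mat_transpose_def ip_def)
  also have "\<dots> \<le> ip d x x" by (rule bessel[OF assms])
  finally show ?thesis by (simp add: L2_set_ip)
qed

lemma mat_vec_zero: "i \<ge> k \<Longrightarrow> mat_vec k d A x i = 0"
  by (simp add: mat_vec_def)

lemma mat_vec_ip: "i < k \<Longrightarrow> mat_vec k d A x i = ip d (A i) x"
  by (simp add: mat_vec_def ip_def)

lemma query_point_in_ball:
  assumes \<Phi>: "\<Phi> \<in> space (matrix_measure m d)" and i: "i < m" and x: "\<xi> j \<in> euclid_sphere d"
    and e: "0 < \<epsilon>" "\<epsilon> * sqrt (real d / real m) \<le> eb"
  shows "query_point d \<epsilon> \<Phi> \<xi> i j \<in> euclid_cball d (1 + eb)"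
proof -
  have x1: "L2_set (\<xi> j) {..<d} = 1" using x by (simp add: euclid_sphere_def)
  have "L2_set (query_point d \<epsilon> \<Phi> \<xi> i j) {..<d} = L2_set (\<lambda>l. \<xi> j l + \<epsilon> * \<Phi> i l) {..<d}"
    by (rule L2_set_cong) (auto simp: query_point_def)
  also have "\<dots> \<le> L2_set (\<xi> j) {..<d} + L2_set (\<lambda>l. \<epsilon> * \<Phi> i l) {..<d}" by (rule L2_set_triangle_ineq)
  also have "L2_set (\<lambda>l. \<epsilon> * \<Phi> i l) {..<d} = \<epsilon> * L2_set (\<Phi> i) {..<d}" using e by (simp add: L2_scale)
  also have "L2_set (\<Phi> i) {..<d} = sqrt (real d / real m)"
  proof -
    have "(\<Phi> i l)\<^sup>2 = 1 / real m" if "l < d" for l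
      using matrix_entries(1)[OF \<Phi> i that] by (metis of_nat_0_le_iff power2_abs power_one_over real_sqrt_pow2)
    then have "(\<Sum>l<d. (\<Phi> i l)\<^sup>2) = (\<Sum>l<d. 1 / real m)" by (intro sum.cong) auto
    then show ?thesis by (simp add: L2_set_def)
  qed
  finally have "L2_set (query_point d \<epsilon> \<Phi> \<xi> i j) {..<d} \<le> 1 + eb" using e x1 by linarith
  then show ?thesis by (simp add: euclid_cball_iff query_point_def)
qed

lemma queries_facts:
  assumes \<Phi>: "\<Phi> \<in> space (matrix_measure m d)" and x: "\<And>j. j < mX \<Longrightarrow> \<xi> j \<in> euclid_sphere d"
    and e: "0 < \<epsilon>" "\<epsilon> * sqrt (real d / real m) \<le> eb" "0 < eb"
  shows "length (queries m mX d \<epsilon> \<Phi> \<xi>) = mX * (m + 1)"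
    "set (queries m mX d \<epsilon> \<Phi> \<xi>) \<subseteq> euclid_cball d (1 + eb)"
proof -
  show "length (queries m mX d \<epsilon> \<Phi> \<xi>) = mX * (m + 1)"
    by (simp add: queries_def length_concat comp_def sum_list_triv)
  have sph: "\<xi> j \<in> euclid_cball d (1 + eb)" if "j < mX" for j
    using x[OF that] e(3) by (simp add: euclid_sphere_def euclid_cball_def)
  have qp: "query_point d \<epsilon> \<Phi> \<xi> i j \<in> euclid_cball d (1 + eb)" if "i < m" "j < mX" for i j
    by (rule query_point_in_ball[where \<xi> = \<xi> and j = j, OF \<Phi> that(1) x[OF that(2)] e(1,2)])
  show "set (queries m mX d \<epsilon> \<Phi> \<xi>) \<subseteq> euclid_cball d (1 + eb)"
    unfolding queries_def using sph qp by auto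
qed

lemma difference_quotients_restrict:
  assumes "j < mX"
  shows "difference_quotients m d \<epsilon> (restrict f (set (queries m mX d \<epsilon> \<Phi> \<xi>))) \<Phi> \<xi> j = difference_quotients m d \<epsilon> f \<Phi> \<xi> j"
proof
  fix i
  have "\<xi> j \<in> set (queries m mX d \<epsilon> \<Phi> \<xi>)" using assms by (auto simp: queries_def)
  moreover have "query_point d \<epsilon> \<Phi> \<xi> i j \<in> set (queries m mX d \<epsilon> \<Phi> \<xi>)" if "i < m"
    using assms that by (auto simp: queries_def intro!: bexI[of _ j])
  ultimately show "difference_quotients m d \<epsilon> (restrict f (set (queries m mX d \<epsilon> \<Phi> \<xi>))) \<Phi> \<xi> j i = difference_quotients m d \<epsilon> f \<Phi> \<xi> j i"
    by (simp add: difference_quotients_def)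
qed

lemma quotient_solve:
  assumes m: "0 < m" and Q: "quotient_property m d R (sign_matrix m \<Phi>)" and R: "0 \<le> R"
    and e: "0 \<le> \<delta>" "\<And>i. i < m \<Longrightarrow> \<bar>sqrt (real m) * e i\<bar> \<le> \<delta>"
  obtains u where "\<And>l. l \<ge> d \<Longrightarrow> u l = 0" "\<And>i. i < m \<Longrightarrow> ip d (\<Phi> i) u = e i" "(\<Sum>l<d. \<bar>u l\<bar>) \<le> R * \<delta>"
proof -
  define B where "B = (\<lambda>i l. sqrt (real m) * \<Phi> i l)"
  have LQ: "(\<Sum>i<m. \<bar>t i\<bar>) \<le> R * M" if "\<And>l. l < d \<Longrightarrow> \<bar>\<Sum>i<m. B i l * t i\<bar> \<le> M" "0 \<le> M" for t M
  proof -
    have "bmul_t {..<m} (sign_matrix m \<Phi>) t l = (\<Sum>i<m. B i l * t i)" for l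
      by (simp add: bmul_t_def sign_matrix_def B_def)
    then show ?thesis using Q that unfolding quotient_property_def by simp
  qed
  have "\<exists>u. (\<forall>l\<ge>d. u l = 0) \<and> (\<forall>i<m. ip d (B i) u = sqrt (real m) * e i) \<and> (\<Sum>l<d. \<bar>u l\<bar>) \<le> R * \<delta>"
  proof (rule dual_solve[where d = d and m = m and B = B and R = R and b = \<delta> and v = "\<lambda>i. sqrt (real m) * e i"])
    show "(\<Sum>i<m. \<bar>t i\<bar>) \<le> R * M" if "\<And>l. l < d \<Longrightarrow> \<bar>\<Sum>i<m. B i l * t i\<bar> \<le> M" "0 \<le> M" for t M
      by (rule LQ) (use that in auto)
  qed (use R e in auto)
  then obtain u where u: "\<And>l. l \<ge> d \<Longrightarrow> u l = 0" "\<And>i. i < m \<Longrightarrow> ip d (B i) u = sqrt (real m) * e i" "(\<Sum>l<d. \<bar>u l\<bar>) \<le> R * \<delta>"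
    by blast
  have "ip d (\<Phi> i) u = e i" if "i < m" for i
  proof -
    have "sqrt (real m) * ip d (\<Phi> i) u = sqrt (real m) * e i" using u(2)[OF that] by (simp add: B_def ip_scale_left)
    then show ?thesis using m by simp
  qed
  then show thesis using that u by blast
qed

text \<open>Any quotient property makes \<open>\<Phi>\<close> surjective, so the constraint of each
  minimization is feasible whatever the data are; the size of R does not matter here.\<close>

lemma algorithm2_output_exists:
  assumes m: "0 < m" and Q: "quotient_property m d R (sign_matrix m \<Phi>)" and R: "0 \<le> R"
  shows "\<exists>fhat. algorithm2_output m mX d k \<epsilon> f \<Phi> \<xi> fhat"
proof -
  define y where "y = difference_quotients m d \<epsilon> (restrict f (set (queries m mX d \<epsilon> \<Phi> \<xi>))) \<Phi> \<xi>"
  have "\<exists>x. is_l1_minimizer m d \<Phi> (y j) x" for j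
  proof -
    define \<delta> where "\<delta> = (\<Sum>i<m. \<bar>sqrt (real m) * y j i\<bar>)"
    have d: "\<bar>sqrt (real m) * y j i\<bar> \<le> \<delta>" if "i < m" for i
      unfolding \<delta>_def by (rule member_le_sum) (use that in auto)
    have d0: "0 \<le> \<delta>" unfolding \<delta>_def by (rule sum_nonneg) simp
    obtain u where u: "\<And>l. l \<ge> d \<Longrightarrow> u l = 0" "\<And>i. i < m \<Longrightarrow> ip d (\<Phi> i) u = y j i"
      by (rule quotient_solve[OF m Q R d0 d]) auto
    have "mat_vec m d \<Phi> u = y j"
      using u(2) by (auto simp: fun_eq_iff mat_vec_def ip_def y_def difference_quotients_def)
    moreover have "u \<in> topspace (Euclidean_space d)" using u(1) by (simp add: topspace_Euclidean_space)
    ultimately show ?thesis using l1_minimizer_exists by blast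
  qed
  then obtain X where X: "\<And>j. is_l1_minimizer m d \<Phi> (y j) (X j)" by metis
  obtain U s V where "is_svd mX d X U s V" using svd_exists by blast
  then show ?thesis using X unfolding algorithm2_output_def algorithm2_matrix_def y_def by blast
qed

text \<open>The competitor in the minimization is x + u, where \<open>u\<close> reproduces the noise
  and has l1 norm at most CL sqrt \<kappa> \<delta>. The kernel width is of order 1 / sqrt \<kappa>,
  so the noise finally enters as a multiple of \<delta> independent of m and d.\<close>

lemma recovered_gradient_error:
  assumes m: "0 < m" and md: "289 * real m \<le> 100 * real d" and sp: "1 \<le> sparsity m d"
    and good: "good_matrix m d CL (sign_matrix m \<Phi>)" and CL: "0 \<le> CL"
    and min: "is_l1_minimizer m d \<Phi> y xh"
    and q: "0 < q" "q \<le> 1" and xq: "(\<Sum>l<d. \<bar>x l\<bar> powr q) \<le> Q" and Q: "0 < Q"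
    and noise: "0 \<le> \<delta>" "\<And>i. i < m \<Longrightarrow> \<bar>sqrt (real m) * (y i - ip d (\<Phi> i) x)\<bar> \<le> \<delta>"
  defines "\<kappa> \<equiv> real m / ln (real d / real m)"
  shows "L2_set (\<lambda>l. xh l - x l) {..<d} \<le>
    3000 * 8000000 powr (1 / q - 1) * Q powr (1 / q) * \<kappa> powr (1 / 2 - 1 / q) + (1500 * CL + 4) * \<delta>"
proof -
  define b where "b = sign_matrix m \<Phi>"
  define K where "K = nat \<lfloor>sparsity m d\<rfloor>"
  have grid: "good_on_grid m d K b" and QP: "quotient_property m d (CL * sqrt \<kappa>) b"
    using good sp unfolding good_matrix_def b_def K_def \<kappa>_def by auto
  have lnD: "1 \<le> ln (real d / real m)" by (rule ln_ratio_ge_1[OF md m])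
  have \<kappa>: "0 < \<kappa>" unfolding \<kappa>_def using m lnD by simp
  have spk: "sparsity m d = \<kappa> / 10000" by (simp add: sparsity_def \<kappa>_def)
  have fl: "1 \<le> \<lfloor>sparsity m d\<rfloor>" using sp by (simp add: le_floor_iff)
  have K0: "0 < K" unfolding K_def using fl by simp
  \<comment> \<open>Rounding the sparsity down loses at most a factor 2, because it is at least
    1.\<close>
  have K2: "\<kappa> / 20000 \<le> real K"
  proof -
    have "real K = real_of_int \<lfloor>sparsity m d\<rfloor>" unfolding K_def using fl by simp
    moreover have "sparsity m d < real_of_int \<lfloor>sparsity m d\<rfloor> + 1" by linarith
    ultimately show ?thesis using K0 spk by (simp add: field_simps)
  qed
  \<comment> \<open>400 is 20^2: the kernel width constant 5 / sqrt K times sqrt s0 is then exactly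
    the 1/4 required by \<open>l1_recovery\<close>. With 20000 it produces the 8000000 in the
    bound.\<close>
  define s0 where "s0 = real K / 400"
  have s0: "0 < s0" using K0 by (simp add: s0_def)
  obtain S where S: "S \<subseteq> {..<d}" "real (card S) \<le> s0" "(\<Sum>l\<in>{..<d} - S. \<bar>x l\<bar>) \<le> Q powr (1 / q) * s0 powr (1 - 1 / q)"
    by (rule best_sparse_approximation[OF q xq Q s0])
  define e where "e = (\<lambda>i. y i - ip d (\<Phi> i) x)"
  have R0: "0 \<le> CL * sqrt \<kappa>" using CL \<kappa> by simp
  have noise': "\<bar>sqrt (real m) * e i\<bar> \<le> \<delta>" if "i < m" for i using noise(2)[OF that] by (simp add: e_def)
  obtain u where u: "\<And>l. l \<ge> d \<Longrightarrow> u l = 0" "\<And>i. i < m \<Longrightarrow> ip d (\<Phi> i) u = e i" "(\<Sum>l<d. \<bar>u l\<bar>) \<le> CL * sqrt \<kappa> * \<delta>"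
    by (rule quotient_solve[OF m QP[unfolded b_def] R0 noise(1) noise']) auto
  define U where "U = CL * sqrt \<kappa> * \<delta>"
  define z where "z = (\<lambda>l. if l < d then x l + u l else 0)"
  have xh: "mat_vec m d \<Phi> xh = y" "\<And>w. w \<in> topspace (Euclidean_space d) \<Longrightarrow> mat_vec m d \<Phi> w = y \<Longrightarrow> (\<Sum>l<d. \<bar>xh l\<bar>) \<le> (\<Sum>l<d. \<bar>w l\<bar>)"
    using min by (auto simp: is_l1_minimizer_def)
  have yi: "ip d (\<Phi> i) xh = y i" if "i < m" for i using xh(1) mat_vec_ip[OF that, of d \<Phi> xh] by simp
  have y0: "y i = 0" if "i \<ge> m" for i using xh(1) mat_vec_zero[OF that, of d \<Phi> xh] by simp
  have "mat_vec m d \<Phi> z = y"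
  proof
    fix i
    show "mat_vec m d \<Phi> z i = y i"
    proof (cases "i < m")
      case True
      have "ip d (\<Phi> i) z = ip d (\<Phi> i) (\<lambda>l. x l + u l)" by (rule ip_cong) (auto simp: z_def)
      then show ?thesis using True u(2)[OF True] by (simp add: mat_vec_ip ip_linear e_def)
    next
      case False
      then show ?thesis using y0[of i] by (simp add: mat_vec_zero)
    qed
  qed
  then have "(\<Sum>l<d. \<bar>xh l\<bar>) \<le> (\<Sum>l<d. \<bar>z l\<bar>)" by (intro xh(2)) (auto simp: topspace_Euclidean_space z_def)
  also have "\<dots> \<le> (\<Sum>l<d. \<bar>x l\<bar> + \<bar>u l\<bar>)" by (rule sum_mono) (simp add: z_def)
  also have "\<dots> \<le> (\<Sum>l<d. \<bar>x l\<bar>) + U" using u(3) by (simp add: sum.distrib U_def)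
  finally have l1: "(\<Sum>l<d. \<bar>xh l\<bar>) \<le> (\<Sum>l<d. \<bar>x l\<bar>) + U" .
  define h where "h = (\<lambda>l. xh l - x l)"
  have Bh: "bmul d b h i = sqrt (real m) * e i" if "i < m" for i
  proof -
    have "bmul d b h i = sqrt (real m) * ip d (\<Phi> i) h"
      by (simp add: bmul_def b_def sign_matrix_def ip_def sum_distrib_left mult_ac)
    then show ?thesis using yi[OF that] by (simp add: h_def ip_linear e_def)
  qed
  have "2 / sqrt (real m) * L2_set (bmul d b h) {..<m} \<le> 2 * \<delta>"
  proof -
    have "L2_set (bmul d b h) {..<m} = L2_set (\<lambda>i. \<bar>sqrt (real m) * e i\<bar>) {..<m}"
      unfolding L2_set_def by (simp add: Bh)
    also have "\<dots> \<le> L2_set (\<lambda>i. \<delta>) {..<m}" by (rule L2_set_mono) (use noise(2) in \<open>auto simp: e_def\<close>)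
    also have "\<dots> = sqrt (real m) * \<delta>" using noise(1) by (simp add: L2_set_constant)
    finally have "2 / sqrt (real m) * L2_set (bmul d b h) {..<m} \<le> 2 / sqrt (real m) * (sqrt (real m) * \<delta>)"
      by (rule mult_left_mono) simp
    then show ?thesis using m by simp
  qed
  then have width: "sqrt (ip d h h) \<le> 5 / sqrt (real K) * (\<Sum>l<d. \<bar>h l\<bar>) + 2 * \<delta>"
    using kernel_width[OF grid K0 m, of h] by (simp add: L2_set_ip)
  have a14: "5 / sqrt (real K) * sqrt s0 \<le> 1 / 4"
    using K0 by (simp add: s0_def real_sqrt_divide)
  have "sqrt (ip d h h) \<le> 2 * (5 / sqrt (real K)) * (2 * (Q powr (1 / q) * s0 powr (1 - 1 / q)) + U) + 2 * (2 * \<delta>)"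
    by (rule l1_recovery[OF width h_def l1 S _ a14]) simp
  also have "2 * (5 / sqrt (real K)) * (2 * (Q powr (1 / q) * s0 powr (1 - 1 / q)) + U)
    \<le> 1500 / sqrt \<kappa> * (2 * (Q powr (1 / q) * (8000000 powr (1 / q - 1) * \<kappa> powr (1 - 1 / q))) + U)"
  proof (rule mult_mono)
    \<comment> \<open>22500 = 150^2 is a square above 20000, whence 10 / sqrt K <= 1500 / sqrt
      \<kappa>.\<close>
    have "sqrt \<kappa> \<le> sqrt (22500 * real K)" using K2 by (intro real_sqrt_le_mono) simp
    also have "\<dots> = 150 * sqrt (real K)" unfolding real_sqrt_mult by simp
    finally show "2 * (5 / sqrt (real K)) \<le> 1500 / sqrt \<kappa>" using K0 \<kappa> by (simp add: field_simps)
    have "s0 powr (1 - 1 / q) \<le> (\<kappa> / 8000000) powr (1 - 1 / q)"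
      using K2 \<kappa> q by (intro powr_mono2') (auto simp: s0_def)
    also have "\<dots> = \<kappa> powr (1 - 1 / q) / 8000000 powr (1 - 1 / q)"
      using \<kappa> by (simp add: powr_divide)
    also have "\<dots> = 8000000 powr (1 / q - 1) * \<kappa> powr (1 - 1 / q)"
      by (simp add: powr_minus_divide[symmetric] divide_inverse powr_minus[symmetric])
    finally have "Q powr (1 / q) * s0 powr (1 - 1 / q) \<le> Q powr (1 / q) * (8000000 powr (1 / q - 1) * \<kappa> powr (1 - 1 / q))"
      by (rule mult_left_mono) simp
    then show "2 * (Q powr (1 / q) * s0 powr (1 - 1 / q)) + U \<le> 2 * (Q powr (1 / q) * (8000000 powr (1 / q - 1) * \<kappa> powr (1 - 1 / q))) + U"
      by simp
    show "0 \<le> 2 * (Q powr (1 / q) * s0 powr (1 - 1 / q)) + U" unfolding U_def using R0 noise(1) by simp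
  qed (use \<kappa> in simp)
  also have "\<dots> = 3000 * 8000000 powr (1 / q - 1) * Q powr (1 / q) * (\<kappa> powr (1 - 1 / q) / sqrt \<kappa>) + 1500 * CL * \<delta>"
    using \<kappa> by (simp add: U_def field_simps)
  also have "\<kappa> powr (1 - 1 / q) / sqrt \<kappa> = \<kappa> powr (1 / 2 - 1 / q)"
  proof -
    have "\<kappa> powr (1 - 1 / q) / sqrt \<kappa> = \<kappa> powr (1 - 1 / q) / \<kappa> powr (1 / 2)" using \<kappa> by (simp add: powr_half_sqrt)
    also have "\<dots> = \<kappa> powr (1 - 1 / q - 1 / 2)" by (rule powr_diff[symmetric])
    finally show ?thesis by simp
  qed
  finally show ?thesis by (simp add: L2_set_ip h_def[symmetric] algebra_simps)
qed

lemma ln_six_ge: "17 / 10 \<le> ln (6::real)"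
proof -
  have "exp (17 / 10 :: real) ^ 10 = exp 1 ^ 17"
    by (simp add: exp_of_nat_mult[symmetric])
  also have "\<dots> \<le> (272 / 100) ^ 17" using e_less_272 by (intro power_mono) auto
  also have "\<dots> \<le> 6 ^ 10" by (simp add: field_simps)
  finally have "exp (17 / 10 :: real) \<le> 6" by (rule power_le_imp_le_base[of _ 9, simplified]) simp_all
  then show ?thesis by (subst ln_ge_iff) auto
qed

lemma ratio_bound:
  assumes "real m \<le> real d / (ln 6)\<^sup>2"
  shows "289 * real m \<le> 100 * real d"
proof -
  have "(17 / 10)\<^sup>2 \<le> (ln (6::real))\<^sup>2" using ln_six_ge by (intro power_mono) auto
  then have l: "289 / 100 \<le> (ln (6::real))\<^sup>2" by (simp add: power2_eq_square)
  have "289 / 100 * real m \<le> (ln 6)\<^sup>2 * real m" using l by (intro mult_right_mono) auto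
  also have "\<dots> \<le> real d"
  proof -
    have "0 < (ln (6::real))\<^sup>2" using l by linarith
    then show ?thesis using assms by (simp add: pos_le_divide_eq mult.commute)
  qed
  finally show ?thesis by simp
qed

section \<open>Error analysis for a ridge function\<close>

locale ridge_function =
  fixes k d :: nat and r C2 :: real and A :: "nat \<Rightarrow> nat \<Rightarrow> real" and g :: "(nat \<Rightarrow> real) \<Rightarrow> real"
  assumes k: "1 \<le> k" "k \<le> d" and r: "1 < r" and C2_pos: "0 < C2"
    and A: "orthonormal_columns d k (mat_transpose A)"
    and C2_on: "C2_on_cball k r g"
    and bounds: "\<forall>\<beta>\<in>multi_indices k 2. \<forall>x\<in>euclid_ball k r. \<bar>iter_partial \<beta> g x\<bar> \<le> C2"
begin

lemma gradient_le: "i < k \<Longrightarrow> x \<in> euclid_ball k r \<Longrightarrow> \<bar>partial_deriv i g x\<bar> \<le> C2"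
  using bspec[OF bounds, of "[i]"] by (auto simp: multi_indices_def)

lemma hessian_le:
  "i < k \<Longrightarrow> j < k \<Longrightarrow> x \<in> euclid_ball k r \<Longrightarrow> \<bar>partial_deriv j (partial_deriv i g) x\<bar> \<le> C2"
  using bspec[OF bounds, of "[j, i]"] by (auto simp: multi_indices_def)

lemma image_in_cball: "x \<in> euclid_cball d R \<Longrightarrow> mat_vec k d A x \<in> euclid_cball k R"
  using mat_vec_norm_le[OF A, of x] by (auto simp: euclid_cball_iff mat_vec_zero)

lemma sphere_image: "x \<in> euclid_sphere d \<Longrightarrow> mat_vec k d A x \<in> euclid_ball k r"
  using mat_vec_norm_le[OF A, of x] r by (auto simp: euclid_ball_iff mat_vec_zero euclid_sphere_def)

text \<open>The second moment matrix of f is A^T Hg A with Hg that of grad g at A x, so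
  \<open>sandwich_singular_values\<close> turns the hypothesis on singular values into a lower bound
  for all directions in dimension k. The matrix Chernoff bound is then applied with R = k C2^2, the
  bound for |grad g|^2.\<close>

lemma gradient_chernoff:
  assumes \<mu>: "uniform_on_sphere d \<mu>"
    and sv: "has_singular_values d d (gradient_second_moment \<mu> (\<lambda>x. g (mat_vec k d A x))) \<sigma>"
    and \<alpha>: "0 < \<alpha>" "\<And>i. i < k \<Longrightarrow> \<alpha> \<le> \<sigma> i" and s: "0 < s" "s < 1"
  shows "\<alpha> \<le> C2\<^sup>2"
    and "\<exists>E \<in> sets (Pi\<^sub>M {..<n} (\<lambda>_. \<mu>)).
      1 - real k * exp (- (real n * \<alpha> * s\<^sup>2) / (2 * real k * C2\<^sup>2)) \<le> measure (Pi\<^sub>M {..<n} (\<lambda>_. \<mu>)) E \<and>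
      (\<forall>\<xi>\<in>E. \<forall>v. real n * (\<alpha> * (1 - s)) * ip k v v \<le>
        (\<Sum>j<n. (ip k (\<lambda>i. partial_deriv i g (mat_vec k d A (\<xi> j))) v)\<^sup>2))"
proof -
  have prob: "prob_space \<mu>" and sets: "sets \<mu> = sets (restrict_space borel (euclid_sphere d))"
    using \<mu> by (auto simp: uniform_on_sphere_def)
  interpret prob_space \<mu> by (rule prob)
  have space: "space \<mu> = euclid_sphere d" using sets_eq_imp_space_eq[OF sets] by (simp add: space_restrict_space)
  have "\<forall>i. \<exists>D. i < k \<longrightarrow> continuous_on (euclid_cball k r) D \<and> (\<forall>x\<in>euclid_ball k r. D x = partial_deriv i g x)"
    using C2_on_cball_facts(4)[OF C2_on] by blast
  then obtain D where D: "\<And>i. i < k \<Longrightarrow> continuous_on (euclid_cball k r) (D i)"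
    "\<And>i x. i < k \<Longrightarrow> x \<in> euclid_ball k r \<Longrightarrow> D i x = partial_deriv i g x" by metis
  \<comment> \<open>The continuous extensions \<open>D\<close> give measurability; on the sphere the
    images under \<open>A\<close> are inside the open ball, where they agree with the partial
    derivatives.\<close>
  define X where "X = (\<lambda>om i. D i (mat_vec k d A om))"
  have Xp: "X om i = partial_deriv i g (mat_vec k d A om)" if "om \<in> space \<mu>" "i < k" for om i
    unfolding X_def by (rule D(2)[OF that(2)]) (use that(1) space sphere_image in auto)
  have Xb: "\<bar>X om i\<bar> \<le> C2" if "om \<in> space \<mu>" "i < k" for om i
    unfolding Xp[OF that] by (rule gradient_le[OF that(2)]) (use that(1) space sphere_image in auto)
  have Xm: "(\<lambda>om. X om i) \<in> borel_measurable \<mu>" if i: "i < k" for i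
  proof -
    have "continuous_on (euclid_sphere d) (\<lambda>om. mat_vec k d A om a)" for a
    proof (cases "a < k")
      case True
      then show ?thesis unfolding mat_vec_def
        by (auto intro!: continuous_intros continuous_on_subset[OF continuous_on_product_coordinates])
    next
      case False
      then show ?thesis by (simp add: mat_vec_def)
    qed
    then have c: "continuous_on (euclid_sphere d) (mat_vec k d A)"
      by (intro continuous_on_coordinatewise_then_product)
    have "continuous_on (euclid_sphere d) (\<lambda>om. D i (mat_vec k d A om))"
    proof (rule continuous_on_compose2[OF D(1)[OF i] c])
      show "mat_vec k d A ` euclid_sphere d \<subseteq> euclid_cball k r"
      proof (rule image_subsetI)
        fix om assume "om \<in> euclid_sphere d"
        from sphere_image[OF this] show "mat_vec k d A om \<in> euclid_cball k r"
          by (simp add: euclid_ball_iff euclid_cball_iff)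
      qed
    qed
    then have "(\<lambda>om. X om i) \<in> borel_measurable (restrict_space borel (euclid_sphere d))"
      unfolding X_def by (rule borel_measurable_continuous_on_restrict)
    then show ?thesis by (simp add: measurable_cong_sets[OF sets refl])
  qed
  have int: "integrable \<mu> (\<lambda>om. X om a * X om b)" if "a < k" "b < k" for a b
  proof (rule integrable_const_bound)
    show "(\<lambda>om. X om a * X om b) \<in> borel_measurable \<mu>" using Xm[OF that(1)] Xm[OF that(2)] by measurable
    show "AE om in \<mu>. norm (X om a * X om b) \<le> C2 * C2"
    proof (rule AE_I2)
      fix om assume "om \<in> space \<mu>"
      then show "norm (X om a * X om b) \<le> C2 * C2"
        unfolding real_norm_def abs_mult using Xb that C2_pos by (intro mult_mono) auto
    qed
  qed
  define Hg where "Hg = (\<lambda>a b. \<integral>om. X om a * X om b \<partial>\<mu>)"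
  have bil: "(\<integral>om. (\<Sum>a<k. p a * X om a) * (\<Sum>b<k. t b * X om b) \<partial>\<mu>) = (\<Sum>a<k. \<Sum>b<k. p a * t b * Hg a b)" for p t
  proof -
    have "(\<lambda>om. (\<Sum>a<k. p a * X om a) * (\<Sum>b<k. t b * X om b)) = (\<lambda>om. \<Sum>a<k. \<Sum>b<k. p a * t b * (X om a * X om b))"
      by (simp add: sum_product mult_ac)
    moreover have "(\<integral>om. (\<Sum>a<k. \<Sum>b<k. p a * t b * (X om a * X om b)) \<partial>\<mu>)
      = (\<Sum>a<k. \<integral>om. (\<Sum>b<k. p a * t b * (X om a * X om b)) \<partial>\<mu>)"
      by (rule Bochner_Integration.integral_sum) (auto intro!: Bochner_Integration.integrable_sum integrable_mult_right int)
    moreover have "(\<integral>om. (\<Sum>b<k. p a * t b * (X om a * X om b)) \<partial>\<mu>) = (\<Sum>b<k. p a * t b * Hg a b)" if "a < k" for a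
    proof -
      have "(\<integral>om. (\<Sum>b<k. p a * t b * (X om a * X om b)) \<partial>\<mu>) = (\<Sum>b<k. \<integral>om. p a * t b * (X om a * X om b) \<partial>\<mu>)"
        by (rule Bochner_Integration.integral_sum) (auto intro!: integrable_mult_right int that)
      then show ?thesis by (simp add: Hg_def)
    qed
    ultimately show ?thesis by simp
  qed
  have quad: "ip k u (\<lambda>a. ip k (Hg a) u) = (\<integral>om. (ip k (X om) u)\<^sup>2 \<partial>\<mu>)" for u
  proof -
    have "(\<integral>om. (ip k (X om) u)\<^sup>2 \<partial>\<mu>) = (\<integral>om. (\<Sum>a<k. u a * X om a) * (\<Sum>b<k. u b * X om b) \<partial>\<mu>)"
      by (simp add: ip_def power2_eq_square mult.commute)
    also have "\<dots> = (\<Sum>a<k. \<Sum>b<k. u a * u b * Hg a b)" by (rule bil)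
    finally show ?thesis by (simp add: ip_def sum_distrib_left mult_ac)
  qed
  have H: "gradient_second_moment \<mu> (\<lambda>x. g (mat_vec k d A x)) i j = (\<Sum>a<k. \<Sum>b<k. A a i * A b j * Hg a b)"
    if "i < d" "j < d" for i j
  proof -
    have "partial_deriv l (\<lambda>x. g (mat_vec k d A x)) om = (\<Sum>a<k. A a l * X om a)" if "l < d" "om \<in> space \<mu>" for l om
    proof -
      have "mat_vec k d A om \<in> euclid_ball k r" using that(2) space sphere_image by auto
      then show ?thesis using Xp[OF that(2)] by (simp add: partial_deriv_ridge[OF C2_on_cball_facts(2)[OF C2_on] _ that(1)])
    qed
    then have "gradient_second_moment \<mu> (\<lambda>x. g (mat_vec k d A x)) i j
      = (\<integral>om. (\<Sum>a<k. A a i * X om a) * (\<Sum>b<k. A b j * X om b) \<partial>\<mu>)"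
      unfolding gradient_second_moment_def by (intro Bochner_Integration.integral_cong) (use that in auto)
    then show ?thesis using bil[of "\<lambda>a. A a i" "\<lambda>b. A b j"] by simp
  qed
  have second: "\<alpha> * ip k v v \<le> (\<integral>om. (ip k (X om) v)\<^sup>2 \<partial>\<mu>)" for v
  proof -
    have "\<alpha> * ip k v v \<le> ip k v (\<lambda>a. ip k (Hg a) v)"
    proof (rule sandwich_singular_values[OF A H _ _ sv \<alpha>(2,1)])
      show "Hg a b = Hg b a" for a b by (simp add: Hg_def mult.commute)
      show "0 \<le> ip k u (\<lambda>a. ip k (Hg a) u)" for u unfolding quad by simp
    qed
    then show ?thesis by (simp only: quad)
  qed
  show \<alpha>C: "\<alpha> \<le> C2\<^sup>2"
  proof -
    \<comment> \<open>The first coordinate direction already bounds \<alpha> by the mean square of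
      one partial derivative.\<close>
    define u :: "nat \<Rightarrow> real" where "u = (\<lambda>l. if l = 0 then 1 else 0)"
    have k0: "0 < k" using k by simp
    have uu: "ip k u u = 1" unfolding u_def using ip_unit[OF k0] by simp
    have Xu: "ip k (X om) u = X om 0" for om unfolding u_def using ip_unit[OF k0] by (simp add: ip_commute)
    have "\<alpha> \<le> (\<integral>om. (X om 0)\<^sup>2 \<partial>\<mu>)" using second[of u] uu Xu by simp
    also have "\<dots> \<le> C2\<^sup>2"
    proof (rule integral_le_const)
      show "integrable \<mu> (\<lambda>om. (X om 0)\<^sup>2)" using int[OF k0 k0] by (simp add: power2_eq_square)
      show "AE om in \<mu>. (X om 0)\<^sup>2 \<le> C2\<^sup>2"
      proof (rule AE_I2)
        fix om assume "om \<in> space \<mu>"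
        then show "(X om 0)\<^sup>2 \<le> C2\<^sup>2" using Xb[OF _ k0, of om] C2_pos by (intro abs_le_square_iff[THEN iffD1]) simp
      qed
    qed
    finally show ?thesis .
  qed
  define R where "R = real k * C2\<^sup>2"
  have R0: "0 < R" using k C2_pos by (simp add: R_def)
  have XR: "ip k (X om) (X om) \<le> R" if om: "om \<in> space \<mu>" for om
  proof -
    have "(X om i)\<^sup>2 \<le> C2\<^sup>2" if "i < k" for i
      using Xb[OF om that] C2_pos by (intro abs_le_square_iff[THEN iffD1]) simp
    then have "(\<Sum>i<k. (X om i)\<^sup>2) \<le> (\<Sum>i<k. C2\<^sup>2)" by (intro sum_mono) simp
    then show ?thesis by (simp add: ip_self R_def)
  qed
  have "1 * C2\<^sup>2 \<le> real k * C2\<^sup>2" using k by (intro mult_right_mono) auto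
  then have \<alpha>R: "\<alpha> \<le> R" using \<alpha>C by (simp add: R_def)
  have "\<exists>E \<in> sets (Pi\<^sub>M {..<n} (\<lambda>_. \<mu>)).
    1 - real k * exp (- (real n * \<alpha> * s\<^sup>2) / (2 * R)) \<le> measure (Pi\<^sub>M {..<n} (\<lambda>_. \<mu>)) E \<and>
    (\<forall>\<xi>\<in>E. \<forall>v. real n * (\<alpha> * (1 - s)) * ip k v v \<le> (\<Sum>j<n. (ip k (X (\<xi> j)) v)\<^sup>2))"
    by (rule matrix_chernoff[of \<mu> k X R \<alpha>, OF prob Xm XR R0 \<alpha>(1) \<alpha>R second s])
  then obtain E where E: "E \<in> sets (Pi\<^sub>M {..<n} (\<lambda>_. \<mu>))"
    "1 - real k * exp (- (real n * \<alpha> * s\<^sup>2) / (2 * R)) \<le> measure (Pi\<^sub>M {..<n} (\<lambda>_. \<mu>)) E"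
    "\<And>\<xi> v. \<xi> \<in> E \<Longrightarrow> real n * (\<alpha> * (1 - s)) * ip k v v \<le> (\<Sum>j<n. (ip k (X (\<xi> j)) v)\<^sup>2)" by blast
  have "(\<Sum>j<n. (ip k (X (\<xi> j)) v)\<^sup>2) = (\<Sum>j<n. (ip k (\<lambda>i. partial_deriv i g (mat_vec k d A (\<xi> j))) v)\<^sup>2)"
    if "\<xi> \<in> E" for \<xi> v
  proof (rule sum.cong[OF refl])
    fix j assume "j \<in> {..<n}"
    moreover have "\<xi> \<in> space (Pi\<^sub>M {..<n} (\<lambda>_. \<mu>))" using sets.sets_into_space[OF E(1)] that by blast
    ultimately have "\<xi> j \<in> space \<mu>" by (auto simp: space_PiM PiE_iff)
    then have "ip k (X (\<xi> j)) v = ip k (\<lambda>i. partial_deriv i g (mat_vec k d A (\<xi> j))) v"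
      by (intro ip_cong) (auto simp: Xp)
    then show "(ip k (X (\<xi> j)) v)\<^sup>2 = (ip k (\<lambda>i. partial_deriv i g (mat_vec k d A (\<xi> j))) v)\<^sup>2" by simp
  qed
  then have 3: "real n * (\<alpha> * (1 - s)) * ip k v v \<le>
    (\<Sum>j<n. (ip k (\<lambda>i. partial_deriv i g (mat_vec k d A (\<xi> j))) v)\<^sup>2)" if "\<xi> \<in> E" for \<xi> v
    using E(3)[OF that, of v] that by simp
  have "2 * R = 2 * real k * C2\<^sup>2" by (simp add: R_def)
  then show "\<exists>E \<in> sets (Pi\<^sub>M {..<n} (\<lambda>_. \<mu>)).
      1 - real k * exp (- (real n * \<alpha> * s\<^sup>2) / (2 * real k * C2\<^sup>2)) \<le> measure (Pi\<^sub>M {..<n} (\<lambda>_. \<mu>)) E \<and>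
      (\<forall>\<xi>\<in>E. \<forall>v. real n * (\<alpha> * (1 - s)) * ip k v v \<le>
        (\<Sum>j<n. (ip k (\<lambda>i. partial_deriv i g (mat_vec k d A (\<xi> j))) v)\<^sup>2))"
    using E(1,2) 3 by metis
qed

text \<open>Taylor's formula makes the difference quotients noisy measurements of the compressible
  vector \<open>x\<close>. The two conditions on \<open>C\<close> match the compressibility and the
  noise contribution to \<nu>2 respectively.\<close>

lemma sampled_gradient_error:
  assumes m: "0 < m" and md: "289 * real m \<le> 100 * real d" and sp: "1 \<le> sparsity m d"
    and good: "good_matrix m d CL (sign_matrix m \<Phi>)" and CL: "0 \<le> CL"
    and \<Phi>: "\<Phi> \<in> space (matrix_measure m d)" and \<xi>: "\<xi> j \<in> euclid_sphere d"
    and q: "0 < q" "q \<le> 1" and C1: "0 < C1" and Aq: "\<And>i. i < k \<Longrightarrow> (\<Sum>j<d. \<bar>A i j\<bar> powr q) powr (1 / q) \<le> C1"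
    and e: "0 < \<epsilon>" "\<epsilon> * sqrt (real d / real m) \<le> r - 1"
    and min: "is_l1_minimizer m d \<Phi> (difference_quotients m d \<epsilon> (\<lambda>x. g (mat_vec k d A x)) \<Phi> \<xi> j) xh"
    and C: "3000 * 8000000 powr (1 / q - 1) * (C1 * C2) \<le> C" "(1500 * CL + 4) * (C2 * C1\<^sup>2) \<le> C"
  shows "L2_set (\<lambda>l. xh l - (\<Sum>i<k. partial_deriv i g (mat_vec k d A (\<xi> j)) * A i l)) {..<d} \<le> nu2 C q k d m \<epsilon>"
proof -
  define G where "G = (\<lambda>i. partial_deriv i g (mat_vec k d A (\<xi> j)))"
  define x where "x = (\<lambda>l. \<Sum>i<k. G i * A i l)"
  define y where "y = difference_quotients m d \<epsilon> (\<lambda>x. g (mat_vec k d A x)) \<Phi> \<xi> j"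
  define Q where "Q = real k * (C1 * C2) powr q"
  \<comment> \<open>The Taylor remainder is \<epsilon> C2 |A \<phi>_i|_1^2. Each coordinate of A
    \<phi>_i is at most C1 / sqrt m, as the l1 norm is below the lq quasinorm, so the remainder is
    at most \<epsilon> C2 k^2 C1^2 / m; the entries of \<open>sign_matrix\<close> are larger by sqrt
    m.\<close>
  define \<delta> where "\<delta> = \<epsilon> * C2 * C1\<^sup>2 * (real k)\<^sup>2 / sqrt (real m)"
  have b: "mat_vec k d A (\<xi> j) \<in> euclid_ball k r" by (rule sphere_image[OF \<xi>])
  have xq: "(\<Sum>l<d. \<bar>x l\<bar> powr q) \<le> Q"
    unfolding x_def Q_def
    by (rule quasinorm_combination[OF q C1 C2_pos]) (use Aq in \<open>auto simp: G_def intro: gradient_le[OF _ b]\<close>)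
  have Q0: "0 < Q" using k C1 C2_pos by (simp add: Q_def)
  have \<delta>0: "0 \<le> \<delta>" using e C2_pos by (simp add: \<delta>_def)
  have noise: "\<bar>sqrt (real m) * (y i - ip d (\<Phi> i) x)\<bar> \<le> \<delta>" if i: "i < m" for i
  proof -
    define v where "v = mat_vec k d A (\<Phi> i)"
    have Aqp: "mat_vec k d A (query_point d \<epsilon> \<Phi> \<xi> i j) = (\<lambda>l. mat_vec k d A (\<xi> j) l + \<epsilon> * v l)"
      by (auto simp: fun_eq_iff v_def mat_vec_def query_point_def sum.distrib sum_distrib_left algebra_simps)
    have "query_point d \<epsilon> \<Phi> \<xi> i j \<in> euclid_cball d (1 + (r - 1))"
      by (rule query_point_in_ball[where \<xi> = \<xi> and j = j, OF \<Phi> i \<xi> e])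
    then have z: "(\<lambda>l. mat_vec k d A (\<xi> j) l + \<epsilon> * v l) \<in> euclid_cball k r"
      unfolding Aqp[symmetric] using image_in_cball by simp
    have v0: "v l = 0" if "l \<ge> k" for l using that by (simp add: v_def mat_vec_zero)
    have yi: "y i = (g (\<lambda>l. mat_vec k d A (\<xi> j) l + \<epsilon> * v l) - g (mat_vec k d A (\<xi> j))) / \<epsilon>"
      using i by (simp add: y_def difference_quotients_def Aqp)
    have ipx: "ip d (\<Phi> i) x = (\<Sum>a<k. v a * G a)"
    proof -
      have "ip d (\<Phi> i) x = (\<Sum>a<k. G a * ip d (\<Phi> i) (A a))" unfolding x_def by (simp add: ip_linear)
      also have "\<dots> = (\<Sum>a<k. v a * G a)"
        by (rule sum.cong) (auto simp: v_def mat_vec_ip ip_commute mult.commute)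
      finally show ?thesis .
    qed
    have "\<bar>y i - ip d (\<Phi> i) x\<bar> \<le> \<epsilon> * C2 * (\<Sum>a<k. \<bar>v a\<bar>)\<^sup>2"
      unfolding yi ipx G_def
      by (rule taylor_bound[OF C2_on_cball_facts(1)[OF C2_on] C2_on_cball_facts(2)[OF C2_on]
            C2_on_cball_facts(3)[OF C2_on] hessian_le b z e(1) v0]) (use C2_pos in auto)
    also have "\<dots> \<le> \<epsilon> * C2 * (real k * (C1 / sqrt (real m)))\<^sup>2"
    proof -
      have "\<bar>v a\<bar> \<le> C1 / sqrt (real m)" if a: "a < k" for a
      proof -
        have "\<bar>v a\<bar> \<le> (\<Sum>l<d. \<bar>A a l * \<Phi> i l\<bar>)" using a by (simp add: v_def mat_vec_def)
        also have "\<dots> = (\<Sum>l<d. \<bar>A a l\<bar> * (1 / sqrt (real m)))"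
          by (rule sum.cong) (simp_all add: abs_mult matrix_entries(1)[OF \<Phi> i])
        also have "\<dots> = (\<Sum>l<d. \<bar>A a l\<bar>) / sqrt (real m)" by (simp add: sum_divide_distrib)
        also have "\<dots> \<le> C1 / sqrt (real m)"
          using sum_le_quasinorm[OF q, of "{..<d}" "A a"] Aq[OF a] by (intro divide_right_mono) auto
        finally show ?thesis .
      qed
      then have "(\<Sum>a<k. \<bar>v a\<bar>) \<le> (\<Sum>a<k. C1 / sqrt (real m))" by (intro sum_mono) simp
      then have "(\<Sum>a<k. \<bar>v a\<bar>)\<^sup>2 \<le> (real k * (C1 / sqrt (real m)))\<^sup>2"
        by (intro power_mono) (auto intro: sum_nonneg)
      then show ?thesis using e C2_pos by (intro mult_left_mono) auto
    qed
    finally have "sqrt (real m) * \<bar>y i - ip d (\<Phi> i) x\<bar> \<le> sqrt (real m) * (\<epsilon> * C2 * (real k * (C1 / sqrt (real m)))\<^sup>2)"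
      by (rule mult_left_mono) simp
    also have "\<dots> = \<delta>" using m by (simp add: \<delta>_def power2_eq_square field_simps)
    finally show ?thesis by (simp add: abs_mult)
  qed
  have pw: "Q powr (1 / q) = real k powr (1 / q) * (C1 * C2)"
    using q C1 C2_pos by (simp add: Q_def powr_mult powr_powr)
  define T where "T = (real m / ln (real d / real m)) powr (1 / 2 - 1 / q)"
  have "L2_set (\<lambda>l. xh l - x l) {..<d} \<le>
    3000 * 8000000 powr (1 / q - 1) * Q powr (1 / q) * T + (1500 * CL + 4) * \<delta>"
    unfolding T_def
    by (rule recovered_gradient_error[OF m md sp good CL min[folded y_def] q xq Q0 \<delta>0 noise])
  also have "\<dots> = (3000 * 8000000 powr (1 / q - 1) * (C1 * C2)) * (real k powr (1 / q) * T)
      + ((1500 * CL + 4) * (C2 * C1\<^sup>2)) * (\<epsilon> * (real k)\<^sup>2 / sqrt (real m))"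
    unfolding pw \<delta>_def by (simp add: algebra_simps add_divide_distrib)
  also have "\<dots> \<le> C * (real k powr (1 / q) * T) + C * (\<epsilon> * (real k)\<^sup>2 / sqrt (real m))"
    using e by (intro add_mono mult_right_mono C) (auto simp: T_def)
  also have "\<dots> = nu2 C q k d m \<epsilon>" by (simp add: nu2_def T_def distrib_left)
  finally show ?thesis by (simp add: x_def G_def)
qed

text \<open>\<open>w\<close> is the part of x orthogonal to the first k right singular vectors, that
  is, x minus its reconstruction. The change of f is governed by A w alone; the Lipschitz estimate
  in l1 contributes the factor sqrt k. Both points stay in the closed ball since orthogonal
  projection does not increase norms.\<close>

lemma projection_error:
  assumes svd: "is_svd n d X U sv V" and n: "0 < n"
    and close: "\<And>j. j < n \<Longrightarrow> L2_set (\<lambda>l. X j l - (\<Sum>i<k. G j i * A i l)) {..<d} \<le> \<nu>"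
    and lower: "\<And>u. real n * \<beta> * ip k u u \<le> (\<Sum>j<n. (ip k (G j) u)\<^sup>2)"
    and \<nu>: "\<nu> < sqrt \<beta>" and x: "x \<in> euclid_cball d r"
  defines "B \<equiv> \<lambda>i l. if i < k \<and> l < d then V l i else 0"
  shows "\<bar>g (mat_vec k d A x) - g (mat_vec k d A (mat_vec d k (mat_transpose B) (mat_vec k d B x)))\<bar> \<le>
    2 * C2 * sqrt (real k) * r * (\<nu> / (sqrt \<beta> - \<nu>))"
proof -
  have "0 \<le> L2_set (\<lambda>l. X 0 l - (\<Sum>i<k. G 0 i * A i l)) {..<d}" by (rule L2_set_nonneg)
  then have \<nu>0: "0 \<le> \<nu>" using close[OF n] by linarith
  then have sb: "0 < sqrt \<beta>" using \<nu> by linarith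
  then have \<beta>: "0 < \<beta>" by simp
  have V: "orthonormal_columns d k V" using svd k unfolding is_svd_def orthonormal_columns_def by auto
  define c where "c = (\<lambda>i. ip d (\<lambda>l. V l i) x)"
  define w where "w = (\<lambda>l. x l - (\<Sum>i<k. c i * V l i))"
  define p where "p = mat_vec d k (mat_transpose B) (mat_vec k d B x)"
  have Bx: "mat_vec k d B x i = c i" if "i < k" for i
    using that by (simp add: mat_vec_def B_def c_def ip_def)
  have p: "p l = (\<Sum>i<k. c i * V l i)" if "l < d" for l
  proof -
    have "p l = (\<Sum>i<k. B i l * mat_vec k d B x i)" using that by (simp add: p_def mat_vec_def[of d k] mat_transpose_def)
    also have "\<dots> = (\<Sum>i<k. c i * V l i)"
    proof (rule sum.cong[OF refl])
      fix i assume "i \<in> {..<k}"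
      then have i: "i < k" by simp
      have "B i l = V l i" using i that by (simp add: B_def)
      then show "B i l * mat_vec k d B x i = c i * V l i" by (simp add: Bx[OF i])
    qed
    finally show ?thesis .
  qed
  have xr: "sqrt (ip d x x) \<le> r" using x by (simp add: euclid_cball_iff L2_set_ip)
  have pn: "ip d p p \<le> ip d x x"
  proof -
    have "ip d p p = ip d (\<lambda>l. \<Sum>i<k. c i * V l i) (\<lambda>l. \<Sum>i<k. c i * V l i)" by (rule ip_cong) (auto simp: p)
    also have "\<dots> = (\<Sum>i<k. (c i)\<^sup>2)" by (rule orthonormal_combination_norm[OF V])
    also have "\<dots> \<le> ip d x x" unfolding c_def by (rule bessel[OF V])
    finally show ?thesis .
  qed
  have pc: "p \<in> euclid_cball d r"
  proof -
    have "sqrt (ip d p p) \<le> r" using pn xr by (meson order_trans real_sqrt_le_mono)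
    then show ?thesis by (simp add: euclid_cball_iff L2_set_ip) (simp add: p_def mat_vec_zero)
  qed
  have wn: "ip d w w \<le> ip d x x"
    using residual_norm[OF V, of x] by (simp add: w_def c_def sum_nonneg)
  have wo: "ip d (\<lambda>j. V j l) w = 0" if "l < k" for l
    unfolding w_def c_def by (rule residual_orthogonal[OF V that])
  have diff: "mat_vec k d A x i - mat_vec k d A p i = ip d (A i) w" if "i < k" for i
  proof -
    have "mat_vec k d A x i - mat_vec k d A p i = ip d (A i) (\<lambda>l. x l - p l)" using that by (simp add: mat_vec_ip ip_linear)
    also have "\<dots> = ip d (A i) w" by (rule ip_cong) (auto simp: w_def p)
    finally show ?thesis .
  qed
  define S where "S = (\<Sum>i<k. (ip d (A i) w)\<^sup>2)"
  have close': "ip d (\<lambda>l. X j l - (\<Sum>i<k. G j i * A i l)) (\<lambda>l. X j l - (\<Sum>i<k. G j i * A i l)) \<le> \<nu>\<^sup>2" if "j < n" for j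
  proof -
    have "sqrt (ip d (\<lambda>l. X j l - (\<Sum>i<k. G j i * A i l)) (\<lambda>l. X j l - (\<Sum>i<k. G j i * A i l))) \<le> \<nu>"
      using close[OF that] by (simp only: L2_set_ip)
    then show ?thesis by (rule sqrt_le_D)
  qed
  have "\<beta> * S \<le> 4 * \<nu>\<^sup>2 * ip d w w"
    unfolding S_def by (rule subspace_error[OF svd n close' lower wo])
  also have "\<dots> \<le> 4 * \<nu>\<^sup>2 * r\<^sup>2"
  proof (rule mult_left_mono)
    have "ip d x x \<le> r\<^sup>2" using xr by (rule sqrt_le_D)
    then show "ip d w w \<le> r\<^sup>2" using wn by linarith
  qed simp
  also have "\<dots> = (2 * \<nu> * r)\<^sup>2" by (simp add: power_mult_distrib)
  finally have "sqrt (\<beta> * S) \<le> 2 * \<nu> * r" using \<nu>0 r by (intro real_le_lsqrt) (auto simp: S_def sum_nonneg \<beta> less_imp_le)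
  then have "sqrt S \<le> 2 * \<nu> * r / sqrt \<beta>" using sb by (simp add: real_sqrt_mult field_simps)
  \<comment> \<open>Shrinking the denominator brings the bound into the form of the theorem; \<nu> <
    sqrt \<beta> keeps it positive.\<close>
  also have "\<dots> \<le> 2 * \<nu> * r / (sqrt \<beta> - \<nu>)"
    using \<nu>0 \<nu> r \<beta> by (intro divide_left_mono mult_pos_pos) auto
  finally have sS: "sqrt S \<le> 2 * \<nu> * r / (sqrt \<beta> - \<nu>)" .
  have "\<bar>g (mat_vec k d A x) - g (mat_vec k d A p)\<bar> \<le> C2 * (\<Sum>i<k. \<bar>mat_vec k d A x i - mat_vec k d A p i\<bar>)"
    by (rule lipschitz_l1[OF C2_on_cball_facts(1)[OF C2_on] C2_on_cball_facts(2)[OF C2_on] gradient_le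
          image_in_cball[OF pc] image_in_cball[OF x]])
  also have "(\<Sum>i<k. \<bar>mat_vec k d A x i - mat_vec k d A p i\<bar>) = (\<Sum>i<k. \<bar>ip d (A i) w\<bar>)"
    by (rule sum.cong) (auto simp: diff)
  also have "C2 * \<dots> \<le> C2 * (sqrt (real k) * sqrt S)"
    using l1_le_sqrt_l2[of "\<lambda>i. ip d (A i) w" k] C2_pos by (intro mult_left_mono) (auto simp: S_def ip_self)
  also have "\<dots> \<le> C2 * (sqrt (real k) * (2 * \<nu> * r / (sqrt \<beta> - \<nu>)))"
    using sS C2_pos by (intro mult_left_mono) auto
  finally show ?thesis by (simp add: p_def mult_ac)
qed

end

section \<open>Assembly of the probability and error estimates\<close>

lemma measure_Times_ge:
  assumes M: "prob_space M" and N: "prob_space N" and A: "A \<in> sets M" and B: "B \<in> sets N"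
    and a: "1 - a \<le> measure M A" and b: "1 - b \<le> measure N B"
  shows "1 - (a + b) \<le> measure (M \<Otimes>\<^sub>M N) (A \<times> B)"
proof -
  interpret M: prob_space M by (rule M)
  interpret N: prob_space N by (rule N)
  have "measure (M \<Otimes>\<^sub>M N) (A \<times> B) = measure M A * measure N B"
    unfolding measure_def using A B by (simp add: N.emeasure_pair_measure_Times enn2real_mult)
  moreover have "0 \<le> (1 - measure M A) * (1 - measure N B)"
    using M.prob_le_1[of A] N.prob_le_1[of B] by (intro mult_nonneg_nonneg) auto
  then have "measure M A + measure N B - 1 \<le> measure M A * measure N B" by (simp add: algebra_simps)
  ultimately show ?thesis using a b by linarith
qed

text \<open>Since \<open>\<alpha> \<le> C\<^sub>2\<^sup>2\<close>, this contradicts \<open>\<nu>\<^sub>2 < sqrt (\<alpha> (1 - s))\<close>.\<close>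

lemma nu2_large:
  assumes sp: "sparsity m d < 1" and m: "0 < m" and md: "289 * real m \<le> 100 * real d"
    and q: "0 < q" "q \<le> 1" and k: "1 \<le> k" and e: "0 < \<epsilon>"
    and C: "C2 * 10000 powr (1 / q - 1 / 2) \<le> C" and C2: "0 < C2"
  shows "C2 \<le> nu2 C q k d m \<epsilon>"
proof -
  define \<kappa> where "\<kappa> = real m / ln (real d / real m)"
  have lnD: "1 \<le> ln (real d / real m)" by (rule ln_ratio_ge_1[OF md m])
  have \<kappa>: "0 < \<kappa>" unfolding \<kappa>_def using m lnD by simp
  have "sparsity m d = \<kappa> / 10000" by (simp add: sparsity_def \<kappa>_def)
  then have \<kappa>1: "\<kappa> \<le> 10000" using sp by simp
  have "0 < C2 * 10000 powr (1 / q - 1 / 2)" using C2 by simp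
  then have C0: "0 < C" using C by linarith
  have "1 \<le> 1 / q" using q by simp
  then have w: "10000 powr (1 / 2 - 1 / q) \<le> \<kappa> powr (1 / 2 - 1 / q)" using \<kappa> \<kappa>1 by (intro powr_mono2') auto
  have kq: "1 \<le> real k powr (1 / q)" using k q by (intro ge_one_powr_ge_zero) auto
  have "C2 = C2 * 10000 powr (1 / q - 1 / 2) * 10000 powr (1 / 2 - 1 / q)"
    by (simp add: mult.assoc powr_add[symmetric])
  also have "\<dots> \<le> C * \<kappa> powr (1 / 2 - 1 / q)" using C C0 w by (intro mult_mono) auto
  also have "\<dots> \<le> C * (real k powr (1 / q) * \<kappa> powr (1 / 2 - 1 / q))"
    using mult_right_mono[OF kq, of "\<kappa> powr (1 / 2 - 1 / q)"] C0 by simp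
  also have "\<dots> \<le> nu2 C q k d m \<epsilon>"
    unfolding nu2_def \<kappa>_def[symmetric] using C0 e by (intro mult_left_mono) auto
  finally show ?thesis .
qed

lemma (in ridge_function) algorithm2_error:
  assumes m: "0 < m" and md: "289 * real m \<le> 100 * real d" and n: "0 < n"
    and good: "good_matrix m d CL (sign_matrix m \<Phi>)" and CL: "0 \<le> CL"
    and \<Phi>: "\<Phi> \<in> space (matrix_measure m d)" and \<xi>: "\<And>j. j < n \<Longrightarrow> \<xi> j \<in> euclid_sphere d"
    and q: "0 < q" "q \<le> 1" and C1: "0 < C1" and Aq: "\<And>i. i < k \<Longrightarrow> (\<Sum>j<d. \<bar>A i j\<bar> powr q) powr (1 / q) \<le> C1"
    and e: "0 < \<epsilon>" "\<epsilon> * sqrt (real d / real m) \<le> r - 1"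
    and C: "3000 * 8000000 powr (1 / q - 1) * (C1 * C2) \<le> C" "(1500 * CL + 4) * (C2 * C1\<^sup>2) \<le> C"
      "C2 * 10000 powr (1 / q - 1 / 2) \<le> C"
    and \<beta>: "sqrt \<beta> \<le> C2"
    and lower: "\<And>v. real n * \<beta> * ip k v v \<le> (\<Sum>j<n. (ip k (\<lambda>i. partial_deriv i g (mat_vec k d A (\<xi> j))) v)\<^sup>2)"
    and out: "algorithm2_output m n d k \<epsilon> (\<lambda>x. g (mat_vec k d A x)) \<Phi> \<xi> fhat"
    and \<nu>: "nu2 C q k d m \<epsilon> < sqrt \<beta>" and x: "x \<in> euclid_cball d r"
  shows "\<bar>g (mat_vec k d A x) - fhat x\<bar> \<le>
    2 * C2 * sqrt (real k) * r * (nu2 C q k d m \<epsilon> / (sqrt \<beta> - nu2 C q k d m \<epsilon>))"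
proof -
  let ?f = "\<lambda>x. g (mat_vec k d A x)"
  obtain X U sv V where min: "\<And>j. j < n \<Longrightarrow> is_l1_minimizer m d \<Phi>
      (difference_quotients m d \<epsilon> (restrict ?f (set (queries m n d \<epsilon> \<Phi> \<xi>))) \<Phi> \<xi> j) (X j)"
    and svd: "is_svd n d X U sv V"
    and fhat: "fhat = (\<lambda>x. ?f (mat_vec d k (mat_transpose (\<lambda>i l. if i < k \<and> l < d then V l i else 0))
      (mat_vec k d (\<lambda>i l. if i < k \<and> l < d then V l i else 0) x)))"
    using out unfolding algorithm2_output_def algorithm2_matrix_def by blast
  \<comment> \<open>From \<nu>2 < sqrt \<beta> <= C2: the isometry and the quotient property in
    \<open>good_matrix\<close> become available only through this.\<close>
  have "\<not> sparsity m d < 1"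
    using nu2_large[OF _ m md q k(1) e(1) C(3) C2_pos] \<nu> \<beta> by (meson not_le order_trans)
  then have sp: "1 \<le> sparsity m d" by simp
  have close: "L2_set (\<lambda>l. X j l - (\<Sum>i<k. partial_deriv i g (mat_vec k d A (\<xi> j)) * A i l)) {..<d} \<le> nu2 C q k d m \<epsilon>"
    if j: "j < n" for j
    by (rule sampled_gradient_error[where \<xi> = \<xi> and j = j, OF m md sp good CL \<Phi> \<xi>[OF j] q C1 Aq e _ C(1,2)])
      (use min[OF j] in \<open>simp_all only: difference_quotients_restrict[OF j]\<close>)
  show ?thesis unfolding fhat
    by (rule projection_error[OF svd n, where G = "\<lambda>j i. partial_deriv i g (mat_vec k d A (\<xi> j))", OF close lower \<nu> x])
qed

text \<open>A sum, so that it dominates three requirements at once: compressibility, noise, and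
  \<nu>2 >= C2 at sparsity below 1. The powers with exponents 1/q - 1 and 1/q - 1/2 carry the
  dependence on q.\<close>

definition recovery_const :: "real \<Rightarrow> real \<Rightarrow> real \<Rightarrow> real" where
  "recovery_const C1 C2 q = 3000 * 8000000 powr (1 / q - 1) * (C1 * C2)
    + (1500 * 540000000 + 4) * (C2 * C1\<^sup>2) + C2 * 10000 powr (1 / q - 1 / 2)"

lemma recovery_const_ge:
  assumes "0 < C1" "0 < C2"
  shows "3000 * 8000000 powr (1 / q - 1) * (C1 * C2) \<le> recovery_const C1 C2 q"
    "(1500 * 540000000 + 4) * (C2 * C1\<^sup>2) \<le> recovery_const C1 C2 q"
    "C2 * 10000 powr (1 / q - 1 / 2) \<le> recovery_const C1 C2 q" "0 < recovery_const C1 C2 q"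
proof -
  have "0 \<le> 3000 * 8000000 powr (1 / q - 1) * (C1 * C2)" "0 \<le> (1500 * 540000000 + 4) * (C2 * C1\<^sup>2)"
    "0 < C2 * 10000 powr (1 / q - 1 / 2)" using assms by simp_all
  then show "3000 * 8000000 powr (1 / q - 1) * (C1 * C2) \<le> recovery_const C1 C2 q"
    "(1500 * 540000000 + 4) * (C2 * C1\<^sup>2) \<le> recovery_const C1 C2 q"
    "C2 * 10000 powr (1 / q - 1 / 2) \<le> recovery_const C1 C2 q" "0 < recovery_const C1 C2 q"
    unfolding recovery_const_def by linarith+
qed

lemma algorithm2_success:
  assumes gm: "\<forall>m d. 0 < m \<longrightarrow> 289 * real m \<le> 100 * real d \<longrightarrow> ln (real d) \<le> real m \<longrightarrow>
      sprob ({..<m} \<times> {..<d}) (\<lambda>b. \<not> good_matrix m d 540000000 b) \<le> exp (- c1 * real m)"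
    and C1: "C1 > 0" and C2: "C2 > 0" and q: "0 < q" "q \<le> 1"
    and k: "1 \<le> k" "k \<le> d" and eb: "\<epsilon>b > 0"
    and A: "orthonormal_columns d k (mat_transpose A)"
    and Aq: "\<forall>i<k. (\<Sum>j<d. \<bar>A i j\<bar> powr q) powr (1 / q) \<le> C1"
    and g: "C2_on_cball k (1 + \<epsilon>b) g"
    and bounds: "\<forall>\<beta> \<in> multi_indices k 2. \<forall>x \<in> euclid_ball k (1 + \<epsilon>b). \<bar>iter_partial \<beta> g x\<bar> \<le> C2"
    and f: "f = (\<lambda>x. g (mat_vec k d A x))"
    and \<mu>: "uniform_on_sphere d \<mu>" and \<alpha>: "\<alpha> > 0"
    and sv: "has_singular_values d d (gradient_second_moment \<mu> f) \<sigma>" and \<sigma>: "\<forall>i<k. \<alpha> \<le> \<sigma> i"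
    and s: "0 < s" "s < 1"
    and m: "ln (real d) \<le> real m\<Phi>" "real m\<Phi> \<le> real d / (ln 6)\<^sup>2"
    and e: "\<epsilon> > 0" "\<epsilon> * sqrt (real d / real m\<Phi>) \<le> \<epsilon>b"
  shows "(\<forall>(\<Phi>, \<xi>) \<in> space (draw_measure m\<Phi> mX d \<mu>).
             length (queries m\<Phi> mX d \<epsilon> \<Phi> \<xi>) = mX * (m\<Phi> + 1) \<and>
             set (queries m\<Phi> mX d \<epsilon> \<Phi> \<xi>) \<subseteq> euclid_cball d (1 + \<epsilon>b)) \<and>
          (\<exists>E \<in> sets (draw_measure m\<Phi> mX d \<mu>).
             measure (draw_measure m\<Phi> mX d \<mu>) E \<ge>
               1 - (exp (- c1 * real m\<Phi>) + exp (- sqrt (real m\<Phi> * real d))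
                    + real k * exp (- (real mX * \<alpha> * s\<^sup>2) / (2 * real k * C2\<^sup>2))) \<and>
             (\<forall>(\<Phi>, \<xi>) \<in> E.
                (\<exists>fhat. algorithm2_output m\<Phi> mX d k \<epsilon> f \<Phi> \<xi> fhat) \<and>
                (\<forall>fhat. algorithm2_output m\<Phi> mX d k \<epsilon> f \<Phi> \<xi> fhat \<longrightarrow>
                   nu2 (recovery_const C1 C2 q) q k d m\<Phi> \<epsilon> < sqrt (\<alpha> * (1 - s)) \<longrightarrow>
                   (\<forall>x \<in> euclid_cball d (1 + \<epsilon>b).
                      \<bar>f x - fhat x\<bar> \<le>
                        2 * C2 * sqrt (real k) * (1 + \<epsilon>b) *
                        (nu2 (recovery_const C1 C2 q) q k d m\<Phi> \<epsilon> / (sqrt (\<alpha> * (1 - s)) - nu2 (recovery_const C1 C2 q) q k d m\<Phi> \<epsilon>))))))"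
proof (rule conjI)
  interpret ridge_function k d "1 + \<epsilon>b" C2 A g
    by standard (use k eb C2 A g bounds in auto)
  let ?M = "matrix_measure m\<Phi> d" and ?N = "\<Pi>\<^sub>M j\<in>{..<mX}. \<mu>" and ?D = "draw_measure m\<Phi> mX d \<mu>"
  have prob\<mu>: "prob_space \<mu>" and sets\<mu>: "sets \<mu> = sets (restrict_space borel (euclid_sphere d))"
    using \<mu> by (auto simp: uniform_on_sphere_def)
  have space\<mu>: "space \<mu> = euclid_sphere d" using sets_eq_imp_space_eq[OF sets\<mu>] by (simp add: space_restrict_space)
  have D: "?D = ?M \<Otimes>\<^sub>M ?N" by (rule draw_measure_def)
  have sphere: "\<xi> j \<in> euclid_sphere d" if "\<xi> \<in> space ?N" "j < mX" for \<xi> j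
    using that by (auto simp: space_PiM PiE_iff space\<mu>)
  have quer: "length (queries m\<Phi> mX d \<epsilon> \<Phi> \<xi>) = mX * (m\<Phi> + 1)"
    "set (queries m\<Phi> mX d \<epsilon> \<Phi> \<xi>) \<subseteq> euclid_cball d (1 + \<epsilon>b)" if "\<Phi> \<in> space ?M" "\<xi> \<in> space ?N" for \<Phi> \<xi>
    by (rule queries_facts[where \<xi> = \<xi> and mX = mX, OF that(1) _ e eb], rule sphere[OF that(2)], assumption)+
  show "\<forall>(\<Phi>, \<xi>) \<in> space ?D.
      length (queries m\<Phi> mX d \<epsilon> \<Phi> \<xi>) = mX * (m\<Phi> + 1) \<and>
      set (queries m\<Phi> mX d \<epsilon> \<Phi> \<xi>) \<subseteq> euclid_cball d (1 + \<epsilon>b)"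
  proof (rule ballI, rule case_prodI2)
    fix p \<Phi> \<xi> assume "p \<in> space ?D" "p = (\<Phi>, \<xi>)"
    then have "\<Phi> \<in> space ?M" "\<xi> \<in> space ?N" by (simp_all only: D space_pair_measure mem_Times_iff fst_conv snd_conv)
    then show "length (queries m\<Phi> mX d \<epsilon> \<Phi> \<xi>) = mX * (m\<Phi> + 1) \<and>
      set (queries m\<Phi> mX d \<epsilon> \<Phi> \<xi>) \<subseteq> euclid_cball d (1 + \<epsilon>b)" using quer by blast
  qed
  define \<nu> where "\<nu> = nu2 (recovery_const C1 C2 q) q k d m\<Phi> \<epsilon>"
  define p1 where "p1 = exp (- c1 * real m\<Phi>)"
  define p2 where "p2 = exp (- sqrt (real m\<Phi> * real d))"
  define p3 where "p3 = real k * exp (- (real mX * \<alpha> * s\<^sup>2) / (2 * real k * C2\<^sup>2))"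
  have p2: "0 \<le> p2" by (simp add: p2_def)
  define Good where "Good = (\<lambda>\<Phi> \<xi>. (\<exists>fhat. algorithm2_output m\<Phi> mX d k \<epsilon> f \<Phi> \<xi> fhat) \<and>
    (\<forall>fhat. algorithm2_output m\<Phi> mX d k \<epsilon> f \<Phi> \<xi> fhat \<longrightarrow> \<nu> < sqrt (\<alpha> * (1 - s)) \<longrightarrow>
      (\<forall>x \<in> euclid_cball d (1 + \<epsilon>b). \<bar>f x - fhat x\<bar> \<le>
        2 * C2 * sqrt (real k) * (1 + \<epsilon>b) * (\<nu> / (sqrt (\<alpha> * (1 - s)) - \<nu>)))))"
  have "\<exists>E \<in> sets ?D. 1 - (p1 + p2 + p3) \<le> measure ?D E \<and> (\<forall>(\<Phi>, \<xi>) \<in> E. Good \<Phi> \<xi>)"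
  proof (cases "0 < m\<Phi> \<and> 0 < mX")
    case False
    \<comment> \<open>Without measurements or samples the claimed lower bound for the probability is
      not positive, and the empty event will do. The value m = 0 is admissible for d = 1, because ln
      1 = 0.\<close>
    have "1 \<le> p1 + p3"
    proof (cases "m\<Phi> = 0")
      case True
      then show ?thesis by (simp add: p1_def p3_def)
    next
      case nz: False
      then have "mX = 0" using False by simp
      then show ?thesis using k by (simp add: p1_def p3_def add_increasing)
    qed
    then show ?thesis using p2 by (intro bexI[of _ "{}"]) auto
  next
    case True
    then have m0: "0 < m\<Phi>" and n0: "0 < mX" by auto
    have md: "289 * real m\<Phi> \<le> 100 * real d" by (rule ratio_bound[OF m(2)])
    have gmp: "sprob ({..<m\<Phi>} \<times> {..<d}) (\<lambda>b. \<not> good_matrix m\<Phi> d 540000000 b) \<le> p1"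
      unfolding p1_def using gm m0 md m(1) by blast
    define EP where "EP = {\<Phi> \<in> space ?M. good_matrix m\<Phi> d 540000000 (sign_matrix m\<Phi> \<Phi>)}"
    note ms = matrix_measure_sprob[OF m0 good_matrix_depends gmp, folded EP_def]
    have \<sigma>': "\<alpha> \<le> \<sigma> i" if "i < k" for i using \<sigma> that by simp
    note gc = gradient_chernoff[OF \<mu> sv[unfolded f] \<alpha> \<sigma>' s]
    obtain ES where ES: "ES \<in> sets ?N" "1 - p3 \<le> measure ?N ES"
      "\<And>\<xi> v. \<xi> \<in> ES \<Longrightarrow> real mX * (\<alpha> * (1 - s)) * ip k v v \<le>
        (\<Sum>j<mX. (ip k (\<lambda>i. partial_deriv i g (mat_vec k d A (\<xi> j))) v)\<^sup>2)"
      using gc(2)[of mX] unfolding p3_def by blast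
    have probN: "prob_space ?N" by (intro prob_space_PiM prob\<mu>)
    have "1 - (p1 + p3) \<le> measure ?D (EP \<times> ES)"
      unfolding D by (rule measure_Times_ge[OF ms(3) probN ms(1) ES(1) ms(2) ES(2)])
    moreover have "EP \<times> ES \<in> sets ?D" unfolding D by (rule pair_measureI[OF ms(1) ES(1)])
    moreover have "Good \<Phi> \<xi>" if mem: "\<Phi> \<in> EP" "\<xi> \<in> ES" for \<Phi> \<xi>
    proof -
      have \<Phi>: "\<Phi> \<in> space ?M" and good: "good_matrix m\<Phi> d 540000000 (sign_matrix m\<Phi> \<Phi>)"
        using mem(1) unfolding EP_def by blast+
      have \<xi>: "\<xi> \<in> space ?N" using sets.sets_into_space[OF ES(1)] mem(2) by blast
      obtain R where R: "0 \<le> R" "quotient_property m\<Phi> d R (sign_matrix m\<Phi> \<Phi>)"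
        using good unfolding good_matrix_def by blast
      have \<beta>: "sqrt (\<alpha> * (1 - s)) \<le> C2"
      proof (rule real_le_lsqrt)
        have "\<alpha> * (1 - s) \<le> \<alpha> * 1" using \<alpha> s by (intro mult_left_mono) auto
        then show "\<alpha> * (1 - s) \<le> C2\<^sup>2" using gc(1) by linarith
      qed (use C2 in auto)
      show ?thesis unfolding Good_def
      proof (intro conjI allI impI ballI)
        show "\<exists>fhat. algorithm2_output m\<Phi> mX d k \<epsilon> f \<Phi> \<xi> fhat" by (rule algorithm2_output_exists[OF m0 R(2,1)])
      next
        fix fhat x assume out: "algorithm2_output m\<Phi> mX d k \<epsilon> f \<Phi> \<xi> fhat" and \<nu>: "\<nu> < sqrt (\<alpha> * (1 - s))"
          and x: "x \<in> euclid_cball d (1 + \<epsilon>b)"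
        have e2: "\<epsilon> * sqrt (real d / real m\<Phi>) \<le> 1 + \<epsilon>b - 1" using e(2) by simp
        have Aq': "(\<Sum>j<d. \<bar>A i j\<bar> powr q) powr (1 / q) \<le> C1" if "i < k" for i using Aq that by simp
        have "(0::real) \<le> 540000000" by simp
        then show "\<bar>f x - fhat x\<bar> \<le> 2 * C2 * sqrt (real k) * (1 + \<epsilon>b) * (\<nu> / (sqrt (\<alpha> * (1 - s)) - \<nu>))"
          unfolding f \<nu>_def
          by (rule algorithm2_error[OF m0 md n0 good _ \<Phi> sphere[OF \<xi>] q C1 Aq' e(1) e2
                recovery_const_ge(1-3)[OF C1 C2] \<beta> ES(3)[OF mem(2)] out[unfolded f] \<nu>[unfolded \<nu>_def] x])
      qed
    qed
    ultimately show ?thesis using p2 by (intro bexI[of _ "EP \<times> ES"] conjI) auto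
  qed
  then show "(\<exists>E \<in> sets (draw_measure m\<Phi> mX d \<mu>).
             measure (draw_measure m\<Phi> mX d \<mu>) E \<ge>
               1 - (exp (- c1 * real m\<Phi>) + exp (- sqrt (real m\<Phi> * real d))
                    + real k * exp (- (real mX * \<alpha> * s\<^sup>2) / (2 * real k * C2\<^sup>2))) \<and>
             (\<forall>(\<Phi>, \<xi>) \<in> E.
                (\<exists>fhat. algorithm2_output m\<Phi> mX d k \<epsilon> f \<Phi> \<xi> fhat) \<and>
                (\<forall>fhat. algorithm2_output m\<Phi> mX d k \<epsilon> f \<Phi> \<xi> fhat \<longrightarrow>
                   nu2 (recovery_const C1 C2 q) q k d m\<Phi> \<epsilon> < sqrt (\<alpha> * (1 - s)) \<longrightarrow>
                   (\<forall>x \<in> euclid_cball d (1 + \<epsilon>b).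
                      \<bar>f x - fhat x\<bar> \<le>
                        2 * C2 * sqrt (real k) * (1 + \<epsilon>b) *
                        (nu2 (recovery_const C1 C2 q) q k d m\<Phi> \<epsilon> / (sqrt (\<alpha> * (1 - s)) - nu2 (recovery_const C1 C2 q) q k d m\<Phi> \<epsilon>))))))"
    unfolding Good_def \<nu>_def p1_def p2_def p3_def .
qed

theorem theorem4p1:
  shows "\<exists>c1::real. c1 > 0 \<and>
    (\<forall>(C1::real) (C2::real) (q::real). C1 > 0 \<and> C2 > 0 \<and> 0 < q \<and> q \<le> 1 \<longrightarrow>
      (\<exists>C::real. C > 0 \<and>
        (\<forall>(k::nat) (d::nat) (\<epsilon>b::real) (A :: nat \<Rightarrow> nat \<Rightarrow> real) (g :: (nat \<Rightarrow> real) \<Rightarrow> real)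
          (f :: (nat \<Rightarrow> real) \<Rightarrow> real) (\<mu> :: (nat \<Rightarrow> real) measure) (\<sigma> :: nat \<Rightarrow> real)
          (\<alpha>::real) (s::real) (mX::nat) (m\<Phi>::nat) (\<epsilon>::real).
          1 \<le> k \<and> k \<le> d \<and> \<epsilon>b > 0 \<and>
          orthonormal_columns d k (mat_transpose A) \<and>
          (\<forall>i<k. (\<Sum>j<d. \<bar>A i j\<bar> powr q) powr (1 / q) \<le> C1) \<and>
          C2_on_cball k (1 + \<epsilon>b) g \<and>
          (\<forall>\<beta> \<in> multi_indices k 2. \<forall>x \<in> euclid_ball k (1 + \<epsilon>b). \<bar>iter_partial \<beta> g x\<bar> \<le> C2) \<and>
          f = (\<lambda>x. g (mat_vec k d A x)) \<and>
          uniform_on_sphere d \<mu> \<and>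
          \<alpha> > 0 \<and>
          has_singular_values d d (gradient_second_moment \<mu> f) \<sigma> \<and>
          (\<forall>i<k. \<alpha> \<le> \<sigma> i) \<and>
          0 < s \<and> s < 1 \<and>
          ln (real d) \<le> real m\<Phi> \<and> real m\<Phi> \<le> real d / (ln 6)\<^sup>2 \<and>
          \<epsilon> > 0 \<and> \<epsilon> * sqrt (real d / real m\<Phi>) \<le> \<epsilon>b
          \<longrightarrow>
          (\<forall>(\<Phi>, \<xi>) \<in> space (draw_measure m\<Phi> mX d \<mu>).
             length (queries m\<Phi> mX d \<epsilon> \<Phi> \<xi>) = mX * (m\<Phi> + 1) \<and>
             set (queries m\<Phi> mX d \<epsilon> \<Phi> \<xi>) \<subseteq> euclid_cball d (1 + \<epsilon>b)) \<and>
          (\<exists>E \<in> sets (draw_measure m\<Phi> mX d \<mu>).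
             measure (draw_measure m\<Phi> mX d \<mu>) E \<ge>
               1 - (exp (- c1 * real m\<Phi>) + exp (- sqrt (real m\<Phi> * real d))
                    + real k * exp (- (real mX * \<alpha> * s\<^sup>2) / (2 * real k * C2\<^sup>2))) \<and>
             (\<forall>(\<Phi>, \<xi>) \<in> E.
                (\<exists>fhat. algorithm2_output m\<Phi> mX d k \<epsilon> f \<Phi> \<xi> fhat) \<and>
                (\<forall>fhat. algorithm2_output m\<Phi> mX d k \<epsilon> f \<Phi> \<xi> fhat \<longrightarrow>
                   nu2 C q k d m\<Phi> \<epsilon> < sqrt (\<alpha> * (1 - s)) \<longrightarrow>
                   (\<forall>x \<in> euclid_cball d (1 + \<epsilon>b).
                      \<bar>f x - fhat x\<bar> \<le>
                        2 * C2 * sqrt (real k) * (1 + \<epsilon>b) *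
                        (nu2 C q k d m\<Phi> \<epsilon> / (sqrt (\<alpha> * (1 - s)) - nu2 C q k d m\<Phi> \<epsilon>)))))))))"
proof -
  obtain c1 :: real where c1: "c1 > 0" and gm: "\<forall>m d. 0 < m \<longrightarrow> 289 * real m \<le> 100 * real d \<longrightarrow> ln (real d) \<le> real m \<longrightarrow>
      sprob ({..<m} \<times> {..<d}) (\<lambda>b. \<not> good_matrix m d 540000000 b) \<le> exp (- c1 * real m)"
    using good_matrix_prob by blast
  show ?thesis
    apply (rule exI[of _ c1], rule conjI, rule c1, (rule allI)+, rule impI, (erule conjE)+)
    subgoal for C1 C2 q
      apply (rule exI[of _ "recovery_const C1 C2 q"], rule conjI, rule recovery_const_ge(4), assumption, assumption)
      apply ((rule allI)+, rule impI, (erule conjE)+)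
      by (rule algorithm2_success[OF gm]; assumption)
    done
qed

end
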